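(* Suppose that $R$ is a left perfect ring and that $M$ is an $(R,R)$-bimodule such that $R\propto M$ is morphic. Then $R=R_1\times\dots\times R_n$ where each $R_i$ is a matrix ring over an artinian principal local ring, and $M$ can be written as $M=M_1\oplus\dots\oplus M_n$, where each $M_i$ is a bimodule over $R_i$. Further, for each $i$: if $R_i$ is simple artinian, then $M_i=0$ or $M_i\cong R_i(\sigma_i)$ (as $(R_i,R_i)$-bimodules) for some ring automorphism $\sigma_i$ of $R_i$; and $M_i=0$ otherwise. Conversely, any such trivial extension is morphic; that is, if $R=R_1\times\dots\times R_n$ and $M=M_1\oplus\dots\oplus M_n$ have the form just described, then $R\propto M$ is morphic.
   Context: All rings are associative with identity. For a ring $R$ and an $(R,R)$-bimodule $M$, the trivial extension $R\propto M$ is the set of pairs $(r,m)$ with $r\in R$, $m\in M$, with componentwise addition and multiplication $(r,m)(s,n)=(rs,rn+ms)$. For a ring endomorphism $\sigma$ of $R$, $R(\sigma)$ is the $(R,R)$-bimodule which equals ${}_RR$ as a left module and has right multiplication $s\cdot r=s\sigma(r)$ for $s\in R(\sigma)$, $r\in R$. An element $a$ of a ring $S$ is left morphic if $S/Sa\cong \{x\in S: xa=0\}$ as left $S$-modules; $S$ is left morphic if every element of $S$ is left morphic. Right morphic is defined symmetrically, and a ring is morphic if it is both left and right morphic. A principal ring is a ring in which every left ideal and every right ideal is principal. A ring $R$ with Jacobson radical $J$ is left perfect if $R/J$ is semisimple and $J$ is left T-nilpotent, i.e. for every sequence $r_1,r_2,\dots$ in $J$ there is $n$ with $r_1r_2\cdots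 r_n=0$. An $(R_i,R_i)$-bimodule is regarded as an $(R,R)$-bimodule through the projection $R\to R_i$. *)

theory Defs
  imports "HOL-Algebra.Module" "HOL-Algebra.QuotRing" "HOL-Algebra.Chinese_Remainder"
begin

section \<open>One-sided notions for rings\<close>

definition opposite_ring :: "('a, 'x) ring_scheme \<Rightarrow> ('a, 'x) ring_scheme" where
  "opposite_ring R = R\<lparr>mult := (\<lambda>x y. y \<otimes>\<^bsub>R\<^esub> x)\<rparr>"

locale left_ideal = additive_subgroup I R + ring R for I and R (structure) +
  assumes left_closed: "\<lbrakk>a \<in> I; x \<in> carrier R\<rbrakk> \<Longrightarrow> x \<otimes> a \<in> I"

abbreviation right_ideal :: "'a set \<Rightarrow> ('a, 'x) ring_scheme \<Rightarrow> bool" where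
  "right_ideal I R \<equiv> left_ideal I (opposite_ring R)"

definition maximal_left_ideal :: "'a set \<Rightarrow> ('a, 'x) ring_scheme \<Rightarrow> bool" where
  "maximal_left_ideal I R \<longleftrightarrow> left_ideal I R \<and> I \<noteq> carrier R \<and>
     (\<forall>K. left_ideal K R \<and> I \<subseteq> K \<longrightarrow> K = I \<or> K = carrier R)"

definition local_ring :: "('a, 'x) ring_scheme \<Rightarrow> bool" where
  "local_ring R \<longleftrightarrow> ring R \<and> (\<exists>!I. maximal_left_ideal I R)"

text \<open>\<^term>\<open>PIdl\<^bsub>R\<^esub> a\<close> is the set of all \<^term>\<open>x \<otimes>\<^bsub>R\<^esub> a\<close>, i.e. the left ideal \<open>Ra\<close>, also when
  \<open>R\<close> is not commutative.\<close>

definition principal_ring :: "('a, 'x) ring_scheme \<Rightarrow> bool" where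
  "principal_ring R \<longleftrightarrow> ring R \<and>
     (\<forall>I. left_ideal I R \<longrightarrow> (\<exists>a\<in>carrier R. I = PIdl\<^bsub>R\<^esub> a)) \<and>
     (\<forall>I. right_ideal I R \<longrightarrow> (\<exists>a\<in>carrier R. I = PIdl\<^bsub>opposite_ring R\<^esub> a))"

definition left_artinian :: "('a, 'x) ring_scheme \<Rightarrow> bool" where
  "left_artinian R \<longleftrightarrow> ring R \<and>
     (\<forall>I :: nat \<Rightarrow> 'a set. (\<forall>n. left_ideal (I n) R) \<and> (\<forall>n. I (Suc n) \<subseteq> I n)
        \<longrightarrow> (\<exists>N. \<forall>n\<ge>N. I n = I N))"

definition artinian_ring :: "('a, 'x) ring_scheme \<Rightarrow> bool" where
  "artinian_ring R \<longleftrightarrow> left_artinian R \<and> left_artinian (opposite_ring R)"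

definition simple_ring :: "('a, 'x) ring_scheme \<Rightarrow> bool" where
  "simple_ring R \<longleftrightarrow> ring R \<and> carrier R \<noteq> {\<zero>\<^bsub>R\<^esub>} \<and>
     (\<forall>I. ideal I R \<longrightarrow> I = {\<zero>\<^bsub>R\<^esub>} \<or> I = carrier R)"

text \<open>The intersection with the carrier makes the radical of the zero ring the zero ring.\<close>

definition jacobson_radical :: "('a, 'x) ring_scheme \<Rightarrow> 'a set" where
  "jacobson_radical R = carrier R \<inter> \<Inter>{I. maximal_left_ideal I R}"

text \<open>A ring is semisimple when its left regular module is: every left ideal is a direct
  summand.\<close>

definition semisimple_ring :: "('a, 'x) ring_scheme \<Rightarrow> bool" where
  "semisimple_ring R \<longleftrightarrow> ring R \<and>
     (\<forall>I. left_ideal I R \<longrightarrow>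
        (\<exists>K. left_ideal K R \<and> I \<inter> K = {\<zero>\<^bsub>R\<^esub>} \<and> I <+>\<^bsub>R\<^esub> K = carrier R))"

definition left_T_nilpotent :: "'a set \<Rightarrow> ('a, 'x) ring_scheme \<Rightarrow> bool" where
  "left_T_nilpotent J R \<longleftrightarrow>
     (\<forall>r :: nat \<Rightarrow> 'a. (\<forall>i. r i \<in> J) \<longrightarrow>
        (\<exists>n\<ge>1. foldr (\<otimes>\<^bsub>R\<^esub>) (map r [1..<Suc n]) \<one>\<^bsub>R\<^esub> = \<zero>\<^bsub>R\<^esub>))"

definition left_perfect :: "('a, 'x) ring_scheme \<Rightarrow> bool" where
  "left_perfect R \<longleftrightarrow> ring R \<and> semisimple_ring (R Quot jacobson_radical R) \<and>
     left_T_nilpotent (jacobson_radical R) R"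


section \<open>Left modules and morphic rings\<close>

text \<open>The locale \<^locale>\<open>module\<close> of the library is restricted to commutative rings, so only
  its record is used here.  The fields \<^const>\<open>mult\<close> and \<^const>\<open>one\<close> which the record
  inherits from rings carry no information for a module.\<close>

definition left_module_iso ::
  "('a, 'x) ring_scheme \<Rightarrow> ('a, 'm, 'y) module_scheme \<Rightarrow> ('a, 'n, 'z) module_scheme \<Rightarrow> bool" where
  "left_module_iso R M N \<longleftrightarrow> (\<exists>f. bij_betw f (carrier M) (carrier N) \<and>
     (\<forall>x\<in>carrier M. \<forall>y\<in>carrier M. f (x \<oplus>\<^bsub>M\<^esub> y) = f x \<oplus>\<^bsub>N\<^esub> f y) \<and>
     (\<forall>r\<in>carrier R. \<forall>x\<in>carrier M. f (r \<odot>\<^bsub>M\<^esub> x) = r \<odot>\<^bsub>N\<^esub> f x))"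

definition left_regular_module :: "('a, 'x) ring_scheme \<Rightarrow> ('a, 'a) module" where
  "left_regular_module R =
     \<lparr>carrier = carrier R, mult = (\<otimes>\<^bsub>R\<^esub>), one = \<one>\<^bsub>R\<^esub>, zero = \<zero>\<^bsub>R\<^esub>, add = (\<oplus>\<^bsub>R\<^esub>),
      smult = (\<otimes>\<^bsub>R\<^esub>)\<rparr>"

definition quotient_module :: "('a, 'm, 'y) module_scheme \<Rightarrow> 'm set \<Rightarrow> ('a, 'm set) module" where
  "quotient_module M N =
     \<lparr>carrier = a_rcosets\<^bsub>M\<^esub> N, mult = undefined, one = undefined, zero = N, add = set_add M,
      smult = (\<lambda>r X. \<Union>x\<in>X. N +>\<^bsub>M\<^esub> (r \<odot>\<^bsub>M\<^esub> x))\<rparr>"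

definition left_annihilator :: "('a, 'x) ring_scheme \<Rightarrow> 'a \<Rightarrow> 'a set" where
  "left_annihilator R a = {x \<in> carrier R. x \<otimes>\<^bsub>R\<^esub> a = \<zero>\<^bsub>R\<^esub>}"

definition left_morphic :: "('a, 'x) ring_scheme \<Rightarrow> bool" where
  "left_morphic S \<longleftrightarrow> (\<forall>a\<in>carrier S.
     left_module_iso S (quotient_module (left_regular_module S) (PIdl\<^bsub>S\<^esub> a))
       ((left_regular_module S)\<lparr>carrier := left_annihilator S a\<rparr>))"

definition morphic :: "('a, 'x) ring_scheme \<Rightarrow> bool" where
  "morphic S \<longleftrightarrow> left_morphic S \<and> left_morphic (opposite_ring S)"


section \<open>Bimodules and trivial extensions\<close>

record ('a, 'b) bimodule = "('a, 'b) module" +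
  rsmult :: "['b, 'a] \<Rightarrow> 'b"

text \<open>Only bimodules over the same ring on both sides.\<close>

locale bimodule = R?: ring R + M?: abelian_group M
  for R :: "('a, 'x) ring_scheme" (structure) and M :: "('a, 'm, 'y) bimodule_scheme" (structure) +
  assumes lsmult_closed: "\<lbrakk>a \<in> carrier R; x \<in> carrier M\<rbrakk> \<Longrightarrow> a \<odot>\<^bsub>M\<^esub> x \<in> carrier M"
    and lsmult_l_distr: "\<lbrakk>a \<in> carrier R; b \<in> carrier R; x \<in> carrier M\<rbrakk> \<Longrightarrow>
      (a \<oplus>\<^bsub>R\<^esub> b) \<odot>\<^bsub>M\<^esub> x = a \<odot>\<^bsub>M\<^esub> x \<oplus>\<^bsub>M\<^esub> b \<odot>\<^bsub>M\<^esub> x"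
    and lsmult_r_distr: "\<lbrakk>a \<in> carrier R; x \<in> carrier M; y \<in> carrier M\<rbrakk> \<Longrightarrow>
      a \<odot>\<^bsub>M\<^esub> (x \<oplus>\<^bsub>M\<^esub> y) = a \<odot>\<^bsub>M\<^esub> x \<oplus>\<^bsub>M\<^esub> a \<odot>\<^bsub>M\<^esub> y"
    and lsmult_assoc: "\<lbrakk>a \<in> carrier R; b \<in> carrier R; x \<in> carrier M\<rbrakk> \<Longrightarrow>
      (a \<otimes>\<^bsub>R\<^esub> b) \<odot>\<^bsub>M\<^esub> x = a \<odot>\<^bsub>M\<^esub> (b \<odot>\<^bsub>M\<^esub> x)"
    and lsmult_one: "x \<in> carrier M \<Longrightarrow> \<one>\<^bsub>R\<^esub> \<odot>\<^bsub>M\<^esub> x = x"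
    and rsmult_closed: "\<lbrakk>a \<in> carrier R; x \<in> carrier M\<rbrakk> \<Longrightarrow> rsmult M x a \<in> carrier M"
    and rsmult_r_distr: "\<lbrakk>a \<in> carrier R; b \<in> carrier R; x \<in> carrier M\<rbrakk> \<Longrightarrow>
      rsmult M x (a \<oplus>\<^bsub>R\<^esub> b) = rsmult M x a \<oplus>\<^bsub>M\<^esub> rsmult M x b"
    and rsmult_l_distr: "\<lbrakk>a \<in> carrier R; x \<in> carrier M; y \<in> carrier M\<rbrakk> \<Longrightarrow>
      rsmult M (x \<oplus>\<^bsub>M\<^esub> y) a = rsmult M x a \<oplus>\<^bsub>M\<^esub> rsmult M y a"
    and rsmult_assoc: "\<lbrakk>a \<in> carrier R; b \<in> carrier R; x \<in> carrier M\<rbrakk> \<Longrightarrow>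
      rsmult M x (a \<otimes>\<^bsub>R\<^esub> b) = rsmult M (rsmult M x a) b"
    and rsmult_one: "x \<in> carrier M \<Longrightarrow> rsmult M x \<one>\<^bsub>R\<^esub> = x"
    and smult_rsmult_assoc: "\<lbrakk>a \<in> carrier R; b \<in> carrier R; x \<in> carrier M\<rbrakk> \<Longrightarrow>
      rsmult M (a \<odot>\<^bsub>M\<^esub> x) b = a \<odot>\<^bsub>M\<^esub> (rsmult M x b)"

definition bimodule_iso ::
  "('a, 'x) ring_scheme \<Rightarrow> ('a, 'm, 'y) bimodule_scheme \<Rightarrow> ('a, 'n, 'z) bimodule_scheme \<Rightarrow> bool" where
  "bimodule_iso R M N \<longleftrightarrow> (\<exists>f. bij_betw f (carrier M) (carrier N) \<and>
     (\<forall>x\<in>carrier M. \<forall>y\<in>carrier M. f (x \<oplus>\<^bsub>M\<^esub> y) = f x \<oplus>\<^bsub>N\<^esub> f y) \<and>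
     (\<forall>r\<in>carrier R. \<forall>x\<in>carrier M. f (r \<odot>\<^bsub>M\<^esub> x) = r \<odot>\<^bsub>N\<^esub> f x) \<and>
     (\<forall>r\<in>carrier R. \<forall>x\<in>carrier M. f (rsmult M x r) = rsmult N (f x) r))"

definition trivial_extension ::
  "('a, 'x) ring_scheme \<Rightarrow> ('a, 'm, 'y) bimodule_scheme \<Rightarrow> ('a \<times> 'm) ring" (infixl \<open>\<propto>\<close> 65) where
  "R \<propto> M =
     \<lparr>carrier = carrier R \<times> carrier M,
      mult = (\<lambda>(r, m) (s, n). (r \<otimes>\<^bsub>R\<^esub> s, r \<odot>\<^bsub>M\<^esub> n \<oplus>\<^bsub>M\<^esub> rsmult M m s)),
      one = (\<one>\<^bsub>R\<^esub>, \<zero>\<^bsub>M\<^esub>),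
      zero = (\<zero>\<^bsub>R\<^esub>, \<zero>\<^bsub>M\<^esub>),
      add = (\<lambda>(r, m) (s, n). (r \<oplus>\<^bsub>R\<^esub> s, m \<oplus>\<^bsub>M\<^esub> n))\<rparr>"

text \<open>The bimodule \<open>R(\<sigma>)\<close>.\<close>

definition twisted_bimodule :: "('a, 'x) ring_scheme \<Rightarrow> ('a \<Rightarrow> 'a) \<Rightarrow> ('a, 'a) bimodule" where
  "twisted_bimodule R \<sigma> =
     \<lparr>carrier = carrier R, mult = (\<otimes>\<^bsub>R\<^esub>), one = \<one>\<^bsub>R\<^esub>, zero = \<zero>\<^bsub>R\<^esub>, add = (\<oplus>\<^bsub>R\<^esub>),
      smult = (\<otimes>\<^bsub>R\<^esub>), rsmult = (\<lambda>s r. s \<otimes>\<^bsub>R\<^esub> \<sigma> r)\<rparr>"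

text \<open>Restriction of scalars along a map \<open>p\<close> into the ring acting on \<open>M\<close>.\<close>

definition restrict_scalars :: "('b \<Rightarrow> 'a) \<Rightarrow> ('a, 'm) bimodule \<Rightarrow> ('b, 'm) bimodule" where
  "restrict_scalars p M =
     \<lparr>carrier = carrier M, mult = (\<otimes>\<^bsub>M\<^esub>), one = \<one>\<^bsub>M\<^esub>, zero = \<zero>\<^bsub>M\<^esub>, add = (\<oplus>\<^bsub>M\<^esub>),
      smult = (\<lambda>r x. p r \<odot>\<^bsub>M\<^esub> x), rsmult = (\<lambda>x r. rsmult M x (p r))\<rparr>"

text \<open>Elements of a finite direct sum are lists, as in \<^const>\<open>RDirProd_list\<close>.\<close>

definition bimodule_direct_sum :: "nat \<Rightarrow> (nat \<Rightarrow> ('a, 'm) bimodule) \<Rightarrow> ('a, 'm list) bimodule" where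
  "bimodule_direct_sum n Ms =
     \<lparr>carrier = {xs. length xs = n \<and> (\<forall>i<n. xs ! i \<in> carrier (Ms i))},
      mult = undefined,
      one = undefined,
      zero = map (\<lambda>i. \<zero>\<^bsub>Ms i\<^esub>) [0..<n],
      add = (\<lambda>xs ys. map (\<lambda>i. xs ! i \<oplus>\<^bsub>Ms i\<^esub> ys ! i) [0..<n]),
      smult = (\<lambda>r xs. map (\<lambda>i. r \<odot>\<^bsub>Ms i\<^esub> xs ! i) [0..<n]),
      rsmult = (\<lambda>xs r. map (\<lambda>i. rsmult (Ms i) (xs ! i) r) [0..<n])\<rparr>"


section \<open>Matrix rings\<close>

definition matrix_ring :: "nat \<Rightarrow> ('a, 'x) ring_scheme \<Rightarrow> (nat \<times> nat \<Rightarrow> 'a) ring" where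
  "matrix_ring k R =
     \<lparr>carrier = {..<k} \<times> {..<k} \<rightarrow>\<^sub>E carrier R,
      mult = (\<lambda>A B. \<lambda>(i, j)\<in>{..<k} \<times> {..<k}. \<Oplus>\<^bsub>R\<^esub>l\<in>{..<k}. A (i, l) \<otimes>\<^bsub>R\<^esub> B (l, j)),
      one = (\<lambda>(i, j)\<in>{..<k} \<times> {..<k}. if i = j then \<one>\<^bsub>R\<^esub> else \<zero>\<^bsub>R\<^esub>),
      zero = (\<lambda>(i, j)\<in>{..<k} \<times> {..<k}. \<zero>\<^bsub>R\<^esub>),
      add = (\<lambda>A B. \<lambda>(i, j)\<in>{..<k} \<times> {..<k}. A (i, j) \<oplus>\<^bsub>R\<^esub> B (i, j))\<rparr>"


section \<open>Decompositions\<close>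

text \<open>\<open>R = R\<^sub>1 \<times> \<dots> \<times> R\<^sub>n\<close> and \<open>M = M\<^sub>1 \<oplus> \<dots> \<oplus> M\<^sub>n\<close>, with components indexed by \<open>0, \<dots>, n - 1\<close>.
  Both equalities are read as isomorphisms, and the second one is an isomorphism of
  \<open>R\<close>-bimodules, where \<open>R\<close> acts on \<open>M\<^sub>i\<close> through the projection \<open>R \<rightarrow> R\<^sub>i\<close> given by the first one.
  The zero ring is the product with \<open>n = 0\<close>.\<close>

definition decomposition ::
  "'a ring \<Rightarrow> ('a, 'm) bimodule \<Rightarrow> nat \<Rightarrow> (nat \<Rightarrow> 'b ring) \<Rightarrow> (nat \<Rightarrow> ('b, 'n) bimodule) \<Rightarrow> bool" where
  "decomposition R M n Rs Ms \<longleftrightarrow>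
     (\<forall>i<n. bimodule (Rs i) (Ms i)) \<and>
     (\<exists>\<phi>\<in>ring_iso R (RDirProd_list (map Rs [0..<n])).
        bimodule_iso R M (bimodule_direct_sum n (\<lambda>i. restrict_scalars (\<lambda>r. \<phi> r ! i) (Ms i))))"

definition matrix_ring_over_artinian_principal_local :: "'b ring \<Rightarrow> nat \<Rightarrow> 'c ring \<Rightarrow> bool" where
  "matrix_ring_over_artinian_principal_local S k L \<longleftrightarrow>
     k \<ge> 1 \<and> artinian_ring L \<and> principal_ring L \<and> local_ring L \<and> S \<simeq> matrix_ring k L"

definition zero_or_twisted :: "'b ring \<Rightarrow> ('b, 'n) bimodule \<Rightarrow> bool" where
  "zero_or_twisted S N \<longleftrightarrow>
     (if simple_ring S \<and> artinian_ring S
      then carrier N = {\<zero>\<^bsub>N\<^esub>} \<or> (\<exists>\<sigma>\<in>ring_iso S S. bimodule_iso S N (twisted_bimodule S \<sigma>))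
      else carrier N = {\<zero>\<^bsub>N\<^esub>})"

text \<open>\<open>Ls i\<close> is the local ring and \<open>ks i\<close> the size of the matrices in the \<open>i\<close>-th component.\<close>

definition decomposition_into_standard_components ::
  "'a ring \<Rightarrow> ('a, 'm) bimodule \<Rightarrow> nat \<Rightarrow> (nat \<Rightarrow> 'b ring) \<Rightarrow> (nat \<Rightarrow> ('b, 'n) bimodule)
     \<Rightarrow> (nat \<Rightarrow> nat) \<Rightarrow> (nat \<Rightarrow> 'c ring) \<Rightarrow> bool" where
  "decomposition_into_standard_components R M n Rs Ms ks Ls \<longleftrightarrow>
     decomposition R M n Rs Ms \<and>
     (\<forall>i<n. matrix_ring_over_artinian_principal_local (Rs i) (ks i) (Ls i) \<and>
            zero_or_twisted (Rs i) (Ms i))"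

end

theory Submission
  imports Defs
begin

text \<open>An element \<open>a\<close> of a ring \<open>S\<close> is left morphic iff some \<open>b\<close> satisfies \<open>l(a) = Sb\<close> and \<open>l(b) = Sa\<close>. Put
  \<open>S = R \<propto> M\<close>.

  If \<open>R\<close> is left perfect, then \<open>1\<close> is a sum of orthogonal local idempotents of \<open>R\<close>, which stay local in \<open>S\<close>. For
  non-isomorphic \<open>e\<close> and \<open>f\<close> among them the right morphic condition forces \<open>eSf = 0\<close>, so the isomorphism
  classes give central idempotents and, through matrix units, matrix rings over the corners \<open>eRe\<close>. Each corner \<open>T = eSe\<close>
  is again morphic; elements annihilated by its radical show that the radical is both \<open>cT\<close> and \<open>Td\<close> with \<open>c\<close>
  nilpotent, so that every element of \<open>T\<close> is a unit times a power of \<open>c\<close>, on either side. Comparing \<open>(t, 0)\<close>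
  with \<open>(0, n)\<close> in \<open>T\<close> shows that \<open>eMe \<noteq> 0\<close> is only possible if \<open>eRe\<close> is a division ring over which \<open>eMe\<close> is
  one-dimensional on both sides.

  Conversely, each block of \<open>S\<close> is a matrix ring over such a uniserial ring \<open>T\<close>. There every matrix is equivalent to
  a diagonal one, and \<open>c\<^sup>s\<close> is morphic since \<open>l(c\<^sup>s) = Tc\<^sup>N\<^sup>-\<^sup>s\<close>, where \<open>N\<close> is the nilpotency index of \<open>c\<close>.\<close>

text \<open>Left perfectness is one-sided while the morphic condition is imposed on both sides, and
  this fixes the order of the argument on a corner \<open>T\<close> with radical \<open>J\<close>.
  T-nilpotence controls products that grow to the right, so it yields a nonzero \<open>x\<close>
  with \<open>xJ = 0\<close>; the right morphic condition turns this into \<open>J = cT\<close>. The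
  mirror image is not obtained in the same way. It is replaced by the last nonzero power of
  \<open>c\<close>, which \<open>J\<close> annihilates from the left, so that the left morphic
  condition gives \<open>J = Td\<close>. No chain condition on ideals of \<open>R\<close> is at hand
  when \<open>1\<close> is split into local idempotents. The splitting stops because a strictly
  descending sequence of idempotents would produce a nonzero idempotent in the radical. The trivial
  extension is reached by carrying the idempotents of \<open>R\<close> over to it, together with the
  T-nilpotent ideal \<open>J \<times> M\<close>. All components of the decomposition are corners
  inside \<open>R\<close> and \<open>M\<close>, which is why they have the same types.\<close>

section \<open>Opposite rings and left ideals\<close>

lemma opposite_ring_simps [simp]:
  "carrier (opposite_ring R) = carrier R"
  "x \<otimes>\<^bsub>opposite_ring R\<^esub> y = y \<otimes>\<^bsub>R\<^esub> x"
  "\<one>\<^bsub>opposite_ring R\<^esub> = \<one>\<^bsub>R\<^esub>"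
  "\<zero>\<^bsub>opposite_ring R\<^esub> = \<zero>\<^bsub>R\<^esub>"
  "x \<oplus>\<^bsub>opposite_ring R\<^esub> y = x \<oplus>\<^bsub>R\<^esub> y"
  "opposite_ring (opposite_ring R) = R"
  by (auto simp: opposite_ring_def)

lemma opposite_ring_additive [simp]:
  "a_inv (opposite_ring R) = a_inv R"
  "finsum (opposite_ring R) = finsum R"
  "a_minus (opposite_ring R) x y = a_minus R x y"
  "Units (opposite_ring R) = Units R"
  by (auto simp: a_inv_def finsum_def a_minus_def Units_def opposite_ring_def fun_eq_iff)

lemma ring_opposite_ring:
  assumes "ring R"
  shows "ring (opposite_ring R)"
proof -
  interpret ring R by fact
  show ?thesis
  proof (rule ringI)
    show "abelian_group (opposite_ring R)"
      by (rule abelian_groupI) (auto simp: a_ac intro!: bexI[of _ "\<ominus>\<^bsub>R\<^esub> x" for x] l_neg)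
    show "monoid (opposite_ring R)"
      by (rule monoidI) (auto simp: m_assoc)
  qed (auto simp: l_distr r_distr)
qed

lemma ring_opposite_ring_iff [simp]: "ring (opposite_ring R) \<longleftrightarrow> ring R"
  using ring_opposite_ring[of R] ring_opposite_ring[of "opposite_ring R"] by auto

lemma nat_pow_opposite_ring:
  assumes "ring R" "x \<in> carrier R"
  shows "x [^]\<^bsub>opposite_ring R\<^esub> (n::nat) = x [^]\<^bsub>R\<^esub> n"
proof -
  interpret ring R by fact
  interpret o: ring "opposite_ring R" using assms by simp
  show ?thesis
    using assms(2) proof (induct n)
    case (Suc n)
    have "x [^]\<^bsub>opposite_ring R\<^esub> Suc n = x \<otimes>\<^bsub>R\<^esub> x [^]\<^bsub>R\<^esub> n"
      using Suc by (simp add: o.nat_pow_Suc)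
    then show ?case using Suc by (simp only: nat_pow_Suc2)
  qed simp
qed

lemma (in ring) additive_subgroupI':
  assumes "I \<subseteq> carrier R" "\<zero> \<in> I" "\<And>x y. x \<in> I \<Longrightarrow> y \<in> I \<Longrightarrow> x \<oplus> y \<in> I"
    "\<And>x. x \<in> I \<Longrightarrow> \<ominus> x \<in> I"
  shows "additive_subgroup I R"
  by (rule additive_subgroupI, rule add.subgroupI) (use assms in \<open>auto simp: a_inv_def\<close>)

lemma (in ring) left_idealI:
  assumes "I \<subseteq> carrier R" "\<zero> \<in> I" "\<And>x y. x \<in> I \<Longrightarrow> y \<in> I \<Longrightarrow> x \<oplus> y \<in> I"
    "\<And>r x. r \<in> carrier R \<Longrightarrow> x \<in> I \<Longrightarrow> r \<otimes> x \<in> I"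
  shows "left_ideal I R"
proof -
  have "\<ominus> x \<in> I" if "x \<in> I" for x
  proof -
    have "\<ominus> x = (\<ominus> \<one>) \<otimes> x" using that assms(1) by (simp add: l_minus subset_iff)
    then show ?thesis using assms(4)[of "\<ominus> \<one>" x] that by simp
  qed
  then have "additive_subgroup I R"
    using assms by (intro additive_subgroupI') auto
  then show ?thesis
    by (intro left_ideal.intro left_ideal_axioms.intro ring_axioms) (use assms in auto)
qed

lemma left_idealD:
  assumes "left_ideal I R"
  shows "ring R" "I \<subseteq> carrier R" "\<zero>\<^bsub>R\<^esub> \<in> I" "\<And>x y. x \<in> I \<Longrightarrow> y \<in> I \<Longrightarrow> x \<oplus>\<^bsub>R\<^esub> y \<in> I"
    "\<And>x. x \<in> I \<Longrightarrow> \<ominus>\<^bsub>R\<^esub> x \<in> I" "\<And>x y. x \<in> I \<Longrightarrow> y \<in> I \<Longrightarrow> x \<ominus>\<^bsub>R\<^esub> y \<in> I"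
    "\<And>r x. r \<in> carrier R \<Longrightarrow> x \<in> I \<Longrightarrow> r \<otimes>\<^bsub>R\<^esub> x \<in> I"
proof -
  interpret left_ideal I R by fact
  show "ring R" by (rule ring_axioms)
  show "I \<subseteq> carrier R" by (rule a_subset)
  show "\<zero>\<^bsub>R\<^esub> \<in> I" "\<And>x y. x \<in> I \<Longrightarrow> y \<in> I \<Longrightarrow> x \<oplus>\<^bsub>R\<^esub> y \<in> I"
    "\<And>x. x \<in> I \<Longrightarrow> \<ominus>\<^bsub>R\<^esub> x \<in> I" "\<And>x y. x \<in> I \<Longrightarrow> y \<in> I \<Longrightarrow> x \<ominus>\<^bsub>R\<^esub> y \<in> I"
    by (auto simp: a_minus_def)
  show "\<And>r x. r \<in> carrier R \<Longrightarrow> x \<in> I \<Longrightarrow> r \<otimes>\<^bsub>R\<^esub> x \<in> I" by (rule left_closed)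
qed

lemma (in ring) left_ideal_PIdl:
  assumes "a \<in> carrier R"
  shows "left_ideal (PIdl a) R"
proof (rule left_idealI)
  show "PIdl a \<subseteq> carrier R" using assms by (auto simp: cgenideal_def)
  show "\<zero> \<in> PIdl a" using assms by (auto simp: cgenideal_def intro!: exI[of _ \<zero>])
  show "x \<oplus> y \<in> PIdl a" if xy: "x \<in> PIdl a" "y \<in> PIdl a" for x y
  proof -
    from xy obtain s t where "s \<in> carrier R" "t \<in> carrier R" "x = s \<otimes> a" "y = t \<otimes> a"
      by (auto simp: cgenideal_def)
    then show ?thesis using assms
      by (auto simp: cgenideal_def l_distr intro!: exI[of _ "s \<oplus> t"])
  qed
  show "r \<otimes> x \<in> PIdl a" if rx: "r \<in> carrier R" "x \<in> PIdl a" for r x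
  proof -
    from rx obtain s where "s \<in> carrier R" "x = s \<otimes> a" by (auto simp: cgenideal_def)
    then show ?thesis using assms rx
      by (auto simp: cgenideal_def m_assoc intro!: exI[of _ "r \<otimes> s"])
  qed
qed

section \<open>An elementwise form of the morphic condition\<close>

text \<open>The idempotents \<open>g\<close> and \<open>h\<close> allow for rectangular blocks \<open>gSh\<close>, which arise when a matrix is diagonalised
  without permuting its rows and columns; left morphic elements are the case \<open>g = h = 1\<close>.\<close>

definition left_morphic_pair :: "('a, 'x) ring_scheme \<Rightarrow> 'a \<Rightarrow> 'a \<Rightarrow> 'a \<Rightarrow> 'a \<Rightarrow> bool" where
  "left_morphic_pair S g h a b \<longleftrightarrow> a \<in> carrier S \<and> b \<in> carrier S \<and>
     g \<otimes>\<^bsub>S\<^esub> a = a \<and> a \<otimes>\<^bsub>S\<^esub> h = a \<and> h \<otimes>\<^bsub>S\<^esub> b = b \<and> b \<otimes>\<^bsub>S\<^esub> g = b \<and>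
     (\<forall>x\<in>carrier S. x \<otimes>\<^bsub>S\<^esub> g = x \<longrightarrow>
        (x \<otimes>\<^bsub>S\<^esub> a = \<zero>\<^bsub>S\<^esub> \<longleftrightarrow> (\<exists>y\<in>carrier S. x = y \<otimes>\<^bsub>S\<^esub> b))) \<and>
     (\<forall>x\<in>carrier S. x \<otimes>\<^bsub>S\<^esub> h = x \<longrightarrow>
        (x \<otimes>\<^bsub>S\<^esub> b = \<zero>\<^bsub>S\<^esub> \<longleftrightarrow> (\<exists>y\<in>carrier S. x = y \<otimes>\<^bsub>S\<^esub> a)))"

text \<open>A module homomorphism on \<open>S/Sa\<close> is determined by the image \<open>b\<close>
  of the coset of 1: it sends the coset of \<open>x\<close> to \<open>xb\<close>. Being well defined
  and injective means \<open>l(b) = Sa\<close>, being onto means \<open>Sb = l(a)\<close>.\<close>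

lemma left_module_iso_iff_pair:
  assumes "ring S" and a: "a \<in> carrier S"
  shows "left_module_iso S (quotient_module (left_regular_module S) (PIdl\<^bsub>S\<^esub> a))
       ((left_regular_module S)\<lparr>carrier := left_annihilator S a\<rparr>) \<longleftrightarrow>
     (\<exists>b. left_morphic_pair S \<one>\<^bsub>S\<^esub> \<one>\<^bsub>S\<^esub> a b)"
proof -
  interpret ring S by fact
  define N where "N = PIdl\<^bsub>S\<^esub> a"
  have NL: "left_ideal N S" unfolding N_def using a by (rule left_ideal_PIdl)
  then have Na: "additive_subgroup N S" by (simp add: left_ideal_def)
  then have N: "abelian_subgroup N S" using is_abelian_group by (rule abelian_subgroupI3)
  have Nc: "N \<subseteq> carrier S" using NL by (rule left_idealD)
  have memN: "x \<in> N \<longleftrightarrow> (\<exists>y\<in>carrier S. x = y \<otimes>\<^bsub>S\<^esub> a)" for x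
    unfolding N_def cgenideal_def by blast
  let ?Q = "quotient_module (left_regular_module S) N"
  let ?A = "(left_regular_module S)\<lparr>carrier := left_annihilator S a\<rparr>"
  have cosets: "N +>\<^bsub>left_regular_module S\<^esub> x = N +>\<^bsub>S\<^esub> x" for x
    by (simp add: a_r_coset_def r_coset_def left_regular_module_def)
  have Qcar: "carrier ?Q = {N +>\<^bsub>S\<^esub> x |x. x \<in> carrier S}"
    by (auto simp: quotient_module_def A_RCOSETS_def' cosets)
       (auto simp: left_regular_module_def)
  have Qadd: "(N +>\<^bsub>S\<^esub> x) \<oplus>\<^bsub>?Q\<^esub> (N +>\<^bsub>S\<^esub> y) = N +>\<^bsub>S\<^esub> (x \<oplus>\<^bsub>S\<^esub> y)"
    if "x \<in> carrier S" "y \<in> carrier S" for x y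
    using abelian_subgroup.a_rcos_sum[OF N that]
    by (simp add: quotient_module_def set_add_def set_mult_def left_regular_module_def)
  have coset_eq: "N +>\<^bsub>S\<^esub> x = N +>\<^bsub>S\<^esub> y \<longleftrightarrow> x \<ominus>\<^bsub>S\<^esub> y \<in> N"
    if "x \<in> carrier S" "y \<in> carrier S" for x y
  proof
    assume "N +>\<^bsub>S\<^esub> x = N +>\<^bsub>S\<^esub> y"
    then have "x \<in> N +>\<^bsub>S\<^esub> y" using abelian_subgroup.a_rcos_self[OF N that(1)] by simp
    then obtain n where n: "n \<in> N" "x = n \<oplus>\<^bsub>S\<^esub> y" by (auto simp: a_r_coset_def')
    then have "n \<in> carrier S" using Nc by auto
    then have "x \<ominus>\<^bsub>S\<^esub> y = n" unfolding n(2) using that by (simp add: minus_eq a_assoc r_neg)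
    then show "x \<ominus>\<^bsub>S\<^esub> y \<in> N" using n by simp
  next
    assume n: "x \<ominus>\<^bsub>S\<^esub> y \<in> N"
    have "x = (x \<ominus>\<^bsub>S\<^esub> y) \<oplus>\<^bsub>S\<^esub> y" using that by (simp add: minus_eq a_assoc l_neg)
    then have "x \<in> N +>\<^bsub>S\<^esub> y" using n by (auto simp: a_r_coset_def')
    then show "N +>\<^bsub>S\<^esub> x = N +>\<^bsub>S\<^esub> y"
      using a_repr_independence[of x N y] that additive_subgroup.a_subgroup[OF Na] by simp
  qed
  have in_coset: "\<exists>n\<in>N. z = n \<oplus>\<^bsub>S\<^esub> x" if "z \<in> N +>\<^bsub>S\<^esub> x" for z x
    using that by (auto simp: a_r_coset_def')
  have Qsm: "r \<odot>\<^bsub>?Q\<^esub> (N +>\<^bsub>S\<^esub> x) = N +>\<^bsub>S\<^esub> (r \<otimes>\<^bsub>S\<^esub> x)"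
    if r: "r \<in> carrier S" and x: "x \<in> carrier S" for r x
  proof -
    have "N +>\<^bsub>S\<^esub> (r \<otimes>\<^bsub>S\<^esub> z) = N +>\<^bsub>S\<^esub> (r \<otimes>\<^bsub>S\<^esub> x)" if z: "z \<in> N +>\<^bsub>S\<^esub> x" for z
    proof -
      from in_coset[OF z] obtain n where n: "n \<in> N" "z = n \<oplus>\<^bsub>S\<^esub> x" by auto
      then have nc: "n \<in> carrier S" using Nc by auto
      have "r \<otimes>\<^bsub>S\<^esub> z \<ominus>\<^bsub>S\<^esub> r \<otimes>\<^bsub>S\<^esub> x = r \<otimes>\<^bsub>S\<^esub> n"
        unfolding n(2) using r x nc by algebra
      then show ?thesis using coset_eq[of "r \<otimes>\<^bsub>S\<^esub> z" "r \<otimes>\<^bsub>S\<^esub> x"] n r x nc left_idealD(7)[OF NL] by auto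
    qed
    moreover have "x \<in> N +>\<^bsub>S\<^esub> x" using x by (rule abelian_subgroup.a_rcos_self[OF N])
    ultimately have "(\<Union>z\<in>N +>\<^bsub>S\<^esub> x. N +>\<^bsub>S\<^esub> (r \<otimes>\<^bsub>S\<^esub> z)) = N +>\<^bsub>S\<^esub> (r \<otimes>\<^bsub>S\<^esub> x)"
      by (intro UN_constant_eq) blast+
    then show ?thesis by (simp add: quotient_module_def cosets) (simp add: left_regular_module_def)
  qed
  have Asimps: "carrier ?A = left_annihilator S a" "x \<oplus>\<^bsub>?A\<^esub> y = x \<oplus>\<^bsub>S\<^esub> y" "x \<odot>\<^bsub>?A\<^esub> y = x \<otimes>\<^bsub>S\<^esub> y" for x y
    by (simp_all add: left_regular_module_def)
  show ?thesis
  proof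
    assume "left_module_iso S (quotient_module (left_regular_module S) (PIdl\<^bsub>S\<^esub> a)) ?A"
    then obtain f where bij: "bij_betw f (carrier ?Q) (left_annihilator S a)"
      and sm: "\<And>r X. r \<in> carrier S \<Longrightarrow> X \<in> carrier ?Q \<Longrightarrow> f (r \<odot>\<^bsub>?Q\<^esub> X) = r \<otimes>\<^bsub>S\<^esub> f X"
      unfolding left_module_iso_def N_def[symmetric] Asimps by auto
    define b where "b = f (N +>\<^bsub>S\<^esub> \<one>\<^bsub>S\<^esub>)"
    have inQ: "N +>\<^bsub>S\<^esub> x \<in> carrier ?Q" if "x \<in> carrier S" for x using that Qcar by auto
    have fx: "f (N +>\<^bsub>S\<^esub> x) = x \<otimes>\<^bsub>S\<^esub> b" if "x \<in> carrier S" for x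
      using sm[OF that inQ[of "\<one>\<^bsub>S\<^esub>"]] Qsm[OF that one_closed] that by (simp add: b_def)
    have "b \<in> left_annihilator S a" unfolding b_def using bij inQ[of "\<one>\<^bsub>S\<^esub>"] by (auto simp: bij_betw_def)
    then have b: "b \<in> carrier S" by (auto simp: left_annihilator_def)
    have 1: "x \<otimes>\<^bsub>S\<^esub> a = \<zero>\<^bsub>S\<^esub> \<longleftrightarrow> (\<exists>y\<in>carrier S. x = y \<otimes>\<^bsub>S\<^esub> b)" if x: "x \<in> carrier S" for x
    proof -
      have "x \<otimes>\<^bsub>S\<^esub> a = \<zero>\<^bsub>S\<^esub> \<longleftrightarrow> x \<in> f ` carrier ?Q"
        using bij x by (auto simp: bij_betw_def left_annihilator_def)
      also have "\<dots> \<longleftrightarrow> (\<exists>y\<in>carrier S. x = y \<otimes>\<^bsub>S\<^esub> b)"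
        unfolding Qcar using fx by (auto simp: image_iff)
      finally show ?thesis .
    qed
    have 2: "x \<otimes>\<^bsub>S\<^esub> b = \<zero>\<^bsub>S\<^esub> \<longleftrightarrow> (\<exists>y\<in>carrier S. x = y \<otimes>\<^bsub>S\<^esub> a)" if x: "x \<in> carrier S" for x
    proof -
      have "x \<otimes>\<^bsub>S\<^esub> b = \<zero>\<^bsub>S\<^esub> \<longleftrightarrow> f (N +>\<^bsub>S\<^esub> x) = f (N +>\<^bsub>S\<^esub> \<zero>\<^bsub>S\<^esub>)" using fx x b by simp
      also have "\<dots> \<longleftrightarrow> N +>\<^bsub>S\<^esub> x = N +>\<^bsub>S\<^esub> \<zero>\<^bsub>S\<^esub>"
        using bij inQ x by (auto simp: bij_betw_def dest: inj_onD)
      also have "\<dots> \<longleftrightarrow> x \<in> N" using coset_eq[of x "\<zero>\<^bsub>S\<^esub>"] x by (simp add: minus_eq)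
      finally show ?thesis using memN by simp
    qed
    show "\<exists>b. left_morphic_pair S \<one>\<^bsub>S\<^esub> \<one>\<^bsub>S\<^esub> a b"
      unfolding left_morphic_pair_def using a b 1 2 by (intro exI[of _ b]) auto
  next
    assume "\<exists>b. left_morphic_pair S \<one>\<^bsub>S\<^esub> \<one>\<^bsub>S\<^esub> a b"
    then obtain b where b: "b \<in> carrier S"
      and 1: "\<And>x. x \<in> carrier S \<Longrightarrow> x \<otimes>\<^bsub>S\<^esub> a = \<zero>\<^bsub>S\<^esub> \<longleftrightarrow> (\<exists>y\<in>carrier S. x = y \<otimes>\<^bsub>S\<^esub> b)"
      and 2: "\<And>x. x \<in> carrier S \<Longrightarrow> x \<otimes>\<^bsub>S\<^esub> b = \<zero>\<^bsub>S\<^esub> \<longleftrightarrow> (\<exists>y\<in>carrier S. x = y \<otimes>\<^bsub>S\<^esub> a)"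
      by (auto simp: left_morphic_pair_def)
    \<comment> \<open>The choice of the representative is harmless: two of them differ by an element
      of \<open>N = Sa\<close>, and right multiplication by \<open>b\<close> sends \<open>N\<close>
      to zero.\<close>
    define f where "f X = (SOME x. x \<in> X) \<otimes>\<^bsub>S\<^esub> b" for X
    have fx: "f (N +>\<^bsub>S\<^esub> x) = x \<otimes>\<^bsub>S\<^esub> b" if x: "x \<in> carrier S" for x
    proof -
      have "(SOME z. z \<in> N +>\<^bsub>S\<^esub> x) \<in> N +>\<^bsub>S\<^esub> x" using abelian_subgroup.a_rcos_self[OF N x] by (rule someI)
      then obtain n where n: "n \<in> N" "(SOME z. z \<in> N +>\<^bsub>S\<^esub> x) = n \<oplus>\<^bsub>S\<^esub> x" using in_coset by blast
      then have "n \<in> carrier S" "n \<otimes>\<^bsub>S\<^esub> b = \<zero>\<^bsub>S\<^esub>" using Nc 2 memN by auto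
      then show ?thesis unfolding f_def n(2) using x b by (simp add: l_distr)
    qed
    have "bij_betw f (carrier ?Q) (left_annihilator S a)"
    proof (rule bij_betw_imageI)
      show "inj_on f (carrier ?Q)"
      proof (rule inj_onI)
        fix X Y assume XY: "X \<in> carrier ?Q" "Y \<in> carrier ?Q" "f X = f Y"
        then obtain x y where xy: "x \<in> carrier S" "y \<in> carrier S" "X = N +>\<^bsub>S\<^esub> x" "Y = N +>\<^bsub>S\<^esub> y"
          unfolding Qcar by auto
        then have "x \<otimes>\<^bsub>S\<^esub> b = y \<otimes>\<^bsub>S\<^esub> b" using XY fx by simp
        then have "(x \<ominus>\<^bsub>S\<^esub> y) \<otimes>\<^bsub>S\<^esub> b = \<zero>\<^bsub>S\<^esub>" using xy b by (simp add: minus_eq l_distr l_minus r_neg)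
        then have "x \<ominus>\<^bsub>S\<^esub> y \<in> N" using 2 xy memN by simp
        then show "X = Y" using coset_eq xy by simp
      qed
      show "f ` carrier ?Q = left_annihilator S a"
        unfolding Qcar left_annihilator_def
      proof (intro equalityI subsetI)
        fix z assume "z \<in> f ` {N +>\<^bsub>S\<^esub> x |x. x \<in> carrier S}"
        then show "z \<in> {x \<in> carrier S. x \<otimes>\<^bsub>S\<^esub> a = \<zero>\<^bsub>S\<^esub>}" using fx b 1 by auto
      next
        fix z assume "z \<in> {x \<in> carrier S. x \<otimes>\<^bsub>S\<^esub> a = \<zero>\<^bsub>S\<^esub>}"
        then obtain y where "y \<in> carrier S" "z = y \<otimes>\<^bsub>S\<^esub> b" using 1 by auto
        then show "z \<in> f ` {N +>\<^bsub>S\<^esub> x |x. x \<in> carrier S}" using fx by force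
      qed
    qed
    moreover have "f (X \<oplus>\<^bsub>?Q\<^esub> Y) = f X \<oplus>\<^bsub>S\<^esub> f Y" if "X \<in> carrier ?Q" "Y \<in> carrier ?Q" for X Y
      using that b unfolding Qcar by (auto simp: Qadd fx l_distr)
    moreover have "f (r \<odot>\<^bsub>?Q\<^esub> X) = r \<otimes>\<^bsub>S\<^esub> f X" if "r \<in> carrier S" "X \<in> carrier ?Q" for r X
      using that b unfolding Qcar by (auto simp: Qsm fx m_assoc)
    ultimately show "left_module_iso S (quotient_module (left_regular_module S) (PIdl\<^bsub>S\<^esub> a)) ?A"
      unfolding left_module_iso_def N_def[symmetric] Asimps by blast
  qed
qed

lemma left_morphic_iff_pair:
  assumes "ring S"
  shows "left_morphic S \<longleftrightarrow>
    (\<forall>a\<in>carrier S. \<exists>b. left_morphic_pair S \<one>\<^bsub>S\<^esub> \<one>\<^bsub>S\<^esub> a b)"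
  using left_module_iso_iff_pair[OF assms] by (auto simp: left_morphic_def)

lemma left_morphic_iff:
  assumes "ring S"
  shows "left_morphic S \<longleftrightarrow> (\<forall>a\<in>carrier S. \<exists>b\<in>carrier S. \<forall>x\<in>carrier S.
     (x \<otimes>\<^bsub>S\<^esub> a = \<zero>\<^bsub>S\<^esub> \<longleftrightarrow> (\<exists>y\<in>carrier S. x = y \<otimes>\<^bsub>S\<^esub> b)) \<and>
     (x \<otimes>\<^bsub>S\<^esub> b = \<zero>\<^bsub>S\<^esub> \<longleftrightarrow> (\<exists>y\<in>carrier S. x = y \<otimes>\<^bsub>S\<^esub> a)))"
proof -
  interpret ring S by fact
  show ?thesis unfolding left_morphic_iff_pair[OF assms] left_morphic_pair_def Bex_def
    by (intro ball_cong refl arg_cong[where f = Ex] ext) auto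
qed

section \<open>Corner rings\<close>

text \<open>The operations of \<open>R\<close> are kept and only \<open>carrier\<close> and
  \<open>one\<close> are replaced. So a corner has the type of \<open>R\<close>, a corner of a
  corner is literally a corner, and passing to the opposite ring commutes with it as an equality of
  records.\<close>

definition corner :: "('a, 'x) ring_scheme \<Rightarrow> 'a \<Rightarrow> ('a, 'x) ring_scheme" where
  "corner R e = R\<lparr>carrier := {x \<in> carrier R. e \<otimes>\<^bsub>R\<^esub> x = x \<and> x \<otimes>\<^bsub>R\<^esub> e = x}, one := e\<rparr>"

lemma corner_simps [simp]:
  "x \<in> carrier (corner R e) \<longleftrightarrow> x \<in> carrier R \<and> e \<otimes>\<^bsub>R\<^esub> x = x \<and> x \<otimes>\<^bsub>R\<^esub> e = x"
  "x \<otimes>\<^bsub>corner R e\<^esub> y = x \<otimes>\<^bsub>R\<^esub> y"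
  "\<one>\<^bsub>corner R e\<^esub> = e"
  "\<zero>\<^bsub>corner R e\<^esub> = \<zero>\<^bsub>R\<^esub>"
  "x \<oplus>\<^bsub>corner R e\<^esub> y = x \<oplus>\<^bsub>R\<^esub> y"
  by (auto simp: corner_def)

lemma opposite_ring_corner: "opposite_ring (corner R e) = corner (opposite_ring R) e"
  by (simp add: corner_def opposite_ring_def conj_commute)

lemma ring_corner:
  assumes "ring R" and e: "e \<in> carrier R" "e \<otimes>\<^bsub>R\<^esub> e = e"
  shows "ring (corner R e)"
proof -
  interpret ring R by fact
  show ?thesis
  proof (rule ringI)
    show "abelian_group (corner R e)"
    proof (rule abelian_groupI)
      fix x assume "x \<in> carrier (corner R e)"
      then show "\<exists>y\<in>carrier (corner R e). y \<oplus>\<^bsub>corner R e\<^esub> x = \<zero>\<^bsub>corner R e\<^esub>"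
        using e by (intro bexI[of _ "\<ominus>\<^bsub>R\<^esub> x"]) (auto simp: l_neg l_minus r_minus)
    qed (use e in \<open>auto simp: a_ac l_distr r_distr\<close>)
    show "monoid (corner R e)"
    proof (rule monoidI)
      fix x y assume "x \<in> carrier (corner R e)" "y \<in> carrier (corner R e)"
      then show "x \<otimes>\<^bsub>corner R e\<^esub> y \<in> carrier (corner R e)"
        using e by (auto simp: m_assoc) (metis m_assoc)
    qed (use e in \<open>auto simp: m_assoc\<close>)
  qed (auto simp: l_distr r_distr)
qed

lemma a_inv_corner:
  assumes "ring R" and e: "e \<in> carrier R" "e \<otimes>\<^bsub>R\<^esub> e = e" and x: "x \<in> carrier (corner R e)"
  shows "\<ominus>\<^bsub>corner R e\<^esub> x = \<ominus>\<^bsub>R\<^esub> x"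
proof -
  interpret ring R by fact
  interpret C: ring "corner R e" by (rule ring_corner[OF assms(1-3)])
  have "\<ominus>\<^bsub>R\<^esub> x \<in> carrier (corner R e)" using x e by (auto simp: l_minus r_minus)
  moreover have "\<ominus>\<^bsub>R\<^esub> x \<oplus>\<^bsub>corner R e\<^esub> x = \<zero>\<^bsub>corner R e\<^esub>" using x by (simp add: l_neg)
  ultimately show ?thesis using C.minus_equality x by blast
qed

text \<open>\<open>finsum\<close> refers to the carrier of its ring, so an induction is required
  although the additions coincide.\<close>

lemma finsum_corner:
  assumes "ring R" and e: "e \<in> carrier R" "e \<otimes>\<^bsub>R\<^esub> e = e" and "finite A" "f \<in> A \<rightarrow> carrier (corner R e)"
  shows "finsum (corner R e) f A = finsum R f A"
proof -
  interpret ring R by fact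
  interpret C: ring "corner R e" by (rule ring_corner[OF assms(1-3)])
  show ?thesis using assms(4,5)
  proof (induct rule: finite_induct)
    case (insert a A)
    then have "f \<in> A \<rightarrow> carrier R" "f a \<in> carrier R" "f \<in> A \<rightarrow> carrier (corner R e)" "f a \<in> carrier (corner R e)"
      by (auto simp: Pi_iff)
    with insert show ?case by simp
  qed simp
qed

section \<open>The trivial extension\<close>

lemma trivial_extension_simps [simp]:
  "carrier (R \<propto> M) = carrier R \<times> carrier M"
  "(r, m) \<otimes>\<^bsub>R \<propto> M\<^esub> (s, n) = (r \<otimes>\<^bsub>R\<^esub> s, r \<odot>\<^bsub>M\<^esub> n \<oplus>\<^bsub>M\<^esub> rsmult M m s)"
  "\<one>\<^bsub>R \<propto> M\<^esub> = (\<one>\<^bsub>R\<^esub>, \<zero>\<^bsub>M\<^esub>)"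
  "\<zero>\<^bsub>R \<propto> M\<^esub> = (\<zero>\<^bsub>R\<^esub>, \<zero>\<^bsub>M\<^esub>)"
  "(r, m) \<oplus>\<^bsub>R \<propto> M\<^esub> (s, n) = (r \<oplus>\<^bsub>R\<^esub> s, m \<oplus>\<^bsub>M\<^esub> n)"
  by (auto simp: trivial_extension_def)

lemma (in bimodule) smult_zero [simp]:
  assumes "a \<in> carrier R"
  shows "a \<odot>\<^bsub>M\<^esub> \<zero>\<^bsub>M\<^esub> = \<zero>\<^bsub>M\<^esub>"
  using lsmult_r_distr[of a "\<zero>\<^bsub>M\<^esub>" "\<zero>\<^bsub>M\<^esub>"] lsmult_closed[of a "\<zero>\<^bsub>M\<^esub>"] assms
    M.add.l_cancel_one'[of "a \<odot>\<^bsub>M\<^esub> \<zero>\<^bsub>M\<^esub>" "a \<odot>\<^bsub>M\<^esub> \<zero>\<^bsub>M\<^esub>"] by simp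

lemma (in bimodule) zero_smult [simp]:
  assumes "x \<in> carrier M"
  shows "\<zero>\<^bsub>R\<^esub> \<odot>\<^bsub>M\<^esub> x = \<zero>\<^bsub>M\<^esub>"
  using lsmult_l_distr[of "\<zero>\<^bsub>R\<^esub>" "\<zero>\<^bsub>R\<^esub>" x] lsmult_closed[of "\<zero>\<^bsub>R\<^esub>" x] assms
    M.add.l_cancel_one'[of "\<zero>\<^bsub>R\<^esub> \<odot>\<^bsub>M\<^esub> x" "\<zero>\<^bsub>R\<^esub> \<odot>\<^bsub>M\<^esub> x"] by simp

lemma (in bimodule) rsmult_zero [simp]:
  assumes "a \<in> carrier R"
  shows "rsmult M \<zero>\<^bsub>M\<^esub> a = \<zero>\<^bsub>M\<^esub>"
  using rsmult_l_distr[of a "\<zero>\<^bsub>M\<^esub>" "\<zero>\<^bsub>M\<^esub>"] rsmult_closed[of a "\<zero>\<^bsub>M\<^esub>"] assms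
    M.add.l_cancel_one'[of "rsmult M \<zero>\<^bsub>M\<^esub> a" "rsmult M \<zero>\<^bsub>M\<^esub> a"] by simp

lemma (in bimodule) rsmult_zero_right [simp]:
  assumes "x \<in> carrier M"
  shows "rsmult M x \<zero>\<^bsub>R\<^esub> = \<zero>\<^bsub>M\<^esub>"
  using rsmult_r_distr[of "\<zero>\<^bsub>R\<^esub>" "\<zero>\<^bsub>R\<^esub>" x] rsmult_closed[of "\<zero>\<^bsub>R\<^esub>" x] assms
    M.add.l_cancel_one'[of "rsmult M x \<zero>\<^bsub>R\<^esub>" "rsmult M x \<zero>\<^bsub>R\<^esub>"] by simp

lemma (in bimodule) ring_trivial_extension: "ring (R \<propto> M)"
proof (rule ringI)
  show "abelian_group (R \<propto> M)"
  proof (rule abelian_groupI)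
    fix x assume "x \<in> carrier (R \<propto> M)"
    then obtain r m where "x = (r, m)" "r \<in> carrier R" "m \<in> carrier M" by auto
    then show "\<exists>y\<in>carrier (R \<propto> M). y \<oplus>\<^bsub>R \<propto> M\<^esub> x = \<zero>\<^bsub>R \<propto> M\<^esub>"
      by (intro bexI[of _ "(\<ominus>\<^bsub>R\<^esub> r, \<ominus>\<^bsub>M\<^esub> m)"]) (auto simp: R.l_neg M.l_neg)
  qed (auto simp: R.a_ac M.a_ac)
  show "monoid (R \<propto> M)"
    by (rule monoidI)
      (auto simp: lsmult_closed rsmult_closed R.m_assoc lsmult_one rsmult_one lsmult_assoc rsmult_assoc
        smult_rsmult_assoc lsmult_r_distr rsmult_l_distr M.a_ac)
qed (auto simp: lsmult_closed rsmult_closed R.l_distr R.r_distr lsmult_l_distr lsmult_r_distr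
    rsmult_l_distr rsmult_r_distr M.a_ac)

section \<open>Artinian principal local rings\<close>

definition uniformizer :: "('a, 'x) ring_scheme \<Rightarrow> 'a \<Rightarrow> bool" where
  "uniformizer T c \<longleftrightarrow> ring T \<and> \<one>\<^bsub>T\<^esub> \<noteq> \<zero>\<^bsub>T\<^esub> \<and> c \<in> carrier T \<and> (\<exists>n::nat. c [^]\<^bsub>T\<^esub> n = \<zero>\<^bsub>T\<^esub>) \<and>
     (\<forall>x\<in>carrier T. \<exists>s::nat. \<exists>u\<in>Units T. x = u \<otimes>\<^bsub>T\<^esub> c [^]\<^bsub>T\<^esub> s) \<and>
     (\<forall>x\<in>carrier T. \<exists>s::nat. \<exists>u\<in>Units T. x = c [^]\<^bsub>T\<^esub> s \<otimes>\<^bsub>T\<^esub> u)"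

lemma uniformizer_opposite_ring:
  assumes "uniformizer T c"
  shows "uniformizer (opposite_ring T) c"
  using assms by (auto simp: uniformizer_def nat_pow_opposite_ring)

lemma ring_hom_Units:
  assumes "h \<in> ring_hom R S" "u \<in> Units R"
  shows "h u \<in> Units S"
proof -
  obtain v where v: "u \<in> carrier R" "v \<in> carrier R" "v \<otimes>\<^bsub>R\<^esub> u = \<one>\<^bsub>R\<^esub>" "u \<otimes>\<^bsub>R\<^esub> v = \<one>\<^bsub>R\<^esub>"
    using assms(2) by (auto simp: Units_def)
  then have "h v \<otimes>\<^bsub>S\<^esub> h u = \<one>\<^bsub>S\<^esub>" "h u \<otimes>\<^bsub>S\<^esub> h v = \<one>\<^bsub>S\<^esub>"
    using ring_hom_memE[OF assms(1)] by metis+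
  then show ?thesis using ring_hom_memE(1)[OF assms(1)] v by (auto simp: Units_def)
qed

lemma ring_hom_nat_pow:
  assumes "ring R" "ring S" "h \<in> ring_hom R S" "x \<in> carrier R"
  shows "h (x [^]\<^bsub>R\<^esub> (n::nat)) = h x [^]\<^bsub>S\<^esub> n"
proof -
  interpret R: ring R by fact
  interpret S: ring S by fact
  show ?thesis using assms(4) ring_hom_memE[OF assms(3)] by (induct n) auto
qed

text \<open>Units and powers are carried along by homomorphisms, so nonzero quotients of chain rings
  are chain rings. This serves the corner of a matrix ring at one matrix unit, the embedding of
  \<open>eRe\<close> when \<open>M = 0\<close>, and the projection from the corner of
  \<open>R \<propto> M\<close> to \<open>eRe\<close>.\<close>

lemma uniformizer_ring_hom:
  assumes T: "uniformizer T c" and A: "ring A" "\<one>\<^bsub>A\<^esub> \<noteq> \<zero>\<^bsub>A\<^esub>"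
    and h: "h \<in> ring_hom T A" "carrier A \<subseteq> h ` carrier T"
  shows "uniformizer A (h c)"
proof -
  from T have "ring T" and c: "c \<in> carrier T" by (auto simp: uniformizer_def)
  interpret T: ring T by fact
  interpret A: ring A by fact
  note hh = ring_hom_memE[OF h(1)]
  note hp = ring_hom_nat_pow[OF \<open>ring T\<close> A(1) h(1) c]
  have h0: "h \<zero>\<^bsub>T\<^esub> = \<zero>\<^bsub>A\<^esub>" by (rule ring_hom_zero[OF h(1) T.ring_axioms A.ring_axioms])
  obtain n :: nat where "c [^]\<^bsub>T\<^esub> n = \<zero>\<^bsub>T\<^esub>" using T by (auto simp: uniformizer_def)
  then have n: "h c [^]\<^bsub>A\<^esub> n = \<zero>\<^bsub>A\<^esub>" using hp[of n] h0 by simp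
  have "(\<exists>s::nat. \<exists>u\<in>Units A. y = u \<otimes>\<^bsub>A\<^esub> h c [^]\<^bsub>A\<^esub> s) \<and> (\<exists>s::nat. \<exists>u\<in>Units A. y = h c [^]\<^bsub>A\<^esub> s \<otimes>\<^bsub>A\<^esub> u)"
    if "y \<in> carrier A" for y
  proof -
    from that h(2) obtain x where x: "x \<in> carrier T" "y = h x" by auto
    obtain s :: nat and u where su: "u \<in> Units T" "x = u \<otimes>\<^bsub>T\<^esub> c [^]\<^bsub>T\<^esub> s"
      using T x by (auto simp: uniformizer_def)
    obtain t :: nat and v where tv: "v \<in> Units T" "x = c [^]\<^bsub>T\<^esub> t \<otimes>\<^bsub>T\<^esub> v"
      using T x by (auto simp: uniformizer_def)
    have "y = h u \<otimes>\<^bsub>A\<^esub> h c [^]\<^bsub>A\<^esub> s" using su x c hh hp T.Units_closed[OF su(1)] by simp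
    moreover have "y = h c [^]\<^bsub>A\<^esub> t \<otimes>\<^bsub>A\<^esub> h v" using tv x c hh hp T.Units_closed[OF tv(1)] by simp
    ultimately show ?thesis using ring_hom_Units[OF h(1)] su tv by blast
  qed
  then show ?thesis unfolding uniformizer_def using A n c hh by auto
qed

lemma decreasing_finite_range_stabilises:
  fixes I :: "nat \<Rightarrow> 'a set"
  assumes "\<And>n. I (Suc n) \<subseteq> I n" "finite (range I)"
  shows "\<exists>N. \<forall>n\<ge>N. I n = I N"
proof -
  obtain N where N: "\<And>n. I n \<subseteq> I N \<Longrightarrow> I N = I n"
    using finite_has_minimal[OF assms(2)] by auto
  have "I n \<subseteq> I N" if "n \<ge> N" for n using lift_Suc_antimono_le[of I, OF assms(1) that] .
  then show ?thesis using N by blast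
qed

lemma (in ring) left_ideal_contains_unit:
  assumes "left_ideal I R" "u \<in> I" "u \<in> Units R"
  shows "I = carrier R"
proof -
  have "inv u \<otimes> u \<in> I" by (rule left_idealD(7)[OF assms(1)]) (use assms in auto)
  then have "\<one> \<in> I" using assms(3) by (simp add: Units_l_inv)
  then have "x \<in> I" if "x \<in> carrier R" for x using left_idealD(7)[OF assms(1) that, of \<one>] that by simp
  then show ?thesis using left_idealD(2)[OF assms(1)] by auto
qed

locale uniformizer_ring = ring R for R (structure) +
  fixes c
  assumes unif: "uniformizer R c"
begin

lemma c_closed [simp, intro]: "c \<in> carrier R"
  and one_not_zero: "\<one> \<noteq> \<zero>"
  using unif by (auto simp: uniformizer_def)

lemma nilpotent: "\<exists>n::nat. c [^] n = \<zero>"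
  using unif by (auto simp: uniformizer_def)

lemma left_form: "x \<in> carrier R \<Longrightarrow> \<exists>s::nat. \<exists>u\<in>Units R. x = u \<otimes> c [^] s"
  using unif by (auto simp: uniformizer_def)

text \<open>Otherwise \<open>c\<close> has a left inverse \<open>w\<close>, and
  \<open>w^n c^n = 1\<close> for all \<open>n\<close> contradicts nilpotence.\<close>

lemma multiple_not_unit:
  assumes "y \<in> carrier R"
  shows "y \<otimes> c \<notin> Units R"
proof
  assume u: "y \<otimes> c \<in> Units R"
  define w where "w = inv (y \<otimes> c) \<otimes> y"
  have w: "w \<in> carrier R" "w \<otimes> c = \<one>" using u assms by (auto simp: w_def m_assoc Units_l_inv)
  have "w [^] n \<otimes> c [^] n = \<one>" for n :: nat
  proof (induct n)
    case (Suc n)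
    have "w [^] Suc n \<otimes> c [^] Suc n = (w [^] n \<otimes> w) \<otimes> (c \<otimes> c [^] n)"
      using nat_pow_Suc2[of c n] by simp
    also have "\<dots> = w [^] n \<otimes> ((w \<otimes> c) \<otimes> c [^] n)" using w(1) by (simp add: m_assoc)
    finally show ?case unfolding w(2) using w(1) Suc by simp
  qed simp
  then show False using nilpotent one_not_zero w by (metis nat_pow_closed r_null)
qed

lemma nonunit_multiple:
  assumes "x \<in> carrier R" "x \<notin> Units R"
  shows "\<exists>y\<in>carrier R. x = y \<otimes> c"
proof -
  obtain s :: nat and u where su: "u \<in> Units R" "x = u \<otimes> c [^] s" using left_form[OF assms(1)] by auto
  then have "s \<noteq> 0" using assms by (auto intro: ccontr)
  then obtain t where "s = Suc t" by (cases s) auto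
  then have "x = (u \<otimes> c [^] t) \<otimes> c" using su(2) Units_closed[OF su(1)] by (simp add: m_assoc)
  then show ?thesis using su by blast
qed

text \<open>\<open>s\<close> is the least exponent with \<open>c^s\<close> in \<open>I\<close>: an
  element \<open>u c^r\<close> of \<open>I\<close> puts \<open>c^r\<close> into \<open>I\<close>, so
  \<open>r \<ge> s\<close>. The bound \<open>s \<le> n\<close> leaves only finitely many left
  ideals, which gives the descending chain condition.\<close>

lemma left_ideal_power:
  assumes n: "c [^] (n::nat) = \<zero>" and I: "left_ideal I R"
  shows "\<exists>s\<le>n. I = PIdl (c [^] s)"
proof -
  have "c [^] n \<in> I" using n left_idealD(3)[OF I] by simp
  define s where "s = (LEAST s::nat. c [^] s \<in> I)"
  have s: "c [^] s \<in> I" "s \<le> n" unfolding s_def using \<open>c [^] n \<in> I\<close> by (auto intro: LeastI Least_le)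
  have "x \<in> PIdl (c [^] s)" if x: "x \<in> I" for x
  proof -
    have "x \<in> carrier R" using x left_idealD(2)[OF I] by auto
    then obtain r :: nat and u where ru: "u \<in> Units R" "x = u \<otimes> c [^] r" using left_form[of x] by auto
    then have "c [^] r = inv u \<otimes> x" using Units_closed[OF ru(1)] by (simp add: m_assoc[symmetric] Units_l_inv)
    moreover have "inv u \<otimes> x \<in> I" by (rule left_idealD(7)[OF I _ x]) (use ru in simp)
    ultimately have "c [^] r \<in> I" by metis
    then have "s \<le> r" unfolding s_def by (rule Least_le)
    then have "c [^] r = c [^] (r - s) \<otimes> c [^] s" by (simp add: nat_pow_mult)
    then have "x = (u \<otimes> c [^] (r - s)) \<otimes> c [^] s" using ru(2) Units_closed[OF ru(1)] by (simp add: m_assoc)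
    then show ?thesis using ru unfolding cgenideal_def by blast
  qed
  moreover have "PIdl (c [^] s) \<subseteq> I" using left_idealD(7)[OF I _ s(1)] by (auto simp: cgenideal_def)
  ultimately show ?thesis using s by blast
qed

lemma left_principal: "left_ideal I R \<Longrightarrow> \<exists>a\<in>carrier R. I = PIdl a"
  using left_ideal_power nilpotent nat_pow_closed[OF c_closed] by metis

lemma left_artinian: "left_artinian R"
  unfolding left_artinian_def
proof (intro conjI ring_axioms allI impI)
  fix I :: "nat \<Rightarrow> 'a set" assume I: "(\<forall>n. left_ideal (I n) R) \<and> (\<forall>n. I (Suc n) \<subseteq> I n)"
  obtain n :: nat where n: "c [^] n = \<zero>" using nilpotent by auto
  have "range I \<subseteq> (\<lambda>s. PIdl (c [^] s)) ` {..n}" using left_ideal_power[OF n] I by blast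
  then have "finite (range I)" by (rule finite_subset) simp
  then show "\<exists>N. \<forall>n\<ge>N. I n = I N" using I by (intro decreasing_finite_range_stabilises) auto
qed

text \<open>The nonunits are exactly the left multiples of \<open>c\<close> and so form a left
  ideal; a proper left ideal contains no unit and therefore lies inside it.\<close>

lemma is_local: "local_ring R"
proof -
  let ?M = "PIdl c"
  have M: "left_ideal ?M R" by (rule left_ideal_PIdl) simp
  have memM: "x \<in> ?M \<longleftrightarrow> x \<in> carrier R \<and> x \<notin> Units R" for x
    using nonunit_multiple multiple_not_unit unfolding cgenideal_def by auto
  have ne: "?M \<noteq> carrier R" using memM[of \<one>] by auto
  have sub: "K \<subseteq> ?M" if "left_ideal K R" "K \<noteq> carrier R" for K
    using that memM left_ideal_contains_unit left_idealD(2)[OF that(1)] by blast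
  have max: "maximal_left_ideal ?M R" unfolding maximal_left_ideal_def using M ne sub by blast
  moreover have "I = ?M" if "maximal_left_ideal I R" for I
    using that M ne sub unfolding maximal_left_ideal_def by blast
  ultimately show ?thesis unfolding local_ring_def using ring_axioms by blast
qed

end

lemma uniformizer_imp:
  assumes "uniformizer T c"
  shows "artinian_ring T" "principal_ring T" "local_ring T"
proof -
  interpret T: uniformizer_ring T c
    using assms by (simp add: uniformizer_ring_def uniformizer_ring_axioms_def uniformizer_def)
  interpret O: uniformizer_ring "opposite_ring T" c
    using uniformizer_opposite_ring[OF assms]
    by (simp add: uniformizer_ring_def uniformizer_ring_axioms_def uniformizer_def)
  show "artinian_ring T" unfolding artinian_ring_def using T.left_artinian O.left_artinian by auto
  show "principal_ring T" unfolding principal_ring_def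
    using T.left_principal O.left_principal T.ring_axioms by auto
  show "local_ring T" by (rule T.is_local)
qed

text \<open>As long as the cofactor is a nonunit, another \<open>c\<close> can be split off from it.
  After \<open>n\<close> rounds the element is \<open>c^n y = 0\<close>, and zero itself counts as
  \<open>c^n\<close> times the unit \<open>1\<close>.\<close>

lemma (in ring) power_form:
  assumes c: "c \<in> carrier R" "c [^] (n::nat) = \<zero>"
    and J: "\<And>x. x \<in> carrier R \<Longrightarrow> x \<notin> Units R \<Longrightarrow> \<exists>y\<in>carrier R. x = c \<otimes> y"
    and x: "x \<in> carrier R"
  shows "\<exists>s::nat. \<exists>u\<in>Units R. x = c [^] s \<otimes> u"
proof -
  have "(\<exists>s::nat. \<exists>u\<in>Units R. x = c [^] s \<otimes> u) \<or> (\<exists>y\<in>carrier R. x = c [^] m \<otimes> y)" for m :: nat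
  proof (induct m)
    case 0
    then show ?case using x by auto
  next
    case (Suc m)
    show ?case
    proof (rule disjCI)
      assume no: "\<not> (\<exists>y\<in>carrier R. x = c [^] Suc m \<otimes> y)"
      show "\<exists>s::nat. \<exists>u\<in>Units R. x = c [^] s \<otimes> u"
      proof (rule ccontr)
        assume no': "\<not> ?thesis"
        with Suc obtain y where y: "y \<in> carrier R" "x = c [^] m \<otimes> y" by auto
        with no' have "y \<notin> Units R" by auto
        then obtain z where z: "z \<in> carrier R" "y = c \<otimes> z" using J y by auto
        then have "x = c [^] Suc m \<otimes> z" using y c by (simp add: m_assoc)
        then show False using no z by auto
      qed
    qed
  qed
  from this[of n] show ?thesis
  proof
    assume "\<exists>y\<in>carrier R. x = c [^] n \<otimes> y"
    then have "x = c [^] n \<otimes> \<one>" using c by auto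
    then show ?thesis by blast
  qed
qed

text \<open>If the nonunits form both \<open>cT\<close> and \<open>Td\<close>, then they also form \<open>Tc\<close>: writing \<open>c = yd\<close>, a nonunit
  \<open>y\<close> would give \<open>d \<in> ydT \<subseteq> yTd\<close> and hence \<open>d = 0\<close>.\<close>

lemma uniformizerI:
  assumes "ring T" and "\<one>\<^bsub>T\<^esub> \<noteq> \<zero>\<^bsub>T\<^esub>" and c: "c \<in> carrier T" and n: "c [^]\<^bsub>T\<^esub> (n::nat) = \<zero>\<^bsub>T\<^esub>"
    and d: "d \<in> carrier T"
    and Jc: "\<And>x. x \<in> carrier T \<Longrightarrow> x \<notin> Units T \<longleftrightarrow> (\<exists>y\<in>carrier T. x = c \<otimes>\<^bsub>T\<^esub> y)"
    and Jd: "\<And>x. x \<in> carrier T \<Longrightarrow> x \<notin> Units T \<longleftrightarrow> (\<exists>y\<in>carrier T. x = y \<otimes>\<^bsub>T\<^esub> d)"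
  shows "uniformizer T c"
proof -
  interpret ring T by fact
  have cJ: "c \<notin> Units T" using Jc[OF c] c by (metis r_one one_closed)
  have dJ: "d \<notin> Units T" using Jd[OF d] d by (metis l_one one_closed)
  have "\<exists>y\<in>carrier T. x = y \<otimes>\<^bsub>T\<^esub> c" if x: "x \<in> carrier T" "x \<notin> Units T" for x
  proof -
    obtain y where y: "y \<in> carrier T" "c = y \<otimes>\<^bsub>T\<^esub> d" using Jd[OF c] cJ by auto
    show ?thesis
    proof (cases "y \<in> Units T")
      case True
      obtain z where z: "z \<in> carrier T" "x = z \<otimes>\<^bsub>T\<^esub> d" using Jd x by auto
      have "d = inv\<^bsub>T\<^esub> y \<otimes>\<^bsub>T\<^esub> c" unfolding y(2) using True d y by (simp add: m_assoc[symmetric] Units_l_inv)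
      then have "x = (z \<otimes>\<^bsub>T\<^esub> inv\<^bsub>T\<^esub> y) \<otimes>\<^bsub>T\<^esub> c" using z True c by (simp add: m_assoc)
      then show ?thesis using z True by blast
    next
      case False
      obtain t where t: "t \<in> carrier T" "d = c \<otimes>\<^bsub>T\<^esub> t" using Jc[OF d] dJ by auto
      have "d \<otimes>\<^bsub>T\<^esub> t = c \<otimes>\<^bsub>T\<^esub> (t \<otimes>\<^bsub>T\<^esub> t)"
        using t(2) m_assoc[OF c t(1) t(1)] by simp
      then have "d \<otimes>\<^bsub>T\<^esub> t \<notin> Units T" using Jc[of "d \<otimes>\<^bsub>T\<^esub> t"] d t(1) by auto
      then obtain t' where t': "t' \<in> carrier T" "d \<otimes>\<^bsub>T\<^esub> t = t' \<otimes>\<^bsub>T\<^esub> d" using Jd[of "d \<otimes>\<^bsub>T\<^esub> t"] d t by auto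
      have "d = y \<otimes>\<^bsub>T\<^esub> (d \<otimes>\<^bsub>T\<^esub> t)" using t(2) y(2) m_assoc[OF y(1) d t(1)] by metis
      then have dd: "d = (y \<otimes>\<^bsub>T\<^esub> t') \<otimes>\<^bsub>T\<^esub> d" using t'(2) m_assoc[OF y(1) t'(1) d] by metis
      obtain y1 where y1: "y1 \<in> carrier T" "y = c \<otimes>\<^bsub>T\<^esub> y1" using Jc[OF y(1)] False by auto
      \<comment> \<open>\<open>y\<close> is a nonunit, so \<open>y \<otimes> t'\<close> lies in
        \<open>cT\<close>. If the difference were a nonunit too, it would also lie in
        \<open>cT\<close>, and then so would \<open>1\<close>.\<close>
      have u: "\<one>\<^bsub>T\<^esub> \<ominus>\<^bsub>T\<^esub> y \<otimes>\<^bsub>T\<^esub> t' \<in> Units T"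
      proof (rule ccontr)
        assume "\<not> ?thesis"
        then obtain z where z: "z \<in> carrier T" "\<one>\<^bsub>T\<^esub> \<ominus>\<^bsub>T\<^esub> y \<otimes>\<^bsub>T\<^esub> t' = c \<otimes>\<^bsub>T\<^esub> z"
          using Jc[of "\<one>\<^bsub>T\<^esub> \<ominus>\<^bsub>T\<^esub> y \<otimes>\<^bsub>T\<^esub> t'"] y t' by auto
        have "\<one>\<^bsub>T\<^esub> = (\<one>\<^bsub>T\<^esub> \<ominus>\<^bsub>T\<^esub> y \<otimes>\<^bsub>T\<^esub> t') \<oplus>\<^bsub>T\<^esub> y \<otimes>\<^bsub>T\<^esub> t'" using y t' by (simp add: minus_eq a_assoc l_neg)
        also have "\<dots> = c \<otimes>\<^bsub>T\<^esub> (z \<oplus>\<^bsub>T\<^esub> y1 \<otimes>\<^bsub>T\<^esub> t')"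
          unfolding z(2) using z y1 t' c by (simp add: r_distr m_assoc)
        finally show False using Jc[of "\<one>\<^bsub>T\<^esub>"] z(1) y1(1) t'(1) by blast
      qed
      have "(\<one>\<^bsub>T\<^esub> \<ominus>\<^bsub>T\<^esub> y \<otimes>\<^bsub>T\<^esub> t') \<otimes>\<^bsub>T\<^esub> d = d \<ominus>\<^bsub>T\<^esub> (y \<otimes>\<^bsub>T\<^esub> t') \<otimes>\<^bsub>T\<^esub> d"
        using y t' d by (simp add: minus_eq l_distr l_minus)
      then have "(\<one>\<^bsub>T\<^esub> \<ominus>\<^bsub>T\<^esub> y \<otimes>\<^bsub>T\<^esub> t') \<otimes>\<^bsub>T\<^esub> d = \<zero>\<^bsub>T\<^esub>" using dd d by (simp add: minus_eq r_neg)
      then have "d = \<zero>\<^bsub>T\<^esub>" using u d by (metis Units_l_cancel Units_closed r_null zero_closed)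
      \<comment> \<open>The nonunits form \<open>Td\<close>, which is now zero, so the nonunit
        \<open>x\<close> vanishes.\<close>
      then have "x = \<zero>\<^bsub>T\<^esub> \<otimes>\<^bsub>T\<^esub> c" using Jd[OF x(1)] x(2) c by auto
      then show ?thesis by blast
    qed
  qed note Jc' = this
  interpret O: ring "opposite_ring T" by (simp add: ring_axioms)
  have 1: "\<exists>s::nat. \<exists>u\<in>Units T. x = c [^]\<^bsub>T\<^esub> s \<otimes>\<^bsub>T\<^esub> u" if "x \<in> carrier T" for x
    using power_form[OF c n _ that] Jc by blast
  have "\<exists>s::nat. \<exists>u\<in>Units T. x = u \<otimes>\<^bsub>T\<^esub> c [^]\<^bsub>T\<^esub> s" if "x \<in> carrier T" for x
    using O.power_form[of c n x] Jc' c n that by (simp add: nat_pow_opposite_ring ring_axioms)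
  then show ?thesis unfolding uniformizer_def using 1 assms by blast
qed

section \<open>Nonunits of local rings\<close>

text \<open>Properness is encoded as the absence of \<open>1\<close>, a condition that passes to
  unions of chains, so that Zorn's lemma applies.\<close>

lemma (in ring) maximal_left_ideal_exists:
  assumes I: "left_ideal I R" "I \<noteq> carrier R"
  shows "\<exists>K. maximal_left_ideal K R \<and> I \<subseteq> K"
proof -
  define A where "A = {K. left_ideal K R \<and> \<one> \<notin> K \<and> I \<subseteq> K}"
  have one: "K = carrier R \<longleftrightarrow> \<one> \<in> K" if "left_ideal K R" for K
    using left_ideal_contains_unit[OF that _ Units_one_closed] by auto
  have "\<exists>M\<in>A. \<forall>X\<in>A. M \<subseteq> X \<longrightarrow> X = M"
  proof (rule subset_Zorn_nonempty)
    show "A \<noteq> {}" using I one[OF I(1)] by (auto simp: A_def)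
    fix C assume C: "C \<noteq> {}" "subset.chain A C"
    then have CA: "\<And>X. X \<in> C \<Longrightarrow> left_ideal X R \<and> \<one> \<notin> X \<and> I \<subseteq> X"
      by (auto simp: subset_chain_def A_def)
    have "left_ideal (\<Union>C) R"
    proof (rule left_idealI)
      show "\<Union>C \<subseteq> carrier R" using CA left_idealD(2) by blast
      show "\<zero> \<in> \<Union>C" using CA C(1) left_idealD(3) by blast
      show "r \<otimes> x \<in> \<Union>C" if rx: "r \<in> carrier R" "x \<in> \<Union>C" for r x
      proof -
        obtain X where "X \<in> C" "x \<in> X" using rx by auto
        then have "r \<otimes> x \<in> X" using CA left_idealD(7) \<open>r \<in> carrier R\<close> by metis
        then show ?thesis using \<open>X \<in> C\<close> by auto
      qed
      show "x \<oplus> y \<in> \<Union>C" if xy: "x \<in> \<Union>C" "y \<in> \<Union>C" for x y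
      proof -
        obtain X Y where XY: "X \<in> C" "Y \<in> C" "x \<in> X" "y \<in> Y" using xy by auto
        then have "X \<subseteq> Y \<or> Y \<subseteq> X" using C(2) by (auto simp: subset_chain_def)
        then show ?thesis using XY CA left_idealD(4) by (metis UnionI subsetD)
      qed
    qed
    then show "\<Union>C \<in> A" using CA C(1) by (auto simp: A_def)
  qed
  then obtain M where M: "M \<in> A" "\<And>X. X \<in> A \<Longrightarrow> M \<subseteq> X \<Longrightarrow> X = M" by blast
  then have "left_ideal M R" "\<one> \<notin> M" "I \<subseteq> M" by (auto simp: A_def)
  moreover have "K = M \<or> K = carrier R" if "left_ideal K R" "M \<subseteq> K" for K
    using that M(2)[of K] one[OF that(1)] \<open>I \<subseteq> M\<close> by (auto simp: A_def)
  ultimately show ?thesis unfolding maximal_left_ideal_def using one by blast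
qed

text \<open>\<open>local_ring\<close> speaks of left ideals only. Outside the unique maximal left
  ideal \<open>I\<close> every \<open>x\<close> has a left inverse \<open>y\<close>; if
  \<open>y\<close> were in \<open>I\<close>, then \<open>1 - xy\<close> would be left invertible
  although \<open>(1 - xy)x = 0\<close>. Hence \<open>y\<close> is outside \<open>I\<close> as well,
  \<open>x\<close> is a unit, and \<open>I\<close> consists of the nonunits. For closure on the
  right, let \<open>x\<close> be in \<open>I\<close>: a product \<open>xr\<close> outside
  \<open>I\<close> gives \<open>x\<close> a right inverse \<open>w\<close>, and
  \<open>xw = 1\<close> is contradictory both for \<open>w\<close> in \<open>I\<close> and for a
  unit \<open>w\<close>.\<close>

lemma (in ring) local_ring_Units:
  assumes "local_ring R"
  shows "left_ideal (carrier R - Units R) R" "right_ideal (carrier R - Units R) R" "\<one> \<noteq> \<zero>"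
proof -
  obtain I where I: "maximal_left_ideal I R" and uniq: "\<And>K. maximal_left_ideal K R \<Longrightarrow> K = I"
    using assms unfolding local_ring_def by blast
  then have LI: "left_ideal I R" and ne: "I \<noteq> carrier R"
    unfolding maximal_left_ideal_def by blast+
  note Ic = left_idealD(2)[OF LI]
  have 1: "\<one> \<notin> I" using left_ideal_contains_unit[OF LI _ Units_one_closed] ne by auto
  have li: "\<exists>y\<in>carrier R. y \<otimes> x = \<one>" if x: "x \<in> carrier R" "x \<notin> I" for x
  proof -
    have "PIdl x = carrier R"
    proof (rule ccontr)
      assume "PIdl x \<noteq> carrier R"
      then obtain K where "maximal_left_ideal K R" "PIdl x \<subseteq> K"
        using maximal_left_ideal_exists[OF left_ideal_PIdl[OF x(1)]] by auto
      moreover have "x \<in> PIdl x" unfolding cgenideal_def using x by (auto intro!: exI[of _ \<one>])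
      ultimately show False using uniq x by blast
    qed
    then have "\<one> \<in> PIdl x" by simp
    then show ?thesis by (auto simp: cgenideal_def)
  qed
  have unit: "x \<in> Units R" if x: "x \<in> carrier R" "x \<notin> I" for x
  proof -
    obtain y where y: "y \<in> carrier R" "y \<otimes> x = \<one>" using li x by auto
    have "y \<notin> I"
    proof
      assume "y \<in> I"
      then have xy: "x \<otimes> y \<in> I" using left_idealD(7)[OF LI] x by auto
      have "\<one> \<ominus> x \<otimes> y \<notin> I"
      proof
        assume "\<one> \<ominus> x \<otimes> y \<in> I"
        then have "(\<one> \<ominus> x \<otimes> y) \<oplus> x \<otimes> y \<in> I" using left_idealD(4)[OF LI] xy by auto
        then show False using 1 x y by (simp add: minus_eq a_assoc l_neg)
      qed
      then obtain z where z: "z \<in> carrier R" "z \<otimes> (\<one> \<ominus> x \<otimes> y) = \<one>"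
        using li[of "\<one> \<ominus> x \<otimes> y"] x(1) y(1) by auto
      have "(\<one> \<ominus> x \<otimes> y) \<otimes> x = x \<ominus> x \<otimes> (y \<otimes> x)"
        using x y by (simp add: minus_eq l_distr l_minus m_assoc)
      then have "(\<one> \<ominus> x \<otimes> y) \<otimes> x = \<zero>" using y x by (simp add: minus_eq r_neg)
      then have "z \<otimes> (\<one> \<ominus> x \<otimes> y) \<otimes> x = \<zero>"
        using x(1) y(1) z(1) m_assoc[of z "\<one> \<ominus> x \<otimes> y" x] by simp
      then have "x = \<zero>" unfolding z(2) using x(1) by simp
      then show False using x left_idealD(3)[OF LI] by simp
    qed
    then obtain w where w: "w \<in> carrier R" "w \<otimes> y = \<one>" using li y by auto
    have "w = w \<otimes> (y \<otimes> x)" using y w by simp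
    also have "\<dots> = (w \<otimes> y) \<otimes> x" using w(1) y(1) x(1) by (simp add: m_assoc)
    also have "\<dots> = x" using w x by simp
    finally show ?thesis using w y x by (auto simp: Units_def)
  qed
  have nu: "x \<notin> Units R" if "x \<in> I" for x using left_ideal_contains_unit[OF LI that] ne by auto
  have I_eq: "carrier R - Units R = I" using unit nu Ic by blast
  then show "left_ideal (carrier R - Units R) R" using LI by simp
  show "\<one> \<noteq> \<zero>" using 1 left_idealD(3)[OF LI] by auto
  have ri: "x \<otimes> r \<in> I" if x: "x \<in> I" and r: "r \<in> carrier R" for x r
  proof (rule ccontr)
    assume "x \<otimes> r \<notin> I"
    moreover have xc: "x \<in> carrier R" using x Ic by auto
    ultimately have u: "x \<otimes> r \<in> Units R" using unit r by auto
    define w where "w = r \<otimes> inv (x \<otimes> r)"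
    have w: "w \<in> carrier R" "x \<otimes> w = \<one>" unfolding w_def using u r xc by (auto simp: m_assoc[symmetric])
    show False
    proof (cases "w \<in> I")
      case True
      then show False using left_idealD(7)[OF LI xc True] w 1 by simp
    next
      case False
      then have wu: "w \<in> Units R" using unit w by auto
      have "x = x \<otimes> (w \<otimes> inv w)" using wu xc by simp
      also have "\<dots> = (x \<otimes> w) \<otimes> inv w" using wu xc w(1) by (simp only: m_assoc Units_inv_closed)
      also have "\<dots> = inv w" unfolding w(2) using wu by simp
      finally show False using wu nu[OF x] by simp
    qed
  qed
  interpret O: ring "opposite_ring R" by (simp add: ring_axioms)
  show "right_ideal (carrier R - Units R) R"
    unfolding I_eq by (rule O.left_idealI) (use left_idealD[OF LI] ri in auto)
qed

text \<open>Principality writes the set of nonunits both as \<open>Ld\<close> and as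
  \<open>cL\<close>. The chain of right ideals \<open>c^n L\<close> stabilises, so
  \<open>c^N = c^N (cy)\<close> for some \<open>N\<close> and \<open>y\<close>; since
  \<open>1 - cy\<close> is a unit, \<open>c^N = 0\<close>.\<close>

lemma uniformizer_exists:
  assumes "artinian_ring L" "principal_ring L" "local_ring L"
  shows "\<exists>c. uniformizer L c"
proof -
  interpret ring L using assms(3) by (simp add: local_ring_def)
  interpret O: ring "opposite_ring L" by (simp add: ring_axioms)
  let ?J = "carrier L - Units L"
  note J = local_ring_Units[OF assms(3)]
  obtain d where d: "d \<in> carrier L" "?J = PIdl\<^bsub>L\<^esub> d"
    using assms(2) J(1) unfolding principal_ring_def by blast
  obtain c where c: "c \<in> carrier L" "?J = PIdl\<^bsub>opposite_ring L\<^esub> c"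
    using assms(2) J(2) unfolding principal_ring_def by blast
  have Jd: "x \<notin> Units L \<longleftrightarrow> (\<exists>y\<in>carrier L. x = y \<otimes>\<^bsub>L\<^esub> d)" if "x \<in> carrier L" for x
    using d(2) that unfolding cgenideal_def by blast
  have Jc: "x \<notin> Units L \<longleftrightarrow> (\<exists>y\<in>carrier L. x = c \<otimes>\<^bsub>L\<^esub> y)" if "x \<in> carrier L" for x
    using c(2) that unfolding cgenideal_def opposite_ring_simps by blast
  define I where "I n = PIdl\<^bsub>opposite_ring L\<^esub> (c [^]\<^bsub>L\<^esub> n)" for n :: nat
  have memI: "x \<in> I n \<longleftrightarrow> (\<exists>y\<in>carrier L. x = c [^]\<^bsub>L\<^esub> n \<otimes>\<^bsub>L\<^esub> y)" for x n
    unfolding I_def cgenideal_def opposite_ring_simps by blast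
  have "left_ideal (I n) (opposite_ring L)" for n unfolding I_def using c by (intro O.left_ideal_PIdl) auto
  moreover have "I (Suc n) \<subseteq> I n" for n
  proof
    fix x assume "x \<in> I (Suc n)"
    then obtain y where "y \<in> carrier L" "x = c [^]\<^bsub>L\<^esub> n \<otimes>\<^bsub>L\<^esub> (c \<otimes>\<^bsub>L\<^esub> y)" using memI c by (auto simp: m_assoc)
    then show "x \<in> I n" using memI c by blast
  qed
  ultimately obtain N where N: "\<And>n. n \<ge> N \<Longrightarrow> I n = I N"
    using assms(1) unfolding artinian_ring_def left_artinian_def by blast
  have "c [^]\<^bsub>L\<^esub> N \<in> I N" unfolding memI using c by (intro bexI[of _ "\<one>\<^bsub>L\<^esub>"]) auto
  then have "c [^]\<^bsub>L\<^esub> N \<in> I (Suc N)" using N[of "Suc N"] by simp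
  then obtain y where y: "y \<in> carrier L" "c [^]\<^bsub>L\<^esub> N = c [^]\<^bsub>L\<^esub> N \<otimes>\<^bsub>L\<^esub> (c \<otimes>\<^bsub>L\<^esub> y)" using memI c by (auto simp: m_assoc)
  have u: "\<one>\<^bsub>L\<^esub> \<ominus>\<^bsub>L\<^esub> c \<otimes>\<^bsub>L\<^esub> y \<in> Units L"
  proof (rule ccontr)
    assume "\<not> ?thesis"
    then have "\<one>\<^bsub>L\<^esub> \<ominus>\<^bsub>L\<^esub> c \<otimes>\<^bsub>L\<^esub> y \<in> ?J" "c \<otimes>\<^bsub>L\<^esub> y \<in> ?J" using c y Jc by auto
    then have "(\<one>\<^bsub>L\<^esub> \<ominus>\<^bsub>L\<^esub> c \<otimes>\<^bsub>L\<^esub> y) \<oplus>\<^bsub>L\<^esub> c \<otimes>\<^bsub>L\<^esub> y \<in> ?J" by (rule left_idealD(4)[OF J(1)])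
    moreover have "(\<one>\<^bsub>L\<^esub> \<ominus>\<^bsub>L\<^esub> c \<otimes>\<^bsub>L\<^esub> y) \<oplus>\<^bsub>L\<^esub> c \<otimes>\<^bsub>L\<^esub> y = \<one>\<^bsub>L\<^esub>" using c y by (simp add: minus_eq a_assoc l_neg)
    ultimately show False by simp
  qed
  have "c [^]\<^bsub>L\<^esub> N \<otimes>\<^bsub>L\<^esub> (\<one>\<^bsub>L\<^esub> \<ominus>\<^bsub>L\<^esub> c \<otimes>\<^bsub>L\<^esub> y) = c [^]\<^bsub>L\<^esub> N \<ominus>\<^bsub>L\<^esub> c [^]\<^bsub>L\<^esub> N \<otimes>\<^bsub>L\<^esub> (c \<otimes>\<^bsub>L\<^esub> y)"
    using c y(1) by (simp add: minus_eq r_distr r_minus)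
  also have "\<dots> = \<zero>\<^bsub>L\<^esub>" using y c by (metis minus_eq r_neg nat_pow_closed)
  finally have z: "c [^]\<^bsub>L\<^esub> N \<otimes>\<^bsub>L\<^esub> (\<one>\<^bsub>L\<^esub> \<ominus>\<^bsub>L\<^esub> c \<otimes>\<^bsub>L\<^esub> y) = \<zero>\<^bsub>L\<^esub>" .
  have "c [^]\<^bsub>L\<^esub> N = c [^]\<^bsub>L\<^esub> N \<otimes>\<^bsub>L\<^esub> (\<one>\<^bsub>L\<^esub> \<ominus>\<^bsub>L\<^esub> c \<otimes>\<^bsub>L\<^esub> y) \<otimes>\<^bsub>L\<^esub> inv\<^bsub>L\<^esub> (\<one>\<^bsub>L\<^esub> \<ominus>\<^bsub>L\<^esub> c \<otimes>\<^bsub>L\<^esub> y)"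
    using u c y(1) by (simp add: m_assoc del: minus_eq)
  also have "\<dots> = \<zero>\<^bsub>L\<^esub>" unfolding z using u by simp
  finally have "c [^]\<^bsub>L\<^esub> N = \<zero>\<^bsub>L\<^esub>" .
  then show ?thesis using uniformizerI[OF ring_axioms J(3) c(1) _ d(1) Jc Jd] by blast
qed

section \<open>Diagonalisation over a uniserial ring\<close>

lemma left_morphic_pair_sym: "left_morphic_pair S g h a b \<longleftrightarrow> left_morphic_pair S h g b a"
  by (auto simp: left_morphic_pair_def)

context ring
begin

text \<open>Multiplying by \<open>h1\<close> and \<open>h2\<close> on the right separates
  \<open>x(p + p') = 0\<close> into \<open>xp = 0\<close> and \<open>xp' = 0\<close>, and
  \<open>x = x g1 + x g2\<close> brings each condition into its own block. This is one half of the
  pair condition for the sum; the other half is the same statement with the roles of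
  \<open>g\<close> and \<open>h\<close> exchanged.\<close>

lemma left_morphic_pair_sum_aux:
  assumes gc: "g1 \<in> carrier R" "g2 \<in> carrier R" "g1 \<otimes> g2 = \<zero>" "g2 \<otimes> g1 = \<zero>" "g1 \<otimes> g1 = g1" "g2 \<otimes> g2 = g2"
    and hc: "h1 \<in> carrier R" "h2 \<in> carrier R" "h1 \<otimes> h2 = \<zero>" "h2 \<otimes> h1 = \<zero>"
    and p: "left_morphic_pair R g1 h1 p q" and p': "left_morphic_pair R g2 h2 p' q'"
    and x: "x \<in> carrier R" "x \<otimes> (g1 \<oplus> g2) = x"
  shows "x \<otimes> (p \<oplus> p') = \<zero> \<longleftrightarrow> (\<exists>y\<in>carrier R. x = y \<otimes> (q \<oplus> q'))"
proof -
  have c: "p \<in> carrier R" "q \<in> carrier R" "p' \<in> carrier R" "q' \<in> carrier R"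
    using p p' by (auto simp: left_morphic_pair_def)
  have e: "g1 \<otimes> p = p" "p \<otimes> h1 = p" "h1 \<otimes> q = q" "q \<otimes> g1 = q"
    "g2 \<otimes> p' = p'" "p' \<otimes> h2 = p'" "h2 \<otimes> q' = q'" "q' \<otimes> g2 = q'"
    using p p' by (auto simp: left_morphic_pair_def)
  have lp: "z \<otimes> p = \<zero> \<longleftrightarrow> (\<exists>y\<in>carrier R. z = y \<otimes> q)" if "z \<in> carrier R" "z \<otimes> g1 = z" for z
    using p that by (auto simp: left_morphic_pair_def)
  have lp': "z \<otimes> p' = \<zero> \<longleftrightarrow> (\<exists>y\<in>carrier R. z = y \<otimes> q')" if "z \<in> carrier R" "z \<otimes> g2 = z" for z
    using p' that by (auto simp: left_morphic_pair_def)
  have z: "q \<otimes> p = \<zero>" "q' \<otimes> p' = \<zero>"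
    using lp[OF c(2) e(4)] lp'[OF c(4) e(8)] l_one[OF c(2)] l_one[OF c(4)] one_closed by metis+
  have "p' \<otimes> h1 = p' \<otimes> (h2 \<otimes> h1)" using e(6) m_assoc[OF c(3) hc(2,1)] by metis
  then have z1: "p' \<otimes> h1 = \<zero>" using c hc by simp
  have "p \<otimes> h2 = p \<otimes> (h1 \<otimes> h2)" using e(2) m_assoc[OF c(1) hc(1,2)] by metis
  then have z2: "p \<otimes> h2 = \<zero>" using c hc by simp
  have "q \<otimes> p' = (q \<otimes> g1) \<otimes> (g2 \<otimes> p')" using e by simp
  also have "\<dots> = q \<otimes> ((g1 \<otimes> g2) \<otimes> p')" using c gc(1,2) by (simp add: m_assoc)
  finally have z3: "q \<otimes> p' = \<zero>" using c gc by simp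
  have "q' \<otimes> p = (q' \<otimes> g2) \<otimes> (g1 \<otimes> p)" using e by simp
  also have "\<dots> = q' \<otimes> ((g2 \<otimes> g1) \<otimes> p)" using c gc(1,2) by (simp add: m_assoc)
  finally have z4: "q' \<otimes> p = \<zero>" using c gc by simp
  have "h1 \<otimes> q' = h1 \<otimes> (h2 \<otimes> q')" using e by simp
  then have z5: "h1 \<otimes> q' = \<zero>" using c hc by (simp add: m_assoc[symmetric])
  have "h2 \<otimes> q = h2 \<otimes> (h1 \<otimes> q)" using e by simp
  then have z6: "h2 \<otimes> q = \<zero>" using c hc by (simp add: m_assoc[symmetric])
  show ?thesis
  proof
    assume x0: "x \<otimes> (p \<oplus> p') = \<zero>"
    have "x \<otimes> (p \<oplus> p') \<otimes> h1 = x \<otimes> p"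
      using x(1) c hc z1 e(2) by (simp add: m_assoc l_distr r_distr)
    then have xp: "x \<otimes> p = \<zero>" using x0 hc by simp
    have "x \<otimes> (p \<oplus> p') \<otimes> h2 = x \<otimes> p'"
      using x(1) c hc z2 e(6) by (simp add: m_assoc l_distr r_distr)
    then have xp': "x \<otimes> p' = \<zero>" using x0 hc by simp
    have "(x \<otimes> g1) \<otimes> p = \<zero>" using xp x(1) gc c e(1) by (simp add: m_assoc)
    then obtain y where y: "y \<in> carrier R" "x \<otimes> g1 = y \<otimes> q"
      using lp[of "x \<otimes> g1"] x(1) gc by (auto simp: m_assoc)
    have "(x \<otimes> g2) \<otimes> p' = \<zero>" using xp' x(1) gc c e(5) by (simp add: m_assoc)
    then obtain y' where y': "y' \<in> carrier R" "x \<otimes> g2 = y' \<otimes> q'"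
      using lp'[of "x \<otimes> g2"] x(1) gc by (auto simp: m_assoc)
    have "x = x \<otimes> g1 \<oplus> x \<otimes> g2" using x(2) r_distr[OF gc(1,2) x(1)] by metis
    also have "\<dots> = (y \<otimes> h1 \<oplus> y' \<otimes> h2) \<otimes> (q \<oplus> q')"
      unfolding y(2) y'(2) using y(1) y'(1) c hc e z5 z6 by (simp add: l_distr r_distr m_assoc)
    finally show "\<exists>y\<in>carrier R. x = y \<otimes> (q \<oplus> q')" using y(1) y'(1) hc by blast
  next
    assume "\<exists>y\<in>carrier R. x = y \<otimes> (q \<oplus> q')"
    then obtain y where y: "y \<in> carrier R" "x = y \<otimes> (q \<oplus> q')" by blast
    show "x \<otimes> (p \<oplus> p') = \<zero>"
      unfolding y(2) using y(1) c z z3 z4 by (simp add: m_assoc l_distr r_distr)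
  qed
qed

lemma left_morphic_pair_sum:
  assumes gc: "g1 \<in> carrier R" "g2 \<in> carrier R" "g1 \<otimes> g2 = \<zero>" "g2 \<otimes> g1 = \<zero>" "g1 \<otimes> g1 = g1" "g2 \<otimes> g2 = g2"
    and hc: "h1 \<in> carrier R" "h2 \<in> carrier R" "h1 \<otimes> h2 = \<zero>" "h2 \<otimes> h1 = \<zero>" "h1 \<otimes> h1 = h1" "h2 \<otimes> h2 = h2"
    and p: "left_morphic_pair R g1 h1 p q" and p': "left_morphic_pair R g2 h2 p' q'"
  shows "left_morphic_pair R (g1 \<oplus> g2) (h1 \<oplus> h2) (p \<oplus> p') (q \<oplus> q')"
proof -
  have c: "p \<in> carrier R" "q \<in> carrier R" "p' \<in> carrier R" "q' \<in> carrier R"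
    using p p' by (auto simp: left_morphic_pair_def)
  have e: "g1 \<otimes> p = p" "p \<otimes> h1 = p" "h1 \<otimes> q = q" "q \<otimes> g1 = q"
    "g2 \<otimes> p' = p'" "p' \<otimes> h2 = p'" "h2 \<otimes> q' = q'" "q' \<otimes> g2 = q'"
    using p p' by (auto simp: left_morphic_pair_def)
  have l: "u \<otimes> x = \<zero>" if "x \<in> carrier R" "u \<in> carrier R" "v \<in> carrier R" "v \<otimes> x = x" "u \<otimes> v = \<zero>" for u v x
    using that m_assoc[of u v x] by simp
  have r: "x \<otimes> u = \<zero>" if "x \<in> carrier R" "u \<in> carrier R" "v \<in> carrier R" "x \<otimes> v = x" "v \<otimes> u = \<zero>" for u v x
    using that m_assoc[of x v u] by simp
  note z = l[of p' g1 g2] l[of p g2 g1] l[of q' h1 h2] l[of q h2 h1]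
    r[of p' h1 h2] r[of p h2 h1] r[of q' g1 g2] r[of q g2 g1]
  show ?thesis
    unfolding left_morphic_pair_def
    using left_morphic_pair_sum_aux[OF gc hc(1-4) p p']
      left_morphic_pair_sum_aux[OF hc gc(1-4) p[unfolded left_morphic_pair_sym[of _ g1]]
        p'[unfolded left_morphic_pair_sym[of _ g2]]]
    by (auto simp: l_distr r_distr c e z gc hc)
qed

text \<open>The unit \<open>v\<close> does not affect left annihilators, and \<open>u\<close>
  translates them by \<open>u'\<close>. That \<open>u\<close> commutes with \<open>g\<close> keeps
  \<open>zu\<close> inside \<open>Rg\<close>, where the given pair can be applied.\<close>

lemma left_morphic_pair_unit_aux:
  assumes p: "left_morphic_pair R g h x y"
    and c: "g \<in> carrier R" "h \<in> carrier R" "u \<in> carrier R" "u' \<in> carrier R" "v \<in> carrier R" "v' \<in> carrier R"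
    and u: "u \<otimes> u' = \<one>" "u' \<otimes> u = \<one>" "g \<otimes> u = u \<otimes> g"
    and v: "v \<otimes> v' = \<one>" "v' \<otimes> v = \<one>"
    and z: "z \<in> carrier R" "z \<otimes> g = z"
  shows "z \<otimes> (u \<otimes> x \<otimes> v) = \<zero> \<longleftrightarrow> (\<exists>w\<in>carrier R. z = w \<otimes> (v' \<otimes> y \<otimes> u'))"
proof -
  have xy: "x \<in> carrier R" "y \<in> carrier R" using p by (auto simp: left_morphic_pair_def)
  have lp: "t \<otimes> x = \<zero> \<longleftrightarrow> (\<exists>w\<in>carrier R. t = w \<otimes> y)" if "t \<in> carrier R" "t \<otimes> g = t" for t
    using p that by (auto simp: left_morphic_pair_def)
  have "(z \<otimes> u) \<otimes> g = (z \<otimes> g) \<otimes> u" using z(1) c u(3) by (simp add: m_assoc)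
  then have zu: "(z \<otimes> u) \<otimes> g = z \<otimes> u" using z by simp
  show ?thesis
  proof
    assume z0: "z \<otimes> (u \<otimes> x \<otimes> v) = \<zero>"
    have "z \<otimes> (u \<otimes> x \<otimes> v) \<otimes> v' = (z \<otimes> u) \<otimes> x" using z(1) xy c v by (simp add: m_assoc)
    then have "(z \<otimes> u) \<otimes> x = \<zero>" using z0 c by simp
    then obtain w where w: "w \<in> carrier R" "z \<otimes> u = w \<otimes> y" using lp[of "z \<otimes> u"] zu z(1) c by auto
    have "z = (z \<otimes> u) \<otimes> u'" using z(1) c u(1) by (simp add: m_assoc)
    also have "\<dots> = w \<otimes> (v \<otimes> v') \<otimes> y \<otimes> u'" unfolding w(2) v(1) using w(1) by simp
    also have "\<dots> = (w \<otimes> v) \<otimes> (v' \<otimes> y \<otimes> u')" using w(1) xy c by (simp add: m_assoc)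
    finally show "\<exists>w\<in>carrier R. z = w \<otimes> (v' \<otimes> y \<otimes> u')" using w(1) c by blast
  next
    assume "\<exists>w\<in>carrier R. z = w \<otimes> (v' \<otimes> y \<otimes> u')"
    then obtain w where w: "w \<in> carrier R" "z = w \<otimes> (v' \<otimes> y \<otimes> u')" by blast
    have yx: "y \<otimes> x = \<zero>" using lp[of y] p l_one[OF xy(2)] one_closed unfolding left_morphic_pair_def by metis
    have "z \<otimes> (u \<otimes> x \<otimes> v) = w \<otimes> v' \<otimes> y \<otimes> (u' \<otimes> u) \<otimes> x \<otimes> v"
      unfolding w(2) using w(1) xy c by (simp add: m_assoc)
    also have "\<dots> = w \<otimes> v' \<otimes> (y \<otimes> x) \<otimes> v" unfolding u(2) using w(1) xy c by (simp add: m_assoc)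
    also have "\<dots> = \<zero>" unfolding yx using w(1) c by simp
    finally show "z \<otimes> (u \<otimes> x \<otimes> v) = \<zero>" .
  qed
qed

text \<open>The second equivalence is the first one for the swapped pair, with \<open>v'\<close> and
  \<open>u'\<close> taking the places of \<open>u\<close> and \<open>v\<close>. So \<open>v'\<close>
  must commute with \<open>h\<close>, which it inherits from \<open>v\<close>.\<close>

lemma left_morphic_pair_unit:
  assumes p: "left_morphic_pair R g h x y"
    and c: "g \<in> carrier R" "h \<in> carrier R" "u \<in> carrier R" "u' \<in> carrier R" "v \<in> carrier R" "v' \<in> carrier R"
    and u: "u \<otimes> u' = \<one>" "u' \<otimes> u = \<one>" "g \<otimes> u = u \<otimes> g"
    and v: "v \<otimes> v' = \<one>" "v' \<otimes> v = \<one>" "h \<otimes> v = v \<otimes> h"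
  shows "left_morphic_pair R g h (u \<otimes> x \<otimes> v) (v' \<otimes> y \<otimes> u')"
proof -
  have xy: "x \<in> carrier R" "y \<in> carrier R" "g \<otimes> x = x" "x \<otimes> h = x" "h \<otimes> y = y" "y \<otimes> g = y"
    using p by (auto simp: left_morphic_pair_def)
  have comm: "g \<otimes> u' = u' \<otimes> g" if "g \<in> carrier R" "u \<in> carrier R" "u' \<in> carrier R" "u \<otimes> u' = \<one>"
    "u' \<otimes> u = \<one>" "g \<otimes> u = u \<otimes> g" for g u u'
  proof -
    have "g \<otimes> u' = (u' \<otimes> u) \<otimes> g \<otimes> u'" unfolding that(5) using that by simp
    also have "\<dots> = u' \<otimes> (u \<otimes> g) \<otimes> u'" using that(1-3) by (simp add: m_assoc)
    also have "\<dots> = u' \<otimes> (g \<otimes> u) \<otimes> u'" using that(6) by simp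
    also have "\<dots> = u' \<otimes> g \<otimes> (u \<otimes> u')" using that(1-3) by (simp add: m_assoc)
    finally show ?thesis unfolding that(4) using that by simp
  qed
  have hv: "h \<otimes> v' = v' \<otimes> h" by (rule comm[OF c(2,5,6) v])
  have gu': "g \<otimes> u' = u' \<otimes> g" by (rule comm[OF c(1,3,4) u])
  have "g \<otimes> (u \<otimes> x \<otimes> v) = (g \<otimes> u) \<otimes> x \<otimes> v" using c xy(1) by (simp add: m_assoc)
  also have "\<dots> = u \<otimes> (g \<otimes> x) \<otimes> v" unfolding u(3) using c xy(1) by (simp add: m_assoc)
  finally have 1: "g \<otimes> (u \<otimes> x \<otimes> v) = u \<otimes> x \<otimes> v" using xy by simp
  have "(u \<otimes> x \<otimes> v) \<otimes> h = u \<otimes> x \<otimes> (h \<otimes> v)" using c xy(1) v(3) by (simp add: m_assoc)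
  also have "\<dots> = u \<otimes> (x \<otimes> h) \<otimes> v" using c xy(1) by (simp add: m_assoc)
  finally have 2: "(u \<otimes> x \<otimes> v) \<otimes> h = u \<otimes> x \<otimes> v" using xy by simp
  have "h \<otimes> (v' \<otimes> y \<otimes> u') = (h \<otimes> v') \<otimes> y \<otimes> u'" using c xy(2) by (simp add: m_assoc)
  also have "\<dots> = v' \<otimes> (h \<otimes> y) \<otimes> u'" unfolding hv using c xy(2) by (simp add: m_assoc)
  finally have 3: "h \<otimes> (v' \<otimes> y \<otimes> u') = v' \<otimes> y \<otimes> u'" using xy by simp
  have "(v' \<otimes> y \<otimes> u') \<otimes> g = v' \<otimes> y \<otimes> (g \<otimes> u')" using c xy(2) gu' by (simp add: m_assoc)
  also have "\<dots> = v' \<otimes> (y \<otimes> g) \<otimes> u'" using c xy(2) by (simp add: m_assoc)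
  finally have 4: "(v' \<otimes> y \<otimes> u') \<otimes> g = v' \<otimes> y \<otimes> u'" using xy by simp
  show ?thesis
    unfolding left_morphic_pair_def
    using left_morphic_pair_unit_aux[OF p c u v(1,2)]
      left_morphic_pair_unit_aux[OF p[unfolded left_morphic_pair_sym[of R g]] c(2,1,6,5,4,3) v(2,1) hv u(2,1)]
      c xy 1 2 3 4 by auto
qed

end

section \<open>Divisibility and annihilators in a chain ring\<close>

context uniformizer_ring
begin

text \<open>\<open>SOME\<close> suffices, since no argument depends on which representing exponent
  is taken. For \<open>x = 0\<close> the value is some \<open>s\<close> with
  \<open>c^s = 0\<close>.\<close>

definition val :: "'a \<Rightarrow> nat" where
  "val x = (SOME s. \<exists>u\<in>Units R. x = u \<otimes> c [^] s)"

lemma val: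
  assumes "x \<in> carrier R"
  shows "\<exists>u\<in>Units R. x = u \<otimes> c [^] val x"
  unfolding val_def using someI_ex[OF left_form[OF assms]] .

lemma uniformizer_opposite_intro: "uniformizer_ring (opposite_ring R) c"
  using uniformizer_opposite_ring[OF unif]
  by (simp add: uniformizer_ring_def uniformizer_ring_axioms_def uniformizer_def)

lemma mult_c_iff: "x \<in> carrier R \<Longrightarrow> (\<exists>y\<in>carrier R. x = y \<otimes> c) \<longleftrightarrow> x \<notin> Units R"
  using nonunit_multiple multiple_not_unit by blast

lemma c_mult_iff: "x \<in> carrier R \<Longrightarrow> (\<exists>y\<in>carrier R. x = c \<otimes> y) \<longleftrightarrow> x \<notin> Units R"
proof -
  interpret O: uniformizer_ring "opposite_ring R" c by (rule uniformizer_opposite_intro)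
  show "x \<in> carrier R \<Longrightarrow> (\<exists>y\<in>carrier R. x = c \<otimes> y) \<longleftrightarrow> x \<notin> Units R"
    using O.mult_c_iff[of x] by simp
qed

text \<open>\<open>Rc\<close> and \<open>cR\<close> agree because both consist of the nonunits; the
  induction moves one factor \<open>c\<close> at a time.\<close>

lemma mult_power_iff:
  assumes "x \<in> carrier R"
  shows "(\<exists>y\<in>carrier R. x = y \<otimes> c [^] (s::nat)) \<longleftrightarrow> (\<exists>y\<in>carrier R. x = c [^] s \<otimes> y)"
  using assms
proof (induct s arbitrary: x)
  case 0
  then show ?case by auto
next
  case (Suc s)
  show ?case
  proof
    assume "\<exists>y\<in>carrier R. x = y \<otimes> c [^] Suc s"
    then obtain y where y: "y \<in> carrier R" "x = y \<otimes> c [^] Suc s" by blast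
    have "\<exists>z\<in>carrier R. y \<otimes> c [^] s = c [^] s \<otimes> z" using Suc.hyps[of "y \<otimes> c [^] s"] y(1) by blast
    then obtain z where z: "z \<in> carrier R" "y \<otimes> c [^] s = c [^] s \<otimes> z" by blast
    have "\<exists>w\<in>carrier R. z \<otimes> c = c \<otimes> w" using mult_c_iff[of "z \<otimes> c"] c_mult_iff[of "z \<otimes> c"] z(1) by blast
    then obtain w where w: "w \<in> carrier R" "z \<otimes> c = c \<otimes> w" by blast
    have "x = (y \<otimes> c [^] s) \<otimes> c" using y by (simp add: m_assoc)
    also have "\<dots> = c [^] s \<otimes> (z \<otimes> c)" unfolding z(2) using z(1) by (simp add: m_assoc)
    also have "\<dots> = c [^] Suc s \<otimes> w" unfolding w(2) using w(1) by (simp add: m_assoc)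
    finally show "\<exists>y\<in>carrier R. x = c [^] Suc s \<otimes> y" using w(1) by blast
  next
    assume "\<exists>y\<in>carrier R. x = c [^] Suc s \<otimes> y"
    then obtain y where y: "y \<in> carrier R" "x = c [^] Suc s \<otimes> y" by blast
    have "\<exists>w\<in>carrier R. c \<otimes> y = w \<otimes> c" using mult_c_iff[of "c \<otimes> y"] c_mult_iff[of "c \<otimes> y"] y(1) by blast
    then obtain w where w: "w \<in> carrier R" "c \<otimes> y = w \<otimes> c" by blast
    have "\<exists>z\<in>carrier R. c [^] s \<otimes> w = z \<otimes> c [^] s" using Suc.hyps[of "c [^] s \<otimes> w"] w(1) by blast
    then obtain z where z: "z \<in> carrier R" "c [^] s \<otimes> w = z \<otimes> c [^] s" by blast
    have "x = c [^] s \<otimes> (c \<otimes> y)" using y by (simp add: m_assoc)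
    also have "\<dots> = (c [^] s \<otimes> w) \<otimes> c" unfolding w(2) using w(1) by (simp add: m_assoc)
    also have "\<dots> = z \<otimes> c [^] Suc s" unfolding z(2) using z(1) by (simp add: m_assoc)
    finally show "\<exists>y\<in>carrier R. x = y \<otimes> c [^] Suc s" using z(1) by blast
  qed
qed

text \<open>The left quotient comes from the exponents directly, the right one from
  \<open>Rc^s = c^s R\<close>. One comparison of numbers thus settles divisibility on both sides, as
  needed for clearing a row and a column with the same pivot.\<close>

lemma val_divides:
  assumes x: "x \<in> carrier R" and y: "y \<in> carrier R" and le: "val x \<le> val y"
  shows "\<exists>r\<in>carrier R. y = r \<otimes> x" and "\<exists>r\<in>carrier R. y = x \<otimes> r"
proof -
  define s where "s = val x"
  obtain u where u: "u \<in> Units R" "x = u \<otimes> c [^] s" using val[OF x] unfolding s_def by blast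
  obtain v where v: "v \<in> Units R" "y = v \<otimes> c [^] val y" using val[OF y] by blast
  note uc = Units_closed[OF u(1)] Units_closed[OF v(1)] Units_inv_closed[OF u(1)]
  define m where "m = val y - s"
  have "c [^] val y = c [^] m \<otimes> c [^] s" using le by (simp add: s_def m_def nat_pow_mult)
  then have "v \<otimes> c [^] val y = (v \<otimes> c [^] m) \<otimes> c [^] s" using uc by (simp add: m_assoc)
  with v(2) have y': "y = (v \<otimes> c [^] m) \<otimes> c [^] s" by (rule trans)
  have cs: "c [^] s = inv u \<otimes> x" unfolding u(2) using uc u(1) by (simp add: m_assoc[symmetric])
  have "y = (v \<otimes> c [^] m \<otimes> inv u) \<otimes> x"
    unfolding y'[unfolded cs] using uc x by (simp add: m_assoc)
  then show "\<exists>r\<in>carrier R. y = r \<otimes> x" using uc by blast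
  have "\<exists>z\<in>carrier R. inv u \<otimes> y = z \<otimes> c [^] s"
  proof
    show "inv u \<otimes> y = (inv u \<otimes> (v \<otimes> c [^] m)) \<otimes> c [^] s"
      by (subst y') (use uc in \<open>simp add: m_assoc\<close>)
  qed (use uc in simp)
  then obtain z where z: "z \<in> carrier R" "inv u \<otimes> y = c [^] s \<otimes> z"
    using mult_power_iff[of "inv u \<otimes> y" s] uc y by auto
  have "y = u \<otimes> (inv u \<otimes> y)" using u(1) uc y by (simp add: m_assoc[symmetric])
  also have "\<dots> = x \<otimes> z" unfolding z(2) u(2) using uc z(1) by (simp add: m_assoc)
  finally show "\<exists>r\<in>carrier R. y = x \<otimes> r" using z(1) by blast
qed

text \<open>For \<open>t = u c^s\<close> the partner is \<open>c^(N-s)\<close> times the inverse of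
  \<open>u\<close>. \<open>N\<close> has to be the exact nilpotency index, so that
  \<open>c^(r+s) = 0\<close> forces \<open>r + s \<ge> N\<close>.\<close>

lemma left_morphic_pair_exists:
  assumes t: "t \<in> carrier R"
  shows "\<exists>q. left_morphic_pair R \<one> \<one> t q"
proof -
  define N where "N = (LEAST n::nat. c [^] n = \<zero>)"
  have N0: "c [^] N = \<zero>" unfolding N_def using nilpotent by (rule LeastI_ex)
  have N1: "N \<le> n" if "c [^] n = \<zero>" for n :: nat unfolding N_def using that by (rule Least_le)
  have N2: "c [^] n = \<zero>" if "N \<le> n" for n :: nat
    using N0 nat_pow_mult[of c N "n - N"] that by simp
  have ucz: "N \<le> n" if "w \<in> Units R" "w \<otimes> c [^] n = \<zero>" for w and n :: nat
    using that N1[of n] by (metis Units_closed Units_l_cancel c_closed nat_pow_closed r_null zero_closed)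
  \<comment> \<open>\<open>val t\<close> may exceed \<open>N\<close> when \<open>t = 0\<close>; it
    is then replaced by \<open>N\<close>, so that \<open>N - s\<close> is a true difference.\<close>
  obtain s u where su: "s \<le> N" "u \<in> Units R" "t = u \<otimes> c [^] s"
  proof (cases "val t \<le> N")
    case True
    then show ?thesis using val[OF t] that by blast
  next
    case False
    obtain u where u: "u \<in> Units R" "t = u \<otimes> c [^] val t" using val[OF t] by blast
    then have "t = u \<otimes> c [^] N" using N2[of "val t"] N0 False by simp
    then show ?thesis using that[of N u] u by simp
  qed
  define q where "q = c [^] (N - s) \<otimes> inv u"
  note uc = Units_closed[OF su(2)] Units_inv_closed[OF su(2)]
  have q: "q \<in> carrier R" unfolding q_def using uc by simp
  have pow: "c [^] (N - s) \<otimes> c [^] s = \<zero>" "c [^] s \<otimes> c [^] (N - s) = \<zero>"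
    using su(1) N0 by (simp_all add: nat_pow_mult)
  have 1: "x \<otimes> t = \<zero> \<longleftrightarrow> (\<exists>y\<in>carrier R. x = y \<otimes> q)" if x: "x \<in> carrier R" for x
  proof
    assume xt: "x \<otimes> t = \<zero>"
    obtain w where w: "w \<in> Units R" "x \<otimes> u = w \<otimes> c [^] val (x \<otimes> u)" using val[of "x \<otimes> u"] x uc by auto
    define r where "r = val (x \<otimes> u)"
    have xu: "x \<otimes> u = w \<otimes> c [^] r" using w(2) unfolding r_def .
    note wc = Units_closed[OF w(1)]
    have "x \<otimes> t = (x \<otimes> u) \<otimes> c [^] s" unfolding su(3) using x uc by (simp add: m_assoc)
    also have "\<dots> = w \<otimes> c [^] (r + s)" unfolding xu using wc by (simp add: m_assoc nat_pow_mult)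
    finally have "N \<le> r + s" using ucz[OF w(1)] xt by simp
    then have cr: "c [^] r = c [^] (r + s - N) \<otimes> c [^] (N - s)" using su(1) by (simp add: nat_pow_mult)
    have "x = (x \<otimes> u) \<otimes> inv u" using x uc su(2) by (simp add: m_assoc)
    also have "\<dots> = (w \<otimes> c [^] (r + s - N)) \<otimes> q"
      unfolding xu cr q_def using wc uc by (simp add: m_assoc)
    finally show "\<exists>y\<in>carrier R. x = y \<otimes> q" using wc by blast
  next
    assume "\<exists>y\<in>carrier R. x = y \<otimes> q"
    then obtain y where y: "y \<in> carrier R" "x = y \<otimes> q" by blast
    have "x \<otimes> t = y \<otimes> (c [^] (N - s) \<otimes> ((inv u \<otimes> u) \<otimes> c [^] s))"
      unfolding y(2) q_def su(3) using y(1) uc by (simp add: m_assoc)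
    then show "x \<otimes> t = \<zero>" using su(2) y(1) pow by simp
  qed
  have 2: "x \<otimes> q = \<zero> \<longleftrightarrow> (\<exists>y\<in>carrier R. x = y \<otimes> t)" if x: "x \<in> carrier R" for x
  proof
    assume xq: "x \<otimes> q = \<zero>"
    obtain w where w: "w \<in> Units R" "x = w \<otimes> c [^] val x" using val[OF x] by auto
    define r where "r = val x"
    note wc = Units_closed[OF w(1)]
    have xr: "x = w \<otimes> c [^] r" using w(2) unfolding r_def .
    have "(x \<otimes> q) \<otimes> u = x \<otimes> c [^] (N - s)" unfolding q_def using x uc su(2) by (simp add: m_assoc)
    also have "\<dots> = w \<otimes> c [^] (r + (N - s))" unfolding xr using wc by (simp add: m_assoc nat_pow_mult)
    finally have "N \<le> r + (N - s)" using ucz[OF w(1)] xq uc by simp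
    then have cr: "c [^] r = c [^] (r - s) \<otimes> c [^] s" using su(1) by (simp add: nat_pow_mult)
    have "x = w \<otimes> c [^] (r - s) \<otimes> (inv u \<otimes> u) \<otimes> c [^] s" unfolding xr cr using wc uc su(2) by (simp add: m_assoc)
    also have "\<dots> = (w \<otimes> c [^] (r - s) \<otimes> inv u) \<otimes> t"
      unfolding su(3) using wc uc by (simp add: m_assoc)
    finally show "\<exists>y\<in>carrier R. x = y \<otimes> t" using wc uc by blast
  next
    assume "\<exists>y\<in>carrier R. x = y \<otimes> t"
    then obtain y where y: "y \<in> carrier R" "x = y \<otimes> t" by blast
    have "x \<otimes> q = y \<otimes> (u \<otimes> ((c [^] s \<otimes> c [^] (N - s)) \<otimes> inv u))"
      unfolding y(2) q_def su(3) using y(1) uc by (simp add: m_assoc)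
    then show "x \<otimes> q = \<zero>" using uc y(1) pow by simp
  qed
  show ?thesis unfolding left_morphic_pair_def using t q 1 2 by (intro exI[of _ q]) auto
qed

end

text \<open>One step of block elimination: \<open>p\<close> is the pivot, \<open>s\<close> and
  \<open>t\<close> hold the multipliers for its column and its row, and \<open>x''\<close> is the
  Schur complement. The factorisation is exact because \<open>s x'' = 0\<close> and
  \<open>x'' t = 0\<close>.\<close>

lemma (in ring) diagonal_step:
  assumes c: "e1 \<in> carrier R" "g' \<in> carrier R" "f1 \<in> carrier R" "h' \<in> carrier R" "x \<in> carrier R"
      "s \<in> carrier R" "t \<in> carrier R"
    and e: "e1 \<otimes> g' = \<zero>" "h' \<otimes> f1 = \<zero>" "h' \<otimes> h' = h'"
    and x: "(e1 \<oplus> g') \<otimes> x = x" "x \<otimes> (f1 \<oplus> h') = x"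
    and t: "f1 \<otimes> t = t" "t \<otimes> h' = t" "e1 \<otimes> x \<otimes> h' = (e1 \<otimes> x \<otimes> f1) \<otimes> t"
    and s: "g' \<otimes> s = s" "s \<otimes> e1 = s" "g' \<otimes> x \<otimes> f1 = s \<otimes> (e1 \<otimes> x \<otimes> f1)"
    and p: "p = e1 \<otimes> x \<otimes> f1" and x'': "x'' = g' \<otimes> x \<otimes> h' \<ominus> s \<otimes> p \<otimes> t"
  shows "x = (\<one> \<oplus> s) \<otimes> (p \<oplus> x'') \<otimes> (\<one> \<oplus> t)"
proof -
  have pc: "p \<in> carrier R" "x'' \<in> carrier R" using c p x'' by auto
  have "s \<otimes> g' = s \<otimes> (e1 \<otimes> g')" using s(2) m_assoc[OF c(6,1,2)] by metis
  then have sg: "s \<otimes> g' = \<zero>" using c e by simp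
  have ss: "s \<otimes> s = \<zero>" using s(1) m_assoc[OF c(6,2,6)] sg c by (metis l_null)
  have "h' \<otimes> t = h' \<otimes> (f1 \<otimes> t)" using t(1) by simp
  then have ht: "h' \<otimes> t = \<zero>" using c e by (simp add: m_assoc[symmetric])
  have tt: "t \<otimes> t = \<zero>" using t(2) m_assoc[OF c(7,4,7)] ht c by (metis r_null)
  have "s \<otimes> (g' \<otimes> x \<otimes> h') = (s \<otimes> g') \<otimes> x \<otimes> h'" using c by (simp add: m_assoc)
  moreover have "s \<otimes> (s \<otimes> p \<otimes> t) = (s \<otimes> s) \<otimes> p \<otimes> t" using c pc by (simp add: m_assoc)
  ultimately have sx: "s \<otimes> x'' = \<zero>" unfolding x'' using c pc sg ss by (simp add: minus_eq r_distr r_minus)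
  have "(g' \<otimes> x \<otimes> h') \<otimes> t = g' \<otimes> x \<otimes> (h' \<otimes> t)" using c by (simp add: m_assoc)
  moreover have "(s \<otimes> p \<otimes> t) \<otimes> t = s \<otimes> p \<otimes> (t \<otimes> t)" using c pc by (simp add: m_assoc)
  ultimately have xt: "x'' \<otimes> t = \<zero>" unfolding x'' using c pc ht tt by (simp add: minus_eq l_distr l_minus)
  have "x = (e1 \<oplus> g') \<otimes> x \<otimes> (f1 \<oplus> h')" using x by simp
  also have "\<dots> = p \<oplus> (s \<otimes> p) \<oplus> (p \<otimes> t) \<oplus> g' \<otimes> x \<otimes> h'"
    unfolding p s(3)[symmetric] t(3)[symmetric] using c by (simp add: l_distr r_distr a_ac)
  also have "g' \<otimes> x \<otimes> h' = x'' \<oplus> s \<otimes> p \<otimes> t" unfolding x'' using c pc by (simp add: minus_eq a_assoc l_neg)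
  also have "p \<oplus> (s \<otimes> p) \<oplus> (p \<otimes> t) \<oplus> (x'' \<oplus> s \<otimes> p \<otimes> t) = (\<one> \<oplus> s) \<otimes> (p \<oplus> x'') \<otimes> (\<one> \<oplus> t)"
    using c pc sx xt by (simp add: l_distr r_distr a_ac m_assoc)
  finally show ?thesis .
qed

section \<open>Matrix units\<close>

text \<open>With \<open>e\<close> as unit of the corner \<open>eRe\<close>, the elements \<open>b i\<close> form a column and the \<open>a i\<close> a row, so that
  \<open>b i \<otimes> x \<otimes> a j\<close> plays the role of the matrix with \<open>x \<in> eRe\<close> as its only nonzero entry.\<close>

locale matrix_units = ring R for R (structure) +
  fixes e :: 'a and k :: nat and a b :: "nat \<Rightarrow> 'a"
  assumes e_closed [simp]: "e \<in> carrier R"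
    and e_idem [simp]: "e \<otimes> e = e"
    and a_closed [simp]: "i < k \<Longrightarrow> a i \<in> carrier R"
    and b_closed [simp]: "i < k \<Longrightarrow> b i \<in> carrier R"
    and e_a: "i < k \<Longrightarrow> e \<otimes> a i = a i"
    and b_e: "i < k \<Longrightarrow> b i \<otimes> e = b i"
    and a_b: "\<lbrakk>i < k; j < k\<rbrakk> \<Longrightarrow> a i \<otimes> b j = (if i = j then e else \<zero>)"
    and sum_ba: "(\<Oplus>i\<in>{..<k}. b i \<otimes> a i) = \<one>"
begin

text \<open>The diagonal idempotent of a set of positions. Blocks are cut out as
  \<open>diag X \<otimes> x \<otimes> diag Y\<close>, so that elimination can drop a row and a
  column while staying in the same ring.\<close>

definition diag :: "nat set \<Rightarrow> 'a" where
  "diag X = (\<Oplus>i\<in>X. b i \<otimes> a i)"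

text \<open>Transposition: the opposite ring exchanges the row \<open>a\<close> with the column
  \<open>b\<close>.\<close>

lemma matrix_units_opposite: "matrix_units (opposite_ring R) e k b a"
  by (intro matrix_units.intro matrix_units_axioms.intro)
    (auto simp: ring_axioms e_a b_e a_b sum_ba)

lemma finite_index: "X \<subseteq> {..<k} \<Longrightarrow> finite X"
  by (rule finite_subset) auto

lemma diag_closed [simp]: "X \<subseteq> {..<k} \<Longrightarrow> diag X \<in> carrier R"
  unfolding diag_def by (rule finsum_closed) auto

lemma diag_empty [simp]: "diag {} = \<zero>"
  by (simp add: diag_def)

lemma diag_insert: "\<lbrakk>insert i X \<subseteq> {..<k}; i \<notin> X\<rbrakk> \<Longrightarrow> diag (insert i X) = b i \<otimes> a i \<oplus> diag X"
  unfolding diag_def by (subst finsum_insert) (auto intro: finite_index)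

lemma diag_all: "diag {..<k} = \<one>"
  by (simp add: diag_def sum_ba)

lemma a_diag:
  assumes "i < k" "X \<subseteq> {..<k}"
  shows "a i \<otimes> diag X = (if i \<in> X then a i else \<zero>)"
  using finite_index[OF assms(2)] assms(2)
proof (induct X rule: finite_induct)
  case (insert j X)
  then have j: "j < k" "X \<subseteq> {..<k}" by auto
  have "a i \<otimes> diag (insert j X) = (a i \<otimes> b j) \<otimes> a j \<oplus> a i \<otimes> diag X"
    using diag_insert[OF insert.prems insert.hyps(2)] assms(1) j by (simp add: r_distr m_assoc)
  then show ?case using insert.hyps j assms(1) by (auto simp: a_b e_a)
qed (use assms in simp)

lemma diag_b:
  assumes "i < k" "X \<subseteq> {..<k}"
  shows "diag X \<otimes> b i = (if i \<in> X then b i else \<zero>)"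
proof -
  interpret O: matrix_units "opposite_ring R" e k b a by (rule matrix_units_opposite)
  have "O.diag X = diag X" by (simp add: O.diag_def diag_def)
  then show ?thesis using O.a_diag[OF assms] by simp
qed

lemma diag_mult:
  assumes "X \<subseteq> {..<k}" "Y \<subseteq> {..<k}"
  shows "diag X \<otimes> diag Y = diag (X \<inter> Y)"
  using finite_index[OF assms(2)] assms(2)
proof (induct Y rule: finite_induct)
  case (insert j Y)
  then have j: "j < k" "Y \<subseteq> {..<k}" by auto
  have "diag X \<otimes> diag (insert j Y) = (diag X \<otimes> b j) \<otimes> a j \<oplus> diag (X \<inter> Y)"
    using diag_insert[OF insert.prems insert.hyps(2)] assms(1) j insert.hyps(3)
    by (simp add: r_distr m_assoc)
  also have "\<dots> = diag (X \<inter> insert j Y)"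
  proof (cases "j \<in> X")
    case True
    have "diag (insert j (X \<inter> Y)) = b j \<otimes> a j \<oplus> diag (X \<inter> Y)"
      using insert.hyps(2) j by (intro diag_insert) auto
    moreover have "X \<inter> insert j Y = insert j (X \<inter> Y)" using True by auto
    ultimately show ?thesis using True j assms(1) by (simp add: diag_b)
  next
    case False
    have "X \<inter> insert j Y = X \<inter> Y" using False by auto
    moreover have "diag (X \<inter> Y) \<in> carrier R" using assms(1) by (intro diag_closed) auto
    ultimately show ?thesis using False j assms(1) by (simp add: diag_b)
  qed
  finally show ?case .
qed (use assms in simp)

lemma unit_idem: "i < k \<Longrightarrow> b i \<otimes> a i = diag {i}"
  using diag_insert[of i "{}"] by simp

lemma entry_closed:
  assumes "i < k" "j < k" "x \<in> carrier R"
  shows "a i \<otimes> x \<otimes> b j \<in> carrier (corner R e)"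
proof -
  have "e \<otimes> (a i \<otimes> x \<otimes> b j) = (e \<otimes> a i) \<otimes> x \<otimes> b j" using assms by (simp add: m_assoc)
  moreover have "(a i \<otimes> x \<otimes> b j) \<otimes> e = a i \<otimes> x \<otimes> (b j \<otimes> e)" using assms by (simp add: m_assoc)
  ultimately show ?thesis using assms by (simp add: e_a b_e)
qed

text \<open>The multipliers are placed in row \<open>j\<close>: \<open>t\<close> is the sum of the
  \<open>b j \<otimes> r l \<otimes> a l\<close>, and multiplying the entry at \<open>(i, j)\<close>
  by it reproduces the part of row \<open>i\<close> over \<open>Y\<close>.\<close>

lemma row_multiple:
  assumes ij: "i < k" "j < k" and Y: "Y \<subseteq> {..<k}" and x: "x \<in> carrier R"
    and r: "\<And>l. l \<in> Y \<Longrightarrow> \<exists>r\<in>carrier (corner R e). a i \<otimes> x \<otimes> b l = (a i \<otimes> x \<otimes> b j) \<otimes> r"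
  shows "\<exists>t\<in>carrier R. diag {j} \<otimes> t = t \<and> t \<otimes> diag Y = t \<and>
           diag {i} \<otimes> x \<otimes> diag Y = (diag {i} \<otimes> x \<otimes> diag {j}) \<otimes> t"
proof -
  obtain r where r: "\<And>l. l \<in> Y \<Longrightarrow> r l \<in> carrier (corner R e)"
    "\<And>l. l \<in> Y \<Longrightarrow> a i \<otimes> x \<otimes> b l = (a i \<otimes> x \<otimes> b j) \<otimes> r l"
    using r by metis
  have rc: "r l \<in> carrier R" "e \<otimes> r l = r l" if "l \<in> Y" for l using r(1)[OF that] by auto
  have lk: "l < k" if "l \<in> Y" for l using that Y by auto
  note fin = finite_index[OF Y]
  define t where "t = (\<Oplus>l\<in>Y. b j \<otimes> r l \<otimes> a l)"
  have fc: "(\<lambda>l. b j \<otimes> r l \<otimes> a l) \<in> Y \<rightarrow> carrier R" using rc lk ij by auto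
  have tc: "t \<in> carrier R" unfolding t_def by (rule finsum_closed[OF fc])
  have "diag {j} \<otimes> t = (\<Oplus>l\<in>Y. diag {j} \<otimes> (b j \<otimes> r l \<otimes> a l))"
    unfolding t_def using fin fc ij by (intro finsum_rdistr) auto
  also have "\<dots> = t" unfolding t_def
  proof (rule finsum_cong', goal_cases)
    case (3 l)
    have "diag {j} \<otimes> (b j \<otimes> r l \<otimes> a l) = (diag {j} \<otimes> b j) \<otimes> r l \<otimes> a l"
      using 3 ij rc lk by (simp add: m_assoc)
    then show ?case using ij by (simp add: diag_b)
  qed (use fc in auto)
  finally have 1: "diag {j} \<otimes> t = t" .
  have "t \<otimes> diag Y = (\<Oplus>l\<in>Y. b j \<otimes> r l \<otimes> a l \<otimes> diag Y)"
    unfolding t_def using fin fc Y by (intro finsum_ldistr) auto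
  also have "\<dots> = t" unfolding t_def
  proof (rule finsum_cong', goal_cases)
    case (3 l)
    then show ?case using ij rc lk Y by (simp add: m_assoc a_diag)
  qed (use fc in auto)
  finally have 2: "t \<otimes> diag Y = t" .
  have pc: "diag {i} \<otimes> x \<otimes> diag {j} \<in> carrier R" using ij x by simp
  have "(diag {i} \<otimes> x \<otimes> diag {j}) \<otimes> t = (\<Oplus>l\<in>Y. (diag {i} \<otimes> x \<otimes> diag {j}) \<otimes> (b j \<otimes> r l \<otimes> a l))"
    unfolding t_def using fin fc pc by (intro finsum_rdistr) auto
  also have "\<dots> = (\<Oplus>l\<in>Y. (diag {i} \<otimes> x) \<otimes> (b l \<otimes> a l))"
  proof (rule finsum_cong', goal_cases)
    case (3 l)
    have "(diag {i} \<otimes> x \<otimes> diag {j}) \<otimes> (b j \<otimes> r l \<otimes> a l) = diag {i} \<otimes> x \<otimes> (diag {j} \<otimes> b j) \<otimes> r l \<otimes> a l"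
      using 3 ij rc lk x by (simp add: m_assoc)
    also have "\<dots> = (b i \<otimes> a i) \<otimes> x \<otimes> b j \<otimes> r l \<otimes> a l" using ij by (simp add: diag_b unit_idem)
    also have "\<dots> = b i \<otimes> ((a i \<otimes> x \<otimes> b j) \<otimes> r l) \<otimes> a l" using 3 ij rc lk x by (simp add: m_assoc)
    also have "\<dots> = b i \<otimes> (a i \<otimes> x \<otimes> b l) \<otimes> a l" using r(2)[OF 3] by simp
    also have "\<dots> = ((b i \<otimes> a i) \<otimes> x) \<otimes> (b l \<otimes> a l)" using 3 ij lk x by (simp add: m_assoc)
    finally show ?case using ij by (simp add: unit_idem)
  qed (use ij x lk in auto)
  also have "\<dots> = (diag {i} \<otimes> x) \<otimes> diag Y"
    unfolding diag_def[of Y] using fin ij x lk by (intro finsum_rdistr[symmetric]) auto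
  finally show ?thesis using tc 1 2 by auto
qed

lemma column_multiple:
  assumes ij: "i < k" "j < k" and X: "X \<subseteq> {..<k}" and x: "x \<in> carrier R"
    and r: "\<And>l. l \<in> X \<Longrightarrow> \<exists>r\<in>carrier (corner R e). a l \<otimes> x \<otimes> b j = r \<otimes> (a i \<otimes> x \<otimes> b j)"
  shows "\<exists>s\<in>carrier R. diag X \<otimes> s = s \<and> s \<otimes> diag {i} = s \<and>
           diag X \<otimes> x \<otimes> diag {j} = s \<otimes> (diag {i} \<otimes> x \<otimes> diag {j})"
proof -
  interpret O: matrix_units "opposite_ring R" e k b a by (rule matrix_units_opposite)
  have d: "O.diag Z = diag Z" for Z by (simp add: O.diag_def diag_def)
  have "\<exists>r\<in>carrier (corner (opposite_ring R) e). b j \<otimes>\<^bsub>opposite_ring R\<^esub> x \<otimes>\<^bsub>opposite_ring R\<^esub> a l =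
      (b j \<otimes>\<^bsub>opposite_ring R\<^esub> x \<otimes>\<^bsub>opposite_ring R\<^esub> a i) \<otimes>\<^bsub>opposite_ring R\<^esub> r" if l: "l \<in> X" for l
  proof -
    have lk: "l < k" using l X by auto
    obtain r where "r \<in> carrier (corner R e)" "a l \<otimes> x \<otimes> b j = r \<otimes> (a i \<otimes> x \<otimes> b j)" using r[OF l] by blast
    then show ?thesis using ij lk x by (intro bexI[of _ r]) (auto simp: m_assoc)
  qed
  from O.row_multiple[OF ij(2,1) X _ this] x
  show ?thesis unfolding d using ij X x by (auto simp: m_assoc)
qed

text \<open>An element \<open>z = z \<otimes> diag {i}\<close> is a single column with the entries
  \<open>a l \<otimes> z \<otimes> b i\<close> in the corner, so the condition reduces to the pair
  \<open>(t, q)\<close> entry by entry. The partner sits at the transposed position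
  \<open>(j, i)\<close>.\<close>

lemma entry_pair_aux:
  assumes ij: "i < k" "j < k" and pair: "left_morphic_pair (corner R e) e e t q"
    and z: "z \<in> carrier R" "z \<otimes> diag {i} = z"
  shows "z \<otimes> (b i \<otimes> t \<otimes> a j) = \<zero> \<longleftrightarrow> (\<exists>y\<in>carrier R. z = y \<otimes> (b j \<otimes> q \<otimes> a i))"
proof -
  have tq: "t \<in> carrier R" "q \<in> carrier R" "t \<otimes> e = t" "e \<otimes> q = q"
    using pair by (auto simp: left_morphic_pair_def)
  have pt: "w \<otimes> t = \<zero> \<longleftrightarrow> (\<exists>y\<in>carrier (corner R e). w = y \<otimes> q)" if "w \<in> carrier (corner R e)" for w
    using pair that by (auto simp: left_morphic_pair_def)
  show ?thesis
  proof
    assume z0: "z \<otimes> (b i \<otimes> t \<otimes> a j) = \<zero>"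
    have "z \<otimes> (b i \<otimes> t \<otimes> a j) \<otimes> b j = z \<otimes> b i \<otimes> (t \<otimes> (a j \<otimes> b j))"
      using z(1) tq(1) ij by (simp add: m_assoc)
    also have "\<dots> = z \<otimes> b i \<otimes> t" using ij tq by (simp add: a_b)
    finally have zbt: "z \<otimes> b i \<otimes> t = \<zero>" using z0 ij by simp
    have "\<exists>y\<in>carrier (corner R e). a l \<otimes> z \<otimes> b i = y \<otimes> q" if l: "l < k" for l
    proof -
      have "(a l \<otimes> z \<otimes> b i) \<otimes> t = a l \<otimes> (z \<otimes> b i \<otimes> t)" using z(1) tq(1) ij l by (simp add: m_assoc)
      then show ?thesis using zbt l pt[OF entry_closed[OF l ij(1) z(1)]] by simp
    qed
    then obtain y where y: "\<And>l. l < k \<Longrightarrow> y l \<in> carrier (corner R e)"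
      "\<And>l. l < k \<Longrightarrow> a l \<otimes> z \<otimes> b i = y l \<otimes> q" by metis
    have yc: "y l \<in> carrier R" if "l < k" for l using y(1)[OF that] by simp
    define Y where "Y = (\<Oplus>l\<in>{..<k}. b l \<otimes> y l)"
    have Yc: "Y \<in> carrier R" unfolding Y_def using yc by (intro finsum_closed) auto
    have "z \<otimes> b i = (\<Oplus>l\<in>{..<k}. b l \<otimes> a l) \<otimes> (z \<otimes> b i)" using z(1) ij by (simp add: sum_ba)
    also have "\<dots> = (\<Oplus>l\<in>{..<k}. (b l \<otimes> a l) \<otimes> (z \<otimes> b i))"
      using z(1) ij by (intro finsum_ldistr) auto
    also have "\<dots> = (\<Oplus>l\<in>{..<k}. (b l \<otimes> y l) \<otimes> q)"
    proof (rule finsum_cong', goal_cases)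
      case (3 l)
      then have l: "l < k" by simp
      have "(b l \<otimes> a l) \<otimes> (z \<otimes> b i) = b l \<otimes> (a l \<otimes> z \<otimes> b i)" using l z(1) ij by (simp add: m_assoc)
      also have "\<dots> = (b l \<otimes> y l) \<otimes> q" unfolding y(2)[OF l] using l yc tq(2) by (simp add: m_assoc)
      finally show ?case .
    qed (use yc tq in auto)
    also have "\<dots> = Y \<otimes> q" unfolding Y_def using yc tq(2) by (intro finsum_ldistr[symmetric]) auto
    finally have zb: "z \<otimes> b i = Y \<otimes> q" .
    have "z = (z \<otimes> b i) \<otimes> a i" using z ij unit_idem[of i] by (simp add: m_assoc)
    also have "\<dots> = Y \<otimes> (e \<otimes> q) \<otimes> a i" unfolding zb tq(4) ..
    also have "\<dots> = Y \<otimes> ((a j \<otimes> b j) \<otimes> q) \<otimes> a i" using ij by (simp add: a_b)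
    also have "\<dots> = (Y \<otimes> a j) \<otimes> (b j \<otimes> q \<otimes> a i)" using Yc tq(2) ij by (simp add: m_assoc)
    finally have zz: "z = (Y \<otimes> a j) \<otimes> (b j \<otimes> q \<otimes> a i)" .
    show "\<exists>y\<in>carrier R. z = y \<otimes> (b j \<otimes> q \<otimes> a i)" 
    proof (rule bexI)
      show "z = (Y \<otimes> a j) \<otimes> (b j \<otimes> q \<otimes> a i)" by (rule zz)
    qed (use Yc ij in simp)
  next
    assume "\<exists>y\<in>carrier R. z = y \<otimes> (b j \<otimes> q \<otimes> a i)"
    then obtain y where y: "y \<in> carrier R" "z = y \<otimes> (b j \<otimes> q \<otimes> a i)" by blast
    have qt: "q \<otimes> t = \<zero>"
    proof -
      have "q \<in> carrier (corner R e)" using pair by (simp add: left_morphic_pair_def)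
      moreover have "\<exists>y\<in>carrier (corner R e). q = y \<otimes> q" by (intro bexI[of _ e]) (simp_all add: tq(4))
      ultimately show ?thesis using pt by blast
    qed
    have "z \<otimes> (b i \<otimes> t \<otimes> a j) = y \<otimes> b j \<otimes> (q \<otimes> ((a i \<otimes> b i) \<otimes> t)) \<otimes> a j"
      unfolding y(2) using y(1) tq(1,2) ij by (simp add: m_assoc)
    also have "(a i \<otimes> b i) \<otimes> t = t" using ij pair by (simp add: a_b left_morphic_pair_def)
    finally show "z \<otimes> (b i \<otimes> t \<otimes> a j) = \<zero>" using qt y(1) ij by simp
  qed
qed

lemma entry_pair:
  assumes u: "uniformizer (corner R e) c" and ij: "i < k" "j < k"
    and p: "p \<in> carrier R" "diag {i} \<otimes> p = p" "p \<otimes> diag {j} = p"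
  shows "\<exists>q. left_morphic_pair R (diag {i}) (diag {j}) p q"
proof -
  interpret T: uniformizer_ring "corner R e" c
    using u by (simp add: uniformizer_ring_def uniformizer_ring_axioms_def uniformizer_def)
  define t where "t = a i \<otimes> p \<otimes> b j"
  have t: "t \<in> carrier (corner R e)" unfolding t_def by (rule entry_closed[OF ij p(1)])
  obtain q where q: "left_morphic_pair (corner R e) e e t q"
    using T.left_morphic_pair_exists[OF t] by auto
  have q': "left_morphic_pair (corner R e) e e q t" using q by (simp add: left_morphic_pair_sym)
  have tq: "t \<in> carrier R" "q \<in> carrier R" using q by (auto simp: left_morphic_pair_def)
  have "b i \<otimes> t \<otimes> a j = (b i \<otimes> a i) \<otimes> p \<otimes> (b j \<otimes> a j)"
    unfolding t_def using ij p(1) by (simp add: m_assoc)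
  also have "\<dots> = p" using ij p by (simp add: unit_idem)
  finally have pt: "b i \<otimes> t \<otimes> a j = p" .
  have "diag {j} \<otimes> (b j \<otimes> q \<otimes> a i) = (diag {j} \<otimes> b j) \<otimes> q \<otimes> a i" using tq ij by (simp add: m_assoc)
  then have 1: "diag {j} \<otimes> (b j \<otimes> q \<otimes> a i) = b j \<otimes> q \<otimes> a i" using ij by (simp add: diag_b)
  have 2: "(b j \<otimes> q \<otimes> a i) \<otimes> diag {i} = b j \<otimes> q \<otimes> a i" using tq ij by (simp add: m_assoc a_diag)
  show ?thesis
    unfolding left_morphic_pair_def
    using entry_pair_aux[OF ij q] entry_pair_aux[OF ij(2,1) q'] 1 2 p ij tq unfolding pt
    by (intro exI[of _ "b j \<otimes> q \<otimes> a i"]) auto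
qed

lemma one_plus_square_zero:
  assumes "s \<in> carrier R" "s \<otimes> s = \<zero>"
  shows "(\<one> \<oplus> s) \<otimes> (\<one> \<ominus> s) = \<one>" "(\<one> \<ominus> s) \<otimes> (\<one> \<oplus> s) = \<one>"
  using assms by (auto simp: minus_eq l_distr r_distr l_minus r_minus a_assoc r_neg l_neg r_neg1 r_neg2)

text \<open>An entry of least \<open>val\<close> divides all others in its row and column. After
  these are cleared, the pivot is handled by \<open>entry_pair\<close> and the rest by induction.
  The two sets must have equal size: a block with rows but no columns contains only zero, and zero
  has no partner there.\<close>

lemma left_morphic_pair_diag:
  assumes u: "uniformizer (corner R e) c"
  shows "\<lbrakk>X \<subseteq> {..<k}; Y \<subseteq> {..<k}; card X = n; card Y = n; x \<in> carrier R; diag X \<otimes> x = x; x \<otimes> diag Y = x\<rbrakk>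
    \<Longrightarrow> \<exists>y. left_morphic_pair R (diag X) (diag Y) x y"
proof (induct n arbitrary: X Y x)
  case 0
  then have "X = {}" "Y = {}" using finite_index by auto
  then show ?case using 0 by (intro exI[of _ \<zero>]) (auto simp: left_morphic_pair_def intro: bexI[of _ \<zero>])
next
  case (Suc n)
  interpret T: uniformizer_ring "corner R e" c
    using u by (simp add: uniformizer_ring_def uniformizer_ring_axioms_def uniformizer_def)
  note X = Suc.prems(1) and Y = Suc.prems(2) and x = Suc.prems(5-7)
  have "X \<noteq> {}" "Y \<noteq> {}" using Suc.prems by auto
  then obtain i0 j0 where "i0 \<in> X" "j0 \<in> Y" by auto
  then have "\<exists>ij. (fst ij \<in> X \<and> snd ij \<in> Y) \<and> (\<forall>y. (fst y \<in> X \<and> snd y \<in> Y) \<longrightarrow>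
     T.val (a (fst ij) \<otimes> x \<otimes> b (snd ij)) \<le> T.val (a (fst y) \<otimes> x \<otimes> b (snd y)))"
    by (intro ex_has_least_nat[where k = "(i0, j0)"]) auto
  then obtain i j where ij: "i \<in> X" "j \<in> Y"
    and min: "\<And>i' j'. i' \<in> X \<Longrightarrow> j' \<in> Y \<Longrightarrow> T.val (a i \<otimes> x \<otimes> b j) \<le> T.val (a i' \<otimes> x \<otimes> b j')"
    by (metis fst_conv snd_conv prod.collapse)
  have ik: "i < k" "j < k" using ij X Y by auto
  define X' Y' where "X' = X - {i}" and "Y' = Y - {j}"
  have X': "X' \<subseteq> {..<k}" "i \<notin> X'" "X = insert i X'" "card X' = n"
    and Y': "Y' \<subseteq> {..<k}" "j \<notin> Y'" "Y = insert j Y'" "card Y' = n"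
    using X Y ij Suc.prems(3,4) finite_index by (auto simp: X'_def Y'_def)
  have dX: "diag X = diag {i} \<oplus> diag X'" using X' X diag_insert[of i X'] unit_idem[OF ik(1)] by simp
  have dY: "diag Y = diag {j} \<oplus> diag Y'" using Y' Y diag_insert[of j Y'] unit_idem[OF ik(2)] by simp
  have dc: "diag {i} \<in> carrier R" "diag X' \<in> carrier R" "diag {j} \<in> carrier R" "diag Y' \<in> carrier R"
    using ik X' Y' by auto
  have em: "{i} \<inter> X' = {}" "X' \<inter> {i} = {}" "{j} \<inter> Y' = {}" "Y' \<inter> {j} = {}" using X' Y' by auto
  have ort: "diag {i} \<otimes> diag X' = \<zero>" "diag X' \<otimes> diag {i} = \<zero>" "diag {i} \<otimes> diag {i} = diag {i}"
    "diag X' \<otimes> diag X' = diag X'" "diag {j} \<otimes> diag Y' = \<zero>" "diag Y' \<otimes> diag {j} = \<zero>"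
    "diag {j} \<otimes> diag {j} = diag {j}" "diag Y' \<otimes> diag Y' = diag Y'"
    using ik X' Y' em by (simp_all add: diag_mult)
  have tc: "a i' \<otimes> x \<otimes> b j' \<in> carrier (corner R e)" if "i' \<in> X" "j' \<in> Y" for i' j'
    using that X Y by (intro entry_closed x) auto
  have "\<exists>t\<in>carrier R. diag {j} \<otimes> t = t \<and> t \<otimes> diag Y' = t \<and>
           diag {i} \<otimes> x \<otimes> diag Y' = (diag {i} \<otimes> x \<otimes> diag {j}) \<otimes> t"
  proof (rule row_multiple[OF ik Y'(1) x(1)])
    fix l assume "l \<in> Y'"
    then have l: "l \<in> Y" using Y' by auto
    show "\<exists>r\<in>carrier (corner R e). a i \<otimes> x \<otimes> b l = a i \<otimes> x \<otimes> b j \<otimes> r"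
      using T.val_divides(2)[OF tc[OF ij] tc[OF ij(1) l] min[OF ij(1) l]] by simp
  qed
  then obtain t where t: "t \<in> carrier R" "diag {j} \<otimes> t = t" "t \<otimes> diag Y' = t"
    "diag {i} \<otimes> x \<otimes> diag Y' = (diag {i} \<otimes> x \<otimes> diag {j}) \<otimes> t" by blast
  have "\<exists>s\<in>carrier R. diag X' \<otimes> s = s \<and> s \<otimes> diag {i} = s \<and>
           diag X' \<otimes> x \<otimes> diag {j} = s \<otimes> (diag {i} \<otimes> x \<otimes> diag {j})"
  proof (rule column_multiple[OF ik X'(1) x(1)])
    fix l assume "l \<in> X'"
    then have l: "l \<in> X" using X' by auto
    show "\<exists>r\<in>carrier (corner R e). a l \<otimes> x \<otimes> b j = r \<otimes> (a i \<otimes> x \<otimes> b j)"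
      using T.val_divides(1)[OF tc[OF ij] tc[OF l ij(2)] min[OF l ij(2)]] by simp
  qed
  then obtain s where s: "s \<in> carrier R" "diag X' \<otimes> s = s" "s \<otimes> diag {i} = s"
    "diag X' \<otimes> x \<otimes> diag {j} = s \<otimes> (diag {i} \<otimes> x \<otimes> diag {j})" by blast
  define p where "p = diag {i} \<otimes> x \<otimes> diag {j}"
  define x' where "x' = diag X' \<otimes> x \<otimes> diag Y' \<ominus> s \<otimes> p \<otimes> t"
  have pc: "p \<in> carrier R" "x' \<in> carrier R" unfolding p_def x'_def using dc x s t by auto
  have x_eq: "x = (\<one> \<oplus> s) \<otimes> (p \<oplus> x') \<otimes> (\<one> \<oplus> t)"
    by (rule diagonal_step[OF dc x(1) s(1) t(1) ort(1,6,8) _ _ t(2-4) s(2-4) p_def x'_def])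
      (use x dX dY in auto)
  have "diag {i} \<otimes> p = p"
    unfolding p_def using dc x ort by (simp add: m_assoc[symmetric])
  moreover have "p \<otimes> diag {j} = p"
    unfolding p_def using dc x ort by (simp add: m_assoc)
  ultimately obtain q where q: "left_morphic_pair R (diag {i}) (diag {j}) p q"
    using entry_pair[OF u ik pc(1)] by blast
  have "diag X' \<otimes> (s \<otimes> p \<otimes> t) = (diag X' \<otimes> s) \<otimes> p \<otimes> t" "(s \<otimes> p \<otimes> t) \<otimes> diag Y' = s \<otimes> p \<otimes> (t \<otimes> diag Y')"
    using dc s(1) t(1) pc by (simp_all add: m_assoc)
  moreover have "diag X' \<otimes> (diag X' \<otimes> x \<otimes> diag Y') = (diag X' \<otimes> diag X') \<otimes> x \<otimes> diag Y'"
    "(diag X' \<otimes> x \<otimes> diag Y') \<otimes> diag Y' = diag X' \<otimes> x \<otimes> (diag Y' \<otimes> diag Y')"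
    using dc x(1) by (simp_all add: m_assoc)
  ultimately have "diag X' \<otimes> x' = x'" "x' \<otimes> diag Y' = x'"
    unfolding x'_def using dc s(1,2) t(1,3) pc x(1) ort
    by (simp_all add: minus_eq l_distr r_distr l_minus r_minus)
  then obtain y' where y': "left_morphic_pair R (diag X') (diag Y') x' y'"
    using Suc.hyps[OF X'(1) Y'(1) X'(4) Y'(4) pc(2)] by blast
  have pair: "left_morphic_pair R (diag X) (diag Y) (p \<oplus> x') (q \<oplus> y')"
    unfolding dX dY
    by (rule left_morphic_pair_sum[OF dc(1,2) ort(1-4) dc(3,4) ort(5-8) q y'])
  have "s \<otimes> s = s \<otimes> diag {i} \<otimes> (diag X' \<otimes> s)" using s by simp
  also have "\<dots> = s \<otimes> ((diag {i} \<otimes> diag X') \<otimes> s)" using s(1) dc by (simp add: m_assoc)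
  finally have ss: "s \<otimes> s = \<zero>" using ort s(1) by simp
  have "t \<otimes> t = t \<otimes> diag Y' \<otimes> (diag {j} \<otimes> t)" using t by simp
  also have "\<dots> = t \<otimes> ((diag Y' \<otimes> diag {j}) \<otimes> t)" using t(1) dc by (simp add: m_assoc)
  finally have tt: "t \<otimes> t = \<zero>" using ort t(1) by simp
  \<comment> \<open>\<open>1 + s\<close> must commute with \<open>diag X\<close>. The rows of
    \<open>s\<close> are in \<open>X'\<close> and its only column is \<open>i\<close>, all inside
    \<open>X\<close>, so \<open>diag X\<close> acts on \<open>s\<close> as the identity from both
    sides. The same holds for \<open>t\<close> and \<open>diag Y\<close>.\<close>
  have "diag {i} \<otimes> s = \<zero>"
    using m_assoc[OF dc(1,2) s(1)] s(1,2) ort(1) by simp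
  moreover have "s \<otimes> diag X' = \<zero>"
    using m_assoc[OF s(1) dc(1,2)] s(1,3) ort(1) by simp
  ultimately have sg: "diag X \<otimes> (\<one> \<oplus> s) = (\<one> \<oplus> s) \<otimes> diag X"
    unfolding dX using dc s by (simp add: l_distr r_distr a_ac)
  have "diag Y' \<otimes> t = \<zero>"
    using m_assoc[OF dc(4,3) t(1)] t(1,2) ort(6) by simp
  moreover have "t \<otimes> diag {j} = \<zero>"
    using m_assoc[OF t(1) dc(4,3)] t(1,3) ort(6) by simp
  ultimately have th: "diag Y \<otimes> (\<one> \<oplus> t) = (\<one> \<oplus> t) \<otimes> diag Y"
    unfolding dY using dc t by (simp add: l_distr r_distr a_ac)
  have cc: "diag X \<in> carrier R" "diag Y \<in> carrier R" "\<one> \<oplus> s \<in> carrier R" "\<one> \<ominus> s \<in> carrier R"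
    "\<one> \<oplus> t \<in> carrier R" "\<one> \<ominus> t \<in> carrier R"
    using X Y s(1) t(1) by auto
  show ?case
    using left_morphic_pair_unit[OF pair cc one_plus_square_zero[OF s(1) ss] sg
        one_plus_square_zero[OF t(1) tt] th] unfolding x_eq[symmetric] by blast
qed

lemma left_morphic:
  assumes "uniformizer (corner R e) c"
  shows "left_morphic R"
  unfolding left_morphic_iff_pair[OF ring_axioms]
  using left_morphic_pair_diag[OF assms, of "{..<k}" "{..<k}" k] diag_all by auto

lemma morphic:
  assumes "uniformizer (corner R e) c"
  shows "morphic R"
proof -
  interpret O: matrix_units "opposite_ring R" e k b a by (rule matrix_units_opposite)
  show ?thesis unfolding morphic_def
    using left_morphic[OF assms] O.left_morphic uniformizer_opposite_ring[OF assms]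
    by (simp add: opposite_ring_corner)
qed

end

section \<open>Morphic rings as direct products\<close>

text \<open>Annihilators and principal left ideals are computed componentwise. The product is
  presented by jointly injective and jointly surjective projections, so that
  \<open>R \<propto> M\<close> can be taken as it is instead of being replaced by a ring of
  tuples.\<close>

lemma left_morphic_product:
  assumes S: "ring S" and T: "\<And>q. q < (n::nat) \<Longrightarrow> ring (T q)" "\<And>q. q < n \<Longrightarrow> left_morphic (T q)"
    and hom: "\<And>q. q < n \<Longrightarrow> \<pi> q \<in> ring_hom S (T q)"
    and inj: "\<And>x y. \<lbrakk>x \<in> carrier S; y \<in> carrier S; \<And>q. q < n \<Longrightarrow> \<pi> q x = \<pi> q y\<rbrakk> \<Longrightarrow> x = y"
    and surj: "\<And>f. (\<And>q. q < n \<Longrightarrow> f q \<in> carrier (T q)) \<Longrightarrow> \<exists>x\<in>carrier S. \<forall>q<n. \<pi> q x = f q"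
  shows "left_morphic S"
  unfolding left_morphic_iff[OF S]
proof
  fix a assume a: "a \<in> carrier S"
  interpret ring S by fact
  have hc: "\<pi> q x \<in> carrier (T q)" if "q < n" "x \<in> carrier S" for q x
    using hom[OF that(1)] that(2) by (rule ring_hom_closed)
  have hm: "\<pi> q (x \<otimes>\<^bsub>S\<^esub> y) = \<pi> q x \<otimes>\<^bsub>T q\<^esub> \<pi> q y" if "q < n" "x \<in> carrier S" "y \<in> carrier S" for q x y
    using hom[OF that(1)] that(2,3) by (rule ring_hom_mult)
  have h0: "\<pi> q \<zero>\<^bsub>S\<^esub> = \<zero>\<^bsub>T q\<^esub>" if "q < n" for q
    using ring_hom_zero[OF hom[OF that] S T(1)[OF that]] .
  have ex: "\<exists>b\<in>carrier (T q). \<forall>x\<in>carrier (T q).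
     (x \<otimes>\<^bsub>T q\<^esub> \<pi> q a = \<zero>\<^bsub>T q\<^esub> \<longleftrightarrow> (\<exists>y\<in>carrier (T q). x = y \<otimes>\<^bsub>T q\<^esub> b)) \<and>
     (x \<otimes>\<^bsub>T q\<^esub> b = \<zero>\<^bsub>T q\<^esub> \<longleftrightarrow> (\<exists>y\<in>carrier (T q). x = y \<otimes>\<^bsub>T q\<^esub> \<pi> q a))" if "q < n" for q
    using T(2)[OF that] hc[OF that a] left_morphic_iff[OF T(1)[OF that]] by blast
  then have "\<forall>q\<in>{..<n}. \<exists>b. b \<in> carrier (T q) \<and> (\<forall>x\<in>carrier (T q).
     (x \<otimes>\<^bsub>T q\<^esub> \<pi> q a = \<zero>\<^bsub>T q\<^esub> \<longleftrightarrow> (\<exists>y\<in>carrier (T q). x = y \<otimes>\<^bsub>T q\<^esub> b)) \<and>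
     (x \<otimes>\<^bsub>T q\<^esub> b = \<zero>\<^bsub>T q\<^esub> \<longleftrightarrow> (\<exists>y\<in>carrier (T q). x = y \<otimes>\<^bsub>T q\<^esub> \<pi> q a)))"
    unfolding Bex_def by simp
  from bchoice[OF this] obtain b where b0: "\<forall>q\<in>{..<n}. b q \<in> carrier (T q) \<and> (\<forall>x\<in>carrier (T q).
     (x \<otimes>\<^bsub>T q\<^esub> \<pi> q a = \<zero>\<^bsub>T q\<^esub> \<longleftrightarrow> (\<exists>y\<in>carrier (T q). x = y \<otimes>\<^bsub>T q\<^esub> b q)) \<and>
     (x \<otimes>\<^bsub>T q\<^esub> b q = \<zero>\<^bsub>T q\<^esub> \<longleftrightarrow> (\<exists>y\<in>carrier (T q). x = y \<otimes>\<^bsub>T q\<^esub> \<pi> q a)))"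
    by (elim exE)
  then have b: "\<And>q. q < n \<Longrightarrow> b q \<in> carrier (T q)"
    "\<And>q x. q < n \<Longrightarrow> x \<in> carrier (T q) \<Longrightarrow> x \<otimes>\<^bsub>T q\<^esub> \<pi> q a = \<zero>\<^bsub>T q\<^esub> \<longleftrightarrow> (\<exists>y\<in>carrier (T q). x = y \<otimes>\<^bsub>T q\<^esub> b q)"
    "\<And>q x. q < n \<Longrightarrow> x \<in> carrier (T q) \<Longrightarrow> x \<otimes>\<^bsub>T q\<^esub> b q = \<zero>\<^bsub>T q\<^esub> \<longleftrightarrow> (\<exists>y\<in>carrier (T q). x = y \<otimes>\<^bsub>T q\<^esub> \<pi> q a)"
    by simp_all
  obtain B where B: "B \<in> carrier S" "\<And>q. q < n \<Longrightarrow> \<pi> q B = b q" using surj[of b] b(1) by blast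
  have zero: "x \<otimes>\<^bsub>S\<^esub> u = \<zero>\<^bsub>S\<^esub> \<longleftrightarrow> (\<forall>q<n. \<pi> q x \<otimes>\<^bsub>T q\<^esub> \<pi> q u = \<zero>\<^bsub>T q\<^esub>)"
    if "x \<in> carrier S" "u \<in> carrier S" for x u
    using inj[of "x \<otimes>\<^bsub>S\<^esub> u" "\<zero>\<^bsub>S\<^esub>"] hm h0 that by (metis m_closed zero_closed)
  have mult: "(\<exists>y\<in>carrier S. x = y \<otimes>\<^bsub>S\<^esub> u) \<longleftrightarrow> (\<forall>q<n. \<exists>y\<in>carrier (T q). \<pi> q x = y \<otimes>\<^bsub>T q\<^esub> \<pi> q u)"
    if xu: "x \<in> carrier S" "u \<in> carrier S" for x u
  proof
    assume "\<exists>y\<in>carrier S. x = y \<otimes>\<^bsub>S\<^esub> u"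
    then show "\<forall>q<n. \<exists>y\<in>carrier (T q). \<pi> q x = y \<otimes>\<^bsub>T q\<^esub> \<pi> q u" using hm hc xu by metis
  next
    assume "\<forall>q<n. \<exists>y\<in>carrier (T q). \<pi> q x = y \<otimes>\<^bsub>T q\<^esub> \<pi> q u"
    then obtain y where y: "\<And>q. q < n \<Longrightarrow> y q \<in> carrier (T q)" "\<And>q. q < n \<Longrightarrow> \<pi> q x = y q \<otimes>\<^bsub>T q\<^esub> \<pi> q u"
      by metis
    obtain Y where Y: "Y \<in> carrier S" "\<And>q. q < n \<Longrightarrow> \<pi> q Y = y q" using surj[of y] y(1) by blast
    have "x = Y \<otimes>\<^bsub>S\<^esub> u" using inj[of x "Y \<otimes>\<^bsub>S\<^esub> u"] hm y Y xu by simp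
    then show "\<exists>y\<in>carrier S. x = y \<otimes>\<^bsub>S\<^esub> u" using Y(1) by blast
  qed
  have "(x \<otimes>\<^bsub>S\<^esub> a = \<zero>\<^bsub>S\<^esub> \<longleftrightarrow> (\<exists>y\<in>carrier S. x = y \<otimes>\<^bsub>S\<^esub> B)) \<and>
        (x \<otimes>\<^bsub>S\<^esub> B = \<zero>\<^bsub>S\<^esub> \<longleftrightarrow> (\<exists>y\<in>carrier S. x = y \<otimes>\<^bsub>S\<^esub> a))" if x: "x \<in> carrier S" for x
    unfolding zero[OF x a] zero[OF x B(1)] mult[OF x a] mult[OF x B(1)]
    using b(2,3) B(2) hc[OF _ x] by simp
  then show "\<exists>b\<in>carrier S. \<forall>x\<in>carrier S.
     (x \<otimes>\<^bsub>S\<^esub> a = \<zero>\<^bsub>S\<^esub> \<longleftrightarrow> (\<exists>y\<in>carrier S. x = y \<otimes>\<^bsub>S\<^esub> b)) \<and>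
     (x \<otimes>\<^bsub>S\<^esub> b = \<zero>\<^bsub>S\<^esub> \<longleftrightarrow> (\<exists>y\<in>carrier S. x = y \<otimes>\<^bsub>S\<^esub> a))" using B(1) by blast
qed

lemma morphic_product:
  assumes S: "ring S" and T: "\<And>q. q < (n::nat) \<Longrightarrow> ring (T q)" "\<And>q. q < n \<Longrightarrow> morphic (T q)"
    and hom: "\<And>q. q < n \<Longrightarrow> \<pi> q \<in> ring_hom S (T q)"
    and inj: "\<And>x y. \<lbrakk>x \<in> carrier S; y \<in> carrier S; \<And>q. q < n \<Longrightarrow> \<pi> q x = \<pi> q y\<rbrakk> \<Longrightarrow> x = y"
    and surj: "\<And>f. (\<And>q. q < n \<Longrightarrow> f q \<in> carrier (T q)) \<Longrightarrow> \<exists>x\<in>carrier S. \<forall>q<n. \<pi> q x = f q"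
  shows "morphic S"
proof -
  have hom': "\<pi> q \<in> ring_hom (opposite_ring S) (opposite_ring (T q))" if "q < n" for q
    using hom[OF that] by (auto simp: ring_hom_def)
  have "left_morphic S"
    by (rule left_morphic_product[where T = T and n = n and \<pi> = \<pi>])
      (use assms in \<open>auto simp: morphic_def\<close>)
  moreover have "left_morphic (opposite_ring S)"
    by (rule left_morphic_product[where T = "\<lambda>q. opposite_ring (T q)" and n = n and \<pi> = \<pi>])
      (use assms hom' in \<open>auto simp: morphic_def\<close>)
  ultimately show ?thesis by (simp add: morphic_def)
qed

section \<open>Matrix units in a ring isomorphic to a matrix ring\<close>

definition single_entry :: "nat \<Rightarrow> ('a, 'x) ring_scheme \<Rightarrow> nat \<Rightarrow> nat \<Rightarrow> 'a \<Rightarrow> nat \<times> nat \<Rightarrow> 'a" where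
  "single_entry k L i j l = (\<lambda>(i', j')\<in>{..<k} \<times> {..<k}. if i' = i \<and> j' = j then l else \<zero>\<^bsub>L\<^esub>)"

lemma single_entry_apply:
  "i' < k \<Longrightarrow> j' < k \<Longrightarrow> single_entry k L i j l (i', j') = (if i' = i \<and> j' = j then l else \<zero>\<^bsub>L\<^esub>)"
  by (simp add: single_entry_def)

lemma matrix_ring_mult_apply:
  "i < k \<Longrightarrow> j < k \<Longrightarrow> (A \<otimes>\<^bsub>matrix_ring k L\<^esub> B) (i, j) = (\<Oplus>\<^bsub>L\<^esub>l\<in>{..<k}. A (i, l) \<otimes>\<^bsub>L\<^esub> B (l, j))"
  by (simp add: matrix_ring_def)

lemma matrix_ring_add_apply:
  "i < k \<Longrightarrow> j < k \<Longrightarrow> (A \<oplus>\<^bsub>matrix_ring k L\<^esub> B) (i, j) = A (i, j) \<oplus>\<^bsub>L\<^esub> B (i, j)"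
  by (simp add: matrix_ring_def)

lemma matrix_ring_one_apply:
  "i < k \<Longrightarrow> j < k \<Longrightarrow> \<one>\<^bsub>matrix_ring k L\<^esub> (i, j) = (if i = j then \<one>\<^bsub>L\<^esub> else \<zero>\<^bsub>L\<^esub>)"
  by (simp add: matrix_ring_def)

lemma matrix_ring_eqI:
  assumes "A \<in> carrier (matrix_ring k L)" "B \<in> carrier (matrix_ring k L)"
    and "\<And>i j. i < k \<Longrightarrow> j < k \<Longrightarrow> A (i, j) = B (i, j)"
  shows "A = B"
proof (rule PiE_ext)
  show "A \<in> {..<k} \<times> {..<k} \<rightarrow>\<^sub>E carrier L" "B \<in> {..<k} \<times> {..<k} \<rightarrow>\<^sub>E carrier L"
    using assms(1,2) by (auto simp: matrix_ring_def)
qed (use assms(3) in auto)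

lemma (in ring) matrix_entry_closed:
  "A \<in> carrier (matrix_ring k R) \<Longrightarrow> i < k \<Longrightarrow> j < k \<Longrightarrow> A (i, j) \<in> carrier R"
  by (auto simp: matrix_ring_def)

context ring
begin

lemma single_entry_closed: "l \<in> carrier R \<Longrightarrow> single_entry k R i j l \<in> carrier (matrix_ring k R)"
  by (auto simp: single_entry_def matrix_ring_def)

lemma matrix_ring_mult_closed:
  "A \<in> carrier (matrix_ring k R) \<Longrightarrow> B \<in> carrier (matrix_ring k R) \<Longrightarrow>
    A \<otimes>\<^bsub>matrix_ring k R\<^esub> B \<in> carrier (matrix_ring k R)"
  by (auto simp: matrix_ring_def intro!: finsum_closed)

lemma single_entry_mult_apply:
  assumes "l \<in> carrier R" "A \<in> carrier (matrix_ring k R)" "j < k" "i' < k" "m < k"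
  shows "(single_entry k R i j l \<otimes>\<^bsub>matrix_ring k R\<^esub> A) (i', m) = (if i' = i then l \<otimes> A (j, m) else \<zero>)"
proof -
  have Ac: "A (l', m) \<in> carrier R" if "l' < k" for l' using assms(2,5) that by (intro matrix_entry_closed)
  have "(single_entry k R i j l \<otimes>\<^bsub>matrix_ring k R\<^esub> A) (i', m)
      = (\<Oplus>l'\<in>{..<k}. if j = l' then (if i' = i then l \<otimes> A (l', m) else \<zero>) else \<zero>)"
    unfolding matrix_ring_mult_apply[OF assms(4,5)]
    by (rule finsum_cong') (use assms Ac in \<open>auto simp: single_entry_apply\<close>)
  also have "\<dots> = (if i' = i then l \<otimes> A (j, m) else \<zero>)"
    by (rule finsum_singleton) (use assms Ac in auto)
  finally show ?thesis .
qed

lemma mult_single_entry_apply: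
  assumes "l \<in> carrier R" "A \<in> carrier (matrix_ring k R)" "i < k" "i' < k" "m < k"
  shows "(A \<otimes>\<^bsub>matrix_ring k R\<^esub> single_entry k R i j l) (i', m) = (if m = j then A (i', i) \<otimes> l else \<zero>)"
proof -
  have Ac: "A (i', l') \<in> carrier R" if "l' < k" for l' using assms(2,4) that by (intro matrix_entry_closed)
  have "(A \<otimes>\<^bsub>matrix_ring k R\<^esub> single_entry k R i j l) (i', m)
      = (\<Oplus>l'\<in>{..<k}. if i = l' then (if m = j then A (i', l') \<otimes> l else \<zero>) else \<zero>)"
    unfolding matrix_ring_mult_apply[OF assms(4,5)]
    by (rule finsum_cong') (use assms Ac in \<open>auto simp: single_entry_apply\<close>)
  also have "\<dots> = (if m = j then A (i', i) \<otimes> l else \<zero>)"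
    by (rule finsum_singleton) (use assms Ac in auto)
  finally show ?thesis .
qed

lemma single_entry_mult:
  assumes "l \<in> carrier R" "l' \<in> carrier R" "i < k" "j < k" "i' < k" "j' < k"
  shows "single_entry k R i j l \<otimes>\<^bsub>matrix_ring k R\<^esub> single_entry k R i' j' l' =
    single_entry k R i j' (if j = i' then l \<otimes> l' else \<zero>)"
  by (rule matrix_ring_eqI[of _ k R])
    (use assms in \<open>auto simp: single_entry_mult_apply single_entry_closed matrix_ring_mult_closed single_entry_apply\<close>)

end

text \<open>The elementary matrices are pulled back: \<open>e\<close> is the one at
  \<open>(0, 0)\<close>, the row consists of those at \<open>(0, i)\<close>, the column of those at
  \<open>(i, 0)\<close>. The corner at \<open>e\<close> is a copy of \<open>L\<close> through
  \<open>E 0 0\<close> and inherits its uniformizer.\<close>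

lemma matrix_units_of_iso:
  assumes P: "ring P" and L: "uniformizer L c" and k: "k \<ge> 1" and \<theta>: "\<theta> \<in> ring_iso P (matrix_ring k L)"
  shows "\<exists>e a b c'. matrix_units P e k a b \<and> uniformizer (corner P e) c'"
proof -
  interpret P: ring P by fact
  interpret L: uniformizer_ring L c
    using L by (simp add: uniformizer_ring_def uniformizer_ring_axioms_def uniformizer_def)
  let ?M = "matrix_ring k L"
  have \<theta>h: "\<theta> \<in> ring_hom P ?M" and \<theta>b: "bij_betw \<theta> (carrier P) (carrier ?M)"
    using \<theta> by (auto simp: ring_iso_def)
  define \<eta> where "\<eta> = inv_into (carrier P) \<theta>"
  have \<eta>c: "\<eta> A \<in> carrier P" and \<theta>\<eta>: "\<theta> (\<eta> A) = A" if "A \<in> carrier ?M" for A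
    unfolding \<eta>_def using that \<theta>b by (auto simp: bij_betw_def inv_into_into f_inv_into_f)
  have \<eta>\<theta>: "\<eta> (\<theta> x) = x" if "x \<in> carrier P" for x
    unfolding \<eta>_def using that \<theta>b by (auto simp: bij_betw_def)
  note \<theta>s = ring_hom_memE[OF \<theta>h]
  have \<theta>eq: "x = y" if "x \<in> carrier P" "y \<in> carrier P" "\<theta> x = \<theta> y" for x y
    using that \<eta>\<theta> by metis
  \<comment> \<open>Ring axioms for \<open>matrix_ring k L\<close> have not been established, so the
    image of zero is found entrywise from \<open>0 = 0 + 0\<close>.\<close>
  have \<theta>0: "\<theta> \<zero>\<^bsub>P\<^esub> (i, j) = \<zero>\<^bsub>L\<^esub>" if "i < k" "j < k" for i j
  proof -
    have "\<theta> \<zero>\<^bsub>P\<^esub> = \<theta> \<zero>\<^bsub>P\<^esub> \<oplus>\<^bsub>?M\<^esub> \<theta> \<zero>\<^bsub>P\<^esub>" using \<theta>s(3)[of "\<zero>\<^bsub>P\<^esub>" "\<zero>\<^bsub>P\<^esub>"] by simp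
    then have "\<theta> \<zero>\<^bsub>P\<^esub> (i, j) = \<theta> \<zero>\<^bsub>P\<^esub> (i, j) \<oplus>\<^bsub>L\<^esub> \<theta> \<zero>\<^bsub>P\<^esub> (i, j)"
      using matrix_ring_add_apply[OF that] by metis
    moreover have "\<theta> \<zero>\<^bsub>P\<^esub> (i, j) \<in> carrier L" using \<theta>s(1)[of "\<zero>\<^bsub>P\<^esub>"] that by (intro L.matrix_entry_closed) auto
    ultimately show ?thesis by simp
  qed
  have \<eta>0: "\<eta> (single_entry k L i j \<zero>\<^bsub>L\<^esub>) = \<zero>\<^bsub>P\<^esub>" for i j
  proof (rule \<theta>eq)
    show "\<theta> (\<eta> (single_entry k L i j \<zero>\<^bsub>L\<^esub>)) = \<theta> \<zero>\<^bsub>P\<^esub>"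
      by (rule matrix_ring_eqI[of _ k L])
        (use \<theta>s(1) \<eta>c \<theta>\<eta> \<theta>0 L.single_entry_closed in \<open>auto simp: single_entry_apply\<close>)
  qed (auto intro: \<eta>c L.single_entry_closed)
  define E where "E i j l = \<eta> (single_entry k L i j l)" for i j l
  have Ec: "E i j l \<in> carrier P" if "l \<in> carrier L" for i j l
    unfolding E_def using that by (intro \<eta>c L.single_entry_closed)
  have \<theta>E: "\<theta> (E i j l) = single_entry k L i j l" if "l \<in> carrier L" for i j l
    unfolding E_def using that by (intro \<theta>\<eta> L.single_entry_closed)
  have Em: "E i j l \<otimes>\<^bsub>P\<^esub> E i' j' l' = (if j = i' then E i j' (l \<otimes>\<^bsub>L\<^esub> l') else \<zero>\<^bsub>P\<^esub>)"
    if "l \<in> carrier L" "l' \<in> carrier L" "i < k" "j < k" "i' < k" "j' < k" for i j l i' j' l'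
  proof -
    have "\<theta> (E i j l \<otimes>\<^bsub>P\<^esub> E i' j' l') = \<theta> (E i j' (if j = i' then l \<otimes>\<^bsub>L\<^esub> l' else \<zero>\<^bsub>L\<^esub>))"
      using that by (simp add: \<theta>s Ec \<theta>E L.single_entry_mult)
    then have "E i j l \<otimes>\<^bsub>P\<^esub> E i' j' l' = E i j' (if j = i' then l \<otimes>\<^bsub>L\<^esub> l' else \<zero>\<^bsub>L\<^esub>)"
      using that by (intro \<theta>eq) (auto intro: Ec)
    then show ?thesis using \<eta>0 by (simp add: E_def)
  qed
  let ?e = "E 0 0 \<one>\<^bsub>L\<^esub>" and ?a = "\<lambda>i. E 0 i \<one>\<^bsub>L\<^esub>" and ?b = "\<lambda>i. E i 0 \<one>\<^bsub>L\<^esub>"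
  have k0: "0 < k" using k by simp
  have sum: "\<theta> (\<Oplus>\<^bsub>P\<^esub>i\<in>{..<m}. ?b i \<otimes>\<^bsub>P\<^esub> ?a i) (i, j) = (if i = j \<and> i < m then \<one>\<^bsub>L\<^esub> else \<zero>\<^bsub>L\<^esub>)"
    if "m \<le> k" "i < k" "j < k" for m i j
    using that(1)
  proof (induct m)
    case 0
    then show ?case using \<theta>0 that by simp
  next
    case (Suc m)
    have ba: "?b l \<otimes>\<^bsub>P\<^esub> ?a l = E l l \<one>\<^bsub>L\<^esub>" if "l < k" for l using Em[of "\<one>\<^bsub>L\<^esub>" "\<one>\<^bsub>L\<^esub>" l 0 0 l] that k0 by simp
    have fs: "(\<Oplus>\<^bsub>P\<^esub>i\<in>{..<m}. ?b i \<otimes>\<^bsub>P\<^esub> ?a i) \<in> carrier P" by (intro P.finsum_closed) (auto intro: Ec)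
    have "(\<Oplus>\<^bsub>P\<^esub>i\<in>{..<Suc m}. ?b i \<otimes>\<^bsub>P\<^esub> ?a i) = E m m \<one>\<^bsub>L\<^esub> \<oplus>\<^bsub>P\<^esub> (\<Oplus>\<^bsub>P\<^esub>i\<in>{..<m}. ?b i \<otimes>\<^bsub>P\<^esub> ?a i)"
      unfolding lessThan_Suc using ba[of m] Suc.prems by (subst P.finsum_insert) (auto intro: Ec)
    then have "\<theta> (\<Oplus>\<^bsub>P\<^esub>i\<in>{..<Suc m}. ?b i \<otimes>\<^bsub>P\<^esub> ?a i) (i, j) =
        single_entry k L m m \<one>\<^bsub>L\<^esub> (i, j) \<oplus>\<^bsub>L\<^esub> (if i = j \<and> i < m then \<one>\<^bsub>L\<^esub> else \<zero>\<^bsub>L\<^esub>)"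
      using that Suc by (simp add: \<theta>s Ec \<theta>E fs matrix_ring_add_apply)
    then show ?case using that by (auto simp: single_entry_apply)
  qed
  have one: "(\<Oplus>\<^bsub>P\<^esub>i\<in>{..<k}. ?b i \<otimes>\<^bsub>P\<^esub> ?a i) = \<one>\<^bsub>P\<^esub>"
  proof (rule \<theta>eq)
    show fs: "(\<Oplus>\<^bsub>P\<^esub>i\<in>{..<k}. ?b i \<otimes>\<^bsub>P\<^esub> ?a i) \<in> carrier P" by (intro P.finsum_closed) (auto intro: Ec)
    show "\<theta> (\<Oplus>\<^bsub>P\<^esub>i\<in>{..<k}. ?b i \<otimes>\<^bsub>P\<^esub> ?a i) = \<theta> \<one>\<^bsub>P\<^esub>"
    proof (rule matrix_ring_eqI)
      show "\<theta> (\<Oplus>\<^bsub>P\<^esub>i\<in>{..<k}. ?b i \<otimes>\<^bsub>P\<^esub> ?a i) \<in> carrier ?M" by (rule \<theta>s(1)[OF fs])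
      show "\<theta> \<one>\<^bsub>P\<^esub> \<in> carrier ?M" by (rule \<theta>s(1)) simp
      fix i j assume "i < k" "j < k"
      then show "\<theta> (\<Oplus>\<^bsub>P\<^esub>i\<in>{..<k}. ?b i \<otimes>\<^bsub>P\<^esub> ?a i) (i, j) = \<theta> \<one>\<^bsub>P\<^esub> (i, j)"
        using sum[of k i j] by (simp add: \<theta>s(4) matrix_ring_one_apply)
    qed
  qed simp
  have mu: "matrix_units P ?e k ?a ?b"
    by (intro matrix_units.intro matrix_units_axioms.intro P.ring_axioms)
      (use k0 Em Ec one in auto)
  have ec: "?e \<in> carrier P" "?e \<otimes>\<^bsub>P\<^esub> ?e = ?e" using Ec Em k0 by auto
  have A: "ring (corner P ?e)" by (rule ring_corner[OF P ec])
  have "\<one>\<^bsub>corner P ?e\<^esub> \<noteq> \<zero>\<^bsub>corner P ?e\<^esub>"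
  proof
    assume "\<one>\<^bsub>corner P ?e\<^esub> = \<zero>\<^bsub>corner P ?e\<^esub>"
    then have "\<theta> ?e (0, 0) = \<theta> \<zero>\<^bsub>P\<^esub> (0, 0)" by simp
    then show False using \<theta>E[of "\<one>\<^bsub>L\<^esub>" 0 0] \<theta>0 k0 L.one_not_zero by (simp add: single_entry_apply)
  qed
  moreover have "(\<lambda>l. E 0 0 l) \<in> ring_hom L (corner P ?e)"
  proof (rule ring_hom_memI)
    fix l l' assume l: "l \<in> carrier L" "l' \<in> carrier L"
    show "E 0 0 (l \<otimes>\<^bsub>L\<^esub> l') = E 0 0 l \<otimes>\<^bsub>corner P ?e\<^esub> E 0 0 l'" using l k0 Em by simp
    show "E 0 0 (l \<oplus>\<^bsub>L\<^esub> l') = E 0 0 l \<oplus>\<^bsub>corner P ?e\<^esub> E 0 0 l'"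
    proof (rule \<theta>eq)
      have add: "\<theta> (E 0 0 l \<oplus>\<^bsub>corner P ?e\<^esub> E 0 0 l') = \<theta> (E 0 0 l) \<oplus>\<^bsub>?M\<^esub> \<theta> (E 0 0 l')"
        using l by (simp add: \<theta>s Ec)
      show "\<theta> (E 0 0 (l \<oplus>\<^bsub>L\<^esub> l')) = \<theta> (E 0 0 l \<oplus>\<^bsub>corner P ?e\<^esub> E 0 0 l')"
      proof (rule matrix_ring_eqI)
        show "\<theta> (E 0 0 (l \<oplus>\<^bsub>L\<^esub> l')) \<in> carrier ?M" using l by (intro \<theta>s(1) Ec) simp
        show "\<theta> (E 0 0 l \<oplus>\<^bsub>corner P ?e\<^esub> E 0 0 l') \<in> carrier ?M" using l Ec by (intro \<theta>s(1)) simp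
        fix i j assume "i < k" "j < k"
        then show "\<theta> (E 0 0 (l \<oplus>\<^bsub>L\<^esub> l')) (i, j) = \<theta> (E 0 0 l \<oplus>\<^bsub>corner P ?e\<^esub> E 0 0 l') (i, j)"
          unfolding add using l by (simp add: \<theta>E matrix_ring_add_apply single_entry_apply)
      qed
    qed (use l Ec in auto)
  qed (use k0 Em Ec in auto)
  moreover have "carrier (corner P ?e) \<subseteq> (\<lambda>l. E 0 0 l) ` carrier L"
  proof
    fix x assume x: "x \<in> carrier (corner P ?e)"
    then have xc: "x \<in> carrier P" "\<theta> x \<in> carrier ?M" using \<theta>s(1) by auto
    have lc: "\<theta> x (0, 0) \<in> carrier L" using xc(2) k0 by (intro L.matrix_entry_closed)
    have x': "?e \<otimes>\<^bsub>P\<^esub> (x \<otimes>\<^bsub>P\<^esub> ?e) = x" using x by simp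
    have "\<theta> (?e \<otimes>\<^bsub>P\<^esub> (x \<otimes>\<^bsub>P\<^esub> ?e)) = single_entry k L 0 0 \<one>\<^bsub>L\<^esub> \<otimes>\<^bsub>?M\<^esub> (\<theta> x \<otimes>\<^bsub>?M\<^esub> single_entry k L 0 0 \<one>\<^bsub>L\<^esub>)"
      using xc ec by (simp add: \<theta>s \<theta>E Ec)
    then have \<theta>x: "\<theta> x = single_entry k L 0 0 \<one>\<^bsub>L\<^esub> \<otimes>\<^bsub>?M\<^esub> (\<theta> x \<otimes>\<^bsub>?M\<^esub> single_entry k L 0 0 \<one>\<^bsub>L\<^esub>)" unfolding x' .
    have "\<theta> x = single_entry k L 0 0 (\<theta> x (0, 0))"
    proof (rule matrix_ring_eqI[OF xc(2)])
      show "single_entry k L 0 0 (\<theta> x (0, 0)) \<in> carrier ?M" by (rule L.single_entry_closed[OF lc])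
      fix i j assume ij: "i < k" "j < k"
      have "(single_entry k L 0 0 \<one>\<^bsub>L\<^esub> \<otimes>\<^bsub>?M\<^esub> (\<theta> x \<otimes>\<^bsub>?M\<^esub> single_entry k L 0 0 \<one>\<^bsub>L\<^esub>)) (i, j)
          = single_entry k L 0 0 (\<theta> x (0, 0)) (i, j)"
        using ij k0 xc(2) lc
        by (simp add: L.single_entry_mult_apply L.mult_single_entry_apply L.matrix_ring_mult_closed
            L.single_entry_closed single_entry_apply)
      then show "\<theta> x (i, j) = single_entry k L 0 0 (\<theta> x (0, 0)) (i, j)" using \<theta>x by metis
    qed
    then have "x = E 0 0 (\<theta> x (0, 0))" using \<theta>eq[OF xc(1) Ec[OF lc]] \<theta>E[OF lc] by simp
    then show "x \<in> (\<lambda>l. E 0 0 l) ` carrier L" using lc by blast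
  qed
  ultimately have "uniformizer (corner P ?e) (E 0 0 c)"
    by (intro uniformizer_ring_hom[OF L A])
  then show ?thesis using mu by blast
qed

section \<open>Trivial extensions of matrix rings\<close>

text \<open>The two products provide a left and a right inverse of \<open>x\<close>, and these
  coincide.\<close>

lemma (in monoid) Units_of_products:
  assumes "x \<in> carrier G" "y \<in> carrier G" "x \<otimes> y \<in> Units G" "y \<otimes> x \<in> Units G"
  shows "x \<in> Units G"
proof -
  define l r where "l = inv (y \<otimes> x) \<otimes> y" and "r = y \<otimes> inv (x \<otimes> y)"
  have c: "l \<in> carrier G" "r \<in> carrier G" using assms by (auto simp: l_def r_def)
  have l: "l \<otimes> x = \<one>" unfolding l_def using assms by (simp add: m_assoc)
  have r: "x \<otimes> r = \<one>" unfolding r_def using assms by (simp add: m_assoc[symmetric])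
  have "l = l \<otimes> (x \<otimes> r)" unfolding r using c by simp
  also have "\<dots> = (l \<otimes> x) \<otimes> r" using c assms by (simp add: m_assoc)
  also have "\<dots> = r" unfolding l using c by simp
  finally show ?thesis using l r c assms(1) by (auto simp: Units_def)
qed

context bimodule
begin

lemma finsum_trivial_extension:
  assumes "finite A" "f \<in> A \<rightarrow> carrier R"
  shows "(\<Oplus>\<^bsub>R \<propto> M\<^esub>i\<in>A. (f i, \<zero>\<^bsub>M\<^esub>)) = (\<Oplus>\<^bsub>R\<^esub>i\<in>A. f i, \<zero>\<^bsub>M\<^esub>)"
proof -
  interpret S: ring "R \<propto> M" by (rule ring_trivial_extension)
  show ?thesis using assms
  proof (induct A rule: finite_induct)
    case (insert x F)
    then have "f \<in> F \<rightarrow> carrier R" "f x \<in> carrier R" "(\<lambda>i. (f i, \<zero>\<^bsub>M\<^esub>)) \<in> F \<rightarrow> carrier (R \<propto> M)"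
      by auto
    with insert show ?case by (simp add: R.finsum_insert S.finsum_insert)
  qed simp
qed

lemma matrix_units_trivial_extension:
  assumes "matrix_units R e k a b"
  shows "matrix_units (R \<propto> M) (e, \<zero>\<^bsub>M\<^esub>) k (\<lambda>i. (a i, \<zero>\<^bsub>M\<^esub>)) (\<lambda>i. (b i, \<zero>\<^bsub>M\<^esub>))"
proof -
  interpret m: matrix_units R e k a b by fact
  interpret S: ring "R \<propto> M" by (rule ring_trivial_extension)
  have "(\<Oplus>\<^bsub>R \<propto> M\<^esub>i\<in>{..<k}. (b i \<otimes>\<^bsub>R\<^esub> a i, \<zero>\<^bsub>M\<^esub>)) = (\<one>\<^bsub>R\<^esub>, \<zero>\<^bsub>M\<^esub>)"
    using finsum_trivial_extension[of "{..<k}" "\<lambda>i. b i \<otimes>\<^bsub>R\<^esub> a i"] m.sum_ba by auto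
  moreover have "(\<Oplus>\<^bsub>R \<propto> M\<^esub>i\<in>{..<k}. (b i, \<zero>\<^bsub>M\<^esub>) \<otimes>\<^bsub>R \<propto> M\<^esub> (a i, \<zero>\<^bsub>M\<^esub>))
      = (\<Oplus>\<^bsub>R \<propto> M\<^esub>i\<in>{..<k}. (b i \<otimes>\<^bsub>R\<^esub> a i, \<zero>\<^bsub>M\<^esub>))"
    by (rule S.finsum_cong') auto
  ultimately show ?thesis
    by (intro matrix_units.intro matrix_units_axioms.intro S.ring_axioms)
      (auto simp: m.e_a m.b_e m.a_b)
qed

lemma corner_trivial_extension_mem:
  assumes "e \<in> carrier R"
  shows "(x, m) \<in> carrier (corner (R \<propto> M) (e, \<zero>\<^bsub>M\<^esub>)) \<longleftrightarrow>
    x \<in> carrier (corner R e) \<and> m \<in> carrier M \<and> e \<odot>\<^bsub>M\<^esub> m = m \<and> rsmult M m e = m"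
  using assms by (auto simp: lsmult_closed rsmult_closed)

lemma ring_corner_trivial_extension:
  assumes "e \<in> carrier R" "e \<otimes>\<^bsub>R\<^esub> e = e"
  shows "ring (corner (R \<propto> M) (e, \<zero>\<^bsub>M\<^esub>))"
  using ring_corner[OF ring_trivial_extension, of "(e, \<zero>\<^bsub>M\<^esub>)"] assms by simp

lemma uniformizer_trivial_extension_zero:
  assumes e: "e \<in> carrier R" "e \<otimes>\<^bsub>R\<^esub> e = e" and M0: "carrier M = {\<zero>\<^bsub>M\<^esub>}"
    and u: "uniformizer (corner R e) c"
  shows "uniformizer (corner (R \<propto> M) (e, \<zero>\<^bsub>M\<^esub>)) (c, \<zero>\<^bsub>M\<^esub>)"
proof -
  have "(\<lambda>x. (x, \<zero>\<^bsub>M\<^esub>)) \<in> ring_hom (corner R e) (corner (R \<propto> M) (e, \<zero>\<^bsub>M\<^esub>))"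
    by (rule ring_hom_memI) (use e in auto)
  moreover have "carrier (corner (R \<propto> M) (e, \<zero>\<^bsub>M\<^esub>)) \<subseteq> (\<lambda>x. (x, \<zero>\<^bsub>M\<^esub>)) ` carrier (corner R e)"
  proof
    fix z assume z: "z \<in> carrier (corner (R \<propto> M) (e, \<zero>\<^bsub>M\<^esub>))"
    obtain x m where xm: "z = (x, m)" by (cases z)
    then have "x \<in> carrier (corner R e)" "m = \<zero>\<^bsub>M\<^esub>"
      using z corner_trivial_extension_mem[OF e(1), of x m] M0 by auto
    then show "z \<in> (\<lambda>x. (x, \<zero>\<^bsub>M\<^esub>)) ` carrier (corner R e)" using xm by blast
  qed
  moreover have "\<one>\<^bsub>corner (R \<propto> M) (e, \<zero>\<^bsub>M\<^esub>)\<^esub> \<noteq> \<zero>\<^bsub>corner (R \<propto> M) (e, \<zero>\<^bsub>M\<^esub>)\<^esub>"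
    using u by (auto simp: uniformizer_def)
  ultimately show ?thesis
    using uniformizer_ring_hom[OF u ring_corner_trivial_extension[OF e]] by blast
qed

text \<open>An element \<open>(x, m)\<close> with \<open>x \<noteq> 0\<close> is a unit, because
  \<open>x\<close> can be normalised to \<open>e\<close> and \<open>(e, w)\<close> has the inverse
  \<open>(e, -w)\<close>. An element \<open>(0, m)\<close> has the forms \<open>(t, 0)(0, n)\<close>
  and \<open>(0, n)(t', 0)\<close>, and the square of \<open>(0, n)\<close> is zero. The degenerate
  case \<open>n = 0\<close>, \<open>eMe = 0\<close> is included.\<close>

lemma uniformizer_trivial_extension_division:
  assumes e: "e \<in> carrier R" "e \<otimes>\<^bsub>R\<^esub> e = e" "e \<noteq> \<zero>\<^bsub>R\<^esub>"
    and div: "\<And>x. x \<in> carrier (corner R e) \<Longrightarrow> x \<noteq> \<zero>\<^bsub>R\<^esub> \<Longrightarrow> x \<in> Units (corner R e)"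
    and n: "n \<in> carrier M" "e \<odot>\<^bsub>M\<^esub> n = n" "rsmult M n e = n"
    and gen: "\<And>m. \<lbrakk>m \<in> carrier M; e \<odot>\<^bsub>M\<^esub> m = m; rsmult M m e = m\<rbrakk> \<Longrightarrow>
      (\<exists>t\<in>carrier (corner R e). m = t \<odot>\<^bsub>M\<^esub> n) \<and> (\<exists>t\<in>carrier (corner R e). m = rsmult M n t)"
  shows "uniformizer (corner (R \<propto> M) (e, \<zero>\<^bsub>M\<^esub>)) (\<zero>\<^bsub>R\<^esub>, n)"
proof -
  let ?T = "corner (R \<propto> M) (e, \<zero>\<^bsub>M\<^esub>)" and ?c = "(\<zero>\<^bsub>R\<^esub>, n)"
  interpret T: ring ?T by (rule ring_corner_trivial_extension[OF e(1,2)])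
  note mem = corner_trivial_extension_mem[OF e(1)]
  have c: "?c \<in> carrier ?T" unfolding mem using e n by auto
  have uni: "(e, w) \<in> Units ?T" if w: "w \<in> carrier M" "e \<odot>\<^bsub>M\<^esub> w = w" "rsmult M w e = w" for w
  proof -
    have "e \<odot>\<^bsub>M\<^esub> (\<ominus>\<^bsub>M\<^esub> w) \<oplus>\<^bsub>M\<^esub> e \<odot>\<^bsub>M\<^esub> w = e \<odot>\<^bsub>M\<^esub> (\<ominus>\<^bsub>M\<^esub> w \<oplus>\<^bsub>M\<^esub> w)"
      using lsmult_r_distr e w by simp
    then have "e \<odot>\<^bsub>M\<^esub> (\<ominus>\<^bsub>M\<^esub> w) \<oplus>\<^bsub>M\<^esub> w = \<zero>\<^bsub>M\<^esub>" using e w by (simp add: M.l_neg)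
    then have 1: "e \<odot>\<^bsub>M\<^esub> (\<ominus>\<^bsub>M\<^esub> w) = \<ominus>\<^bsub>M\<^esub> w"
      using w e lsmult_closed by (metis M.a_inv_closed M.minus_equality)
    have "rsmult M (\<ominus>\<^bsub>M\<^esub> w) e \<oplus>\<^bsub>M\<^esub> rsmult M w e = rsmult M (\<ominus>\<^bsub>M\<^esub> w \<oplus>\<^bsub>M\<^esub> w) e"
      using rsmult_l_distr e w by simp
    then have "rsmult M (\<ominus>\<^bsub>M\<^esub> w) e \<oplus>\<^bsub>M\<^esub> w = \<zero>\<^bsub>M\<^esub>" using e w by (simp add: M.l_neg)
    then have 2: "rsmult M (\<ominus>\<^bsub>M\<^esub> w) e = \<ominus>\<^bsub>M\<^esub> w"
      using w e rsmult_closed by (metis M.a_inv_closed M.minus_equality)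
    have "(e, w) \<in> carrier ?T" "(e, \<ominus>\<^bsub>M\<^esub> w) \<in> carrier ?T" unfolding mem using e w 1 2 by auto
    moreover have "(e, w) \<otimes>\<^bsub>?T\<^esub> (e, \<ominus>\<^bsub>M\<^esub> w) = \<one>\<^bsub>?T\<^esub>" "(e, \<ominus>\<^bsub>M\<^esub> w) \<otimes>\<^bsub>?T\<^esub> (e, w) = \<one>\<^bsub>?T\<^esub>"
      using e w 1 2 by (simp_all add: M.l_neg M.r_neg)
    ultimately show ?thesis unfolding Units_def by blast
  qed
  have unit: "(x, m) \<in> Units ?T" if xm: "(x, m) \<in> carrier ?T" "x \<noteq> \<zero>\<^bsub>R\<^esub>" for x m
  proof -
    have x: "x \<in> carrier (corner R e)" and m: "m \<in> carrier M" "e \<odot>\<^bsub>M\<^esub> m = m" "rsmult M m e = m"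
      using xm mem by auto
    obtain y where y: "y \<in> carrier (corner R e)" "y \<otimes>\<^bsub>R\<^esub> x = e" "x \<otimes>\<^bsub>R\<^esub> y = e"
      using div[OF x xm(2)] by (auto simp: Units_def)
    have yc: "y \<in> carrier R" "e \<otimes>\<^bsub>R\<^esub> y = y" "y \<otimes>\<^bsub>R\<^esub> e = y" using y(1) by auto
    have yT: "(y, \<zero>\<^bsub>M\<^esub>) \<in> carrier ?T" unfolding mem using y(1) e by simp
    have xc: "x \<in> carrier R" using x by simp
    show ?thesis
    proof (rule T.Units_of_products[OF xm(1) yT])
      have "(x, m) \<otimes>\<^bsub>?T\<^esub> (y, \<zero>\<^bsub>M\<^esub>) = (e, rsmult M m y)"
        using y xc yc m by (simp add: rsmult_closed)
      moreover have "(e, rsmult M m y) \<in> Units ?T"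
        using e yc m smult_rsmult_assoc[of e y m] rsmult_assoc[of y e m] by (intro uni) (auto simp: rsmult_closed)
      ultimately show "(x, m) \<otimes>\<^bsub>?T\<^esub> (y, \<zero>\<^bsub>M\<^esub>) \<in> Units ?T" by simp
      have "(y, \<zero>\<^bsub>M\<^esub>) \<otimes>\<^bsub>?T\<^esub> (x, m) = (e, y \<odot>\<^bsub>M\<^esub> m)"
        using y xc yc m by (simp add: lsmult_closed)
      moreover have "(e, y \<odot>\<^bsub>M\<^esub> m) \<in> Units ?T"
        using e yc m smult_rsmult_assoc[of y e m] lsmult_assoc[of e y m] by (intro uni) (auto simp: lsmult_closed)
      ultimately show "(y, \<zero>\<^bsub>M\<^esub>) \<otimes>\<^bsub>?T\<^esub> (x, m) \<in> Units ?T" by simp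
    qed
  qed
  have c1: "?c [^]\<^bsub>?T\<^esub> (1::nat) = ?c" 
    unfolding One_nat_def T.nat_pow_Suc T.nat_pow_0 by (rule T.l_one[OF c])
  have c0: "?c [^]\<^bsub>?T\<^esub> (0::nat) = \<one>\<^bsub>?T\<^esub>" by simp
  have "?c [^]\<^bsub>?T\<^esub> (2::nat) = ?c \<otimes>\<^bsub>?T\<^esub> ?c" using T.nat_pow_mult[OF c, of 1 1] c1 by (simp add: numeral_2_eq_2)
  then have c2: "?c [^]\<^bsub>?T\<^esub> (2::nat) = \<zero>\<^bsub>?T\<^esub>" using n(1) by simp
  have form: "(\<exists>s::nat. \<exists>u\<in>Units ?T. z = u \<otimes>\<^bsub>?T\<^esub> ?c [^]\<^bsub>?T\<^esub> s) \<and> (\<exists>s::nat. \<exists>u\<in>Units ?T. z = ?c [^]\<^bsub>?T\<^esub> s \<otimes>\<^bsub>?T\<^esub> u)"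
    if zT: "z \<in> carrier ?T" for z
  proof -
    obtain x m where z: "z = (x, m)" by (cases z)
    have m: "m \<in> carrier M" "e \<odot>\<^bsub>M\<^esub> m = m" "rsmult M m e = m" using zT z mem by auto
    consider "x \<noteq> \<zero>\<^bsub>R\<^esub>" | "x = \<zero>\<^bsub>R\<^esub>" "m = \<zero>\<^bsub>M\<^esub>" | "x = \<zero>\<^bsub>R\<^esub>" "m \<noteq> \<zero>\<^bsub>M\<^esub>" by blast
    then show ?thesis
    proof cases
      case 1
      then have "z \<in> Units ?T" using unit zT z by simp
      moreover have "z = z \<otimes>\<^bsub>?T\<^esub> ?c [^]\<^bsub>?T\<^esub> (0::nat)" "z = ?c [^]\<^bsub>?T\<^esub> (0::nat) \<otimes>\<^bsub>?T\<^esub> z"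
        unfolding c0 using zT T.r_one[OF zT] T.l_one[OF zT] by metis+
      ultimately show ?thesis by blast
    next
      case 2
      then have "z = \<zero>\<^bsub>?T\<^esub>" using z by simp
      then have "z = \<one>\<^bsub>?T\<^esub> \<otimes>\<^bsub>?T\<^esub> ?c [^]\<^bsub>?T\<^esub> (2::nat)" "z = ?c [^]\<^bsub>?T\<^esub> (2::nat) \<otimes>\<^bsub>?T\<^esub> \<one>\<^bsub>?T\<^esub>"
        unfolding c2 using T.r_null[OF T.one_closed] T.l_null[OF T.one_closed] by metis+
      then show ?thesis using T.Units_one_closed by blast
    next
      case 3
      obtain t where t: "t \<in> carrier (corner R e)" "m = t \<odot>\<^bsub>M\<^esub> n" using gen[OF m] by blast
      obtain t' where t': "t' \<in> carrier (corner R e)" "m = rsmult M n t'" using gen[OF m] by blast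
      have "t \<noteq> \<zero>\<^bsub>R\<^esub>" "t' \<noteq> \<zero>\<^bsub>R\<^esub>" using 3 t(2) t'(2) n(1) by auto
      then have "(t, \<zero>\<^bsub>M\<^esub>) \<in> Units ?T" "(t', \<zero>\<^bsub>M\<^esub>) \<in> Units ?T"
        using t(1) t'(1) e by (auto intro!: unit simp: mem simp del: corner_simps)
      moreover have "z = (t, \<zero>\<^bsub>M\<^esub>) \<otimes>\<^bsub>?T\<^esub> ?c [^]\<^bsub>?T\<^esub> (1::nat)"
        unfolding c1 z using 3 t n by (simp add: lsmult_closed)
      moreover have "z = ?c [^]\<^bsub>?T\<^esub> (1::nat) \<otimes>\<^bsub>?T\<^esub> (t', \<zero>\<^bsub>M\<^esub>)"
        unfolding c1 z using 3 t' n by (simp add: rsmult_closed)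
      ultimately show ?thesis by blast
    qed
  qed
  show ?thesis unfolding uniformizer_def
    using T.ring_axioms e(3) c c2 form by auto
qed

end

context matrix_units
begin

lemma entry_expand:
  assumes "x \<in> carrier R"
  shows "x = (\<Oplus>i\<in>{..<k}. b i \<otimes> (a i \<otimes> x))" and "x = (\<Oplus>i\<in>{..<k}. x \<otimes> b i \<otimes> a i)"
proof -
  have "x = (\<Oplus>i\<in>{..<k}. b i \<otimes> a i) \<otimes> x" using assms sum_ba by simp
  also have "\<dots> = (\<Oplus>i\<in>{..<k}. (b i \<otimes> a i) \<otimes> x)" using assms by (intro finsum_ldistr) auto
  also have "\<dots> = (\<Oplus>i\<in>{..<k}. b i \<otimes> (a i \<otimes> x))"
    by (rule finsum_cong') (use assms in \<open>auto simp: m_assoc\<close>)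
  finally show "x = (\<Oplus>i\<in>{..<k}. b i \<otimes> (a i \<otimes> x))" .
  have "x = x \<otimes> (\<Oplus>i\<in>{..<k}. b i \<otimes> a i)" using assms sum_ba by simp
  also have "\<dots> = (\<Oplus>i\<in>{..<k}. x \<otimes> (b i \<otimes> a i))" using assms by (intro finsum_rdistr) auto
  also have "\<dots> = (\<Oplus>i\<in>{..<k}. x \<otimes> b i \<otimes> a i)"
    by (rule finsum_cong') (use assms in \<open>auto simp: m_assoc\<close>)
  finally show "x = (\<Oplus>i\<in>{..<k}. x \<otimes> b i \<otimes> a i)" .
qed

lemma nonzero_row:
  assumes "x \<in> carrier R" "x \<noteq> \<zero>"
  shows "\<exists>i<k. a i \<otimes> x \<noteq> \<zero>"
proof (rule ccontr)
  assume "\<not> ?thesis"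
  then have "(\<Oplus>i\<in>{..<k}. b i \<otimes> (a i \<otimes> x)) = (\<Oplus>i\<in>{..<k}. \<zero>)"
    by (intro finsum_cong') auto
  then show False using entry_expand(1)[OF assms(1)] assms(2) by simp
qed

lemma nonzero_column:
  assumes "x \<in> carrier R" "x \<noteq> \<zero>"
  shows "\<exists>i<k. x \<otimes> b i \<noteq> \<zero>"
proof (rule ccontr)
  assume "\<not> ?thesis"
  then have "(\<Oplus>i\<in>{..<k}. x \<otimes> b i \<otimes> a i) = (\<Oplus>i\<in>{..<k}. \<zero>)"
    by (intro finsum_cong') auto
  then show False using entry_expand(2)[OF assms(1)] assms(2) by simp
qed

text \<open>The elements whose entries are all nonunits of the corner form an ideal
  \<open>I\<close>. It does not contain \<open>1\<close>, so by simplicity it is zero; but every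
  nonunit of the corner belongs to it.\<close>

lemma simple_imp_division:
  assumes simple: "simple_ring R" and u: "uniformizer (corner R e) c"
    and x: "x \<in> carrier (corner R e)" "x \<noteq> \<zero>"
  shows "x \<in> Units (corner R e)"
proof (rule ccontr)
  assume xu: "x \<notin> Units (corner R e)"
  let ?T = "corner R e"
  interpret T: ring ?T by (rule ring_corner[OF ring_axioms]) simp_all
  let ?J = "carrier ?T - Units ?T"
  note J = T.local_ring_Units[OF uniformizer_imp(3)[OF u]]
  have e0: "e \<noteq> \<zero>" using u by (auto simp: uniformizer_def)
  have k0: "0 < k"
  proof (rule ccontr)
    assume "\<not> 0 < k"
    then have "\<one> = \<zero>" using sum_ba by simp
    then show False using e0 one_zeroD e_closed by auto
  qed
  have J0: "\<zero> \<in> ?J" using left_idealD(3)[OF J(1)] by simp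
  have Ja: "y \<oplus> z \<in> ?J" if "y \<in> ?J" "z \<in> ?J" for y z using left_idealD(4)[OF J(1) that] by simp
  have Jl: "r \<otimes> y \<in> ?J" if "r \<in> carrier ?T" "y \<in> ?J" for r y using left_idealD(7)[OF J(1) that] by simp
  have Jr: "y \<otimes> r \<in> ?J" if "r \<in> carrier ?T" "y \<in> ?J" for r y
    using left_idealD(7)[OF J(2), of r y] that by simp
  have Js: "finsum R f A \<in> ?J" if "finite A" "\<And>i. i \<in> A \<Longrightarrow> f i \<in> ?J" for f and A :: "nat set"
    using that
  proof (induct A rule: finite_induct)
    case (insert i F)
    then have "f \<in> F \<rightarrow> carrier R" "f i \<in> carrier R" by auto
    then show ?case using insert Ja by (simp add: finsum_insert)
  qed (use J0 in simp)
  define I where "I = {y \<in> carrier R. \<forall>i<k. \<forall>j<k. a i \<otimes> y \<otimes> b j \<in> ?J}"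
  have I1: "r \<otimes> y \<in> I" if y: "y \<in> I" and r: "r \<in> carrier R" for y r
  proof -
    have yc: "y \<in> carrier R" using y by (simp add: I_def)
    have "a i \<otimes> (r \<otimes> y) \<otimes> b j \<in> ?J" if ij: "i < k" "j < k" for i j
    proof -
      have "a i \<otimes> (r \<otimes> y) \<otimes> b j = (a i \<otimes> r) \<otimes> (y \<otimes> b j)" using ij r yc by (simp add: m_assoc)
      also have "\<dots> = (\<Oplus>l\<in>{..<k}. (a i \<otimes> r) \<otimes> b l \<otimes> a l) \<otimes> (y \<otimes> b j)"
        using entry_expand(2)[of "a i \<otimes> r"] ij r by simp
      also have "\<dots> = (\<Oplus>l\<in>{..<k}. ((a i \<otimes> r) \<otimes> b l \<otimes> a l) \<otimes> (y \<otimes> b j))"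
        using ij r yc by (intro finsum_ldistr) auto
      also have "\<dots> = (\<Oplus>l\<in>{..<k}. (a i \<otimes> r \<otimes> b l) \<otimes> (a l \<otimes> y \<otimes> b j))"
        by (rule finsum_cong') (use ij r yc in \<open>auto simp: m_assoc\<close>)
      also have "\<dots> \<in> ?J"
      proof (rule Js)
        fix l assume "l \<in> {..<k}"
        then have l: "l < k" by simp
        then have "a l \<otimes> y \<otimes> b j \<in> ?J" using y ij unfolding I_def by blast
        then show "(a i \<otimes> r \<otimes> b l) \<otimes> (a l \<otimes> y \<otimes> b j) \<in> ?J"
          by (rule Jl[OF entry_closed[OF ij(1) l r]])
      qed simp
      finally show ?thesis .
    qed
    then show ?thesis using yc r by (simp add: I_def)
  qed
  have I2: "y \<otimes> r \<in> I" if y: "y \<in> I" and r: "r \<in> carrier R" for y r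
  proof -
    have yc: "y \<in> carrier R" using y by (simp add: I_def)
    have "a i \<otimes> (y \<otimes> r) \<otimes> b j \<in> ?J" if ij: "i < k" "j < k" for i j
    proof -
      have "a i \<otimes> (y \<otimes> r) \<otimes> b j = (a i \<otimes> y) \<otimes> (r \<otimes> b j)" using ij r yc by (simp add: m_assoc)
      also have "\<dots> = (\<Oplus>l\<in>{..<k}. (a i \<otimes> y) \<otimes> b l \<otimes> a l) \<otimes> (r \<otimes> b j)"
        using entry_expand(2)[of "a i \<otimes> y"] ij yc by simp
      also have "\<dots> = (\<Oplus>l\<in>{..<k}. ((a i \<otimes> y) \<otimes> b l \<otimes> a l) \<otimes> (r \<otimes> b j))"
        using ij r yc by (intro finsum_ldistr) auto
      also have "\<dots> = (\<Oplus>l\<in>{..<k}. (a i \<otimes> y \<otimes> b l) \<otimes> (a l \<otimes> r \<otimes> b j))"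
        by (rule finsum_cong') (use ij r yc in \<open>auto simp: m_assoc\<close>)
      also have "\<dots> \<in> ?J"
      proof (rule Js)
        fix l assume "l \<in> {..<k}"
        then have l: "l < k" by simp
        then have "a i \<otimes> y \<otimes> b l \<in> ?J" using y ij unfolding I_def by blast
        then show "(a i \<otimes> y \<otimes> b l) \<otimes> (a l \<otimes> r \<otimes> b j) \<in> ?J"
          by (rule Jr[OF entry_closed[OF l ij(2) r]])
      qed simp
      finally show ?thesis .
    qed
    then show ?thesis using yc r by (simp add: I_def)
  qed
  have Il: "left_ideal I R"
  proof (rule left_idealI)
    show "I \<subseteq> carrier R" by (auto simp: I_def)
    show "\<zero> \<in> I" using J0 by (simp add: I_def)
    show "r \<otimes> y \<in> I" if "r \<in> carrier R" "y \<in> I" for r y using I1 that by blast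
    show "y \<oplus> z \<in> I" if "y \<in> I" "z \<in> I" for y z
    proof -
      have c: "y \<in> carrier R" "z \<in> carrier R" using that by (auto simp: I_def)
      have "a i \<otimes> (y \<oplus> z) \<otimes> b j \<in> ?J" if ij: "i < k" "j < k" for i j
      proof -
        have "a i \<otimes> (y \<oplus> z) \<otimes> b j = a i \<otimes> y \<otimes> b j \<oplus> a i \<otimes> z \<otimes> b j"
          using ij c by (simp add: l_distr r_distr)
        also have "\<dots> \<in> ?J" using \<open>y \<in> I\<close> \<open>z \<in> I\<close> ij by (intro Ja) (auto simp: I_def)
        finally show ?thesis .
      qed
      then show ?thesis using c by (simp add: I_def)
    qed
  qed
  have "ideal I R"
    by (rule idealI[OF ring_axioms])
      (use Il I1 I2 in \<open>auto simp: left_ideal_def additive_subgroup_def\<close>)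
  moreover have "\<one> \<notin> I"
  proof
    assume "\<one> \<in> I"
    then have "a 0 \<otimes> \<one> \<otimes> b 0 \<in> ?J" using k0 unfolding I_def by blast
    then have "e \<in> ?J" using k0 by (simp add: a_b)
    then show False using T.Units_one_closed by simp
  qed
  ultimately have I0: "I = {\<zero>}" using simple unfolding simple_ring_def by blast
  have "a i \<otimes> x \<otimes> b j \<in> ?J" if ij: "i < k" "j < k" for i j
  proof -
    have xc: "x \<in> carrier R" "e \<otimes> x = x" "x \<otimes> e = x" using x by auto
    have 1: "a i \<otimes> e \<in> carrier ?T" "e \<otimes> b j \<in> carrier ?T"
      using ij e_a b_e by (auto simp: m_assoc[symmetric]) (auto simp: m_assoc)
    have "a i \<otimes> x \<otimes> b j = a i \<otimes> (e \<otimes> x \<otimes> e) \<otimes> b j" using xc by simp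
    also have "\<dots> = (a i \<otimes> e) \<otimes> (x \<otimes> (e \<otimes> b j))" using ij xc(1) by (simp add: m_assoc)
    also have "\<dots> \<in> ?J" using 1 x xu by (intro Jl Jr) auto
    finally show ?thesis .
  qed
  then have "x \<in> I" using x by (simp add: I_def)
  then show False using I0 x by simp
qed

end

text \<open>Under \<open>f\<close> the corner \<open>eNe\<close> becomes
  \<open>eP\<sigma>(e)\<close>. For a nonzero \<open>y\<close> there, inverting a nonzero entry in
  the division ring \<open>ePe\<close> yields \<open>r\<close> with \<open>ry = \<sigma>(e)\<close>
  and \<open>r'\<close> with \<open>yr' = e\<close>. Then \<open>z = (zr)y\<close> and
  \<open>z = y(r'z)\<close> show that \<open>y\<close> generates from either side.\<close>

lemma uniformizer_twisted:
  assumes bim: "bimodule P N" and mu: "matrix_units P e k a b" and simple: "simple_ring P"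
    and u: "uniformizer (corner P e) c"
    and \<sigma>: "\<sigma> \<in> ring_iso P P" and iso: "bimodule_iso P N (twisted_bimodule P \<sigma>)"
  shows "\<exists>c. uniformizer (corner (P \<propto> N) (e, \<zero>\<^bsub>N\<^esub>)) c"
proof -
  interpret bimodule P N by fact
  interpret m: matrix_units P e k a b by fact
  have div: "x \<in> Units (corner P e)" if "x \<in> carrier (corner P e)" "x \<noteq> \<zero>\<^bsub>P\<^esub>" for x
    using m.simple_imp_division[OF simple u that] .
  have e0: "e \<noteq> \<zero>\<^bsub>P\<^esub>" using u by (auto simp: uniformizer_def)
  obtain f where fb: "bij_betw f (carrier N) (carrier P)"
    and fl: "\<And>r x. r \<in> carrier P \<Longrightarrow> x \<in> carrier N \<Longrightarrow> f (r \<odot>\<^bsub>N\<^esub> x) = r \<otimes>\<^bsub>P\<^esub> f x"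
    and fr: "\<And>r x. r \<in> carrier P \<Longrightarrow> x \<in> carrier N \<Longrightarrow> f (rsmult N x r) = f x \<otimes>\<^bsub>P\<^esub> \<sigma> r"
    using iso unfolding bimodule_iso_def by (auto simp: twisted_bimodule_def)
  have fc: "f x \<in> carrier P" if "x \<in> carrier N" for x using fb that by (auto simp: bij_betw_def)
  have finj: "x = y" if "x \<in> carrier N" "y \<in> carrier N" "f x = f y" for x y
    using fb that by (auto simp: bij_betw_def dest: inj_onD)
  have f0: "f \<zero>\<^bsub>N\<^esub> = \<zero>\<^bsub>P\<^esub>" using fl[of "\<zero>\<^bsub>P\<^esub>" "\<zero>\<^bsub>N\<^esub>"] fc by simp
  have \<sigma>h: "\<sigma> \<in> ring_hom P P" and \<sigma>b: "bij_betw \<sigma> (carrier P) (carrier P)" using \<sigma> by (auto simp: ring_iso_def)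
  note \<sigma>s = ring_hom_memE[OF \<sigma>h]
  have \<sigma>surj: "\<exists>w\<in>carrier P. y = \<sigma> w" if "y \<in> carrier P" for y using \<sigma>b that by (auto simp: bij_betw_def)
  have \<sigma>inj: "x = y" if "x \<in> carrier P" "y \<in> carrier P" "\<sigma> x = \<sigma> y" for x y
    using \<sigma>b that by (auto simp: bij_betw_def dest: inj_onD)
  have \<sigma>0: "\<sigma> \<zero>\<^bsub>P\<^esub> = \<zero>\<^bsub>P\<^esub>" by (rule ring_hom_zero[OF \<sigma>h R.ring_axioms R.ring_axioms])
  have ec: "e \<in> carrier P" "e \<otimes>\<^bsub>P\<^esub> e = e" "\<sigma> e \<in> carrier P" using \<sigma>s(1) by auto
  show ?thesis
  proof (cases "\<exists>n\<in>carrier N. e \<odot>\<^bsub>N\<^esub> n = n \<and> rsmult N n e = n \<and> n \<noteq> \<zero>\<^bsub>N\<^esub>")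
    case False
    \<comment> \<open>With \<open>eNe = 0\<close> the corner is a copy of the division ring
      \<open>ePe\<close>, whose uniformizer is zero.\<close>
    have "uniformizer (corner (P \<propto> N) (e, \<zero>\<^bsub>N\<^esub>)) (\<zero>\<^bsub>P\<^esub>, \<zero>\<^bsub>N\<^esub>)"
    proof (rule uniformizer_trivial_extension_division[OF ec(1,2) e0 div])
      fix m assume "m \<in> carrier N" "e \<odot>\<^bsub>N\<^esub> m = m" "rsmult N m e = m"
      then have "m = \<zero>\<^bsub>N\<^esub>" using False by blast
      then show "(\<exists>t\<in>carrier (corner P e). m = t \<odot>\<^bsub>N\<^esub> \<zero>\<^bsub>N\<^esub>) \<and> (\<exists>t\<in>carrier (corner P e). m = rsmult N \<zero>\<^bsub>N\<^esub> t)"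
        using ec by (auto intro!: bexI[of _ e])
    qed (use ec in auto)
    then show ?thesis by blast
  next
    case True
    then obtain n where n: "n \<in> carrier N" "e \<odot>\<^bsub>N\<^esub> n = n" "rsmult N n e = n" "n \<noteq> \<zero>\<^bsub>N\<^esub>" by blast
    define y where "y = f n"
    have y: "y \<in> carrier P" "e \<otimes>\<^bsub>P\<^esub> y = y" "y \<otimes>\<^bsub>P\<^esub> \<sigma> e = y" "y \<noteq> \<zero>\<^bsub>P\<^esub>"
      using fc[OF n(1)] fl[OF ec(1) n(1)] fr[OF ec(1) n(1)] n finj[of n "\<zero>\<^bsub>N\<^esub>"] f0 by (auto simp: y_def)
    \<comment> \<open>The right-hand idempotent of \<open>y\<close> is \<open>\<sigma> e\<close>
      rather than \<open>e\<close>. Pulled back along \<open>\<sigma>\<close>, \<open>y\<close>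
      becomes \<open>w = we\<close>, which has a nonzero row \<open>a i \<otimes> w\<close> in the
      corner.\<close>
    have "\<exists>r\<in>carrier P. r \<otimes>\<^bsub>P\<^esub> y = \<sigma> e"
    proof -
      obtain w where w: "w \<in> carrier P" "y = \<sigma> w" using \<sigma>surj[OF y(1)] by blast
      have we: "w \<otimes>\<^bsub>P\<^esub> e = w" using \<sigma>inj[of "w \<otimes>\<^bsub>P\<^esub> e" w] w ec y(3) \<sigma>s(2)[of w e] by simp
      have "w \<noteq> \<zero>\<^bsub>P\<^esub>" using w(2) y(4) \<sigma>0 by auto
      then obtain i where i: "i < k" "a i \<otimes>\<^bsub>P\<^esub> w \<noteq> \<zero>\<^bsub>P\<^esub>" using m.nonzero_row[OF w(1)] by blast
      have "e \<otimes>\<^bsub>P\<^esub> (a i \<otimes>\<^bsub>P\<^esub> w) = (e \<otimes>\<^bsub>P\<^esub> a i) \<otimes>\<^bsub>P\<^esub> w" using i w(1) by (simp add: R.m_assoc)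
      moreover have "(a i \<otimes>\<^bsub>P\<^esub> w) \<otimes>\<^bsub>P\<^esub> e = a i \<otimes>\<^bsub>P\<^esub> (w \<otimes>\<^bsub>P\<^esub> e)" using i w(1) by (simp add: R.m_assoc)
      ultimately have "a i \<otimes>\<^bsub>P\<^esub> w \<in> carrier (corner P e)" using i w(1) we by (simp add: m.e_a)
      from div[OF this i(2)] obtain v where v: "v \<in> carrier P" "v \<otimes>\<^bsub>P\<^esub> (a i \<otimes>\<^bsub>P\<^esub> w) = e" by (auto simp: Units_def)
      have "\<sigma> (v \<otimes>\<^bsub>P\<^esub> a i) \<otimes>\<^bsub>P\<^esub> y = \<sigma> (v \<otimes>\<^bsub>P\<^esub> (a i \<otimes>\<^bsub>P\<^esub> w))"
        unfolding w(2) using v(1) i w(1) \<sigma>s(2)[of "v \<otimes>\<^bsub>P\<^esub> a i" w] by (simp add: R.m_assoc)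
      then show ?thesis using v i \<sigma>s(1)[of "v \<otimes>\<^bsub>P\<^esub> a i"] by auto
    qed
    then obtain r where r: "r \<in> carrier P" "r \<otimes>\<^bsub>P\<^esub> y = \<sigma> e" by blast
    have "\<exists>r\<in>carrier P. y \<otimes>\<^bsub>P\<^esub> r = e"
    proof -
      obtain i where i: "i < k" "y \<otimes>\<^bsub>P\<^esub> b i \<noteq> \<zero>\<^bsub>P\<^esub>" using m.nonzero_column[OF y(1,4)] by blast
      have "e \<otimes>\<^bsub>P\<^esub> (y \<otimes>\<^bsub>P\<^esub> b i) = (e \<otimes>\<^bsub>P\<^esub> y) \<otimes>\<^bsub>P\<^esub> b i" using i y(1) by (simp add: R.m_assoc)
      moreover have "(y \<otimes>\<^bsub>P\<^esub> b i) \<otimes>\<^bsub>P\<^esub> e = y \<otimes>\<^bsub>P\<^esub> (b i \<otimes>\<^bsub>P\<^esub> e)" using i y(1) by (simp add: R.m_assoc)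
      ultimately have "y \<otimes>\<^bsub>P\<^esub> b i \<in> carrier (corner P e)" using i y by (simp add: m.b_e)
      from div[OF this i(2)] obtain v where v: "v \<in> carrier P" "(y \<otimes>\<^bsub>P\<^esub> b i) \<otimes>\<^bsub>P\<^esub> v = e" by (auto simp: Units_def)
      then show ?thesis using i y(1) by (intro bexI[of _ "b i \<otimes>\<^bsub>P\<^esub> v"]) (auto simp: R.m_assoc)
    qed
    then obtain r' where r': "r' \<in> carrier P" "y \<otimes>\<^bsub>P\<^esub> r' = e" by blast
    have "uniformizer (corner (P \<propto> N) (e, \<zero>\<^bsub>N\<^esub>)) (\<zero>\<^bsub>P\<^esub>, n)"
    proof (rule uniformizer_trivial_extension_division[OF ec(1,2) e0 div n(1-3)])
      fix x assume x: "x \<in> carrier N" "e \<odot>\<^bsub>N\<^esub> x = x" "rsmult N x e = x"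
      define z where "z = f x"
      have z: "z \<in> carrier P" "e \<otimes>\<^bsub>P\<^esub> z = z" "z \<otimes>\<^bsub>P\<^esub> \<sigma> e = z"
        using fc[OF x(1)] fl[OF ec(1) x(1)] fr[OF ec(1) x(1)] x by (auto simp: z_def)
      define t where "t = e \<otimes>\<^bsub>P\<^esub> z \<otimes>\<^bsub>P\<^esub> r \<otimes>\<^bsub>P\<^esub> e"
      have t: "t \<in> carrier (corner P e)"
        unfolding t_def using z(1) r(1) ec by (simp add: R.m_assoc) (simp add: R.m_assoc[symmetric])
      have "t \<otimes>\<^bsub>P\<^esub> y = (e \<otimes>\<^bsub>P\<^esub> z) \<otimes>\<^bsub>P\<^esub> (r \<otimes>\<^bsub>P\<^esub> (e \<otimes>\<^bsub>P\<^esub> y))"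
        unfolding t_def using z(1) r(1) ec y(1) by (simp add: R.m_assoc)
      also have "\<dots> = z" using y z r by simp
      finally have ty: "t \<otimes>\<^bsub>P\<^esub> y = z" .
      have xl: "x = t \<odot>\<^bsub>N\<^esub> n"
        by (rule finj) (use x n t ty fl in \<open>auto simp: lsmult_closed y_def z_def\<close>)
      obtain s where s: "s \<in> carrier P" "r' \<otimes>\<^bsub>P\<^esub> z = \<sigma> s" using \<sigma>surj[of "r' \<otimes>\<^bsub>P\<^esub> z"] r' z by auto
      define t' where "t' = e \<otimes>\<^bsub>P\<^esub> s \<otimes>\<^bsub>P\<^esub> e"
      have t': "t' \<in> carrier (corner P e)"
        unfolding t'_def using s(1) ec by (simp add: R.m_assoc) (simp add: R.m_assoc[symmetric])
      have "y \<otimes>\<^bsub>P\<^esub> \<sigma> t' = (y \<otimes>\<^bsub>P\<^esub> \<sigma> e) \<otimes>\<^bsub>P\<^esub> (r' \<otimes>\<^bsub>P\<^esub> z) \<otimes>\<^bsub>P\<^esub> \<sigma> e"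
        unfolding t'_def s(2) using s(1) ec y(1) \<sigma>s(1,2) by (simp add: R.m_assoc)
      also have "\<dots> = (y \<otimes>\<^bsub>P\<^esub> r') \<otimes>\<^bsub>P\<^esub> (z \<otimes>\<^bsub>P\<^esub> \<sigma> e)"
        unfolding y(3) using y(1) r'(1) z(1) ec by (simp add: R.m_assoc)
      also have "\<dots> = z" unfolding r'(2) using z by simp
      finally have yt: "y \<otimes>\<^bsub>P\<^esub> \<sigma> t' = z" .
      have "x = rsmult N n t'"
        by (rule finj) (use x n t' yt fr in \<open>auto simp: rsmult_closed y_def z_def\<close>)
      with xl show "(\<exists>t\<in>carrier (corner P e). x = t \<odot>\<^bsub>N\<^esub> n) \<and> (\<exists>t\<in>carrier (corner P e). x = rsmult N n t)"
        using t t' by blast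
    qed
    then show ?thesis by blast
  qed
qed

text \<open>The matrix units of \<open>P\<close> remain matrix units of
  \<open>P \<propto> N\<close>, so only the corner has to be a chain ring. For \<open>N = 0\<close>
  it is a copy of that of \<open>P\<close>; otherwise \<open>zero_or_twisted\<close> makes
  \<open>P\<close> simple and the corner is built over a division ring.\<close>

lemma morphic_trivial_extension_block:
  assumes bim: "bimodule P N"
    and mat: "matrix_ring_over_artinian_principal_local P k L" and N: "zero_or_twisted P N"
  shows "morphic (P \<propto> N)"
proof -
  interpret bimodule P N by fact
  have L: "artinian_ring L" "principal_ring L" "local_ring L" "k \<ge> 1" "P \<simeq> matrix_ring k L"
    using mat by (auto simp: matrix_ring_over_artinian_principal_local_def)
  obtain c where c: "uniformizer L c" using uniformizer_exists[OF L(1-3)] by blast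
  obtain \<theta> where \<theta>: "\<theta> \<in> ring_iso P (matrix_ring k L)" using L(5) by (auto simp: is_ring_iso_def)
  obtain e a b c' where mu: "matrix_units P e k a b" and u: "uniformizer (corner P e) c'"
    using matrix_units_of_iso[OF R.ring_axioms c L(4) \<theta>] by blast
  interpret m: matrix_units P e k a b by fact
  interpret S: matrix_units "P \<propto> N" "(e, \<zero>\<^bsub>N\<^esub>)" k "\<lambda>i. (a i, \<zero>\<^bsub>N\<^esub>)" "\<lambda>i. (b i, \<zero>\<^bsub>N\<^esub>)"
    by (rule matrix_units_trivial_extension[OF mu])
  have "\<exists>d. uniformizer (corner (P \<propto> N) (e, \<zero>\<^bsub>N\<^esub>)) d"
  proof (cases "carrier N = {\<zero>\<^bsub>N\<^esub>}")
    case True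
    then show ?thesis using uniformizer_trivial_extension_zero[OF m.e_closed m.e_idem _ u] by blast
  next
    case False
    then have "simple_ring P" "\<exists>\<sigma>\<in>ring_iso P P. bimodule_iso P N (twisted_bimodule P \<sigma>)"
      using N unfolding zero_or_twisted_def by (auto split: if_splits)
    then show ?thesis using uniformizer_twisted[OF bim mu _ u] by blast
  qed
  then show ?thesis using S.morphic by blast
qed

section \<open>Direct products of lists of rings\<close>

text \<open>The operations on lists are read off from those on pairs through the homomorphism that
  sends \<open>(x, xs)\<close> to \<open>x # xs\<close>.\<close>

lemma RDirProd_list_Cons_ops:
  assumes "x \<in> carrier R" "y \<in> carrier R" "xs \<in> carrier (RDirProd_list Rs)" "ys \<in> carrier (RDirProd_list Rs)"
  shows "(x # xs) \<otimes>\<^bsub>RDirProd_list (R # Rs)\<^esub> (y # ys) = (x \<otimes>\<^bsub>R\<^esub> y) # (xs \<otimes>\<^bsub>RDirProd_list Rs\<^esub> ys)"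
    and "(x # xs) \<oplus>\<^bsub>RDirProd_list (R # Rs)\<^esub> (y # ys) = (x \<oplus>\<^bsub>R\<^esub> y) # (xs \<oplus>\<^bsub>RDirProd_list Rs\<^esub> ys)"
proof -
  have c: "(x, xs) \<in> carrier (RDirProd R (RDirProd_list Rs))" "(y, ys) \<in> carrier (RDirProd R (RDirProd_list Rs))"
    using assms by (auto simp: RDirProd_carrier)
  have "(x, xs) \<otimes>\<^bsub>RDirProd R (RDirProd_list Rs)\<^esub> (y, ys) = (x \<otimes>\<^bsub>R\<^esub> y, xs \<otimes>\<^bsub>RDirProd_list Rs\<^esub> ys)"
    "(x, xs) \<oplus>\<^bsub>RDirProd R (RDirProd_list Rs)\<^esub> (y, ys) = (x \<oplus>\<^bsub>R\<^esub> y, xs \<oplus>\<^bsub>RDirProd_list Rs\<^esub> ys)"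
    by (simp_all add: RDirProd_def DirProd_def monoid.defs)
  then show "(x # xs) \<otimes>\<^bsub>RDirProd_list (R # Rs)\<^esub> (y # ys) = (x \<otimes>\<^bsub>R\<^esub> y) # (xs \<otimes>\<^bsub>RDirProd_list Rs\<^esub> ys)"
    and "(x # xs) \<oplus>\<^bsub>RDirProd_list (R # Rs)\<^esub> (y # ys) = (x \<oplus>\<^bsub>R\<^esub> y) # (xs \<oplus>\<^bsub>RDirProd_list Rs\<^esub> ys)"
    using ring_hom_mult[OF RDirProd_list_hom1 c] ring_hom_add[OF RDirProd_list_hom1 c] by simp_all
qed

lemma RDirProd_list_ops_nth:
  assumes "xs \<in> carrier (RDirProd_list Rs)" "ys \<in> carrier (RDirProd_list Rs)" "i < length Rs"
  shows "(xs \<otimes>\<^bsub>RDirProd_list Rs\<^esub> ys) ! i = xs ! i \<otimes>\<^bsub>Rs ! i\<^esub> ys ! i \<and>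
         (xs \<oplus>\<^bsub>RDirProd_list Rs\<^esub> ys) ! i = xs ! i \<oplus>\<^bsub>Rs ! i\<^esub> ys ! i"
  using assms
proof (induct Rs arbitrary: xs ys i)
  case (Cons R Rs)
  obtain x xs' where x: "xs = x # xs'" "x \<in> carrier R" "xs' \<in> carrier (RDirProd_list Rs)"
    using Cons.prems(1) by (auto simp: RDirProd_list_carrier)
  obtain y ys' where y: "ys = y # ys'" "y \<in> carrier R" "ys' \<in> carrier (RDirProd_list Rs)"
    using Cons.prems(2) by (auto simp: RDirProd_list_carrier)
  show ?case
    unfolding x(1) y(1) RDirProd_list_Cons_ops[OF x(2) y(2) x(3) y(3)]
    using Cons.hyps[OF x(3) y(3)] Cons.prems(3) by (cases i) auto
qed simp

lemma RDirProd_list_one_nth: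
  "i < length Rs \<Longrightarrow> \<one>\<^bsub>RDirProd_list Rs\<^esub> ! i = \<one>\<^bsub>Rs ! i\<^esub>"
  unfolding RDirProd_list_one by (induct Rs arbitrary: i) (auto simp: nth_Cons split: nat.split)

text \<open>The two isomorphisms of the decomposition combine into projections of
  \<open>R \<propto> M\<close> onto \<open>Rs q \<propto> Ms q\<close>. They are multiplicative
  because \<open>R\<close> acts on \<open>Ms q\<close> through the component \<open>q\<close> of
  \<open>\<phi>\<close>, the same map that is used on the ring part.\<close>

theorem morphic_trivial_extension:
  fixes R :: "'a ring" and M :: "('a, 'm) bimodule"
    and Rs :: "nat \<Rightarrow> 'b ring" and Ms :: "nat \<Rightarrow> ('b, 'n) bimodule" and Ls :: "nat \<Rightarrow> 'c ring"
  assumes bim: "bimodule R M"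
    and dec: "decomposition_into_standard_components R M n Rs Ms ks Ls"
  shows "morphic (R \<propto> M)"
proof -
  interpret bimodule R M by fact
  interpret S: ring "R \<propto> M" by (rule ring_trivial_extension)
  have bi: "bimodule (Rs q) (Ms q)" if "q < n" for q
    using dec that by (auto simp: decomposition_into_standard_components_def decomposition_def)
  have std: "matrix_ring_over_artinian_principal_local (Rs q) (ks q) (Ls q)" "zero_or_twisted (Rs q) (Ms q)"
    if "q < n" for q
    using dec that by (auto simp: decomposition_into_standard_components_def)
  let ?P = "RDirProd_list (map Rs [0..<n])"
  obtain \<phi> where \<phi>: "\<phi> \<in> ring_iso R ?P"
    and "bimodule_iso R M (bimodule_direct_sum n (\<lambda>i. restrict_scalars (\<lambda>r. \<phi> r ! i) (Ms i)))"
    using dec by (auto simp: decomposition_into_standard_components_def decomposition_def)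
  then obtain \<psi> where \<psi>b: "bij_betw \<psi> (carrier M) {xs. length xs = n \<and> (\<forall>i<n. xs ! i \<in> carrier (Ms i))}"
    and \<psi>a: "\<And>x y. x \<in> carrier M \<Longrightarrow> y \<in> carrier M \<Longrightarrow> \<psi> (x \<oplus>\<^bsub>M\<^esub> y) = map (\<lambda>i. \<psi> x ! i \<oplus>\<^bsub>Ms i\<^esub> \<psi> y ! i) [0..<n]"
    and \<psi>l: "\<And>r x. r \<in> carrier R \<Longrightarrow> x \<in> carrier M \<Longrightarrow> \<psi> (r \<odot>\<^bsub>M\<^esub> x) = map (\<lambda>i. (\<phi> r ! i) \<odot>\<^bsub>Ms i\<^esub> \<psi> x ! i) [0..<n]"
    and \<psi>r: "\<And>r x. r \<in> carrier R \<Longrightarrow> x \<in> carrier M \<Longrightarrow> \<psi> (rsmult M x r) = map (\<lambda>i. rsmult (Ms i) (\<psi> x ! i) (\<phi> r ! i)) [0..<n]"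
    unfolding bimodule_iso_def bimodule_direct_sum_def restrict_scalars_def by auto
  have \<phi>b: "bij_betw \<phi> (carrier R) (carrier ?P)" and \<phi>h: "\<phi> \<in> ring_hom R ?P"
    using \<phi> by (auto simp: ring_iso_def)
  note \<phi>s = ring_hom_memE[OF \<phi>h]
  have Pn: "x ! i \<in> carrier (Rs i)" "length x = n" if "x \<in> carrier ?P" "i < n" for x i
    using RDirProd_list_carrier_mem[OF that(1)] that(2) by auto
  have \<psi>c: "\<psi> m ! i \<in> carrier (Ms i)" "length (\<psi> m) = n" if "m \<in> carrier M" "i < n" for m i
    using \<psi>b that by (auto simp: bij_betw_def)
  have \<phi>m: "\<phi> (r \<otimes>\<^bsub>R\<^esub> s) ! i = \<phi> r ! i \<otimes>\<^bsub>Rs i\<^esub> \<phi> s ! i" "\<phi> (r \<oplus>\<^bsub>R\<^esub> s) ! i = \<phi> r ! i \<oplus>\<^bsub>Rs i\<^esub> \<phi> s ! i"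
    if "r \<in> carrier R" "s \<in> carrier R" "i < n" for r s i
    using RDirProd_list_ops_nth[of "\<phi> r" "map Rs [0..<n]" "\<phi> s" i] that \<phi>s by auto
  have \<phi>1: "\<phi> \<one>\<^bsub>R\<^esub> ! i = \<one>\<^bsub>Rs i\<^esub>" if "i < n" for i
    using RDirProd_list_one_nth[of i "map Rs [0..<n]"] that \<phi>s(4) by simp
  \<comment> \<open>The direct sum has not been shown to be a group, so the image of zero is found
    from \<open>0 = 0 + 0\<close> in each component.\<close>
  have \<psi>0: "\<psi> \<zero>\<^bsub>M\<^esub> ! i = \<zero>\<^bsub>Ms i\<^esub>" if "i < n" for i
  proof -
    interpret B: bimodule "Rs i" "Ms i" by (rule bi[OF that])
    have "\<psi> \<zero>\<^bsub>M\<^esub> = map (\<lambda>i. \<psi> \<zero>\<^bsub>M\<^esub> ! i \<oplus>\<^bsub>Ms i\<^esub> \<psi> \<zero>\<^bsub>M\<^esub> ! i) [0..<n]"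
      using \<psi>a[of "\<zero>\<^bsub>M\<^esub>" "\<zero>\<^bsub>M\<^esub>"] unfolding M.l_zero[OF M.zero_closed] by simp
    then have "\<psi> \<zero>\<^bsub>M\<^esub> ! i = map (\<lambda>i. \<psi> \<zero>\<^bsub>M\<^esub> ! i \<oplus>\<^bsub>Ms i\<^esub> \<psi> \<zero>\<^bsub>M\<^esub> ! i) [0..<n] ! i"
      by (rule arg_cong)
    also have "\<dots> = \<psi> \<zero>\<^bsub>M\<^esub> ! i \<oplus>\<^bsub>Ms i\<^esub> \<psi> \<zero>\<^bsub>M\<^esub> ! i" using that by simp
    finally have "\<psi> \<zero>\<^bsub>M\<^esub> ! i = \<psi> \<zero>\<^bsub>M\<^esub> ! i \<oplus>\<^bsub>Ms i\<^esub> \<psi> \<zero>\<^bsub>M\<^esub> ! i" .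
    then show ?thesis using \<psi>c[of "\<zero>\<^bsub>M\<^esub>" i] that by simp
  qed
  define \<pi> where "\<pi> q z = (\<phi> (fst z) ! q, \<psi> (snd z) ! q)" for q and z :: "'a \<times> 'm"
  show ?thesis
  proof (rule morphic_product[where T = "\<lambda>q. Rs q \<propto> Ms q" and n = n and \<pi> = \<pi>])
    show "ring (R \<propto> M)" by (rule S.ring_axioms)
    fix q assume q: "q < n"
    interpret B: bimodule "Rs q" "Ms q" by (rule bi[OF q])
    show "ring (Rs q \<propto> Ms q)" by (rule B.ring_trivial_extension)
    show "morphic (Rs q \<propto> Ms q)" by (rule morphic_trivial_extension_block[OF bi[OF q] std[OF q]])
    show "\<pi> q \<in> ring_hom (R \<propto> M) (Rs q \<propto> Ms q)"
    proof (rule ring_hom_memI)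
      fix z z' assume "z \<in> carrier (R \<propto> M)" "z' \<in> carrier (R \<propto> M)"
      then obtain r m s k where z: "z = (r, m)" "z' = (s, k)" "r \<in> carrier R" "s \<in> carrier R"
        "m \<in> carrier M" "k \<in> carrier M" by auto
      show "\<pi> q z \<in> carrier (Rs q \<propto> Ms q)"
        using z q Pn(1)[OF \<phi>s(1)] \<psi>c by (simp add: \<pi>_def)
      show "\<pi> q (z \<otimes>\<^bsub>R \<propto> M\<^esub> z') = \<pi> q z \<otimes>\<^bsub>Rs q \<propto> Ms q\<^esub> \<pi> q z'"
        unfolding \<pi>_def using z q by (simp add: \<phi>m \<psi>a \<psi>l \<psi>r lsmult_closed rsmult_closed)
      show "\<pi> q (z \<oplus>\<^bsub>R \<propto> M\<^esub> z') = \<pi> q z \<oplus>\<^bsub>Rs q \<propto> Ms q\<^esub> \<pi> q z'"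
        unfolding \<pi>_def using z q by (simp add: \<phi>m \<psi>a)
    qed (use q \<phi>1 \<psi>0 in \<open>simp add: \<pi>_def\<close>)
  next
    fix z z' assume zz: "z \<in> carrier (R \<propto> M)" "z' \<in> carrier (R \<propto> M)" "\<And>q. q < n \<Longrightarrow> \<pi> q z = \<pi> q z'"
    then obtain r m s k where z: "z = (r, m)" "z' = (s, k)" "r \<in> carrier R" "s \<in> carrier R"
      "m \<in> carrier M" "k \<in> carrier M" by auto
    have "length (\<phi> r) = n" "length (\<phi> s) = n"
      using RDirProd_list_carrier_mem(1)[OF \<phi>s(1)] z by auto
    then have "\<phi> r = \<phi> s" using zz(3) z by (auto simp: \<pi>_def intro!: nth_equalityI)
    moreover have "length (\<psi> m) = n" "length (\<psi> k) = n" using \<psi>b z by (auto simp: bij_betw_def)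
    then have "\<psi> m = \<psi> k" using zz(3) z by (auto simp: \<pi>_def intro!: nth_equalityI)
    ultimately have "r = s" "m = k" using z \<phi>b \<psi>b unfolding bij_betw_def by (auto dest: inj_onD)
    then show "z = z'" using z by simp
  next
    fix f :: "nat \<Rightarrow> 'b \<times> 'n" assume f: "\<And>q. q < n \<Longrightarrow> f q \<in> carrier (Rs q \<propto> Ms q)"
    have "map (\<lambda>q. fst (f q)) [0..<n] \<in> carrier ?P"
      using f by (intro RDirProd_list_carrier_memI) (auto simp: mem_Times_iff)
    then obtain r where r: "r \<in> carrier R" "\<phi> r = map (\<lambda>q. fst (f q)) [0..<n]"
      using \<phi>b by (auto simp: bij_betw_def) (metis imageE)
    have "map (\<lambda>q. snd (f q)) [0..<n] \<in> {xs. length xs = n \<and> (\<forall>i<n. xs ! i \<in> carrier (Ms i))}"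
      using f by (auto simp: mem_Times_iff)
    then obtain m where m: "m \<in> carrier M" "\<psi> m = map (\<lambda>q. snd (f q)) [0..<n]"
      using \<psi>b unfolding bij_betw_def by (metis (no_types, lifting) imageE)
    show "\<exists>x\<in>carrier (R \<propto> M). \<forall>q<n. \<pi> q x = f q"
      by (rule bexI[of _ "(r, m)"]) (use r m in \<open>auto simp: \<pi>_def\<close>)
  qed
qed

section \<open>Idempotents of a left perfect ring\<close>

text \<open>Closure on the right is the point, as the radical is defined by maximal left ideals. For
  \<open>s\<close> outside a maximal \<open>m\<close>, right multiplication by \<open>s\<close> maps
  \<open>R\<close> onto \<open>R/m\<close>, so its kernel \<open>m' = {r. rs \<in> m}\<close> is
  again maximal and contains \<open>x\<close>.\<close>

lemma (in ring) ideal_jacobson_radical: "ideal (jacobson_radical R) R"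
proof -
  let ?J = "jacobson_radical R"
  have mem: "x \<in> ?J \<longleftrightarrow> x \<in> carrier R \<and> (\<forall>m. maximal_left_ideal m R \<longrightarrow> x \<in> m)" for x
    by (auto simp: jacobson_radical_def)
  have li: "left_ideal m R" if "maximal_left_ideal m R" for m
    using that unfolding maximal_left_ideal_def by blast
  have L: "left_ideal ?J R"
  proof (rule left_idealI)
    show "?J \<subseteq> carrier R" using mem by blast
    show "\<zero> \<in> ?J" unfolding mem using left_idealD(3)[OF li] by simp
    show "x \<oplus> y \<in> ?J" if "x \<in> ?J" "y \<in> ?J" for x y
      using that left_idealD(4)[OF li] unfolding mem by simp
    show "r \<otimes> x \<in> ?J" if "r \<in> carrier R" "x \<in> ?J" for r x
      using that left_idealD(7)[OF li] unfolding mem by simp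
  qed
  have "x \<otimes> s \<in> ?J" if x: "x \<in> ?J" and s: "s \<in> carrier R" for x s
  proof -
    have xc: "x \<in> carrier R" using x mem by simp
    have "x \<otimes> s \<in> m" if m: "maximal_left_ideal m R" for m
    proof -
      note ml = li[OF m]
      note mD = left_idealD[OF ml]
      define m' where "m' = {r \<in> carrier R. r \<otimes> s \<in> m}"
      have ml': "left_ideal m' R"
        by (rule left_idealI) (use s mD(3,4,7) in \<open>auto simp: m'_def l_distr m_assoc\<close>)
      have max: "K = m' \<or> K = carrier R" if K: "left_ideal K R" "m' \<subseteq> K" for K
      proof -
        note KD = left_idealD[OF K(1)]
        \<comment> \<open>\<open>H = Ks + m\<close> contains \<open>m\<close>, so it is
          \<open>m\<close> or \<open>R\<close>; the first case gives \<open>K = m'\<close>, the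
          second \<open>K = R\<close>.\<close>
        define H where "H = {k \<otimes> s \<oplus> y | k y. k \<in> K \<and> y \<in> m}"
        have Hl: "left_ideal H R"
        proof (rule left_idealI)
          show "H \<subseteq> carrier R" using KD(2) mD(2) s by (auto simp: H_def)
          show "\<zero> \<in> H" using KD(3) mD(3) s by (auto simp: H_def intro!: exI[of _ \<zero>])
          show "u \<oplus> v \<in> H" if uv: "u \<in> H" "v \<in> H" for u v
          proof -
            obtain k y k' y' where e: "k \<in> K" "y \<in> m" "k' \<in> K" "y' \<in> m" "u = k \<otimes> s \<oplus> y" "v = k' \<otimes> s \<oplus> y'"
              using uv by (auto simp: H_def)
            then have c: "k \<in> carrier R" "y \<in> carrier R" "k' \<in> carrier R" "y' \<in> carrier R" using KD(2) mD(2) by auto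
            have "u \<oplus> v = (k \<oplus> k') \<otimes> s \<oplus> (y \<oplus> y')" unfolding e using c s by (simp add: l_distr a_ac)
            then show ?thesis using e KD(4) mD(4) unfolding H_def by blast
          qed
          show "r \<otimes> u \<in> H" if ru: "r \<in> carrier R" "u \<in> H" for r u
          proof -
            obtain k y where e: "k \<in> K" "y \<in> m" "u = k \<otimes> s \<oplus> y" using ru by (auto simp: H_def)
            then have c: "k \<in> carrier R" "y \<in> carrier R" using KD(2) mD(2) by auto
            have "r \<otimes> u = (r \<otimes> k) \<otimes> s \<oplus> r \<otimes> y" unfolding e using c s ru by (simp add: r_distr m_assoc)
            then show ?thesis using e KD(7) mD(7) ru(1) unfolding H_def by blast
          qed
        qed
        have mH: "m \<subseteq> H"
        proof
          fix y assume "y \<in> m"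
          moreover have "y = \<zero> \<otimes> s \<oplus> y" using s \<open>y \<in> m\<close> mD(2) by auto
          ultimately show "y \<in> H" unfolding H_def using KD(3) by blast
        qed
        then have "H = m \<or> H = carrier R" using m Hl unfolding maximal_left_ideal_def by blast
        then show ?thesis
        proof
          assume Hm: "H = m"
          have "k \<in> m'" if "k \<in> K" for k
          proof -
            have kc: "k \<in> carrier R" using that KD(2) by auto
            have "k \<otimes> s = k \<otimes> s \<oplus> \<zero>" using kc s by simp
            then have "k \<otimes> s \<in> H" unfolding H_def using that mD(3) by blast
            then show ?thesis using Hm kc by (simp add: m'_def)
          qed
          then show ?thesis using K(2) by blast
        next
          assume HR: "H = carrier R"
          have "r \<in> K" if r: "r \<in> carrier R" for r
          proof -
            have "r \<otimes> s \<in> H" using HR r s by simp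
            then obtain k y where e: "k \<in> K" "y \<in> m" "r \<otimes> s = k \<otimes> s \<oplus> y" by (auto simp: H_def)
            then have c: "k \<in> carrier R" "y \<in> carrier R" using KD(2) mD(2) by auto
            have "(r \<ominus> k) \<otimes> s = r \<otimes> s \<ominus> k \<otimes> s" using r c s by (simp add: minus_eq l_distr l_minus)
            also have "\<dots> = y" unfolding e(3) using c s by (simp add: minus_eq a_ac r_neg1 r_neg2 r_neg l_neg)
            finally have "r \<ominus> k \<in> m'" unfolding m'_def using e(2) r c by simp
            then have "(r \<ominus> k) \<oplus> k \<in> K" using K(2) KD(4) e(1) by blast
            then show ?thesis using r c by (simp add: minus_eq a_assoc l_neg)
          qed
          then show ?thesis using KD(2) by blast
        qed
      qed
      show ?thesis
      proof (cases "s \<in> m")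
        case True
        then show ?thesis using mD(7)[OF xc] by simp
      next
        case False
        then have "\<one> \<notin> m'" using s by (simp add: m'_def)
        then have "m' \<noteq> carrier R" by auto
        then have "maximal_left_ideal m' R" unfolding maximal_left_ideal_def using ml' max by blast
        then have "x \<in> m'" using x mem by blast
        then show ?thesis by (simp add: m'_def)
      qed
    qed
    then show ?thesis unfolding mem using xc s by simp
  qed
  then show ?thesis
    by (intro idealI[OF ring_axioms]) (use L left_idealD(7)[OF L] in \<open>auto simp: left_ideal_def additive_subgroup_def\<close>)
qed

section \<open>T-nilpotence and right identities modulo the radical\<close>

text \<open>Indexed from 0 and bracketed to the left, so that appending a factor on the right is
  definitional. Length 0 gives \<open>1\<close>, which vanishes only in the zero ring.\<close>

primrec seq_prod :: "('a, 'x) ring_scheme \<Rightarrow> (nat \<Rightarrow> 'a) \<Rightarrow> nat \<Rightarrow> 'a" where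
  "seq_prod R r 0 = \<one>\<^bsub>R\<^esub>"
| "seq_prod R r (Suc n) = seq_prod R r n \<otimes>\<^bsub>R\<^esub> r n"

definition T_nilpotent :: "('a, 'x) ring_scheme \<Rightarrow> 'a set \<Rightarrow> bool" where
  "T_nilpotent R J \<longleftrightarrow> (\<forall>r. (\<forall>i. r i \<in> J) \<longrightarrow> (\<exists>n. seq_prod R r n = \<zero>\<^bsub>R\<^esub>))"

context ring
begin

lemma seq_prod_closed [simp]: "(\<And>i. r i \<in> carrier R) \<Longrightarrow> seq_prod R r n \<in> carrier R"
  by (induct n) auto

lemma foldr_mult_closed:
  "set xs \<subseteq> carrier R \<Longrightarrow> z \<in> carrier R \<Longrightarrow> foldr (\<otimes>) xs z \<in> carrier R"
  by (induct xs) auto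

lemma foldr_mult:
  assumes "set xs \<subseteq> carrier R" "z \<in> carrier R"
  shows "foldr (\<otimes>) xs z = foldr (\<otimes>) xs \<one> \<otimes> z"
  using assms by (induct xs) (auto simp: m_assoc foldr_mult_closed)

lemma left_T_nilpotent_imp:
  assumes "left_T_nilpotent J R" "J \<subseteq> carrier R"
  shows "T_nilpotent R J"
  unfolding T_nilpotent_def
proof (intro allI impI)
  fix r :: "nat \<Rightarrow> 'a" assume r: "\<forall>i. r i \<in> J"
  \<comment> \<open>\<open>left_T_nilpotent\<close> starts at index 1, so the sequence is shifted by
    one; the extra value \<open>r' 0 = r 0\<close> is in \<open>J\<close>, as required
    there.\<close>
  define r' where "r' i = r (i - 1)" for i
  have rc: "r i \<in> carrier R" for i using r assms(2) by auto
  have "foldr (\<otimes>) (map r' [1..<Suc n]) \<one> = seq_prod R r n" for n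
  proof (induct n)
    case (Suc n)
    have s: "set (map r' [1..<Suc n]) \<subseteq> carrier R" using rc by (auto simp: r'_def)
    have "foldr (\<otimes>) (map r' [1..<Suc (Suc n)]) \<one> = foldr (\<otimes>) (map r' [1..<Suc n]) (r n)"
      using rc by (simp add: r'_def)
    also have "\<dots> = seq_prod R r (Suc n)" using foldr_mult[OF s rc[of n]] Suc by simp
    finally show ?case .
  qed simp
  moreover have "\<forall>i. r' i \<in> J" using r by (simp add: r'_def)
  then have "\<exists>n\<ge>1. foldr (\<otimes>) (map r' [1..<Suc n]) \<one> = \<zero>"
    using assms(1) unfolding left_T_nilpotent_def by blast
  ultimately show "\<exists>n. seq_prod R r n = \<zero>" by auto
qed

text \<open>The image of \<open>I\<close> in \<open>R/J\<close> has a complement \<open>K\<close>;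
  write \<open>1 = i + k\<close> there. For \<open>x\<close> in \<open>I\<close> the class of
  \<open>x - xi\<close> is the class of \<open>x\<close> times \<open>k\<close>, so it lies both in
  the image of \<open>I\<close> and in \<open>K\<close> and is zero. Thus \<open>i\<close> is a
  right identity of \<open>I\<close> modulo \<open>J\<close>.\<close>

lemma left_idempotent_mod_radical:
  assumes J: "ideal J R" and ss: "semisimple_ring (R Quot J)" and I: "left_ideal I R"
  shows "\<exists>i\<in>I. \<forall>x\<in>I. x \<ominus> x \<otimes> i \<in> J"
proof -
  let ?Q = "R Quot J" and ?h = "(+>) J"
  interpret h: ring_hom_ring R ?Q ?h by (rule ideal.rcos_ring_hom_ring[OF J])
  have surj: "\<exists>x\<in>carrier R. y = ?h x" if "y \<in> carrier ?Q" for y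
    using that unfolding FactRing_def A_RCOSETS_def' by auto
  have ker: "x \<in> J" if "x \<in> carrier R" "?h x = \<zero>\<^bsub>?Q\<^esub>" for x
    using ideal.rcos_const_imp_mem[OF J that(1)] that(2) unfolding FactRing_def by simp
  note ID = left_idealD[OF I]
  have "left_ideal (?h ` I) ?Q"
  proof (rule h.S.left_idealI)
    show "?h ` I \<subseteq> carrier ?Q" using ID(2) h.hom_closed by blast
    show "\<zero>\<^bsub>?Q\<^esub> \<in> ?h ` I" using ID(3) h.hom_zero by (metis image_eqI)
    show "x \<oplus>\<^bsub>?Q\<^esub> y \<in> ?h ` I" if xy: "x \<in> ?h ` I" "y \<in> ?h ` I" for x y
    proof -
      obtain u v where "u \<in> I" "v \<in> I" "x = ?h u" "y = ?h v" using xy by blast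
      then have "x \<oplus>\<^bsub>?Q\<^esub> y = ?h (u \<oplus> v)" using ID(2) h.hom_add by (simp add: subset_iff)
      then show ?thesis using ID(4) \<open>u \<in> I\<close> \<open>v \<in> I\<close> by blast
    qed
    show "r \<otimes>\<^bsub>?Q\<^esub> x \<in> ?h ` I" if rx: "r \<in> carrier ?Q" "x \<in> ?h ` I" for r x
    proof -
      obtain s u where su: "s \<in> carrier R" "r = ?h s" "u \<in> I" "x = ?h u" using surj[OF rx(1)] rx(2) by blast
      then have "r \<otimes>\<^bsub>?Q\<^esub> x = ?h (s \<otimes> u)" using ID(2) h.hom_mult by (simp add: subset_iff)
      then show ?thesis using ID(7) su by blast
    qed
  qed
  then obtain K where K: "left_ideal K ?Q" "?h ` I \<inter> K = {\<zero>\<^bsub>?Q\<^esub>}" "?h ` I <+>\<^bsub>?Q\<^esub> K = carrier ?Q"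
    using ss unfolding semisimple_ring_def by blast
  have "\<one>\<^bsub>?Q\<^esub> \<in> ?h ` I <+>\<^bsub>?Q\<^esub> K" using K(3) by simp
  then obtain i k where ik: "i \<in> I" "k \<in> K" "\<one>\<^bsub>?Q\<^esub> = ?h i \<oplus>\<^bsub>?Q\<^esub> k" unfolding set_add_def' by blast
  have c: "i \<in> carrier R" "k \<in> carrier ?Q" using ik ID(2) left_idealD(2)[OF K(1)] by auto
  have "x \<ominus> x \<otimes> i \<in> J" if x: "x \<in> I" for x
  proof -
    have xc: "x \<in> carrier R" using x ID(2) by auto
    have hx: "?h x \<in> carrier ?Q" "?h i \<in> carrier ?Q" using xc c by auto
    have "?h x = ?h x \<otimes>\<^bsub>?Q\<^esub> (?h i \<oplus>\<^bsub>?Q\<^esub> k)" using hx ik(3) by (metis h.S.r_one)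
    also have "\<dots> = ?h (x \<otimes> i) \<oplus>\<^bsub>?Q\<^esub> ?h x \<otimes>\<^bsub>?Q\<^esub> k"
      using hx c xc h.hom_mult[OF xc c(1)] h.S.r_distr[OF hx(2) c(2) hx(1)] by simp
    finally have e: "?h x = ?h (x \<otimes> i) \<oplus>\<^bsub>?Q\<^esub> ?h x \<otimes>\<^bsub>?Q\<^esub> k" .
    have xk: "?h x \<otimes>\<^bsub>?Q\<^esub> k \<in> carrier ?Q" using hx c by simp
    have hxi: "?h (x \<otimes> i) \<in> carrier ?Q" using xc c by simp
    have "?h (x \<ominus> x \<otimes> i) = ?h x \<ominus>\<^bsub>?Q\<^esub> ?h (x \<otimes> i)"
      using xc c by (simp add: minus_eq h.S.minus_eq)
    also have "\<dots> = ?h x \<otimes>\<^bsub>?Q\<^esub> k"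
    proof -
      have "(?h (x \<otimes> i) \<oplus>\<^bsub>?Q\<^esub> ?h x \<otimes>\<^bsub>?Q\<^esub> k) \<ominus>\<^bsub>?Q\<^esub> ?h (x \<otimes> i) = ?h x \<otimes>\<^bsub>?Q\<^esub> k"
        using xk hxi by (simp only: h.S.minus_eq h.S.a_comm[OF hxi xk] h.S.a_assoc h.S.a_inv_closed h.S.r_neg h.S.r_zero)
      then show ?thesis using e by simp
    qed
    finally have e2: "?h (x \<ominus> x \<otimes> i) = ?h x \<otimes>\<^bsub>?Q\<^esub> k" .
    have "x \<ominus> x \<otimes> i \<in> I" using ID(6,7) x ik(1) xc by blast
    moreover have "?h x \<otimes>\<^bsub>?Q\<^esub> k \<in> K" by (rule left_idealD(7)[OF K(1) hx(1) ik(2)])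
    ultimately have "?h (x \<ominus> x \<otimes> i) = \<zero>\<^bsub>?Q\<^esub>" using K(2) e2 by (metis IntI empty_iff imageI insert_iff)
    then show ?thesis using ker xc c by simp
  qed
  then show ?thesis using ik(1) by blast
qed

end

text \<open>The form in which left perfectness enters: modulo \<open>J\<close> every left ideal has
  a right identity that can be chosen inside the ideal, and \<open>J\<close> is T-nilpotent.\<close>

locale semiperfect_radical = ring R for R (structure) +
  fixes J :: "'a set"
  assumes ideal_J: "ideal J R"
    and T_nil: "T_nilpotent R J"
    and idempotent_mod: "left_ideal I R \<Longrightarrow> \<exists>i\<in>I. \<forall>x\<in>I. x \<ominus> x \<otimes> i \<in> J"

lemma left_perfect_imp_semiperfect_radical:
  assumes "left_perfect R"
  shows "semiperfect_radical R (jacobson_radical R)"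
proof -
  interpret ring R using assms by (simp add: left_perfect_def)
  have "jacobson_radical R \<subseteq> carrier R" by (auto simp: jacobson_radical_def)
  then show ?thesis
    using assms ideal_jacobson_radical left_T_nilpotent_imp left_idempotent_mod_radical
    by (intro semiperfect_radical.intro semiperfect_radical_axioms.intro ring_axioms)
      (auto simp: left_perfect_def)
qed

lemma (in ring) idempotent_in_T_nilpotent:
  assumes "T_nilpotent R J" "e \<in> J" "e \<in> carrier R" "e \<otimes> e = e"
  shows "e = \<zero>"
proof -
  obtain n where n: "seq_prod R (\<lambda>_. e) n = \<zero>" using assms(1)[unfolded T_nilpotent_def, rule_format, of "\<lambda>_. e"] assms(2) by blast
  have "e \<otimes> seq_prod R (\<lambda>_. e) n = e" for n
    using assms(3,4) by (induct n) (auto simp: m_assoc[symmetric])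
  then show ?thesis using n assms(3) by (metis r_null)
qed

lemma (in ring) nilpotent_in_T_nilpotent:
  assumes "T_nilpotent R J" "y \<in> J" "y \<in> carrier R"
  shows "\<exists>n::nat. y [^] n = \<zero>"
proof -
  obtain n where n: "seq_prod R (\<lambda>_. y) n = \<zero>" using assms(1)[unfolded T_nilpotent_def, rule_format, of "\<lambda>_. y"] assms(2) by blast
  have "seq_prod R (\<lambda>_. y) n = y [^] n" for n by (induct n) auto
  then show ?thesis using n by auto
qed

text \<open>If \<open>y = a - a\<^sup>2\<close> satisfies \<open>y\<^sup>n = 0\<close>, write \<open>1 - (1 - a)\<^sup>n = ap\<close>; then \<open>a\<^sup>n(ap) = a\<^sup>n\<close> and \<open>(ap)\<^sup>n\<close> is
  idempotent.\<close>

lemma (in ring) lift_idempotent: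
  assumes a: "a \<in> carrier R" and y: "(a \<ominus> a \<otimes> a) [^] (n::nat) = \<zero>"
  shows "\<exists>e\<in>carrier R. e \<otimes> e = e \<and> (\<exists>r\<in>carrier R. e = r \<otimes> a [^] n) \<and> a [^] n \<otimes> e = a [^] n"
proof -
  define b where "b = \<one> \<ominus> a"
  have b: "b \<in> carrier R" "a \<otimes> b = b \<otimes> a" "a \<otimes> b = a \<ominus> a \<otimes> a"
    using a by (auto simp: b_def minus_eq r_distr l_distr l_minus r_minus)
  have comm: "x \<otimes> z [^] m = z [^] m \<otimes> x" if "x \<in> carrier R" "z \<in> carrier R" "x \<otimes> z = z \<otimes> x" for x z and m :: nat
  proof (induct m)
    case (Suc m)
    have "x \<otimes> z [^] Suc m = (x \<otimes> z [^] m) \<otimes> z" using that by (simp add: m_assoc)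
    also have "\<dots> = z [^] m \<otimes> (x \<otimes> z)" unfolding Suc using that(1,2) by (simp add: m_assoc)
    also have "\<dots> = z [^] Suc m \<otimes> x" unfolding that(3) using that(1,2) by (simp add: m_assoc)
    finally show ?case .
  qed (use that in simp)
  \<comment> \<open>\<open>p\<close> is the geometric sum \<open>1 + b + ... + b^(m-1)\<close>,
    which commutes with \<open>a = 1 - b\<close>.\<close>
  have "\<exists>p\<in>carrier R. a \<otimes> p = p \<otimes> a \<and> a \<otimes> p = \<one> \<ominus> b [^] m" for m :: nat
  proof (induct m)
    case 0
    then show ?case using a by (intro bexI[of _ \<zero>]) (auto simp: minus_eq r_neg)
  next
    case (Suc m)
    then obtain p where p: "p \<in> carrier R" "a \<otimes> p = p \<otimes> a" "a \<otimes> p = \<one> \<ominus> b [^] m" by blast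
    have "b [^] Suc m = b \<otimes> b [^] m" using b(1) by (rule nat_pow_Suc2)
    also have "\<dots> = b [^] m \<ominus> a \<otimes> b [^] m" unfolding b_def using a by (simp add: minus_eq l_distr l_minus)
    finally have bs: "b [^] Suc m = b [^] m \<ominus> a \<otimes> b [^] m" .
    have "a \<otimes> (p \<oplus> b [^] m) = (\<one> \<ominus> b [^] m) \<oplus> a \<otimes> b [^] m"
      using a p(1) b(1) p(3) by (simp add: r_distr)
    also have "\<dots> = \<one> \<ominus> b [^] Suc m" unfolding bs using a b(1) by (simp add: minus_eq minus_add a_assoc)
    finally have "a \<otimes> (p \<oplus> b [^] m) = \<one> \<ominus> b [^] Suc m" .
    moreover have "a \<otimes> (p \<oplus> b [^] m) = (p \<oplus> b [^] m) \<otimes> a"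
      using a p(1,2) b(1) comm[OF a b(1,2)] by (simp add: r_distr l_distr)
    ultimately show ?case using p(1) b(1) by blast
  qed
  then obtain p where p: "p \<in> carrier R" "a \<otimes> p = p \<otimes> a" "a \<otimes> p = \<one> \<ominus> b [^] n" by blast
  have "a [^] n \<otimes> b [^] n = \<zero>" using pow_mult_distrib[OF b(2) a b(1)] y b(3) by simp
  then have an: "a [^] n \<otimes> (a \<otimes> p) = a [^] n"
    unfolding p(3) using a b(1) by (simp add: minus_eq r_distr r_minus)
  have an': "a [^] n \<otimes> (a \<otimes> p) [^] m = a [^] n" for m :: nat
  proof (induct m)
    case (Suc m)
    have "a [^] n \<otimes> (a \<otimes> p) [^] Suc m = (a [^] n \<otimes> (a \<otimes> p) [^] m) \<otimes> (a \<otimes> p)" using a p(1) by (simp add: m_assoc)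
    then show ?case unfolding Suc an .
  qed (use a in simp)
  define e where "e = (a \<otimes> p) [^] n"
  have e1: "e = a [^] n \<otimes> p [^] n" unfolding e_def using pow_mult_distrib[OF p(2) a p(1)] .
  have "a [^] n \<otimes> p [^] n = p [^] n \<otimes> a [^] n"
    using comm[OF _ a, of "p [^] n"] comm[OF a p(1,2)] a p(1) by simp
  then have e2: "e = p [^] n \<otimes> a [^] n" using e1 by simp
  have ec: "e \<in> carrier R" unfolding e_def using a p by simp
  have ae: "a [^] n \<otimes> e = a [^] n" unfolding e_def by (rule an')
  have "e \<otimes> e = p [^] n \<otimes> (a [^] n \<otimes> e)" using e2 a p(1) ec by (metis m_assoc nat_pow_closed)
  then have "e \<otimes> e = e" using ae e2 by simp
  then show ?thesis using ec ae e2 p(1) by blast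
qed

section \<open>Splitting idempotents into local ones\<close>

context semiperfect_radical
begin

sublocale J: ideal J R by (rule ideal_J)

text \<open>A right identity \<open>a\<close> of \<open>Rx\<close> modulo \<open>J\<close> is
  idempotent modulo \<open>J\<close>, and it lifts to an idempotent \<open>e = s a^(n+1)\<close>,
  which is a multiple of \<open>x\<close> because \<open>a\<close> is. It is nonzero, since
  \<open>a\<close> is congruent to \<open>a^(n+1)\<close> modulo \<open>J\<close> but lies outside
  \<open>J\<close>.\<close>

lemma idempotent_in_left_multiples:
  assumes x: "x \<in> carrier R" "x \<notin> J"
  shows "\<exists>h\<in>carrier R. h \<otimes> h = h \<and> h \<noteq> \<zero> \<and> (\<exists>r\<in>carrier R. h = r \<otimes> x)"
proof -
  have xI: "x \<in> PIdl x" unfolding cgenideal_def using x by (auto intro!: exI[of _ \<one>])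
  obtain a where a: "a \<in> PIdl x" "\<And>z. z \<in> PIdl x \<Longrightarrow> z \<ominus> z \<otimes> a \<in> J"
    using idempotent_mod[OF left_ideal_PIdl[OF x(1)]] by blast
  then obtain r where r: "r \<in> carrier R" "a = r \<otimes> x" unfolding cgenideal_def by blast
  have ac: "a \<in> carrier R" using r x by simp
  have ya: "a \<ominus> a \<otimes> a \<in> J" by (rule a(2)[OF a(1)])
  have xa: "x \<ominus> x \<otimes> a \<in> J" by (rule a(2)[OF xI])
  have aJ: "a \<notin> J"
  proof
    assume "a \<in> J"
    then have "(x \<ominus> x \<otimes> a) \<oplus> x \<otimes> a \<in> J" using xa x J.I_l_closed J.a_closed by blast
    then show False using x ac by (simp add: minus_eq a_assoc l_neg)
  qed
  obtain n :: nat where n: "(a \<ominus> a \<otimes> a) [^] n = \<zero>"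
    using nilpotent_in_T_nilpotent[OF T_nil ya] ac by auto
  \<comment> \<open>With the exponent raised to \<open>Suc n\<close> the power surely ends in a
    factor \<open>a = rx\<close>.\<close>
  then have n': "(a \<ominus> a \<otimes> a) [^] Suc n = \<zero>" using ac by simp
  obtain e s where e: "e \<in> carrier R" "e \<otimes> e = e" "s \<in> carrier R" "e = s \<otimes> a [^] Suc n" "a [^] Suc n \<otimes> e = a [^] Suc n"
    using lift_idempotent[OF ac n'] by blast
  have am: "a \<ominus> a [^] Suc m \<in> J" for m
  proof (induct m)
    case 0
    then show ?case using ac by (simp add: minus_eq r_neg)
  next
    case (Suc m)
    have "(a \<ominus> a [^] Suc m) \<otimes> a \<in> J" using Suc ac J.I_r_closed by blast
    then have "(a \<ominus> a \<otimes> a) \<oplus> (a \<ominus> a [^] Suc m) \<otimes> a \<in> J" using ya J.a_closed by blast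
    also have "(a \<ominus> a \<otimes> a) \<oplus> (a \<ominus> a [^] Suc m) \<otimes> a = a \<ominus> a [^] Suc (Suc m)"
      using ac by (simp add: minus_eq l_distr l_minus a_assoc r_neg1 r_neg2)
    finally show ?case .
  qed
  have "e \<noteq> \<zero>"
  proof
    assume "e = \<zero>"
    then have "a [^] Suc n = \<zero>" using e(5) ac by (metis nat_pow_closed r_null)
    then have "a \<in> J" using am[of n] ac by (simp add: minus_eq)
    then show False using aJ by simp
  qed
  moreover have "e = (s \<otimes> a [^] n \<otimes> r) \<otimes> x"
  proof -
    have "e = s \<otimes> (a [^] n \<otimes> a)" using e(4) by simp
    also have "\<dots> = s \<otimes> (a [^] n \<otimes> (r \<otimes> x))" using r(2) by simp
    finally show ?thesis using e(3) ac r(1) x(1) by (simp add: m_assoc)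
  qed
  ultimately show ?thesis using e r(1) ac by blast
qed

text \<open>Along a strictly descending sequence the left annihilators of the \<open>s n\<close>
  increase to a left ideal \<open>I\<close>. A right identity \<open>i\<close> of \<open>I\<close>
  modulo \<open>J\<close> satisfies \<open>i \<otimes> s N = 0\<close> for some \<open>N\<close>. As
  \<open>x = 1 - s (N+1)\<close> belongs to \<open>I\<close>, multiplying \<open>x - xi\<close> by
  \<open>s N\<close> shows that the idempotent \<open>s N - s (N+1)\<close> is in \<open>J\<close>,
  hence zero.\<close>

lemma wf_idempotents:
  "wf {(f, e). e \<in> carrier R \<and> f \<in> carrier R \<and> e \<otimes> e = e \<and> f \<otimes> f = f \<and> e \<otimes> f = f \<and> f \<otimes> e = f \<and> f \<noteq> e}"
  (is "wf ?rel")
proof (rule ccontr)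
  assume "\<not> wf ?rel"
  then obtain s where s: "\<And>i. (s (Suc i), s i) \<in> ?rel"
    unfolding wf_iff_no_infinite_down_chain by blast
  have sc: "s i \<in> carrier R" "s i \<otimes> s i = s i" "s i \<otimes> s (Suc i) = s (Suc i)" "s (Suc i) \<otimes> s i = s (Suc i)"
    "s (Suc i) \<noteq> s i" for i using s[of i] by auto
  define I where "I = {z \<in> carrier R. \<exists>n. z \<otimes> s n = \<zero>}"
  have up: "z \<otimes> s m = \<zero>" if z: "z \<in> carrier R" "z \<otimes> s n = \<zero>" "n \<le> m" for z n m
    using z(3)
  proof (induct m rule: dec_induct)
    case (step m)
    have "z \<otimes> s (Suc m) = (z \<otimes> s m) \<otimes> s (Suc m)" using z(1) sc by (simp add: m_assoc)
    then show ?case using step sc by simp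
  qed (use z in simp)
  have "left_ideal I R"
  proof (rule left_idealI)
    show "I \<subseteq> carrier R" by (auto simp: I_def)
    show "\<zero> \<in> I" using sc(1) by (auto simp: I_def)
    show "x \<oplus> y \<in> I" if xy: "x \<in> I" "y \<in> I" for x y
    proof -
      obtain n m where nm: "x \<otimes> s n = \<zero>" "y \<otimes> s m = \<zero>" "x \<in> carrier R" "y \<in> carrier R" using xy by (auto simp: I_def)
      have "x \<otimes> s (max n m) = \<zero>" "y \<otimes> s (max n m) = \<zero>" using nm up by auto
      then have "(x \<oplus> y) \<otimes> s (max n m) = \<zero>" using nm sc(1) by (simp add: l_distr)
      then show ?thesis using nm by (auto simp: I_def)
    qed
    show "r \<otimes> x \<in> I" if rx: "r \<in> carrier R" "x \<in> I" for r x
    proof -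
      obtain n where n: "x \<in> carrier R" "x \<otimes> s n = \<zero>" using rx by (auto simp: I_def)
      then have "(r \<otimes> x) \<otimes> s n = \<zero>" using rx sc(1) by (simp add: m_assoc)
      then show ?thesis using n rx by (auto simp: I_def)
    qed
  qed
  then obtain i where i: "i \<in> I" "\<And>x. x \<in> I \<Longrightarrow> x \<ominus> x \<otimes> i \<in> J" using idempotent_mod by blast
  then obtain N where N: "i \<in> carrier R" "i \<otimes> s N = \<zero>" by (auto simp: I_def)
  define x where "x = \<one> \<ominus> s (Suc N)"
  have xc: "x \<in> carrier R" using sc(1) by (simp add: x_def)
  have "x \<otimes> s (Suc N) = \<zero>" unfolding x_def using sc(1,2) by (simp add: minus_eq l_distr l_minus r_neg)
  then have "x \<in> I" using xc by (auto simp: I_def)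
  then have "(x \<ominus> x \<otimes> i) \<otimes> s N \<in> J" using i(2) sc(1) J.I_r_closed by blast
  also have "(x \<ominus> x \<otimes> i) \<otimes> s N = x \<otimes> s N"
    using xc N sc(1) by (simp add: minus_eq l_distr l_minus m_assoc)
  also have "\<dots> = s N \<ominus> s (Suc N)" unfolding x_def using sc by (simp add: minus_eq l_distr l_minus)
  finally have dJ: "s N \<ominus> s (Suc N) \<in> J" .
  have "(s N \<ominus> s (Suc N)) \<otimes> (s N \<ominus> s (Suc N)) = s N \<ominus> s (Suc N)"
    using sc by (simp add: minus_eq l_distr r_distr l_minus r_minus a_assoc r_neg l_neg)
  then have "s N \<ominus> s (Suc N) = \<zero>" using idempotent_in_T_nilpotent[OF T_nil dJ] sc(1) by simp
  then have "s N = s (Suc N)" using sc(1)[of N] sc(1)[of "Suc N"]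
    by (metis a_inv_closed add.inv_equality minus_eq minus_minus)
  then show False using sc(5)[of N] by simp
qed

text \<open>Local relative to \<open>J\<close>, and with left inverses only; that these are
  two-sided is the content of \<open>corner_unit_iff\<close>.\<close>

definition local_idempotent :: "'a \<Rightarrow> bool" where
  "local_idempotent e \<longleftrightarrow> e \<in> carrier R \<and> e \<otimes> e = e \<and> e \<noteq> \<zero> \<and>
    (\<forall>x\<in>carrier (corner R e). x \<notin> J \<longrightarrow> (\<exists>y\<in>carrier (corner R e). y \<otimes> x = e))"

text \<open>An \<open>x\<close> in \<open>eRe\<close> outside \<open>J\<close> without left inverse
  there has a nonzero idempotent multiple \<open>h = rx\<close>, and \<open>he = h\<close>. Then
  \<open>g = eh\<close> is an idempotent of \<open>eRe\<close>, nonzero because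
  \<open>hg = h\<close>; and \<open>g = e\<close> would make \<open>ere\<close> a left inverse of
  \<open>x\<close>.\<close>

lemma split_idempotent:
  assumes e: "e \<in> carrier R" "e \<otimes> e = e" "e \<noteq> \<zero>" "\<not> local_idempotent e"
  shows "\<exists>h\<in>carrier R. h \<otimes> h = h \<and> e \<otimes> h = h \<and> h \<otimes> e = h \<and> h \<noteq> \<zero> \<and> h \<noteq> e"
proof -
  obtain x where x: "x \<in> carrier R" "e \<otimes> x = x" "x \<otimes> e = x" "x \<notin> J"
    and no: "\<And>y. y \<in> carrier (corner R e) \<Longrightarrow> y \<otimes> x \<noteq> e"
    using e unfolding local_idempotent_def by auto
  obtain h r where h: "h \<in> carrier R" "h \<otimes> h = h" "h \<noteq> \<zero>" "r \<in> carrier R" "h = r \<otimes> x"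
    using idempotent_in_left_multiples[OF x(1,4)] by blast
  have he: "h \<otimes> e = h" using h(5) m_assoc[OF h(4) x(1) e(1)] x(3) by simp
  define g where "g = e \<otimes> h"
  have gc: "g \<in> carrier R" using e h by (simp add: g_def)
  have "h \<otimes> g = (h \<otimes> e) \<otimes> h" unfolding g_def using e h(1) by (simp add: m_assoc)
  then have hg: "h \<otimes> g = h" using he h(2) by simp
  have gg: "g \<otimes> g = g"
  proof -
    have "g \<otimes> g = e \<otimes> (h \<otimes> g)" using e h(1) gc by (simp add: g_def m_assoc)
    then show ?thesis unfolding hg by (simp add: g_def)
  qed
  have eg: "e \<otimes> g = g" unfolding g_def using e h(1) by (simp add: m_assoc[symmetric])
  have ge: "g \<otimes> e = g" unfolding g_def using e h(1) he by (simp add: m_assoc)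
  have "g \<noteq> \<zero>" using hg h(1,3) by auto
  moreover have "g \<noteq> e"
  proof
    assume "g = e"
    then have "(e \<otimes> r \<otimes> e) \<otimes> x = e" using h(5) e(1,2) h(4) x(1,2) by (simp add: g_def m_assoc)
    moreover have "e \<otimes> r \<otimes> e \<in> carrier (corner R e)"
      using e(1,2) h(4) by (simp add: m_assoc) (simp add: m_assoc[symmetric])
    ultimately show False using no by blast
  qed
  ultimately show ?thesis using gc gg eg ge by blast
qed

text \<open>A nonzero \<open>e\<close> that is not local is split into \<open>h\<close> and
  \<open>e - h\<close>, both smaller in the relation of \<open>wf_idempotents\<close>. The pieces
  can be kept as a set, since one common to both parts would be orthogonal to itself.\<close>

lemma local_idempotent_decomposition:
  assumes "e \<in> carrier R" "e \<otimes> e = e"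
  shows "\<exists>E. finite E \<and> (\<forall>p\<in>E. local_idempotent p \<and> e \<otimes> p = p \<and> p \<otimes> e = p) \<and>
     (\<forall>p\<in>E. \<forall>q\<in>E. p \<noteq> q \<longrightarrow> p \<otimes> q = \<zero>) \<and> (\<Oplus>p\<in>E. p) = e"
  using wf_idempotents assms
proof (induct e rule: wf_induct_rule)
  case (less e)
  note e = less.prems
  show ?case
  proof (cases "e = \<zero> \<or> local_idempotent e")
    case True
    then show ?thesis
    proof
      assume "e = \<zero>"
      then show ?thesis by (intro exI[of _ "{}"]) auto
    next
      assume "local_idempotent e"
      then show ?thesis using e by (intro exI[of _ "{e}"]) auto
    qed
  next
    case False
    then obtain h where h: "h \<in> carrier R" "h \<otimes> h = h" "e \<otimes> h = h" "h \<otimes> e = h" "h \<noteq> \<zero>" "h \<noteq> e"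
      using split_idempotent e by blast
    define g where "g = e \<ominus> h"
    have g: "g \<in> carrier R" "g \<otimes> g = g" "e \<otimes> g = g" "g \<otimes> e = g" "g \<otimes> h = \<zero>" "h \<otimes> g = \<zero>"
      unfolding g_def using e h by (auto simp: minus_eq l_distr r_distr l_minus r_minus a_assoc r_neg l_neg)
    have "g \<noteq> e"
    proof
      assume "g = e"
      then have "e \<otimes> h = \<zero>" using g(5) by simp
      then show False using h by simp
    qed
    have geh: "h \<oplus> g = e" unfolding g_def using e h(1) by (simp add: minus_eq a_lcomm r_neg)
    have IHh: "\<exists>E. finite E \<and> (\<forall>p\<in>E. local_idempotent p \<and> h \<otimes> p = p \<and> p \<otimes> h = p) \<and>
     (\<forall>p\<in>E. \<forall>q\<in>E. p \<noteq> q \<longrightarrow> p \<otimes> q = \<zero>) \<and> (\<Oplus>p\<in>E. p) = h"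
      by (rule less.hyps) (use e h in auto)
    have IHg: "\<exists>E. finite E \<and> (\<forall>p\<in>E. local_idempotent p \<and> g \<otimes> p = p \<and> p \<otimes> g = p) \<and>
     (\<forall>p\<in>E. \<forall>q\<in>E. p \<noteq> q \<longrightarrow> p \<otimes> q = \<zero>) \<and> (\<Oplus>p\<in>E. p) = g"
      by (rule less.hyps) (use e g \<open>g \<noteq> e\<close> in auto)
    obtain E1 where E1: "finite E1" "\<And>p. p \<in> E1 \<Longrightarrow> local_idempotent p" "\<And>p. p \<in> E1 \<Longrightarrow> h \<otimes> p = p"
      "\<And>p. p \<in> E1 \<Longrightarrow> p \<otimes> h = p" "\<And>p q. p \<in> E1 \<Longrightarrow> q \<in> E1 \<Longrightarrow> p \<noteq> q \<Longrightarrow> p \<otimes> q = \<zero>" "(\<Oplus>p\<in>E1. p) = h"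
      using IHh by blast
    obtain E2 where E2: "finite E2" "\<And>p. p \<in> E2 \<Longrightarrow> local_idempotent p" "\<And>p. p \<in> E2 \<Longrightarrow> g \<otimes> p = p"
      "\<And>p. p \<in> E2 \<Longrightarrow> p \<otimes> g = p" "\<And>p q. p \<in> E2 \<Longrightarrow> q \<in> E2 \<Longrightarrow> p \<noteq> q \<Longrightarrow> p \<otimes> q = \<zero>" "(\<Oplus>p\<in>E2. p) = g"
      using IHg by blast
    have c1: "p \<in> carrier R" "p \<noteq> \<zero>" if "p \<in> E1" for p using E1(2)[OF that] by (auto simp: local_idempotent_def)
    have c2: "p \<in> carrier R" "p \<noteq> \<zero>" if "p \<in> E2" for p using E2(2)[OF that] by (auto simp: local_idempotent_def)
    have o12: "p \<otimes> q = \<zero>" if "p \<in> E1" "q \<in> E2" for p q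
    proof -
      have "p \<otimes> q = (p \<otimes> h) \<otimes> (g \<otimes> q)" using E1(4) E2(3) that by simp
      also have "\<dots> = p \<otimes> (h \<otimes> g) \<otimes> q" using c1 c2 that h(1) g(1) by (simp add: m_assoc)
      finally show ?thesis using c1 c2 that g by simp
    qed
    have o21: "q \<otimes> p = \<zero>" if "p \<in> E1" "q \<in> E2" for p q
    proof -
      have "q \<otimes> p = (q \<otimes> g) \<otimes> (h \<otimes> p)" using E1(3) E2(4) that by simp
      also have "\<dots> = q \<otimes> (g \<otimes> h) \<otimes> p" using c1 c2 that h(1) g(1) by (simp add: m_assoc)
      finally show ?thesis using c1 c2 that g by simp
    qed
    have disj: "E1 \<inter> E2 = {}"
    proof (rule ccontr)
      assume "E1 \<inter> E2 \<noteq> {}"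
      then obtain p where p: "p \<in> E1" "p \<in> E2" by blast
      then have "p \<otimes> p = \<zero>" using o12 by blast
      moreover have "p \<otimes> p = p" using E1(2)[OF p(1)] by (simp add: local_idempotent_def)
      ultimately show False using c1[OF p(1)] by simp
    qed
    have sum: "(\<Oplus>p\<in>E1 \<union> E2. p) = e"
      using finsum_Un_disjoint[OF E1(1) E2(1) disj, of "\<lambda>p. p"] c1 c2 E1(6) E2(6) geh by auto
    have "local_idempotent p \<and> e \<otimes> p = p \<and> p \<otimes> e = p" if "p \<in> E1 \<union> E2" for p
      using that
    proof
      assume p: "p \<in> E1"
      have "e \<otimes> p = (e \<otimes> h) \<otimes> p" using m_assoc[OF e(1) h(1) c1(1)[OF p]] E1(3)[OF p] by simp
      moreover have "p \<otimes> e = p \<otimes> (h \<otimes> e)" using m_assoc[OF c1(1)[OF p] h(1) e(1)] E1(4)[OF p] by simp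
      ultimately show ?thesis using E1 p h by simp
    next
      assume p: "p \<in> E2"
      have "e \<otimes> p = (e \<otimes> g) \<otimes> p" using m_assoc[OF e(1) g(1) c2(1)[OF p]] E2(3)[OF p] by simp
      moreover have "p \<otimes> e = p \<otimes> (g \<otimes> e)" using m_assoc[OF c2(1)[OF p] g(1) e(1)] E2(4)[OF p] by simp
      ultimately show ?thesis using E2 p g by simp
    qed
    moreover have "p \<otimes> q = \<zero>" if "p \<in> E1 \<union> E2" "q \<in> E1 \<union> E2" "p \<noteq> q" for p q
      using that E1(5) E2(5) o12 o21 by blast
    ultimately show ?thesis using E1(1) E2(1) sum by (intro exI[of _ "E1 \<union> E2"]) auto
  qed
qed

end

section \<open>Local idempotents in a morphic ring\<close>

text \<open>To \<open>a\<close> in \<open>eRe\<close> add \<open>f = 1 - e\<close>. The partner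
  \<open>b\<close> of \<open>a + f\<close> automatically lies in \<open>eRe\<close>: on one side
  \<open>bf = b(a + f)f = 0\<close>, on the other \<open>f = f(a + f)\<close> is a left multiple of
  \<open>a + f\<close>, so \<open>fb = 0\<close>.\<close>

lemma left_morphic_corner:
  assumes R: "ring R" and lm: "left_morphic R" and e: "e \<in> carrier R" "e \<otimes>\<^bsub>R\<^esub> e = e"
  shows "left_morphic (corner R e)"
  unfolding left_morphic_iff[OF ring_corner[OF R e]]
proof
  interpret ring R by fact
  fix a assume "a \<in> carrier (corner R e)"
  then have a: "a \<in> carrier R" "e \<otimes>\<^bsub>R\<^esub> a = a" "a \<otimes>\<^bsub>R\<^esub> e = a" by auto
  define f where "f = \<one>\<^bsub>R\<^esub> \<ominus>\<^bsub>R\<^esub> e"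
  have f: "f \<in> carrier R" "f \<otimes>\<^bsub>R\<^esub> f = f" "f \<otimes>\<^bsub>R\<^esub> a = \<zero>\<^bsub>R\<^esub>" "a \<otimes>\<^bsub>R\<^esub> f = \<zero>\<^bsub>R\<^esub>" "f \<otimes>\<^bsub>R\<^esub> e = \<zero>\<^bsub>R\<^esub>"
    unfolding f_def using e a by (simp_all add: minus_eq l_distr r_distr l_minus r_minus r_neg l_neg a_assoc)
  define a' where "a' = a \<oplus>\<^bsub>R\<^esub> f"
  have a': "a' \<in> carrier R" "a' \<otimes>\<^bsub>R\<^esub> f = f" "f \<otimes>\<^bsub>R\<^esub> a' = f" "a' \<otimes>\<^bsub>R\<^esub> e = a"
    unfolding a'_def using a f e by (simp_all add: l_distr r_distr)
  obtain b where b: "b \<in> carrier R"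
    and ba: "\<And>x. x \<in> carrier R \<Longrightarrow> x \<otimes>\<^bsub>R\<^esub> a' = \<zero>\<^bsub>R\<^esub> \<longleftrightarrow> (\<exists>y\<in>carrier R. x = y \<otimes>\<^bsub>R\<^esub> b)"
    and ab: "\<And>x. x \<in> carrier R \<Longrightarrow> x \<otimes>\<^bsub>R\<^esub> b = \<zero>\<^bsub>R\<^esub> \<longleftrightarrow> (\<exists>y\<in>carrier R. x = y \<otimes>\<^bsub>R\<^esub> a')"
    using lm[unfolded left_morphic_iff[OF R], rule_format, OF a'(1)] by auto
  have "b \<otimes>\<^bsub>R\<^esub> a' = \<zero>\<^bsub>R\<^esub>" using ba[OF b] l_one[OF b] one_closed by metis
  then have "b \<otimes>\<^bsub>R\<^esub> f = \<zero>\<^bsub>R\<^esub>" using m_assoc[OF b a'(1) f(1)] a'(2) f(1) by simp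
  moreover have "e \<oplus>\<^bsub>R\<^esub> f = \<one>\<^bsub>R\<^esub>"
    unfolding f_def using e a_lcomm[OF e(1) one_closed a_inv_closed[OF e(1)]] by (simp add: minus_eq r_neg)
  ultimately have be: "b \<otimes>\<^bsub>R\<^esub> e = b" using r_distr[OF e(1) f(1) b] b e by simp
  have "f \<otimes>\<^bsub>R\<^esub> b = \<zero>\<^bsub>R\<^esub>" using ab[OF f(1)] a'(3) f(1) by metis
  then have eb: "e \<otimes>\<^bsub>R\<^esub> b = b" using l_distr[OF e(1) f(1) b] b e \<open>e \<oplus>\<^bsub>R\<^esub> f = \<one>\<^bsub>R\<^esub>\<close> by simp
  \<comment> \<open>For \<open>x\<close> in \<open>eRe\<close>, being a multiple of \<open>u\<close>
    in \<open>R\<close> is the same as being a multiple of \<open>u \<otimes> e\<close> in the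
    corner. This is applied to \<open>u = b\<close> and to \<open>u = a + f\<close>.\<close>
  have key: "(\<exists>y\<in>carrier R. x = y \<otimes>\<^bsub>R\<^esub> u) \<longleftrightarrow> (\<exists>y\<in>carrier (corner R e). x = y \<otimes>\<^bsub>R\<^esub> (u \<otimes>\<^bsub>R\<^esub> e))"
    if x: "x \<in> carrier (corner R e)" and u: "u \<in> carrier R" "e \<otimes>\<^bsub>R\<^esub> (u \<otimes>\<^bsub>R\<^esub> e) = u \<otimes>\<^bsub>R\<^esub> e" "e \<otimes>\<^bsub>R\<^esub> u = u \<otimes>\<^bsub>R\<^esub> e" for x u
  proof
    assume "\<exists>y\<in>carrier R. x = y \<otimes>\<^bsub>R\<^esub> u"
    then obtain y where y: "y \<in> carrier R" "x = y \<otimes>\<^bsub>R\<^esub> u" by blast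
    have "x = e \<otimes>\<^bsub>R\<^esub> (y \<otimes>\<^bsub>R\<^esub> u) \<otimes>\<^bsub>R\<^esub> e" using x y(2) by simp
    also have "\<dots> = e \<otimes>\<^bsub>R\<^esub> y \<otimes>\<^bsub>R\<^esub> (e \<otimes>\<^bsub>R\<^esub> (u \<otimes>\<^bsub>R\<^esub> e))" using u(1,2) y(1) e by (simp add: m_assoc)
    also have "\<dots> = (e \<otimes>\<^bsub>R\<^esub> y \<otimes>\<^bsub>R\<^esub> e) \<otimes>\<^bsub>R\<^esub> (u \<otimes>\<^bsub>R\<^esub> e)" using u(1) y(1) e by (simp add: m_assoc)
    finally have "x = (e \<otimes>\<^bsub>R\<^esub> y \<otimes>\<^bsub>R\<^esub> e) \<otimes>\<^bsub>R\<^esub> (u \<otimes>\<^bsub>R\<^esub> e)" .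
    moreover have "e \<otimes>\<^bsub>R\<^esub> y \<otimes>\<^bsub>R\<^esub> e \<in> carrier (corner R e)"
      using y(1) e by (simp add: m_assoc) (simp add: m_assoc[symmetric])
    ultimately show "\<exists>y\<in>carrier (corner R e). x = y \<otimes>\<^bsub>R\<^esub> (u \<otimes>\<^bsub>R\<^esub> e)" by blast
  next
    assume "\<exists>y\<in>carrier (corner R e). x = y \<otimes>\<^bsub>R\<^esub> (u \<otimes>\<^bsub>R\<^esub> e)"
    then obtain y where y: "y \<in> carrier R" "y \<otimes>\<^bsub>R\<^esub> e = y" "x = y \<otimes>\<^bsub>R\<^esub> (u \<otimes>\<^bsub>R\<^esub> e)" by auto
    have "x = (y \<otimes>\<^bsub>R\<^esub> e) \<otimes>\<^bsub>R\<^esub> u" unfolding y(3) u(3)[symmetric] using y(1) u(1) e by (simp add: m_assoc)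
    then show "\<exists>y\<in>carrier R. x = y \<otimes>\<^bsub>R\<^esub> u" using y by auto
  qed
  have ea': "e \<otimes>\<^bsub>R\<^esub> a' = a" unfolding a'_def f_def using a e by (simp add: r_distr minus_eq r_minus r_neg)
  have "(x \<otimes>\<^bsub>R\<^esub> a = \<zero>\<^bsub>R\<^esub> \<longleftrightarrow> (\<exists>y\<in>carrier (corner R e). x = y \<otimes>\<^bsub>R\<^esub> b)) \<and>
      (x \<otimes>\<^bsub>R\<^esub> b = \<zero>\<^bsub>R\<^esub> \<longleftrightarrow> (\<exists>y\<in>carrier (corner R e). x = y \<otimes>\<^bsub>R\<^esub> a))"
    if x: "x \<in> carrier (corner R e)" for x
  proof -
    have xc: "x \<in> carrier R" "x \<otimes>\<^bsub>R\<^esub> e = x" using x by auto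
    have "x \<otimes>\<^bsub>R\<^esub> a' = x \<otimes>\<^bsub>R\<^esub> e \<otimes>\<^bsub>R\<^esub> a'" using xc by simp
    also have "\<dots> = x \<otimes>\<^bsub>R\<^esub> a" using xc(1) e a'(1) ea' by (simp add: m_assoc)
    finally have "x \<otimes>\<^bsub>R\<^esub> a' = x \<otimes>\<^bsub>R\<^esub> a" .
    then show ?thesis
      using ba[OF xc(1)] ab[OF xc(1)] key[OF x b] key[OF x a'(1)] be eb a'(4) ea' a by simp
  qed
  moreover have "b \<in> carrier (corner R e)" using b be eb by simp
  ultimately show "\<exists>b\<in>carrier (corner R e). \<forall>x\<in>carrier (corner R e).
      (x \<otimes>\<^bsub>corner R e\<^esub> a = \<zero>\<^bsub>corner R e\<^esub> \<longleftrightarrow> (\<exists>y\<in>carrier (corner R e). x = y \<otimes>\<^bsub>corner R e\<^esub> b)) \<and>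
      (x \<otimes>\<^bsub>corner R e\<^esub> b = \<zero>\<^bsub>corner R e\<^esub> \<longleftrightarrow> (\<exists>y\<in>carrier (corner R e). x = y \<otimes>\<^bsub>corner R e\<^esub> a))"
    unfolding corner_simps(2,4) by blast
qed

text \<open>Formulated for a T-nilpotent ideal \<open>J\<close>, so that one development serves both
  \<open>R\<close> with its radical and \<open>R \<propto> M\<close> with
  \<open>J \<times> M\<close>.\<close>

locale local_idempotents = ring R for R (structure) +
  fixes J E :: "'a set"
  assumes ideal_J: "ideal J R"
    and T_nil: "T_nilpotent R J"
    and finite_E: "finite E"
    and E_carrier: "e \<in> E \<Longrightarrow> e \<in> carrier R"
    and E_idem: "e \<in> E \<Longrightarrow> e \<otimes> e = e"
    and E_nonzero: "e \<in> E \<Longrightarrow> e \<noteq> \<zero>"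
    and E_local: "\<lbrakk>e \<in> E; x \<in> carrier (corner R e); x \<notin> J\<rbrakk> \<Longrightarrow> \<exists>y\<in>carrier (corner R e). y \<otimes> x = e"
    and E_orth: "\<lbrakk>e \<in> E; f \<in> E; e \<noteq> f\<rbrakk> \<Longrightarrow> e \<otimes> f = \<zero>"
    and E_sum: "(\<Oplus>e\<in>E. e) = \<one>"
begin

sublocale J: ideal J R by (rule ideal_J)

lemma E_not_in_J: "e \<in> E \<Longrightarrow> e \<notin> J"
  using idempotent_in_T_nilpotent[OF T_nil _ E_carrier E_idem] E_nonzero by blast

lemma ring_corner_E: "e \<in> E \<Longrightarrow> ring (corner R e)"
  by (rule ring_corner[OF ring_axioms E_carrier E_idem])

text \<open>The left inverse of an element outside \<open>J\<close> is itself outside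
  \<open>J\<close> and so has a left inverse too, which makes both of them units.\<close>

lemma corner_unit_iff:
  assumes e: "e \<in> E" and x: "x \<in> carrier (corner R e)"
  shows "x \<in> Units (corner R e) \<longleftrightarrow> x \<notin> J"
proof
  interpret T: ring "corner R e" by (rule ring_corner_E[OF e])
  assume "x \<in> Units (corner R e)"
  then obtain y where y: "y \<in> carrier (corner R e)" "y \<otimes> x = e" by (auto simp: Units_def)
  show "x \<notin> J"
  proof
    assume "x \<in> J"
    then have "y \<otimes> x \<in> J" using y(1) by (intro J.I_l_closed) auto
    then show False using y(2) E_not_in_J[OF e] by simp
  qed
next
  assume xJ: "x \<notin> J"
  obtain y where y: "y \<in> carrier (corner R e)" "y \<otimes> x = e" using E_local[OF e x xJ] by blast
  have "y \<notin> J"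
  proof
    assume "y \<in> J"
    then have "y \<otimes> x \<in> J" using x by (intro J.I_r_closed) auto
    then show False using y(2) E_not_in_J[OF e] by simp
  qed
  then obtain z where z: "z \<in> carrier (corner R e)" "z \<otimes> y = e" using E_local[OF e y(1)] by blast
  have "z = z \<otimes> (y \<otimes> x)" unfolding y(2) using z by simp
  also have "\<dots> = (z \<otimes> y) \<otimes> x" using x y(1) z(1) by (simp add: m_assoc)
  also have "\<dots> = x" unfolding z(2) using x by simp
  finally show "x \<in> Units (corner R e)" using x y z by (auto simp: Units_def)
qed

text \<open>Otherwise every nonzero \<open>x\<close> of \<open>eRe\<close> admits a \<open>j\<close>
  in \<open>J\<close> and \<open>eRe\<close> with \<open>xj \<noteq> 0\<close>, and iterating from
  \<open>e\<close> produces products that never vanish. The factors are appended on the right, which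
  is the orientation that left T-nilpotence controls.\<close>

lemma corner_right_socle:
  assumes e: "e \<in> E"
  shows "\<exists>x\<in>carrier (corner R e). x \<noteq> \<zero> \<and> (\<forall>j\<in>carrier (corner R e) \<inter> J. x \<otimes> j = \<zero>)"
proof (rule ccontr)
  assume "\<not> ?thesis"
  then have "\<forall>x\<in>carrier (corner R e) - {\<zero>}. \<exists>j. j \<in> carrier (corner R e) \<inter> J \<and> x \<otimes> j \<noteq> \<zero>" by blast
  from bchoice[OF this] obtain F where F0: "\<forall>x\<in>carrier (corner R e) - {\<zero>}.
      F x \<in> carrier (corner R e) \<inter> J \<and> x \<otimes> F x \<noteq> \<zero>" by (elim exE)
  then have F: "F x \<in> carrier (corner R e)" "F x \<in> J" "x \<otimes> F x \<noteq> \<zero>"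
    if "x \<in> carrier (corner R e)" "x \<noteq> \<zero>" for x using that by auto
  interpret T: ring "corner R e" by (rule ring_corner_E[OF e])
  define s where "s = rec_nat e (\<lambda>_ x. x \<otimes> F x)"
  have s0: "s 0 = e" and sS: "\<And>n. s (Suc n) = s n \<otimes> F (s n)" by (simp_all add: s_def)
  have sc: "s n \<in> carrier (corner R e) \<and> s n \<noteq> \<zero>" for n
  proof (induct n)
    case 0
    then show ?case using E_carrier[OF e] E_idem[OF e] E_nonzero[OF e] by (simp add: s0)
  next
    case (Suc n)
    then show ?case using F[of "s n"] T.m_closed[of "s n" "F (s n)"] unfolding sS corner_simps(2) by blast
  qed
  have "\<forall>n. F (s n) \<in> J" using sc F(2) by blast
  then obtain n where n: "seq_prod R (\<lambda>n. F (s n)) n = \<zero>"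
    using T_nil[unfolded T_nilpotent_def, rule_format, of "\<lambda>n. F (s n)"] by blast
  have Fc: "F (s i) \<in> carrier R" for i using F(1)[of "s i"] sc[of i] by simp
  have "e \<otimes> seq_prod R (\<lambda>n. F (s n)) n = s n" for n
  proof (induct n)
    case 0
    then show ?case using E_carrier[OF e] by (simp add: s0)
  next
    case (Suc n)
    have "e \<otimes> seq_prod R (\<lambda>n. F (s n)) (Suc n) = (e \<otimes> seq_prod R (\<lambda>n. F (s n)) n) \<otimes> F (s n)"
      using Fc E_carrier[OF e] by (simp add: m_assoc)
    then show ?case unfolding Suc sS .
  qed
  then have "s n = \<zero>" using n E_carrier[OF e] by (metis r_null)
  then show False using sc by blast
qed

text \<open>The right annihilator of the socle element \<open>x\<close> is the radical of the corner
  \<open>T\<close>, so the right morphic condition writes the radical as \<open>cT\<close>. For the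
  last nonzero power \<open>w\<close> of \<open>c\<close> the left annihilator is again the radical,
  because a radical element times \<open>c^l\<close> lies in \<open>c^(l+1) T\<close>; the left
  morphic condition then writes it as \<open>Td\<close>.\<close>

lemma corner_uniformizer:
  assumes e: "e \<in> E" and lm: "left_morphic R" and rm: "left_morphic (opposite_ring R)"
  shows "\<exists>c. uniformizer (corner R e) c"
proof -
  let ?T = "corner R e"
  interpret T: ring ?T by (rule ring_corner_E[OF e])
  interpret O: ring "opposite_ring R" by (simp add: ring_axioms)
  note ec = E_carrier[OF e] E_idem[OF e]
  have lmT: "left_morphic ?T" by (rule left_morphic_corner[OF ring_axioms lm ec])
  have rmT: "left_morphic (opposite_ring ?T)"
    unfolding opposite_ring_corner by (rule left_morphic_corner[OF O.ring_axioms rm]) (use ec in simp_all)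
  obtain x where x: "x \<in> carrier ?T" "x \<noteq> \<zero>" "\<And>j. j \<in> carrier ?T \<Longrightarrow> j \<in> J \<Longrightarrow> x \<otimes> j = \<zero>"
    using corner_right_socle[OF e] by blast
  have oT: "ring (opposite_ring ?T)" using T.ring_axioms by simp
  have "\<exists>c\<in>carrier ?T. \<forall>z\<in>carrier ?T. x \<otimes> z = \<zero> \<longleftrightarrow> (\<exists>y\<in>carrier ?T. z = c \<otimes> y)"
    using rmT[unfolded left_morphic_iff[OF oT], rule_format, of x] x(1) unfolding opposite_ring_simps corner_simps(2,4) by blast
  then obtain c where c: "c \<in> carrier ?T" "\<And>z. z \<in> carrier ?T \<Longrightarrow> x \<otimes> z = \<zero> \<longleftrightarrow> (\<exists>y\<in>carrier ?T. z = c \<otimes> y)"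
    by blast
  have xz: "x \<otimes> z = \<zero> \<longleftrightarrow> z \<in> J" if z: "z \<in> carrier ?T" for z
  proof
    assume xz: "x \<otimes> z = \<zero>"
    show "z \<in> J"
    proof (rule ccontr)
      assume "z \<notin> J"
      then obtain w where w: "w \<in> carrier ?T" "z \<otimes> w = e"
        using corner_unit_iff[OF e z] by (auto simp: Units_def)
      have "x = x \<otimes> (z \<otimes> w)" unfolding w(2) using x by simp
      also have "\<dots> = (x \<otimes> z) \<otimes> w" using x(1) z w(1) by (simp add: m_assoc)
      finally show False using xz x(2) w(1) by simp
    qed
  qed (use x(3) z in blast)
  have Jc: "z \<in> J \<longleftrightarrow> (\<exists>y\<in>carrier ?T. z = c \<otimes> y)" if "z \<in> carrier ?T" for z
    using c(2)[OF that] xz[OF that] by simp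
  have "c = c \<otimes> e" using c(1) by simp
  then have cJ: "c \<in> J" using Jc[OF c(1)] T.one_closed by (metis corner_simps(3))
  have cR: "c \<in> carrier R" using c(1) by simp
  obtain n0 :: nat where n0: "c [^] n0 = \<zero>" using nilpotent_in_T_nilpotent[OF T_nil cJ cR] by blast
  have "c [^]\<^bsub>?T\<^esub> n = e \<otimes> c [^] n" for n :: nat
  proof (induct n)
    case (Suc n)
    then show ?case using cR ec by (simp add: m_assoc)
  qed (use ec in simp)
  then have n0T: "c [^]\<^bsub>?T\<^esub> n0 = \<zero>" using n0 ec by simp
  define n where "n = (LEAST n::nat. c [^]\<^bsub>?T\<^esub> n = \<zero>)"
  have n: "c [^]\<^bsub>?T\<^esub> n = \<zero>" unfolding n_def using n0T by (rule LeastI)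
  have "n \<noteq> 0"
  proof
    assume "n = 0"
    then show False using n E_nonzero[OF e] by simp
  qed
  then obtain m where m: "n = Suc m" by (cases n) auto
  have wn: "c [^]\<^bsub>?T\<^esub> m \<noteq> \<zero>" using not_less_Least[of m "\<lambda>n. c [^]\<^bsub>?T\<^esub> n = \<zero>"] m unfolding n_def by auto
  define w where "w = c [^]\<^bsub>?T\<^esub> m"
  have w: "w \<in> carrier ?T" "w \<noteq> \<zero>" unfolding w_def using T.nat_pow_closed[OF c(1)] wn by auto
  have pass: "\<exists>t\<in>carrier ?T. z \<otimes> c [^]\<^bsub>?T\<^esub> l = c [^]\<^bsub>?T\<^esub> Suc l \<otimes> t" if z: "z \<in> carrier ?T" "z \<in> J" for z l
  proof (induct l)
    case 0
    obtain y where y: "y \<in> carrier ?T" "z = c \<otimes> y" using Jc z by blast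
    have "z \<otimes> c [^]\<^bsub>?T\<^esub> (0::nat) = c [^]\<^bsub>?T\<^esub> Suc 0 \<otimes> y" using z(1) y c(1) by simp
    then show ?case using y(1) by blast
  next
    case (Suc l)
    then obtain t where t: "t \<in> carrier ?T" "z \<otimes> c [^]\<^bsub>?T\<^esub> l = c [^]\<^bsub>?T\<^esub> Suc l \<otimes> t" by blast
    have tc: "t \<otimes> c \<in> carrier ?T" using T.m_closed[OF t(1) c(1)] by simp
    have "t \<otimes> c \<in> J" using t(1) cJ by (intro J.I_l_closed) auto
    then obtain t' where t': "t' \<in> carrier ?T" "t \<otimes> c = c \<otimes> t'" using Jc[OF tc] by blast
    have p: "c [^]\<^bsub>?T\<^esub> l \<in> carrier R" "c [^]\<^bsub>?T\<^esub> Suc l \<in> carrier R" "c [^]\<^bsub>?T\<^esub> Suc (Suc l) = c [^]\<^bsub>?T\<^esub> Suc l \<otimes> c"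
      "c [^]\<^bsub>?T\<^esub> Suc l = c [^]\<^bsub>?T\<^esub> l \<otimes> c"
      using T.nat_pow_closed[OF c(1), of l] T.nat_pow_closed[OF c(1), of "Suc l"] by simp_all
    have "z \<otimes> c [^]\<^bsub>?T\<^esub> Suc l = (z \<otimes> c [^]\<^bsub>?T\<^esub> l) \<otimes> c" unfolding p(4) using z(1) p(1) cR by (simp add: m_assoc)
    also have "\<dots> = c [^]\<^bsub>?T\<^esub> Suc l \<otimes> (t \<otimes> c)" unfolding t(2) using t(1) p(2) cR by (intro m_assoc) auto
    also have "\<dots> = c [^]\<^bsub>?T\<^esub> Suc (Suc l) \<otimes> t'" unfolding t'(2) p(3) using t'(1) p(2) cR by (intro m_assoc[symmetric]) auto
    finally show ?case using t'(1) by blast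
  qed
  have zw: "z \<otimes> w = \<zero> \<longleftrightarrow> z \<in> J" if z: "z \<in> carrier ?T" for z
  proof
    assume zw: "z \<otimes> w = \<zero>"
    show "z \<in> J"
    proof (rule ccontr)
      assume "z \<notin> J"
      then obtain v where v: "v \<in> carrier ?T" "v \<otimes> z = e"
        using corner_unit_iff[OF e z] by (auto simp: Units_def)
      have "w = (v \<otimes> z) \<otimes> w" unfolding v(2) using w by simp
      also have "\<dots> = v \<otimes> (z \<otimes> w)" using w(1) z v(1) by (simp add: m_assoc)
      finally show False using zw w(2) v(1) by simp
    qed
  next
    assume "z \<in> J"
    then obtain t where t: "t \<in> carrier ?T" "z \<otimes> w = c [^]\<^bsub>?T\<^esub> n \<otimes> t" using pass[OF z, of m] unfolding w_def m by blast
    then show "z \<otimes> w = \<zero>" using n by simp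
  qed
  obtain d where d: "d \<in> carrier ?T" "\<And>z. z \<in> carrier ?T \<Longrightarrow> z \<otimes> w = \<zero> \<longleftrightarrow> (\<exists>y\<in>carrier ?T. z = y \<otimes> d)"
    using lmT[unfolded left_morphic_iff[OF T.ring_axioms], rule_format, OF w(1)] unfolding corner_simps(2,4) by blast
  have "uniformizer ?T c"
  proof (rule uniformizerI[OF T.ring_axioms _ c(1) _ d(1)])
    show "\<one>\<^bsub>?T\<^esub> \<noteq> \<zero>\<^bsub>?T\<^esub>" using E_nonzero[OF e] by simp
    show "c [^]\<^bsub>?T\<^esub> n = \<zero>\<^bsub>?T\<^esub>" using n by simp
    fix z assume z: "z \<in> carrier ?T"
    show "z \<notin> Units ?T \<longleftrightarrow> (\<exists>y\<in>carrier ?T. z = c \<otimes>\<^bsub>?T\<^esub> y)"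
      unfolding corner_unit_iff[OF e z] corner_simps(2) using Jc[OF z] by blast
    show "z \<notin> Units ?T \<longleftrightarrow> (\<exists>y\<in>carrier ?T. z = y \<otimes>\<^bsub>?T\<^esub> d)"
      unfolding corner_unit_iff[OF e z] corner_simps(2) using d(2)[OF z] zw[OF z] by blast
  qed
  then show ?thesis by blast
qed

text \<open>For \<open>v \<in> eRf\<close> apply the right morphic condition to \<open>a = v + (1 - e - f)\<close>: as \<open>ae = 0\<close>, the element
  \<open>b\<close> paired with \<open>a\<close> has \<open>e \<in> bR\<close>, which makes \<open>ebe\<close> a unit of \<open>eRe\<close>, while \<open>bv = 0\<close>.\<close>

lemma nonisomorphic_imp_zero:
  assumes rm: "left_morphic (opposite_ring R)" and e: "e \<in> E" and f: "f \<in> E" and ef: "e \<noteq> f"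
    and J: "\<And>x y. \<lbrakk>x \<in> carrier R; y \<in> carrier R; e \<otimes> x = x; x \<otimes> f = x; f \<otimes> y = y; y \<otimes> e = y\<rbrakk> \<Longrightarrow> x \<otimes> y \<in> J"
    and v: "v \<in> carrier R" "e \<otimes> v = v" "v \<otimes> f = v"
  shows "v = \<zero>"
proof -
  note c = E_carrier[OF e] E_idem[OF e] E_carrier[OF f] E_idem[OF f] E_orth[OF e f ef] E_orth[OF f e ef[symmetric]]
  define g where "g = \<one> \<ominus> e \<ominus> f"
  have g: "g \<in> carrier R" "g \<otimes> g = g" "g \<otimes> e = \<zero>" "e \<oplus> f \<oplus> g = \<one>"
    unfolding g_def using c
    by (simp_all add: minus_eq l_distr r_distr l_minus r_minus a_assoc r_neg l_neg r_neg1 r_neg2 a_lcomm minus_add)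
  have ve: "v \<otimes> e = \<zero>" using m_assoc[OF v(1) c(3) c(1)] v c by simp
  have "v = v \<otimes> (e \<oplus> f \<oplus> g)" using g(4) v(1) by simp
  also have "\<dots> = v \<oplus> v \<otimes> g" using v c g(1) ve by (simp add: r_distr)
  finally have vg: "v \<otimes> g = \<zero>" using v(1) g(1) by simp
  define a where "a = v \<oplus> g"
  have a: "a \<in> carrier R" "a \<otimes> e = \<zero>" "a \<otimes> g = g" unfolding a_def using v c g ve vg by (simp_all add: l_distr)
  interpret O: ring "opposite_ring R" by (simp add: ring_axioms)
  have "\<exists>b\<in>carrier R. \<forall>x\<in>carrier R. (a \<otimes> x = \<zero> \<longleftrightarrow> (\<exists>y\<in>carrier R. x = b \<otimes> y)) \<and>
      (b \<otimes> x = \<zero> \<longleftrightarrow> (\<exists>y\<in>carrier R. x = a \<otimes> y))"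
    using rm[unfolded left_morphic_iff[OF O.ring_axioms], rule_format, of a] a(1) unfolding opposite_ring_simps by blast
  then obtain b where b: "b \<in> carrier R"
    and ab: "\<And>x. x \<in> carrier R \<Longrightarrow> a \<otimes> x = \<zero> \<longleftrightarrow> (\<exists>y\<in>carrier R. x = b \<otimes> y)"
    and ba: "\<And>x. x \<in> carrier R \<Longrightarrow> b \<otimes> x = \<zero> \<longleftrightarrow> (\<exists>y\<in>carrier R. x = a \<otimes> y)"
    by blast
  have ba0: "b \<otimes> a = \<zero>" using ba[OF a(1)] r_one[OF a(1)] one_closed by metis
  have bg: "b \<otimes> g = \<zero>" using m_assoc[OF b a(1) g(1)] a(3) ba0 g(1) by simp
  have "b \<otimes> v \<oplus> b \<otimes> g = \<zero>" using ba0 r_distr[OF v(1) g(1) b] by (simp add: a_def)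
  then have bv: "b \<otimes> v = \<zero>" using bg b v(1) by simp
  obtain t where t: "t \<in> carrier R" "e = b \<otimes> t" using ab[OF c(1)] a(2) by blast
  \<comment> \<open>Compressing \<open>e = bt\<close> by \<open>e\<close> and inserting
    \<open>1 = e + f + g\<close>, where \<open>bg = 0\<close>, gives \<open>e = pq + xy\<close> with
    \<open>xy\<close> in \<open>J\<close>. Hence \<open>p\<close> is outside \<open>J\<close> and
    left invertible in \<open>eRe\<close>, while \<open>pv = ebv = 0\<close>.\<close>
  define p q where "p = e \<otimes> b \<otimes> e" and "q = e \<otimes> t \<otimes> e"
  define x y where "x = e \<otimes> b \<otimes> f" and "y = f \<otimes> t \<otimes> e"
  have pc: "p \<in> carrier (corner R e)" and qc: "q \<in> carrier R"
    unfolding p_def q_def using b t(1) c by (simp_all add: m_assoc) (simp add: m_assoc[symmetric])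
  have pR: "p \<in> carrier R" using pc by simp
  have x: "x \<in> carrier R" "e \<otimes> x = x" "x \<otimes> f = x" and y: "y \<in> carrier R" "f \<otimes> y = y" "y \<otimes> e = y"
    unfolding x_def y_def using b t(1) c by (simp_all add: m_assoc) (simp_all add: m_assoc[symmetric])
  have ee: "z \<otimes> (h \<otimes> (h \<otimes> w)) = z \<otimes> (h \<otimes> w)" if "h \<otimes> h = h" "z \<in> carrier R" "h \<in> carrier R" "w \<in> carrier R" for z h w
    using m_assoc[OF that(3,3,4)] that(1) by simp
  have pq: "p \<otimes> q = e \<otimes> b \<otimes> e \<otimes> t \<otimes> e" and xy: "x \<otimes> y = e \<otimes> b \<otimes> f \<otimes> t \<otimes> e"
    unfolding p_def q_def x_def y_def using b t(1) c by (simp_all add: m_assoc ee)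
  have "e = e \<otimes> (b \<otimes> (e \<oplus> f \<oplus> g) \<otimes> t) \<otimes> e" using t(2) c(1,2) b t(1) g(4) by simp
  also have "b \<otimes> (e \<oplus> f \<oplus> g) \<otimes> t = b \<otimes> e \<otimes> t \<oplus> b \<otimes> f \<otimes> t"
    using b t(1) c(1,3) g(1) bg by (simp add: r_distr l_distr)
  also have "e \<otimes> (b \<otimes> e \<otimes> t \<oplus> b \<otimes> f \<otimes> t) \<otimes> e = p \<otimes> q \<oplus> x \<otimes> y"
    unfolding pq xy using b t(1) c(1,3) by (simp add: r_distr l_distr m_assoc)
  finally have e_eq: "e = p \<otimes> q \<oplus> x \<otimes> y" .
  have "p \<notin> J"
  proof
    assume "p \<in> J"
    then have "p \<otimes> q \<in> J" using qc by (intro J.I_r_closed)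
    then have "p \<otimes> q \<oplus> x \<otimes> y \<in> J" using J[OF x(1) y(1) x(2,3) y(2,3)] by (intro J.a_closed)
    then show False using e_eq E_not_in_J[OF e] by simp
  qed
  then obtain p' where p': "p' \<in> carrier R" "p' \<otimes> p = e" using E_local[OF e pc] by auto
  have "p \<otimes> v = e \<otimes> (b \<otimes> (e \<otimes> v))" unfolding p_def using b v(1) c(1) by (simp add: m_assoc)
  then have "p \<otimes> v = \<zero>" using v(2) bv c(1) by simp
  then have "(p' \<otimes> p) \<otimes> v = \<zero>" using p'(1) pR v(1) by (simp add: m_assoc)
  then show "v = \<zero>" unfolding p'(2) v(2) .
qed

text \<open>Isomorphism of idempotents: the left modules \<open>Re\<close> and \<open>Rf\<close> are
  isomorphic.\<close>

definition linked :: "'a \<Rightarrow> 'a \<Rightarrow> bool" where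
  "linked e f \<longleftrightarrow> (\<exists>x\<in>carrier R. \<exists>y\<in>carrier R. e \<otimes> x = x \<and> x \<otimes> f = x \<and> f \<otimes> y = y \<and> y \<otimes> e = y \<and>
     x \<otimes> y = e \<and> y \<otimes> x = f)"

text \<open>One of the two products suffices: \<open>yx\<close> is an idempotent, nonzero because
  \<open>x(yx)y = e\<close>. It is therefore outside \<open>J\<close> and left invertible in the
  local corner \<open>fRf\<close>, and a left invertible idempotent is the identity.\<close>

lemma linkedI:
  assumes e: "e \<in> E" and f: "f \<in> E"
    and x: "x \<in> carrier R" "e \<otimes> x = x" "x \<otimes> f = x" and y: "y \<in> carrier R" "f \<otimes> y = y" "y \<otimes> e = y"
    and xy: "x \<otimes> y = e"
  shows "linked e f"
proof -
  have yxc: "y \<otimes> x \<in> carrier (corner R f)"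
    using x y E_carrier[OF f] by (simp add: m_assoc) (simp add: m_assoc[symmetric])
  have "(y \<otimes> x) \<otimes> (y \<otimes> x) = y \<otimes> ((x \<otimes> y) \<otimes> x)" using x(1) y(1) by (simp add: m_assoc)
  then have idem: "(y \<otimes> x) \<otimes> (y \<otimes> x) = y \<otimes> x" unfolding xy x(2) .
  have "x \<otimes> (y \<otimes> x) \<otimes> y = (x \<otimes> y) \<otimes> (x \<otimes> y)" using x(1) y(1) by (simp add: m_assoc)
  then have "x \<otimes> (y \<otimes> x) \<otimes> y = e" unfolding xy E_idem[OF e] .
  then have "y \<otimes> x \<noteq> \<zero>" using x(1) y(1) E_nonzero[OF e] by auto
  then have "y \<otimes> x \<notin> J" using idempotent_in_T_nilpotent[OF T_nil _ _ idem] x(1) y(1) by auto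
  then obtain z where z: "z \<in> carrier R" "z \<otimes> (y \<otimes> x) = f" using E_local[OF f yxc] by auto
  have "f = z \<otimes> ((y \<otimes> x) \<otimes> (y \<otimes> x))" using z idem by simp
  also have "\<dots> = (z \<otimes> (y \<otimes> x)) \<otimes> (y \<otimes> x)" using z(1) x(1) y(1) by (simp add: m_assoc)
  also have "\<dots> = y \<otimes> x" unfolding z(2) using yxc by simp
  finally show ?thesis unfolding linked_def using x y xy by metis
qed

lemma linked_refl: "e \<in> E \<Longrightarrow> linked e e"
  using linkedI[of e e e e] E_carrier E_idem by simp

lemma linked_sym: "linked e f \<Longrightarrow> linked f e"
  unfolding linked_def by blast

lemma linked_trans:
  assumes E: "e \<in> E" "f \<in> E" "g \<in> E" and "linked e f" "linked f g"
  shows "linked e g"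
proof -
  obtain x y where x: "x \<in> carrier R" "e \<otimes> x = x" "x \<otimes> f = x" and y: "y \<in> carrier R" "f \<otimes> y = y" "y \<otimes> e = y" "x \<otimes> y = e"
    using assms(4) unfolding linked_def by blast
  obtain u v where u: "u \<in> carrier R" "f \<otimes> u = u" "u \<otimes> g = u" and v: "v \<in> carrier R" "g \<otimes> v = v" "v \<otimes> f = v" "u \<otimes> v = f"
    using assms(5) unfolding linked_def by blast
  note c = E_carrier[OF E(1)] E_carrier[OF E(2)] E_carrier[OF E(3)]
  have 1: "e \<otimes> (x \<otimes> u) = x \<otimes> u" using x u(1) c m_assoc[OF c(1) x(1) u(1)] by simp
  have 2: "(x \<otimes> u) \<otimes> g = x \<otimes> u" using x(1) u c by (simp add: m_assoc)
  have 3: "g \<otimes> (v \<otimes> y) = v \<otimes> y" using v y(1) c m_assoc[OF c(3) v(1) y(1)] by simp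
  have 4: "(v \<otimes> y) \<otimes> e = v \<otimes> y" using v(1) y c by (simp add: m_assoc)
  have "(x \<otimes> u) \<otimes> (v \<otimes> y) = x \<otimes> ((u \<otimes> v) \<otimes> y)" using x(1) u(1) v(1) y(1) by (simp add: m_assoc)
  then have 5: "(x \<otimes> u) \<otimes> (v \<otimes> y) = e" unfolding v(4) y(2) y(4) .
  show ?thesis by (rule linkedI[OF E(1,3) _ 1 2 _ 3 4 5]) (use x u v y in simp_all)
qed

text \<open>If the product of some \<open>x\<close> in \<open>eRf\<close> and \<open>y\<close> in
  \<open>fRe\<close> were outside \<open>J\<close>, it would be left invertible in
  \<open>eRe\<close> and link \<open>e\<close> to \<open>f\<close>. So all such products are in
  \<open>J\<close>, as \<open>nonisomorphic_imp_zero\<close> requires.\<close>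

lemma not_linked_imp_zero:
  assumes rm: "left_morphic (opposite_ring R)" and E: "e \<in> E" "f \<in> E" and nl: "\<not> linked e f"
    and v: "v \<in> carrier R" "e \<otimes> v = v" "v \<otimes> f = v"
  shows "v = \<zero>"
proof (rule nonisomorphic_imp_zero[OF rm E _ _ v])
  show "e \<noteq> f" using nl linked_refl E by auto
  note c = E_carrier[OF E(1)] E_carrier[OF E(2)]
  fix x y assume x: "x \<in> carrier R" "e \<otimes> x = x" "x \<otimes> f = x" and y: "y \<in> carrier R" "f \<otimes> y = y" "y \<otimes> e = y"
  show "x \<otimes> y \<in> J"
  proof (rule ccontr)
    assume xyJ: "x \<otimes> y \<notin> J"
    have "x \<otimes> y \<in> carrier (corner R e)"
      using x y c m_assoc[OF c(1) x(1) y(1)] m_assoc[OF x(1) y(1) c(1)] by simp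
    then obtain z where z: "z \<in> carrier (corner R e)" "z \<otimes> (x \<otimes> y) = e" using E_local[OF E(1) _ xyJ] by blast
    have zc: "z \<in> carrier R" "e \<otimes> z = z" using z by auto
    have 1: "e \<otimes> (z \<otimes> x) = z \<otimes> x" using m_assoc[OF c(1) zc(1) x(1)] zc by simp
    have 2: "(z \<otimes> x) \<otimes> f = z \<otimes> x" using x zc c by (simp add: m_assoc)
    have 3: "(z \<otimes> x) \<otimes> y = e" using z(2) zc x(1) y(1) by (simp add: m_assoc)
    have "linked e f" by (rule linkedI[OF E _ 1 2 y 3]) (use zc x in simp)
    then show False using nl by simp
  qed
qed

end

section \<open>Passing the local idempotents to the trivial extension\<close>

text \<open>\<open>0 \<times> M\<close> has square zero: some initial segment of the sequence has a
  product with first component zero, a following segment as well, and multiplying the two gives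
  zero.\<close>

lemma (in bimodule) T_nilpotent_trivial_extension:
  assumes J: "J \<subseteq> carrier R" and T: "T_nilpotent R J"
  shows "T_nilpotent (R \<propto> M) (J \<times> carrier M)"
  unfolding T_nilpotent_def
proof (intro allI impI)
  interpret S: ring "R \<propto> M" by (rule ring_trivial_extension)
  fix r :: "nat \<Rightarrow> _" assume r: "\<forall>i. r i \<in> J \<times> carrier M"
  have rc: "r i \<in> carrier (R \<propto> M)" for i using r J by (auto simp: mem_Times_iff)
  have fst: "fst (seq_prod (R \<propto> M) (\<lambda>i. r (n + i)) m) = seq_prod R (\<lambda>i. fst (r (n + i))) m" for n m
  proof (induct m)
    case (Suc m)
    then show ?case
      by (cases "seq_prod (R \<propto> M) (\<lambda>i. r (n + i)) m"; cases "r (n + m)") simp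
  qed simp
  have add: "seq_prod (R \<propto> M) r (n + m) = seq_prod (R \<propto> M) r n \<otimes>\<^bsub>R \<propto> M\<^esub> seq_prod (R \<propto> M) (\<lambda>i. r (n + i)) m" for n m
  proof (induct m)
    case 0
    have "seq_prod (R \<propto> M) r n \<in> carrier (R \<propto> M)" by (rule S.seq_prod_closed[OF rc])
    then show ?case using S.r_one by simp
  next
    case (Suc m)
    have c: "seq_prod (R \<propto> M) r n \<in> carrier (R \<propto> M)" "seq_prod (R \<propto> M) (\<lambda>i. r (n + i)) m \<in> carrier (R \<propto> M)"
      by (rule S.seq_prod_closed[OF rc])+
    show ?case using Suc S.m_assoc[OF c rc] by simp
  qed
  have ex: "\<exists>m. seq_prod R (\<lambda>i. fst (r (n + i))) m = \<zero>\<^bsub>R\<^esub>" for n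
    using T[unfolded T_nilpotent_def, rule_format, of "\<lambda>i. fst (r (n + i))"] r by (auto simp: mem_Times_iff)
  obtain n where n: "seq_prod R (\<lambda>i. fst (r (0 + i))) n = \<zero>\<^bsub>R\<^esub>" using ex by blast
  obtain m where m: "seq_prod R (\<lambda>i. fst (r (n + i))) m = \<zero>\<^bsub>R\<^esub>" using ex by blast
  have f: "fst (seq_prod (R \<propto> M) r n) = \<zero>\<^bsub>R\<^esub>" "fst (seq_prod (R \<propto> M) (\<lambda>i. r (n + i)) m) = \<zero>\<^bsub>R\<^esub>"
    using fst[of 0 n] fst[of n m] n m by simp_all
  have c: "seq_prod (R \<propto> M) r n \<in> carrier (R \<propto> M)" "seq_prod (R \<propto> M) (\<lambda>i. r (n + i)) m \<in> carrier (R \<propto> M)"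
    by (rule S.seq_prod_closed[OF rc])+
  obtain x y where xy: "seq_prod (R \<propto> M) r n = (\<zero>\<^bsub>R\<^esub>, x)" "seq_prod (R \<propto> M) (\<lambda>i. r (n + i)) m = (\<zero>\<^bsub>R\<^esub>, y)"
    using f by (metis prod.collapse)
  then have "x \<in> carrier M" "y \<in> carrier M" using c by auto
  then have "seq_prod (R \<propto> M) r (n + m) = \<zero>\<^bsub>R \<propto> M\<^esub>" unfolding add xy by simp
  then show "\<exists>n. seq_prod (R \<propto> M) r n = \<zero>\<^bsub>R \<propto> M\<^esub>" by blast
qed

lemma (in bimodule) local_idempotents_trivial_extension:
  assumes "local_idempotents R J E"
  shows "local_idempotents (R \<propto> M) (J \<times> carrier M) ((\<lambda>e. (e, \<zero>\<^bsub>M\<^esub>)) ` E)"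
proof -
  interpret L: local_idempotents R J E by fact
  interpret S: ring "R \<propto> M" by (rule ring_trivial_extension)
  have Jc: "J \<subseteq> carrier R" by (rule L.J.a_subset)
  have inv: "\<ominus>\<^bsub>R \<propto> M\<^esub> (x, m) = (\<ominus>\<^bsub>R\<^esub> x, \<ominus>\<^bsub>M\<^esub> m)" if "x \<in> carrier R" "m \<in> carrier M" for x m
    by (rule S.minus_equality) (use that in \<open>auto simp: R.l_neg M.l_neg\<close>)
  have id: "ideal (J \<times> carrier M) (R \<propto> M)"
  proof (rule idealI[OF S.ring_axioms])
    have "additive_subgroup (J \<times> carrier M) (R \<propto> M)"
    proof (rule S.additive_subgroupI')
      show "J \<times> carrier M \<subseteq> carrier (R \<propto> M)" using Jc by auto
      show "\<ominus>\<^bsub>R \<propto> M\<^esub> x \<in> J \<times> carrier M" if "x \<in> J \<times> carrier M" for x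
        using that inv Jc by (auto simp: subset_iff)
    qed auto
    then show "subgroup (J \<times> carrier M) (add_monoid (R \<propto> M))" by (rule additive_subgroup.a_subgroup)
  qed (use Jc in \<open>auto simp: lsmult_closed rsmult_closed L.J.I_l_closed L.J.I_r_closed subset_iff\<close>)
  have E: "e \<in> carrier R" "e \<otimes>\<^bsub>R\<^esub> e = e" "e \<noteq> \<zero>\<^bsub>R\<^esub>" if "e \<in> E" for e
    using L.E_carrier L.E_idem L.E_nonzero that by auto
  have loc: "\<exists>y\<in>carrier (corner (R \<propto> M) (e, \<zero>\<^bsub>M\<^esub>)). y \<otimes>\<^bsub>R \<propto> M\<^esub> z = (e, \<zero>\<^bsub>M\<^esub>)"
    if e: "e \<in> E" and z: "z \<in> carrier (corner (R \<propto> M) (e, \<zero>\<^bsub>M\<^esub>))" "z \<notin> J \<times> carrier M" for e z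
  proof -
    obtain x m where xm: "z = (x, m)" by (cases z)
    note ec = E[OF e]
    have x: "x \<in> carrier (corner R e)" and m: "m \<in> carrier M" "e \<odot>\<^bsub>M\<^esub> m = m" "rsmult M m e = m" and "x \<notin> J"
      using z corner_trivial_extension_mem[OF ec(1), of x m] unfolding xm by auto
    then obtain y where y: "y \<in> carrier (corner R e)" "y \<otimes>\<^bsub>R\<^esub> x = e" "x \<otimes>\<^bsub>R\<^esub> y = e"
      using L.corner_unit_iff[OF e x] by (auto simp: Units_def)
    have yc: "y \<in> carrier R" "e \<otimes>\<^bsub>R\<^esub> y = y" "y \<otimes>\<^bsub>R\<^esub> e = y" using y(1) by auto
    have xc: "x \<in> carrier R" "e \<otimes>\<^bsub>R\<^esub> x = x" "x \<otimes>\<^bsub>R\<^esub> e = x" using x by auto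
    interpret T: ring "corner (R \<propto> M) (e, \<zero>\<^bsub>M\<^esub>)" by (rule ring_corner_trivial_extension[OF ec(1,2)])
    \<comment> \<open>\<open>k = ymy\<close> is the correction term in the inverse
      \<open>(y, -ymy)\<close> of \<open>(x, m)\<close>.\<close>
    define k where "k = y \<odot>\<^bsub>M\<^esub> rsmult M m y"
    have my: "rsmult M m y \<in> carrier M" using m yc by (simp add: rsmult_closed)
    have k: "k \<in> carrier M" unfolding k_def using my yc by (simp add: lsmult_closed)
    have ek: "e \<odot>\<^bsub>M\<^esub> k = k" unfolding k_def using lsmult_assoc[OF ec(1) yc(1) my] yc by simp
    have ke: "rsmult M k e = k"
      unfolding k_def using smult_rsmult_assoc[OF yc(1) ec(1) my] rsmult_assoc[OF yc(1) ec(1) m(1)] yc by simp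
    have kx: "rsmult M k x = y \<odot>\<^bsub>M\<^esub> m"
      unfolding k_def using smult_rsmult_assoc[OF yc(1) xc(1) my] rsmult_assoc[OF yc(1) xc(1) m(1)] y(2) m by simp
    have kT: "(\<zero>\<^bsub>R\<^esub>, k) \<in> carrier (corner (R \<propto> M) (e, \<zero>\<^bsub>M\<^esub>))"
      unfolding corner_trivial_extension_mem[OF ec(1)] using k ek ke ec by simp
    have yT: "(y, \<zero>\<^bsub>M\<^esub>) \<in> carrier (corner (R \<propto> M) (e, \<zero>\<^bsub>M\<^esub>))"
      unfolding corner_trivial_extension_mem[OF ec(1)] using y ec by simp
    have zc: "z \<in> carrier (R \<propto> M)" "(y, \<zero>\<^bsub>M\<^esub>) \<in> carrier (R \<propto> M)" "(\<zero>\<^bsub>R\<^esub>, k) \<in> carrier (R \<propto> M)"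
      using xm xc m yc k by auto
    have 1: "(y, \<zero>\<^bsub>M\<^esub>) \<otimes>\<^bsub>R \<propto> M\<^esub> z = (e, y \<odot>\<^bsub>M\<^esub> m)" unfolding xm using y xc yc m by (simp add: lsmult_closed)
    have 2: "(\<zero>\<^bsub>R\<^esub>, k) \<otimes>\<^bsub>R \<propto> M\<^esub> z = (\<zero>\<^bsub>R\<^esub>, y \<odot>\<^bsub>M\<^esub> m)" unfolding xm using xc yc m k kx by (simp add: lsmult_closed)
    have "((y, \<zero>\<^bsub>M\<^esub>) \<ominus>\<^bsub>R \<propto> M\<^esub> (\<zero>\<^bsub>R\<^esub>, k)) \<otimes>\<^bsub>R \<propto> M\<^esub> z = (e, y \<odot>\<^bsub>M\<^esub> m) \<ominus>\<^bsub>R \<propto> M\<^esub> (\<zero>\<^bsub>R\<^esub>, y \<odot>\<^bsub>M\<^esub> m)"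
      using 1 2 S.l_distr[OF zc(2) S.a_inv_closed[OF zc(3)] zc(1)] S.l_minus[OF zc(3,1)] by (simp add: S.minus_eq)
    also have "\<dots> = (e, \<zero>\<^bsub>M\<^esub>)" using ec m yc by (simp add: S.minus_eq inv lsmult_closed M.r_neg)
    finally have "((y, \<zero>\<^bsub>M\<^esub>) \<ominus>\<^bsub>R \<propto> M\<^esub> (\<zero>\<^bsub>R\<^esub>, k)) \<otimes>\<^bsub>R \<propto> M\<^esub> z = (e, \<zero>\<^bsub>M\<^esub>)" .
    moreover have "(y, \<zero>\<^bsub>M\<^esub>) \<ominus>\<^bsub>R \<propto> M\<^esub> (\<zero>\<^bsub>R\<^esub>, k) \<in> carrier (corner (R \<propto> M) (e, \<zero>\<^bsub>M\<^esub>))"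
    proof -
      have eS: "(e, \<zero>\<^bsub>M\<^esub>) \<in> carrier (R \<propto> M)" "(e, \<zero>\<^bsub>M\<^esub>) \<otimes>\<^bsub>R \<propto> M\<^esub> (e, \<zero>\<^bsub>M\<^esub>) = (e, \<zero>\<^bsub>M\<^esub>)" using ec by auto
      show ?thesis
        using T.minus_closed[OF yT kT] a_inv_corner[OF S.ring_axioms eS kT] by (simp only: T.minus_eq S.minus_eq corner_simps(5))
    qed
    ultimately show ?thesis by blast
  qed
  have "(\<Oplus>\<^bsub>R \<propto> M\<^esub>z\<in>(\<lambda>e. (e, \<zero>\<^bsub>M\<^esub>)) ` E. z) = (\<Oplus>\<^bsub>R \<propto> M\<^esub>e\<in>E. (e, \<zero>\<^bsub>M\<^esub>))"
    using E by (intro S.finsum_reindex) (auto simp: inj_on_def)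
  then have sum: "(\<Oplus>\<^bsub>R \<propto> M\<^esub>z\<in>(\<lambda>e. (e, \<zero>\<^bsub>M\<^esub>)) ` E. z) = \<one>\<^bsub>R \<propto> M\<^esub>"
    using finsum_trivial_extension[OF L.finite_E, of "\<lambda>e. e"] E L.E_sum by auto
  show ?thesis
  proof (intro local_idempotents.intro local_idempotents_axioms.intro S.ring_axioms id sum)
    show "T_nilpotent (R \<propto> M) (J \<times> carrier M)" by (rule T_nilpotent_trivial_extension[OF Jc L.T_nil])
    show "finite ((\<lambda>e. (e, \<zero>\<^bsub>M\<^esub>)) ` E)" using L.finite_E by simp
    fix z w x assume z: "z \<in> (\<lambda>e. (e, \<zero>\<^bsub>M\<^esub>)) ` E"
    then show "z \<in> carrier (R \<propto> M)" "z \<otimes>\<^bsub>R \<propto> M\<^esub> z = z" "z \<noteq> \<zero>\<^bsub>R \<propto> M\<^esub>" using E by auto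
    show "\<exists>y\<in>carrier (corner (R \<propto> M) z). y \<otimes>\<^bsub>R \<propto> M\<^esub> x = z"
      if "x \<in> carrier (corner (R \<propto> M) z)" "x \<notin> J \<times> carrier M"
      using that z loc by blast
    show "z \<otimes>\<^bsub>R \<propto> M\<^esub> w = \<zero>\<^bsub>R \<propto> M\<^esub>" if w: "w \<in> (\<lambda>e. (e, \<zero>\<^bsub>M\<^esub>)) ` E" "z \<noteq> w"
    proof -
      obtain e f where ef: "e \<in> E" "f \<in> E" "z = (e, \<zero>\<^bsub>M\<^esub>)" "w = (f, \<zero>\<^bsub>M\<^esub>)" using z w(1) by blast
      then have "e \<otimes>\<^bsub>R\<^esub> f = \<zero>\<^bsub>R\<^esub>" using L.E_orth w(2) by auto
      then show ?thesis using ef E by simp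
    qed
  qed
qed

lemma left_perfect_imp_local_idempotents:
  assumes "left_perfect R"
  shows "\<exists>E. local_idempotents R (jacobson_radical R) E"
proof -
  interpret semiperfect_radical R "jacobson_radical R" by (rule left_perfect_imp_semiperfect_radical[OF assms])
  obtain E where E: "finite E" "\<And>p. p \<in> E \<Longrightarrow> local_idempotent p" "\<And>p q. p \<in> E \<Longrightarrow> q \<in> E \<Longrightarrow> p \<noteq> q \<Longrightarrow> p \<otimes>\<^bsub>R\<^esub> q = \<zero>\<^bsub>R\<^esub>"
    "(\<Oplus>\<^bsub>R\<^esub>p\<in>E. p) = \<one>\<^bsub>R\<^esub>"
    using local_idempotent_decomposition[OF one_closed] by auto
  have "local_idempotents R (jacobson_radical R) E"
    by (intro local_idempotents.intro local_idempotents_axioms.intro ring_axioms ideal_J T_nil E)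
      (use E(2) in \<open>auto simp: local_idempotent_def simp del: corner_simps\<close>)
  then show ?thesis by blast
qed

section \<open>From matrix units to matrix rings\<close>

context matrix_units
begin

lemma entries_eqI:
  assumes x: "x \<in> carrier R" and y: "y \<in> carrier R"
    and eq: "\<And>i j. i < k \<Longrightarrow> j < k \<Longrightarrow> a i \<otimes> x \<otimes> b j = a i \<otimes> y \<otimes> b j"
  shows "x = y"
proof -
  have row: "a i \<otimes> x = a i \<otimes> y" if i: "i < k" for i
  proof -
    have "a i \<otimes> x = (\<Oplus>j\<in>{..<k}. (a i \<otimes> x) \<otimes> b j \<otimes> a j)" using entry_expand(2)[of "a i \<otimes> x"] i x by simp
    also have "\<dots> = (\<Oplus>j\<in>{..<k}. (a i \<otimes> y) \<otimes> b j \<otimes> a j)"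
      by (rule finsum_cong') (use i y eq in auto)
    also have "\<dots> = a i \<otimes> y" using entry_expand(2)[of "a i \<otimes> y"] i y by simp
    finally show ?thesis .
  qed
  have "x = (\<Oplus>i\<in>{..<k}. b i \<otimes> (a i \<otimes> x))" by (rule entry_expand(1)[OF x])
  also have "\<dots> = (\<Oplus>i\<in>{..<k}. b i \<otimes> (a i \<otimes> y))" by (rule finsum_cong') (use y row in auto)
  also have "\<dots> = y" using entry_expand(1)[OF y] by simp
  finally show ?thesis .
qed

lemma entries_exist:
  assumes t: "\<And>i j. i < k \<Longrightarrow> j < k \<Longrightarrow> t i j \<in> carrier (corner R e)"
  shows "\<exists>x\<in>carrier R. \<forall>i<k. \<forall>j<k. a i \<otimes> x \<otimes> b j = t i j"
proof -
  have tc: "t i j \<in> carrier R" "e \<otimes> t i j = t i j" "t i j \<otimes> e = t i j" if "i < k" "j < k" for i j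
    using t[OF that] by auto
  \<comment> \<open>The element sought is the sum of all
    \<open>b i \<otimes> t i j \<otimes> a j\<close>; \<open>s i\<close> is its row
    \<open>i\<close>.\<close>
  define s where "s i = (\<Oplus>j\<in>{..<k}. t i j \<otimes> a j)" for i
  have sc: "s i \<in> carrier R" if "i < k" for i unfolding s_def using tc that by (intro finsum_closed) auto
  have es: "e \<otimes> s i = s i" if i: "i < k" for i
  proof -
    have "e \<otimes> s i = (\<Oplus>j\<in>{..<k}. e \<otimes> (t i j \<otimes> a j))" unfolding s_def using tc i by (intro finsum_rdistr) auto
    also have "\<dots> = s i" unfolding s_def
    proof (rule finsum_cong', goal_cases)
      case (3 j)
      then show ?case using tc i m_assoc[OF e_closed tc(1)[of i j], of "a j"] by simp
    qed (use tc i in auto)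
    finally show ?thesis .
  qed
  have sb: "s i \<otimes> b j = t i j" if ij: "i < k" "j < k" for i j
  proof -
    have "s i \<otimes> b j = (\<Oplus>l\<in>{..<k}. t i l \<otimes> a l \<otimes> b j)" unfolding s_def using tc ij by (intro finsum_ldistr) auto
    also have "\<dots> = (\<Oplus>l\<in>{..<k}. if j = l then t i l else \<zero>)"
      by (rule finsum_cong') (use tc ij in \<open>auto simp: m_assoc a_b\<close>)
    also have "\<dots> = t i j" by (rule finsum_singleton) (use tc ij in auto)
    finally show ?thesis .
  qed
  define x where "x = (\<Oplus>i\<in>{..<k}. b i \<otimes> s i)"
  have xc: "x \<in> carrier R" unfolding x_def using sc by (intro finsum_closed) auto
  have ax: "a i \<otimes> x = s i" if i: "i < k" for i
  proof -
    have "a i \<otimes> x = (\<Oplus>l\<in>{..<k}. a i \<otimes> (b l \<otimes> s l))" unfolding x_def using sc i by (intro finsum_rdistr) auto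
    also have "\<dots> = (\<Oplus>l\<in>{..<k}. if i = l then s l else \<zero>)"
      by (rule finsum_cong') (use sc es i in \<open>auto simp: m_assoc[symmetric] a_b\<close>)
    also have "\<dots> = s i" by (rule finsum_singleton) (use sc i in auto)
    finally show ?thesis .
  qed
  show ?thesis
  proof (rule bexI[OF _ xc], intro allI impI)
    fix i j assume "i < k" "j < k"
    then show "a i \<otimes> x \<otimes> b j = t i j" using ax sb by simp
  qed
qed

text \<open>Multiplicativity comes from inserting the sum of the \<open>b l \<otimes> a l\<close>,
  which is \<open>1\<close>, between \<open>x\<close> and \<open>y\<close>.\<close>

lemma matrix_ring_iso:
  "(\<lambda>x. \<lambda>(i, j)\<in>{..<k} \<times> {..<k}. a i \<otimes> x \<otimes> b j) \<in> ring_iso R (matrix_ring k (corner R e))"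
proof -
  let ?A = "corner R e"
  interpret A: ring ?A by (rule ring_corner[OF ring_axioms]) simp_all
  let ?h = "\<lambda>x. \<lambda>(i, j)\<in>{..<k} \<times> {..<k}. a i \<otimes> x \<otimes> b j"
  have hc: "?h x \<in> carrier (matrix_ring k ?A)" if "x \<in> carrier R" for x
  proof -
    have "?h x \<in> {..<k} \<times> {..<k} \<rightarrow>\<^sub>E carrier ?A"
      by (rule restrict_PiE_iff[THEN iffD2])
        (auto simp del: corner_simps intro!: entry_closed[OF _ _ that])
    then show ?thesis by (simp only: matrix_ring_def partial_object.select_convs)
  qed
  show ?thesis
  proof (rule ring_iso_memI)
    show "?h x \<in> carrier (matrix_ring k ?A)" if "x \<in> carrier R" for x by (rule hc[OF that])
    show "?h (x \<otimes> y) = ?h x \<otimes>\<^bsub>matrix_ring k ?A\<^esub> ?h y" if xy: "x \<in> carrier R" "y \<in> carrier R" for x y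
    proof (rule matrix_ring_eqI)
      show "?h (x \<otimes> y) \<in> carrier (matrix_ring k ?A)" using xy by (intro hc) simp
      show "?h x \<otimes>\<^bsub>matrix_ring k ?A\<^esub> ?h y \<in> carrier (matrix_ring k ?A)"
        using xy by (intro A.matrix_ring_mult_closed hc)
      fix i j assume ij: "i < k" "j < k"
      have "(?h x \<otimes>\<^bsub>matrix_ring k ?A\<^esub> ?h y) (i, j) = (\<Oplus>\<^bsub>?A\<^esub>l\<in>{..<k}. (a i \<otimes> x \<otimes> b l) \<otimes>\<^bsub>?A\<^esub> (a l \<otimes> y \<otimes> b j))"
        unfolding matrix_ring_mult_apply[OF ij]
        by (rule A.finsum_cong')
          (use ij entry_closed[OF _ _ xy(1)] entry_closed[OF _ _ xy(2)] A.m_closed in \<open>auto simp del: corner_simps\<close>)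
      also have "\<dots> = (\<Oplus>l\<in>{..<k}. (a i \<otimes> x \<otimes> b l) \<otimes>\<^bsub>?A\<^esub> (a l \<otimes> y \<otimes> b j))"
        by (rule finsum_corner[OF ring_axioms e_closed e_idem])
          (use ij entry_closed[OF _ _ xy(1)] entry_closed[OF _ _ xy(2)] A.m_closed in \<open>auto simp del: corner_simps\<close>)
      also have "\<dots> = (\<Oplus>l\<in>{..<k}. ((a i \<otimes> x) \<otimes> b l \<otimes> a l) \<otimes> (y \<otimes> b j))"
        by (rule finsum_cong') (use ij xy in \<open>auto simp: m_assoc\<close>)
      also have "\<dots> = (\<Oplus>l\<in>{..<k}. (a i \<otimes> x) \<otimes> b l \<otimes> a l) \<otimes> (y \<otimes> b j)"
        using ij xy by (intro finsum_ldistr[symmetric]) auto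
      also have "\<dots> = (a i \<otimes> x) \<otimes> (y \<otimes> b j)" using entry_expand(2)[of "a i \<otimes> x"] ij xy by simp
      also have "\<dots> = ?h (x \<otimes> y) (i, j)" using ij xy by (simp add: m_assoc)
      finally show "?h (x \<otimes> y) (i, j) = (?h x \<otimes>\<^bsub>matrix_ring k ?A\<^esub> ?h y) (i, j)" by simp
    qed
    show "?h (x \<oplus> y) = ?h x \<oplus>\<^bsub>matrix_ring k ?A\<^esub> ?h y" if "x \<in> carrier R" "y \<in> carrier R" for x y
      using that unfolding matrix_ring_def by (auto simp: l_distr r_distr intro!: restrict_ext)
    show "?h \<one> = \<one>\<^bsub>matrix_ring k ?A\<^esub>"
      unfolding matrix_ring_def by (auto simp: a_b intro!: restrict_ext)
    show "bij_betw ?h (carrier R) (carrier (matrix_ring k ?A))"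
    proof (rule bij_betw_imageI)
      show "inj_on ?h (carrier R)"
      proof (rule inj_onI)
        fix x y assume xy: "x \<in> carrier R" "y \<in> carrier R" "?h x = ?h y"
        show "x = y"
        proof (rule entries_eqI[OF xy(1,2)])
          fix i j assume ij: "i < k" "j < k"
          have "?h x (i, j) = ?h y (i, j)" using xy(3) by simp
          then show "a i \<otimes> x \<otimes> b j = a i \<otimes> y \<otimes> b j" using ij by simp
        qed
      qed
      show "?h ` carrier R = carrier (matrix_ring k ?A)"
      proof
        show "?h ` carrier R \<subseteq> carrier (matrix_ring k ?A)" using hc by blast
        show "carrier (matrix_ring k ?A) \<subseteq> ?h ` carrier R"
        proof
          fix t assume t: "t \<in> carrier (matrix_ring k ?A)"
          obtain x where x: "x \<in> carrier R" "\<And>i j. i < k \<Longrightarrow> j < k \<Longrightarrow> a i \<otimes> x \<otimes> b j = t (i, j)"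
            using entries_exist[of "\<lambda>i j. t (i, j)"] A.matrix_entry_closed[OF t] by blast
          have "t = ?h x" by (rule matrix_ring_eqI[OF t hc[OF x(1)]]) (use x(2) in simp)
          then show "t \<in> ?h ` carrier R" using x(1) by blast
        qed
      qed
    qed
  qed
qed

text \<open>Let \<open>P(I)\<close> be the set of the positions \<open>j\<close> of the first nonzero column among the elements of \<open>I\<close>. As in Gaussian
  elimination, left ideals \<open>I \<subseteq> I'\<close> with \<open>P(I) = P(I')\<close> coincide.\<close>

lemma left_artinian_if_division:
  assumes div: "\<And>x. x \<in> carrier (corner R e) \<Longrightarrow> x \<noteq> \<zero> \<Longrightarrow> x \<in> Units (corner R e)"
  shows "left_artinian R"
  unfolding left_artinian_def
proof (intro conjI ring_axioms allI impI)
  fix I :: "nat \<Rightarrow> 'a set" assume I0: "(\<forall>n. left_ideal (I n) R) \<and> (\<forall>n. I (Suc n) \<subseteq> I n)"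
  then have I: "left_ideal (I n) R" "I (Suc n) \<subseteq> I n" for n by auto
  define lead where "lead x j \<longleftrightarrow> (\<forall>i<j. x \<otimes> b i = \<zero>) \<and> x \<otimes> b j \<noteq> \<zero>" for x j
  define P where "P n = {j. j < k \<and> (\<exists>x\<in>I n. lead x j)}" for n
  have "P (Suc n) \<subseteq> P n" for n using I(2) by (auto simp: P_def)
  moreover have "range P \<subseteq> Pow {..<k}" by (auto simp: P_def)
  then have "finite (range P)" by (rule finite_subset) simp
  ultimately obtain N where N: "\<And>n. n \<ge> N \<Longrightarrow> P n = P N"
    using decreasing_finite_range_stabilises[of P] by blast
  have "I n = I N" if n: "n \<ge> N" for n
  proof
    show "I n \<subseteq> I N" using lift_Suc_antimono_le[of I, OF I(2) n] .
    note D = left_idealD[OF I(1)]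
    \<comment> \<open>Induction on the number \<open>m\<close> of columns that may still be nonzero;
      for \<open>m = k\<close> the condition on the columns is empty.\<close>
    have vanish: "x \<in> I n" if "m \<le> k" "x \<in> I N" "\<forall>i<k - m. x \<otimes> b i = \<zero>" for m x
      using that
    proof (induct m arbitrary: x)
      case 0
      then have "x \<in> carrier R" using D(2) by auto
      then have "x = \<zero>" using nonzero_column[of x] 0 by auto
      then show ?case using D(3) by simp
    next
      case (Suc m)
      define j where "j = k - Suc m"
      have jk: "j < k" "k - m = Suc j" using Suc.prems(1) by (auto simp: j_def)
      have xc: "x \<in> carrier R" using D(2) Suc.prems(2) by auto
      \<comment> \<open>Rows are treated one at a time, since the entries of
        \<open>y = a l \<otimes> x\<close> are in the division ring \<open>eRe\<close>. A row that
        is nonzero in column \<open>j\<close> is reduced by an element of \<open>I n\<close> with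
        the same leading position.\<close>
      have row: "a l \<otimes> x \<in> I n" if l: "l < k" for l
      proof -
        define y where "y = a l \<otimes> x"
        have y: "y \<in> carrier R" "y \<in> I N" "e \<otimes> y = y"
          unfolding y_def using xc l D(7)[OF _ Suc.prems(2)] by (auto simp: m_assoc[symmetric] e_a)
        have y0: "y \<otimes> b i = \<zero>" if "i < j" for i
          unfolding y_def using Suc.prems(3) that l xc jk by (simp add: m_assoc j_def)
        show ?thesis
        proof (cases "y \<otimes> b j = \<zero>")
          case True
          have "\<forall>i<k - m. y \<otimes> b i = \<zero>" unfolding jk(2) using y0 True by (auto simp: less_Suc_eq)
          then show ?thesis using Suc.hyps[OF _ y(2)] Suc.prems(1) by (simp add: y_def)
        next
          case False
          then have "lead y j" using y0 by (simp add: lead_def)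
          then have "j \<in> P N" using y(2) jk by (auto simp: P_def)
          then have "j \<in> P n" using N[OF n] by simp
          then obtain z where z: "z \<in> I n" "\<And>i. i < j \<Longrightarrow> z \<otimes> b i = \<zero>" "z \<otimes> b j \<noteq> \<zero>" by (auto simp: P_def lead_def)
          have zc: "z \<in> carrier R" using z(1) D(2) by auto
          obtain q where q: "q < k" "a q \<otimes> (z \<otimes> b j) \<noteq> \<zero>" using nonzero_row[of "z \<otimes> b j"] z zc jk by auto
          define w where "w = a q \<otimes> z"
          have w: "w \<in> carrier R" "w \<in> I n" "w \<otimes> b j \<noteq> \<zero>"
            unfolding w_def using zc q D(7)[OF _ z(1)] jk by (auto simp: m_assoc)
          have wz: "w \<otimes> b i = \<zero>" if "i < j" for i unfolding w_def using z(2)[OF that] q zc that jk by (simp add: m_assoc)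
          have wj: "w \<otimes> b j \<in> carrier (corner R e)" unfolding w_def using entry_closed[OF q(1) jk(1) zc] .
          obtain v where v: "v \<in> carrier R" "v \<otimes> (w \<otimes> b j) = e" using div[OF wj w(3)] by (auto simp: Units_def)
          \<comment> \<open>\<open>v\<close> inverts the leading entry of \<open>w\<close>, so
            \<open>t \<otimes> w\<close> agrees with \<open>y\<close> in column \<open>j\<close> and
            vanishes in the columns before it.\<close>
          define t where "t = y \<otimes> b j \<otimes> v"
          have t: "t \<in> carrier R" unfolding t_def using y v jk by simp
          have "t \<otimes> w \<otimes> b j = y \<otimes> b j \<otimes> (v \<otimes> (w \<otimes> b j))" unfolding t_def using y v w jk by (simp add: m_assoc)
          also have "\<dots> = y \<otimes> b j" unfolding v(2) using y jk by (simp add: m_assoc b_e)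
          finally have tw: "t \<otimes> w \<otimes> b j = y \<otimes> b j" .
          have tI: "t \<otimes> w \<in> I n" by (rule D(7)[OF t w(2)])
          have tIN: "t \<otimes> w \<in> I N" using tI \<open>I n \<subseteq> I N\<close> by blast
          have "y \<ominus> t \<otimes> w \<in> I N" by (rule D(6)[OF y(2) tIN])
          moreover have "\<forall>i<k - m. (y \<ominus> t \<otimes> w) \<otimes> b i = \<zero>"
          proof (intro allI impI)
            fix i assume "i < k - m"
            then have i: "i < k" "i < j \<or> i = j" using jk by auto
            have "(y \<ominus> t \<otimes> w) \<otimes> b i = y \<otimes> b i \<ominus> t \<otimes> w \<otimes> b i"
              using y(1) t w(1) i by (simp add: minus_eq l_distr l_minus)
            moreover have "t \<otimes> w \<otimes> b i = t \<otimes> (w \<otimes> b i)" using t w(1) i by (simp add: m_assoc)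
            ultimately show "(y \<ominus> t \<otimes> w) \<otimes> b i = \<zero>"
              using i(2) y0[of i] wz[of i] tw t y(1) w(1) i(1) by (auto simp: minus_eq r_neg)
          qed
          ultimately have "y \<ominus> t \<otimes> w \<in> I n" using Suc.hyps Suc.prems(1) by simp
          then have "(y \<ominus> t \<otimes> w) \<oplus> t \<otimes> w \<in> I n" using D(4) tI by blast
          then show ?thesis using y(1) t w(1) by (simp add: minus_eq a_assoc l_neg y_def)
        qed
      qed
      have sum_closed: "finsum R f A \<in> I n" if "finite A" "\<And>i. i \<in> A \<Longrightarrow> f i \<in> I n" for f and A :: "nat set"
        using that
      proof (induct A rule: finite_induct)
        case (insert i F)
        then have "f \<in> F \<rightarrow> carrier R" "f i \<in> carrier R" using D(2)[of n] by auto
        then show ?case using insert D(4)[of _ n] by (simp add: finsum_insert)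
      qed (use D(3) in simp)
      have "(\<Oplus>l\<in>{..<k}. b l \<otimes> (a l \<otimes> x)) \<in> I n"
        by (rule sum_closed) (use row D(7) in auto)
      then show ?case using entry_expand(1)[OF xc] by simp
    qed
    show "I N \<subseteq> I n" using vanish[of k] by auto
  qed
  then show "\<exists>N. \<forall>n\<ge>N. I n = I N" by blast
qed

lemma artinian_if_division:
  assumes div: "\<And>x. x \<in> carrier (corner R e) \<Longrightarrow> x \<noteq> \<zero> \<Longrightarrow> x \<in> Units (corner R e)"
  shows "artinian_ring R"
proof -
  interpret O: matrix_units "opposite_ring R" e k b a by (rule matrix_units_opposite)
  have "left_artinian (opposite_ring R)"
  proof (rule O.left_artinian_if_division)
    fix x assume "x \<in> carrier (corner (opposite_ring R) e)" "x \<noteq> \<zero>\<^bsub>opposite_ring R\<^esub>"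
    then have "x \<in> Units (corner R e)" by (intro div) auto
    then show "x \<in> Units (corner (opposite_ring R) e)" by (simp flip: opposite_ring_corner)
  qed
  then show ?thesis unfolding artinian_ring_def using left_artinian_if_division[OF div] by simp
qed

text \<open>A nonzero element has a nonzero entry, which is a unit of the corner and puts
  \<open>e\<close> into the ideal. Then all \<open>b l \<otimes> e \<otimes> a l\<close> belong to
  it, and they add up to \<open>1\<close>.\<close>

lemma simple_if_division:
  assumes div: "\<And>x. x \<in> carrier (corner R e) \<Longrightarrow> x \<noteq> \<zero> \<Longrightarrow> x \<in> Units (corner R e)"
    and e0: "e \<noteq> \<zero>"
  shows "simple_ring R"
  unfolding simple_ring_def
proof (intro conjI ring_axioms allI impI)
  show "carrier R \<noteq> {\<zero>}" using e0 e_closed by blast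
  fix I assume I: "ideal I R"
  interpret I: ideal I R by fact
  show "I = {\<zero>} \<or> I = carrier R"
  proof (rule disjCI)
    assume "I \<noteq> carrier R"
    show "I = {\<zero>}"
    proof (rule ccontr)
      assume "I \<noteq> {\<zero>}"
      then obtain x where x: "x \<in> I" "x \<noteq> \<zero>" using I.zero_closed by blast
      have xc: "x \<in> carrier R" using x I.a_subset by blast
      obtain i where i: "i < k" "a i \<otimes> x \<noteq> \<zero>" using nonzero_row[OF xc x(2)] by blast
      obtain j where j: "j < k" "a i \<otimes> x \<otimes> b j \<noteq> \<zero>" using nonzero_column[of "a i \<otimes> x"] i xc by auto
      obtain v where v: "v \<in> carrier R" "v \<otimes> (a i \<otimes> x \<otimes> b j) = e"
        using div[OF entry_closed[OF i(1) j(1) xc] j(2)] by (auto simp: Units_def)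
      have "v \<otimes> (a i \<otimes> x \<otimes> b j) \<in> I" using x(1) v(1) i j by (intro I.I_l_closed I.I_r_closed) auto
      then have eI: "e \<in> I" using v(2) by simp
      have baI: "b l \<otimes> a l \<in> I" if "l < k" for l
      proof -
        have "b l \<otimes> e \<otimes> a l \<in> I" using eI that by (intro I.I_r_closed I.I_l_closed) auto
        then show ?thesis using that by (simp add: b_e)
      qed
      have "(\<Oplus>l\<in>A. b l \<otimes> a l) \<in> I" if "finite A" "A \<subseteq> {..<k}" for A
        using that
      proof (induct A rule: finite_induct)
        case (insert l A)
        then have "(\<lambda>l. b l \<otimes> a l) \<in> A \<rightarrow> carrier R" "l < k" by auto
        then show ?case using insert baI by (simp add: finsum_insert I.a_closed)
      qed (simp add: I.zero_closed)
      then have "\<one> \<in> I" using sum_ba by (metis finite_lessThan order_refl)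
      then show False using I.one_imp_carrier \<open>I \<noteq> carrier R\<close> by blast
    qed
  qed
qed

end

section \<open>The bimodule over a local corner and over its matrix ring\<close>

text \<open>\<open>cR = Rc\<close> allows all factors \<open>c\<close> to be collected on the left,
  so \<open>x^n\<close> lies in \<open>c^n R\<close>.\<close>

lemma (in uniformizer_ring) nonunit_nilpotent:
  assumes x: "x \<in> carrier R" "x \<notin> Units R"
  shows "\<exists>n::nat. x [^] n = \<zero>"
proof -
  have "\<exists>y\<in>carrier R. x [^] n = c [^] n \<otimes> y" for n :: nat
  proof (induct n)
    case (Suc n)
    then obtain y where y: "y \<in> carrier R" "x [^] n = c [^] n \<otimes> y" by blast
    obtain z where z: "z \<in> carrier R" "x = z \<otimes> c" using nonunit_multiple[OF x] by blast
    have "\<exists>v\<in>carrier R. y \<otimes> x = v \<otimes> c"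
      by (rule bexI[of _ "y \<otimes> z"]) (use y(1) z in \<open>simp_all add: m_assoc\<close>)
    then have "\<exists>w\<in>carrier R. y \<otimes> x = c \<otimes> w"
      using mult_c_iff[of "y \<otimes> x"] c_mult_iff[of "y \<otimes> x"] y(1) x(1) by simp
    then obtain w where w: "w \<in> carrier R" "y \<otimes> x = c \<otimes> w" by blast
    have "x [^] Suc n = c [^] n \<otimes> (y \<otimes> x)" using y x(1) by (simp add: m_assoc)
    also have "\<dots> = c [^] Suc n \<otimes> w" unfolding w(2) using w(1) by (simp add: m_assoc)
    finally show ?case using w(1) by blast
  qed (use x in auto)
  then show ?thesis using nilpotent by (metis l_null)
qed

text \<open>\<open>fst\<close> maps the corner of the trivial extension onto \<open>ePe\<close>, and
  uniformizers pass to nonzero quotients.\<close>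

lemma ring_hom_fst_corner:
  assumes bim: "bimodule P N" and e: "e \<in> carrier P" "e \<otimes>\<^bsub>P\<^esub> e = e"
    and u: "uniformizer (corner (P \<propto> N) (e, \<zero>\<^bsub>N\<^esub>)) c"
  shows "uniformizer (corner P e) (fst c)"
proof -
  interpret bimodule P N by fact
  have ne: "e \<noteq> \<zero>\<^bsub>P\<^esub>" using u by (auto simp: uniformizer_def)
  have "fst \<in> ring_hom (corner (P \<propto> N) (e, \<zero>\<^bsub>N\<^esub>)) (corner P e)"
    by (rule ring_hom_memI) auto
  moreover have "carrier (corner P e) \<subseteq> fst ` carrier (corner (P \<propto> N) (e, \<zero>\<^bsub>N\<^esub>))"
  proof
    fix x assume x: "x \<in> carrier (corner P e)"
    have "(x, \<zero>\<^bsub>N\<^esub>) \<in> carrier (corner (P \<propto> N) (e, \<zero>\<^bsub>N\<^esub>))"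
      unfolding corner_trivial_extension_mem[OF e(1)] using x e(1) by simp
    then show "x \<in> fst ` carrier (corner (P \<propto> N) (e, \<zero>\<^bsub>N\<^esub>))" by force
  qed
  ultimately show ?thesis
    using uniformizer_ring_hom[OF u ring_corner[OF R.ring_axioms e]] ne by simp
qed

text \<open>\<open>T = eSe\<close> is uniserial and \<open>(t, 0)\<close> is not a multiple of \<open>(0, n)\<close>, so the latter is a multiple of the former. Hence
  \<open>eNe = (eNe)t\<close>, which for a nilpotent \<open>t\<close> is only possible if \<open>eNe = 0\<close>.\<close>

lemma corner_bimodule_division:
  assumes bim: "bimodule P N" and e: "e \<in> carrier P" "e \<otimes>\<^bsub>P\<^esub> e = e"
    and u: "uniformizer (corner (P \<propto> N) (e, \<zero>\<^bsub>N\<^esub>)) c"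
    and n: "n \<in> carrier N" "e \<odot>\<^bsub>N\<^esub> n = n" "rsmult N n e = n" "n \<noteq> \<zero>\<^bsub>N\<^esub>"
  shows "\<And>t. t \<in> carrier (corner P e) \<Longrightarrow> t \<noteq> \<zero>\<^bsub>P\<^esub> \<Longrightarrow> t \<in> Units (corner P e)"
    and "\<And>m. m \<in> carrier N \<Longrightarrow> e \<odot>\<^bsub>N\<^esub> m = m \<Longrightarrow> rsmult N m e = m \<Longrightarrow> \<exists>t\<in>carrier (corner P e). m = t \<odot>\<^bsub>N\<^esub> n"
    and "\<And>m. m \<in> carrier N \<Longrightarrow> e \<odot>\<^bsub>N\<^esub> m = m \<Longrightarrow> rsmult N m e = m \<Longrightarrow> \<exists>t\<in>carrier (corner P e). m = rsmult N n t"
proof -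
  interpret bimodule P N by fact
  let ?T = "corner (P \<propto> N) (e, \<zero>\<^bsub>N\<^esub>)"
  note mem = corner_trivial_extension_mem[OF e(1)]
  interpret T: uniformizer_ring ?T c
    using u by (simp add: uniformizer_ring_def uniformizer_ring_axioms_def uniformizer_def)
  note uA = ring_hom_fst_corner[OF bim e u]
  interpret A: uniformizer_ring "corner P e" "fst c"
    using uA by (simp add: uniformizer_ring_def uniformizer_ring_axioms_def uniformizer_def)
  define C where "C = {m \<in> carrier N. e \<odot>\<^bsub>N\<^esub> m = m \<and> rsmult N m e = m}"
  have CT: "(\<zero>\<^bsub>P\<^esub>, m) \<in> carrier ?T" if "m \<in> C" for m using that e unfolding mem C_def by simp
  have AT: "(t, \<zero>\<^bsub>N\<^esub>) \<in> carrier ?T" if "t \<in> carrier (corner P e)" for t using that e unfolding mem by simp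
  have Tc: "fst z \<in> carrier (corner P e)" "snd z \<in> C" if "z \<in> carrier ?T" for z
    using that mem[of "fst z" "snd z"] by (auto simp: C_def simp del: corner_simps)
  \<comment> \<open>A single comparison of \<open>val\<close> decides both sides at once, so the
    same one of the two elements is the left and the right multiple of the other.\<close>
  have comp: "(\<exists>r\<in>carrier ?T. y = r \<otimes>\<^bsub>P \<propto> N\<^esub> x) \<and> (\<exists>r\<in>carrier ?T. y = x \<otimes>\<^bsub>P \<propto> N\<^esub> r) \<or>
      (\<exists>r\<in>carrier ?T. x = r \<otimes>\<^bsub>P \<propto> N\<^esub> y) \<and> (\<exists>r\<in>carrier ?T. x = y \<otimes>\<^bsub>P \<propto> N\<^esub> r)"
    if "x \<in> carrier ?T" "y \<in> carrier ?T" for x y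
    using T.val_divides[OF that] T.val_divides[OF that(2,1)] nat_le_linear unfolding corner_simps(2) by blast
  show div: "t \<in> Units (corner P e)" if t: "t \<in> carrier (corner P e)" "t \<noteq> \<zero>\<^bsub>P\<^esub>" for t
  proof (rule ccontr)
    assume "t \<notin> Units (corner P e)"
    then obtain l :: nat where l: "t [^]\<^bsub>corner P e\<^esub> l = \<zero>\<^bsub>P\<^esub>" using A.nonunit_nilpotent[OF t(1)] by auto
    have tc: "t \<in> carrier P" using t by simp
    have step: "\<exists>m'\<in>C. m = rsmult N m' t" if m: "m \<in> C" for m
    proof -
      have no: "(t, \<zero>\<^bsub>N\<^esub>) \<noteq> r \<otimes>\<^bsub>P \<propto> N\<^esub> (\<zero>\<^bsub>P\<^esub>, m)" if "r \<in> carrier ?T" for r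
        using that t(2) by (cases r) auto
      then obtain r where r: "r \<in> carrier ?T" "(\<zero>\<^bsub>P\<^esub>, m) = r \<otimes>\<^bsub>P \<propto> N\<^esub> (t, \<zero>\<^bsub>N\<^esub>)"
        using comp[OF AT[OF t(1)] CT[OF m]] by blast
      obtain r1 r2 where r12: "r = (r1, r2)" by (cases r)
      then have "r1 \<in> carrier P" "r2 \<in> C" using Tc[OF r(1)] by auto
      then have "m = rsmult N r2 t" using r(2) r12 tc by (simp add: rsmult_closed C_def)
      then show ?thesis using \<open>r2 \<in> C\<close> by blast
    qed
    have "\<exists>m'\<in>C. m = rsmult N m' (t [^]\<^bsub>corner P e\<^esub> l)" if m: "m \<in> C" for m and l :: nat
      using m
    proof (induct l arbitrary: m)
      case 0
      then show ?case by (intro bexI[of _ m]) (auto simp: C_def)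
    next
      case (Suc l)
      obtain m1 where m1: "m1 \<in> C" "m = rsmult N m1 t" using step Suc.prems by blast
      obtain m2 where m2: "m2 \<in> C" "m1 = rsmult N m2 (t [^]\<^bsub>corner P e\<^esub> l)" using Suc.hyps[OF m1(1)] by blast
      have "t [^]\<^bsub>corner P e\<^esub> l \<in> carrier P" using A.nat_pow_closed[OF t(1), of l] by simp
      then have "m = rsmult N m2 (t [^]\<^bsub>corner P e\<^esub> Suc l)"
        unfolding m1(2) m2(2) using m2(1) tc by (simp add: rsmult_assoc C_def)
      then show ?case using m2(1) by blast
    qed
    moreover have "n \<in> C" using n by (simp add: C_def)
    ultimately obtain m' where "m' \<in> C" "n = rsmult N m' \<zero>\<^bsub>P\<^esub>" using l by metis
    then show False using n(4) by (simp add: C_def)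
  qed
  have nC: "n \<in> C" using n by (simp add: C_def)
  fix m assume m: "m \<in> carrier N" "e \<odot>\<^bsub>N\<^esub> m = m" "rsmult N m e = m"
  then have mC: "m \<in> C" by (simp add: C_def)
  have lm: "\<exists>t\<in>carrier (corner P e). y = t \<odot>\<^bsub>N\<^esub> x" if xy: "x \<in> C" "\<exists>r\<in>carrier ?T. (\<zero>\<^bsub>P\<^esub>, y) = r \<otimes>\<^bsub>P \<propto> N\<^esub> (\<zero>\<^bsub>P\<^esub>, x)" for x y
  proof -
    obtain r1 r2 where r: "(r1, r2) \<in> carrier ?T" "(\<zero>\<^bsub>P\<^esub>, y) = (r1, r2) \<otimes>\<^bsub>P \<propto> N\<^esub> (\<zero>\<^bsub>P\<^esub>, x)" using xy(2) by auto
    have "r1 \<in> carrier (corner P e)" "r2 \<in> C" using Tc[OF r(1)] by auto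
    moreover have "y = r1 \<odot>\<^bsub>N\<^esub> x" using r(2) xy(1) calculation by (simp add: C_def lsmult_closed)
    ultimately show ?thesis by blast
  qed
  have rm: "\<exists>t\<in>carrier (corner P e). y = rsmult N x t" if xy: "x \<in> C" "\<exists>r\<in>carrier ?T. (\<zero>\<^bsub>P\<^esub>, y) = (\<zero>\<^bsub>P\<^esub>, x) \<otimes>\<^bsub>P \<propto> N\<^esub> r" for x y
  proof -
    obtain r1 r2 where r: "(r1, r2) \<in> carrier ?T" "(\<zero>\<^bsub>P\<^esub>, y) = (\<zero>\<^bsub>P\<^esub>, x) \<otimes>\<^bsub>P \<propto> N\<^esub> (r1, r2)" using xy(2) by auto
    have "r1 \<in> carrier (corner P e)" "r2 \<in> C" using Tc[OF r(1)] by auto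
    moreover have "y = rsmult N x r1" using r(2) xy(1) calculation by (simp add: C_def rsmult_closed)
    ultimately show ?thesis by blast
  qed
  show "\<exists>t\<in>carrier (corner P e). m = t \<odot>\<^bsub>N\<^esub> n"
  proof (cases "\<exists>r\<in>carrier ?T. (\<zero>\<^bsub>P\<^esub>, m) = r \<otimes>\<^bsub>P \<propto> N\<^esub> (\<zero>\<^bsub>P\<^esub>, n)")
    case True
    then show ?thesis using lm[OF nC] by blast
  next
    case False
    \<comment> \<open>Now \<open>n = tm\<close> with \<open>t \<noteq> 0\<close>, and
      \<open>t\<close> can be moved to the other side because it is a unit of the corner by
      \<open>div\<close>.\<close>
    then have "\<exists>r\<in>carrier ?T. (\<zero>\<^bsub>P\<^esub>, n) = r \<otimes>\<^bsub>P \<propto> N\<^esub> (\<zero>\<^bsub>P\<^esub>, m)" using comp[OF CT[OF nC] CT[OF mC]] by blast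
    then obtain t where t: "t \<in> carrier (corner P e)" "n = t \<odot>\<^bsub>N\<^esub> m" using lm[OF mC] by blast
    then have "t \<noteq> \<zero>\<^bsub>P\<^esub>" using n(4) m(1) by auto
    then obtain v where v: "v \<in> carrier (corner P e)" "v \<otimes>\<^bsub>P\<^esub> t = e" using div[OF t(1)] by (auto simp: Units_def)
    have "v \<odot>\<^bsub>N\<^esub> n = (v \<otimes>\<^bsub>P\<^esub> t) \<odot>\<^bsub>N\<^esub> m" unfolding t(2) using v(1) t(1) m(1) by (simp add: lsmult_assoc)
    then show ?thesis using v m by (intro bexI[of _ v]) auto
  qed
  show "\<exists>t\<in>carrier (corner P e). m = rsmult N n t"
  proof (cases "\<exists>r\<in>carrier ?T. (\<zero>\<^bsub>P\<^esub>, m) = (\<zero>\<^bsub>P\<^esub>, n) \<otimes>\<^bsub>P \<propto> N\<^esub> r")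
    case True
    then show ?thesis using rm[OF nC] by blast
  next
    case False
    then have "\<exists>r\<in>carrier ?T. (\<zero>\<^bsub>P\<^esub>, n) = (\<zero>\<^bsub>P\<^esub>, m) \<otimes>\<^bsub>P \<propto> N\<^esub> r" using comp[OF CT[OF nC] CT[OF mC]] by blast
    then obtain t where t: "t \<in> carrier (corner P e)" "n = rsmult N m t" using rm[OF mC] by blast
    then have "t \<noteq> \<zero>\<^bsub>P\<^esub>" using n(4) m(1) by auto
    then obtain v where v: "v \<in> carrier (corner P e)" "t \<otimes>\<^bsub>P\<^esub> v = e" using div[OF t(1)] by (auto simp: Units_def)
    have "rsmult N n v = rsmult N m (t \<otimes>\<^bsub>P\<^esub> v)" unfolding t(2) using v(1) t(1) m(1) by (simp add: rsmult_assoc)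
    then show ?thesis using v m by (intro bexI[of _ v]) auto
  qed
qed

lemma (in matrix_units) rows_eqI:
  assumes "x \<in> carrier R" "y \<in> carrier R" "\<And>i. i < k \<Longrightarrow> a i \<otimes> x = a i \<otimes> y"
  shows "x = y"
  by (rule entries_eqI) (use assms in simp_all)

lemma (in matrix_units) columns_eqI:
  assumes x: "x \<in> carrier R" and y: "y \<in> carrier R" and eq: "\<And>i. i < k \<Longrightarrow> x \<otimes> b i = y \<otimes> b i"
  shows "x = y"
proof (rule entries_eqI[OF x y])
  fix i j assume "i < k" "j < k"
  then show "a i \<otimes> x \<otimes> b j = a i \<otimes> y \<otimes> b j" using x y eq by (simp add: m_assoc)
qed

text \<open>If \<open>eNe\<close> is generated by \<open>n \<noteq> 0\<close> then \<open>N\<close> is generated, freely on both sides, by the element \<open>u\<close> which corresponds to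
  the diagonal matrix with all diagonal entries equal to \<open>n\<close>; the automorphism is given by \<open>ur = \<sigma>(r)u\<close>.\<close>

lemma zero_or_twisted_if_uniformizer:
  assumes bim: "bimodule P N" and mu: "matrix_units P e k a b"
    and un: "uniformizer (corner (P \<propto> N) (e, \<zero>\<^bsub>N\<^esub>)) c"
  shows "zero_or_twisted P N"
proof (cases "carrier N = {\<zero>\<^bsub>N\<^esub>}")
  case True
  then show ?thesis by (simp add: zero_or_twisted_def)
next
  case False
  interpret bimodule P N by fact
  interpret m: matrix_units P e k a b by fact
  interpret S: matrix_units "P \<propto> N" "(e, \<zero>\<^bsub>N\<^esub>)" k "\<lambda>i. (a i, \<zero>\<^bsub>N\<^esub>)" "\<lambda>i. (b i, \<zero>\<^bsub>N\<^esub>)"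
    by (rule matrix_units_trivial_extension[OF mu])
  let ?A = "corner P e"
  note ec = m.e_closed m.e_idem
  note mem = corner_trivial_extension_mem[OF ec(1)]
  obtain x0 where x0: "x0 \<in> carrier N" "x0 \<noteq> \<zero>\<^bsub>N\<^esub>" using False M.zero_closed by blast
  have x0S: "(\<zero>\<^bsub>P\<^esub>, x0) \<in> carrier (P \<propto> N)" "(\<zero>\<^bsub>P\<^esub>, x0) \<noteq> \<zero>\<^bsub>P \<propto> N\<^esub>" using x0 by auto
  obtain i where i: "i < k" "(a i, \<zero>\<^bsub>N\<^esub>) \<otimes>\<^bsub>P \<propto> N\<^esub> (\<zero>\<^bsub>P\<^esub>, x0) \<noteq> \<zero>\<^bsub>P \<propto> N\<^esub>" using S.nonzero_row[OF x0S] by blast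
  have "(a i, \<zero>\<^bsub>N\<^esub>) \<otimes>\<^bsub>P \<propto> N\<^esub> (\<zero>\<^bsub>P\<^esub>, x0) \<in> carrier (P \<propto> N)"
    by (rule S.m_closed[OF S.a_closed[OF i(1)] x0S(1)])
  from S.nonzero_column[OF this i(2)] obtain j where j: "j < k"
    "(a i, \<zero>\<^bsub>N\<^esub>) \<otimes>\<^bsub>P \<propto> N\<^esub> (\<zero>\<^bsub>P\<^esub>, x0) \<otimes>\<^bsub>P \<propto> N\<^esub> (b j, \<zero>\<^bsub>N\<^esub>) \<noteq> \<zero>\<^bsub>P \<propto> N\<^esub>" by blast
  have entry: "(a i, \<zero>\<^bsub>N\<^esub>) \<otimes>\<^bsub>P \<propto> N\<^esub> (\<zero>\<^bsub>P\<^esub>, x) \<otimes>\<^bsub>P \<propto> N\<^esub> (b j, \<zero>\<^bsub>N\<^esub>) = (\<zero>\<^bsub>P\<^esub>, rsmult N (a i \<odot>\<^bsub>N\<^esub> x) (b j))"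
    if "i < k" "j < k" "x \<in> carrier N" for i j x
    using that by (simp add: lsmult_closed rsmult_closed)
  have entryC: "rsmult N (a i \<odot>\<^bsub>N\<^esub> x) (b j) \<in> carrier N" "e \<odot>\<^bsub>N\<^esub> rsmult N (a i \<odot>\<^bsub>N\<^esub> x) (b j) = rsmult N (a i \<odot>\<^bsub>N\<^esub> x) (b j)"
    "rsmult N (rsmult N (a i \<odot>\<^bsub>N\<^esub> x) (b j)) e = rsmult N (a i \<odot>\<^bsub>N\<^esub> x) (b j)"
    if "i < k" "j < k" "x \<in> carrier N" for i j x
  proof -
    have "(\<zero>\<^bsub>P\<^esub>, x) \<in> carrier (P \<propto> N)" using that by simp
    from S.entry_closed[OF that(1,2) this] entry[OF that]
    have "(\<zero>\<^bsub>P\<^esub>, rsmult N (a i \<odot>\<^bsub>N\<^esub> x) (b j)) \<in> carrier (corner (P \<propto> N) (e, \<zero>\<^bsub>N\<^esub>))" by metis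
    then show "rsmult N (a i \<odot>\<^bsub>N\<^esub> x) (b j) \<in> carrier N" "e \<odot>\<^bsub>N\<^esub> rsmult N (a i \<odot>\<^bsub>N\<^esub> x) (b j) = rsmult N (a i \<odot>\<^bsub>N\<^esub> x) (b j)"
      "rsmult N (rsmult N (a i \<odot>\<^bsub>N\<^esub> x) (b j)) e = rsmult N (a i \<odot>\<^bsub>N\<^esub> x) (b j)" unfolding mem by auto
  qed
  \<comment> \<open>A nonzero entry of \<open>x0\<close>; by \<open>entryC\<close> it lies in
    \<open>eNe\<close>.\<close>
  define n where "n = rsmult N (a i \<odot>\<^bsub>N\<^esub> x0) (b j)"
  have n: "n \<in> carrier N" "e \<odot>\<^bsub>N\<^esub> n = n" "rsmult N n e = n" "n \<noteq> \<zero>\<^bsub>N\<^esub>"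
    using entryC[OF i(1) j(1) x0(1)] j(2) entry[OF i(1) j(1) x0(1)] by (auto simp: n_def)
  note D = corner_bimodule_division[OF bim ec un n]
  have e0: "e \<noteq> \<zero>\<^bsub>P\<^esub>" using n(1,2,4) by auto
  have simple: "simple_ring P" by (rule m.simple_if_division[OF D(1) e0])
  have art: "artinian_ring P" by (rule m.artinian_if_division[OF D(1)])
  interpret A: ring ?A by (rule ring_corner[OF R.ring_axioms ec])
  \<comment> \<open>\<open>n\<close> is free on both sides: a nonzero difference \<open>d\<close> of
    two coefficients is invertible and cannot annihilate \<open>n\<close>.\<close>
  have cancel: "t = t'" if tt: "t \<in> carrier ?A" "t' \<in> carrier ?A"
    "t \<odot>\<^bsub>N\<^esub> n = t' \<odot>\<^bsub>N\<^esub> n \<or> rsmult N n t = rsmult N n t'" for t t'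
  proof (rule ccontr)
    assume ne: "t \<noteq> t'"
    define d where "d = t \<ominus>\<^bsub>P\<^esub> t'"
    have tc: "t \<in> carrier P" "t' \<in> carrier P" using tt by auto
    have dA: "d \<in> carrier ?A"
      unfolding d_def using tt by (auto simp: R.minus_eq R.l_distr R.r_distr R.l_minus R.r_minus)
    have dt: "d \<oplus>\<^bsub>P\<^esub> t' = t" unfolding d_def using tc by (simp add: R.minus_eq R.a_assoc R.l_neg)
    have "d \<noteq> \<zero>\<^bsub>P\<^esub>" using dt ne tc by auto
    then obtain v where v: "v \<in> carrier P" "v \<otimes>\<^bsub>P\<^esub> d = e" "d \<otimes>\<^bsub>P\<^esub> v = e"
      using D(1)[OF dA] by (auto simp: Units_def)
    have dc: "d \<in> carrier P" using dA by simp
    from tt(3) show False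
    proof
      assume eq: "t \<odot>\<^bsub>N\<^esub> n = t' \<odot>\<^bsub>N\<^esub> n"
      have "d \<odot>\<^bsub>N\<^esub> n \<oplus>\<^bsub>N\<^esub> t' \<odot>\<^bsub>N\<^esub> n = t' \<odot>\<^bsub>N\<^esub> n" using lsmult_l_distr[OF dc tc(2) n(1)] dt eq by simp
      then have "d \<odot>\<^bsub>N\<^esub> n = \<zero>\<^bsub>N\<^esub>" using n(1) dc tc lsmult_closed by (metis M.add.r_cancel_one)
      then have "e \<odot>\<^bsub>N\<^esub> n = \<zero>\<^bsub>N\<^esub>" using lsmult_assoc[OF v(1) dc n(1)] v by simp
      then show False using n by simp
    next
      assume eq: "rsmult N n t = rsmult N n t'"
      have "rsmult N n d \<oplus>\<^bsub>N\<^esub> rsmult N n t' = rsmult N n t'" using rsmult_r_distr[OF dc tc(2) n(1)] dt eq by simp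
      then have "rsmult N n d = \<zero>\<^bsub>N\<^esub>" using n(1) dc tc rsmult_closed by (metis M.add.r_cancel_one)
      then have "rsmult N n e = \<zero>\<^bsub>N\<^esub>" using rsmult_assoc[OF dc v(1) n(1)] v by simp
      then show False using n by simp
    qed
  qed
  define \<nu> where "\<nu> = (\<zero>\<^bsub>P\<^esub>, n)"
  have \<nu>C: "\<nu> \<in> carrier (corner (P \<propto> N) (e, \<zero>\<^bsub>N\<^esub>))" unfolding \<nu>_def mem using n ec by simp
  have zC: "\<zero>\<^bsub>P \<propto> N\<^esub> \<in> carrier (corner (P \<propto> N) (e, \<zero>\<^bsub>N\<^esub>))" using ec by simp
  have \<delta>: "(if i = j then \<nu> else \<zero>\<^bsub>P \<propto> N\<^esub>) \<in> carrier (corner (P \<propto> N) (e, \<zero>\<^bsub>N\<^esub>))" for i j :: nat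
    by (cases "i = j") (simp_all only: \<nu>C zC if_True if_False simp_thms)
  \<comment> \<open>\<open>U\<close> is the matrix with \<open>\<nu> = (0, n)\<close> along the
    diagonal. All entries of its ring component \<open>u'\<close> are zero, so it has the form
    \<open>(0, u)\<close>.\<close>
  obtain U where U: "U \<in> carrier (P \<propto> N)"
    "\<And>i j. i < k \<Longrightarrow> j < k \<Longrightarrow> (a i, \<zero>\<^bsub>N\<^esub>) \<otimes>\<^bsub>P \<propto> N\<^esub> U \<otimes>\<^bsub>P \<propto> N\<^esub> (b j, \<zero>\<^bsub>N\<^esub>) = (if i = j then \<nu> else \<zero>\<^bsub>P \<propto> N\<^esub>)"
    using S.entries_exist[of "\<lambda>i j. if i = j then \<nu> else \<zero>\<^bsub>P \<propto> N\<^esub>", OF \<delta>] by blast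
  obtain u' u where Uu: "U = (u', u)" "u' \<in> carrier P" "u \<in> carrier N" using U(1) by auto
  have "u' = \<zero>\<^bsub>P\<^esub>"
  proof (rule m.entries_eqI[OF Uu(2) R.zero_closed])
    fix i j assume "i < k" "j < k"
    then show "a i \<otimes>\<^bsub>P\<^esub> u' \<otimes>\<^bsub>P\<^esub> b j = a i \<otimes>\<^bsub>P\<^esub> \<zero>\<^bsub>P\<^esub> \<otimes>\<^bsub>P\<^esub> b j"
      using U(2)[of i j] Uu by (simp add: \<nu>_def lsmult_closed rsmult_closed split: if_splits)
  qed
  then have Uu: "U = (\<zero>\<^bsub>P\<^esub>, u)" "u \<in> carrier N" using Uu by auto
  have \<nu>c: "\<nu> \<in> carrier (P \<propto> N)" "(e, \<zero>\<^bsub>N\<^esub>) \<otimes>\<^bsub>P \<propto> N\<^esub> \<nu> = \<nu>" "\<nu> \<otimes>\<^bsub>P \<propto> N\<^esub> (e, \<zero>\<^bsub>N\<^esub>) = \<nu>" using \<nu>C by auto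
  \<comment> \<open>\<open>U\<close> passes through the matrix units and becomes
    \<open>\<nu>\<close> in the corner: \<open>U b = b \<nu>\<close>, and likewise
    \<open>a U = \<nu> a\<close>.\<close>
  have UB: "U \<otimes>\<^bsub>P \<propto> N\<^esub> (b j, \<zero>\<^bsub>N\<^esub>) = (b j, \<zero>\<^bsub>N\<^esub>) \<otimes>\<^bsub>P \<propto> N\<^esub> \<nu>" if j: "j < k" for j
  proof (rule S.rows_eqI)
    note bS = S.b_closed[OF j]
    show "U \<otimes>\<^bsub>P \<propto> N\<^esub> (b j, \<zero>\<^bsub>N\<^esub>) \<in> carrier (P \<propto> N)" by (rule S.m_closed[OF U(1) bS])
    show "(b j, \<zero>\<^bsub>N\<^esub>) \<otimes>\<^bsub>P \<propto> N\<^esub> \<nu> \<in> carrier (P \<propto> N)" by (rule S.m_closed[OF bS \<nu>c(1)])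
    fix i assume i: "i < k"
    note aS = S.a_closed[OF i]
    show "(a i, \<zero>\<^bsub>N\<^esub>) \<otimes>\<^bsub>P \<propto> N\<^esub> (U \<otimes>\<^bsub>P \<propto> N\<^esub> (b j, \<zero>\<^bsub>N\<^esub>)) = (a i, \<zero>\<^bsub>N\<^esub>) \<otimes>\<^bsub>P \<propto> N\<^esub> ((b j, \<zero>\<^bsub>N\<^esub>) \<otimes>\<^bsub>P \<propto> N\<^esub> \<nu>)"
      unfolding S.m_assoc[OF aS U(1) bS, symmetric] S.m_assoc[OF aS bS \<nu>c(1), symmetric] U(2)[OF i j] S.a_b[OF i j]
      using \<nu>c by (auto simp: S.l_null simp del: trivial_extension_simps)
  qed
  have AU: "(a i, \<zero>\<^bsub>N\<^esub>) \<otimes>\<^bsub>P \<propto> N\<^esub> U = \<nu> \<otimes>\<^bsub>P \<propto> N\<^esub> (a i, \<zero>\<^bsub>N\<^esub>)" if i: "i < k" for i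
  proof (rule S.columns_eqI)
    note aS = S.a_closed[OF i]
    show "(a i, \<zero>\<^bsub>N\<^esub>) \<otimes>\<^bsub>P \<propto> N\<^esub> U \<in> carrier (P \<propto> N)" by (rule S.m_closed[OF aS U(1)])
    show "\<nu> \<otimes>\<^bsub>P \<propto> N\<^esub> (a i, \<zero>\<^bsub>N\<^esub>) \<in> carrier (P \<propto> N)" by (rule S.m_closed[OF \<nu>c(1) aS])
    fix j assume j: "j < k"
    note bS = S.b_closed[OF j]
    show "(a i, \<zero>\<^bsub>N\<^esub>) \<otimes>\<^bsub>P \<propto> N\<^esub> U \<otimes>\<^bsub>P \<propto> N\<^esub> (b j, \<zero>\<^bsub>N\<^esub>) = \<nu> \<otimes>\<^bsub>P \<propto> N\<^esub> (a i, \<zero>\<^bsub>N\<^esub>) \<otimes>\<^bsub>P \<propto> N\<^esub> (b j, \<zero>\<^bsub>N\<^esub>)"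
      unfolding S.m_assoc[OF \<nu>c(1) aS bS] U(2)[OF i j] S.a_b[OF i j]
      using \<nu>c by (auto simp: S.r_null simp del: trivial_extension_simps)
  qed
  have rS: "(r, \<zero>\<^bsub>N\<^esub>) \<in> carrier (P \<propto> N)" if "r \<in> carrier P" for r using that by simp
  have ent: "(a i, \<zero>\<^bsub>N\<^esub>) \<otimes>\<^bsub>P \<propto> N\<^esub> (r, \<zero>\<^bsub>N\<^esub>) \<otimes>\<^bsub>P \<propto> N\<^esub> (b j, \<zero>\<^bsub>N\<^esub>) = (a i \<otimes>\<^bsub>P\<^esub> r \<otimes>\<^bsub>P\<^esub> b j, \<zero>\<^bsub>N\<^esub>)"
    if "i < k" "j < k" "r \<in> carrier P" for i j r using that by simp
  \<comment> \<open>Entrywise, acting on \<open>u\<close> is acting on \<open>n\<close>, so freeness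
    and generation transfer from \<open>n\<close> over \<open>ePe\<close> to \<open>u\<close> over
    \<open>P\<close>.\<close>
  have left_entry: "rsmult N (a i \<odot>\<^bsub>N\<^esub> (r \<odot>\<^bsub>N\<^esub> u)) (b j) = (a i \<otimes>\<^bsub>P\<^esub> r \<otimes>\<^bsub>P\<^esub> b j) \<odot>\<^bsub>N\<^esub> n"
    if ij: "i < k" "j < k" and r: "r \<in> carrier P" for i j r
  proof -
    have "(\<zero>\<^bsub>P\<^esub>, rsmult N (a i \<odot>\<^bsub>N\<^esub> (r \<odot>\<^bsub>N\<^esub> u)) (b j))
        = (a i, \<zero>\<^bsub>N\<^esub>) \<otimes>\<^bsub>P \<propto> N\<^esub> ((r, \<zero>\<^bsub>N\<^esub>) \<otimes>\<^bsub>P \<propto> N\<^esub> U) \<otimes>\<^bsub>P \<propto> N\<^esub> (b j, \<zero>\<^bsub>N\<^esub>)"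
      unfolding Uu(1) using ij r Uu(2) by (simp add: lsmult_closed rsmult_closed)
    also have "\<dots> = (a i, \<zero>\<^bsub>N\<^esub>) \<otimes>\<^bsub>P \<propto> N\<^esub> (r, \<zero>\<^bsub>N\<^esub>) \<otimes>\<^bsub>P \<propto> N\<^esub> (U \<otimes>\<^bsub>P \<propto> N\<^esub> (b j, \<zero>\<^bsub>N\<^esub>))"
      using S.m_assoc S.a_closed[OF ij(1)] S.b_closed[OF ij(2)] rS[OF r] U(1) S.m_closed by metis
    also have "\<dots> = (a i, \<zero>\<^bsub>N\<^esub>) \<otimes>\<^bsub>P \<propto> N\<^esub> (r, \<zero>\<^bsub>N\<^esub>) \<otimes>\<^bsub>P \<propto> N\<^esub> (b j, \<zero>\<^bsub>N\<^esub>) \<otimes>\<^bsub>P \<propto> N\<^esub> \<nu>"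
      unfolding UB[OF ij(2)] using S.m_assoc S.a_closed[OF ij(1)] S.b_closed[OF ij(2)] rS[OF r] \<nu>c(1) S.m_closed by metis
    also have "\<dots> = (\<zero>\<^bsub>P\<^esub>, (a i \<otimes>\<^bsub>P\<^esub> r \<otimes>\<^bsub>P\<^esub> b j) \<odot>\<^bsub>N\<^esub> n)"
      unfolding ent[OF ij r] \<nu>_def using ij r n(1) by (simp add: lsmult_closed)
    finally show ?thesis by simp
  qed
  have right_entry: "rsmult N (a i \<odot>\<^bsub>N\<^esub> (rsmult N u r)) (b j) = rsmult N n (a i \<otimes>\<^bsub>P\<^esub> r \<otimes>\<^bsub>P\<^esub> b j)"
    if ij: "i < k" "j < k" and r: "r \<in> carrier P" for i j r
  proof -
    have "(\<zero>\<^bsub>P\<^esub>, rsmult N (a i \<odot>\<^bsub>N\<^esub> (rsmult N u r)) (b j))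
        = (a i, \<zero>\<^bsub>N\<^esub>) \<otimes>\<^bsub>P \<propto> N\<^esub> (U \<otimes>\<^bsub>P \<propto> N\<^esub> (r, \<zero>\<^bsub>N\<^esub>)) \<otimes>\<^bsub>P \<propto> N\<^esub> (b j, \<zero>\<^bsub>N\<^esub>)"
      unfolding Uu(1) using ij r Uu(2) by (simp add: lsmult_closed rsmult_closed)
    also have "\<dots> = ((a i, \<zero>\<^bsub>N\<^esub>) \<otimes>\<^bsub>P \<propto> N\<^esub> U) \<otimes>\<^bsub>P \<propto> N\<^esub> (r, \<zero>\<^bsub>N\<^esub>) \<otimes>\<^bsub>P \<propto> N\<^esub> (b j, \<zero>\<^bsub>N\<^esub>)"
      using S.m_assoc S.a_closed[OF ij(1)] S.b_closed[OF ij(2)] rS[OF r] U(1) S.m_closed by metis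
    also have "\<dots> = \<nu> \<otimes>\<^bsub>P \<propto> N\<^esub> ((a i, \<zero>\<^bsub>N\<^esub>) \<otimes>\<^bsub>P \<propto> N\<^esub> (r, \<zero>\<^bsub>N\<^esub>) \<otimes>\<^bsub>P \<propto> N\<^esub> (b j, \<zero>\<^bsub>N\<^esub>))"
      unfolding AU[OF ij(1)] using S.m_assoc S.a_closed[OF ij(1)] S.b_closed[OF ij(2)] rS[OF r] \<nu>c(1) S.m_closed by metis
    also have "\<dots> = (\<zero>\<^bsub>P\<^esub>, rsmult N n (a i \<otimes>\<^bsub>P\<^esub> r \<otimes>\<^bsub>P\<^esub> b j))"
      unfolding ent[OF ij r] \<nu>_def using ij r n(1) by (simp add: rsmult_closed)
    finally show ?thesis by simp
  qed
  have N_eqI: "x = y" if xy: "x \<in> carrier N" "y \<in> carrier N"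
    "\<And>i j. i < k \<Longrightarrow> j < k \<Longrightarrow> rsmult N (a i \<odot>\<^bsub>N\<^esub> x) (b j) = rsmult N (a i \<odot>\<^bsub>N\<^esub> y) (b j)" for x y
  proof -
    have "(\<zero>\<^bsub>P\<^esub>, x) = (\<zero>\<^bsub>P\<^esub>, y)"
      by (rule S.entries_eqI) (use xy entry in \<open>auto simp del: trivial_extension_simps(2)\<close>)
    then show ?thesis by simp
  qed
  have Lb: "bij_betw (\<lambda>r. r \<odot>\<^bsub>N\<^esub> u) (carrier P) (carrier N)"
  proof (rule bij_betw_imageI)
    show "inj_on (\<lambda>r. r \<odot>\<^bsub>N\<^esub> u) (carrier P)"
    proof (rule inj_onI)
      fix r r' assume r: "r \<in> carrier P" "r' \<in> carrier P" "r \<odot>\<^bsub>N\<^esub> u = r' \<odot>\<^bsub>N\<^esub> u"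
      show "r = r'"
      proof (rule m.entries_eqI[OF r(1,2)])
        fix i j assume ij: "i < k" "j < k"
        show "a i \<otimes>\<^bsub>P\<^esub> r \<otimes>\<^bsub>P\<^esub> b j = a i \<otimes>\<^bsub>P\<^esub> r' \<otimes>\<^bsub>P\<^esub> b j"
          using cancel[OF m.entry_closed[OF ij r(1)] m.entry_closed[OF ij r(2)]]
            left_entry[OF ij r(1)] left_entry[OF ij r(2)] r(3) by simp
      qed
    qed
    show "(\<lambda>r. r \<odot>\<^bsub>N\<^esub> u) ` carrier P = carrier N"
    proof
      show "(\<lambda>r. r \<odot>\<^bsub>N\<^esub> u) ` carrier P \<subseteq> carrier N" using Uu(2) lsmult_closed by auto
      show "carrier N \<subseteq> (\<lambda>r. r \<odot>\<^bsub>N\<^esub> u) ` carrier P"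
      proof
        fix x assume x: "x \<in> carrier N"
        define t where "t i j = (SOME t. t \<in> carrier ?A \<and> rsmult N (a i \<odot>\<^bsub>N\<^esub> x) (b j) = t \<odot>\<^bsub>N\<^esub> n)" for i j
        have t: "t i j \<in> carrier ?A \<and> rsmult N (a i \<odot>\<^bsub>N\<^esub> x) (b j) = t i j \<odot>\<^bsub>N\<^esub> n" if "i < k" "j < k" for i j
          unfolding t_def by (rule someI_ex) (use D(2)[OF entryC[OF that x]] in \<open>unfold Bex_def\<close>)
        obtain r where r: "r \<in> carrier P" "\<And>i j. i < k \<Longrightarrow> j < k \<Longrightarrow> a i \<otimes>\<^bsub>P\<^esub> r \<otimes>\<^bsub>P\<^esub> b j = t i j"
          using m.entries_exist[of t, OF conjunct1[OF t]] by blast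
        have "x = r \<odot>\<^bsub>N\<^esub> u"
          by (rule N_eqI) (use x r t Uu(2) left_entry in \<open>auto simp: lsmult_closed\<close>)
        then show "x \<in> (\<lambda>r. r \<odot>\<^bsub>N\<^esub> u) ` carrier P" using r(1) by blast
      qed
    qed
  qed
  have Rb: "bij_betw (\<lambda>r. rsmult N u r) (carrier P) (carrier N)"
  proof (rule bij_betw_imageI)
    show "inj_on (\<lambda>r. rsmult N u r) (carrier P)"
    proof (rule inj_onI)
      fix r r' assume r: "r \<in> carrier P" "r' \<in> carrier P" "rsmult N u r = rsmult N u r'"
      show "r = r'"
      proof (rule m.entries_eqI[OF r(1,2)])
        fix i j assume ij: "i < k" "j < k"
        show "a i \<otimes>\<^bsub>P\<^esub> r \<otimes>\<^bsub>P\<^esub> b j = a i \<otimes>\<^bsub>P\<^esub> r' \<otimes>\<^bsub>P\<^esub> b j"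
          using cancel[OF m.entry_closed[OF ij r(1)] m.entry_closed[OF ij r(2)]]
            right_entry[OF ij r(1)] right_entry[OF ij r(2)] r(3) by simp
      qed
    qed
    show "(\<lambda>r. rsmult N u r) ` carrier P = carrier N"
    proof
      show "(\<lambda>r. rsmult N u r) ` carrier P \<subseteq> carrier N" using Uu(2) rsmult_closed by auto
      show "carrier N \<subseteq> (\<lambda>r. rsmult N u r) ` carrier P"
      proof
        fix x assume x: "x \<in> carrier N"
        define t where "t i j = (SOME t. t \<in> carrier ?A \<and> rsmult N (a i \<odot>\<^bsub>N\<^esub> x) (b j) = rsmult N n t)" for i j
        have t: "t i j \<in> carrier ?A \<and> rsmult N (a i \<odot>\<^bsub>N\<^esub> x) (b j) = rsmult N n (t i j)" if "i < k" "j < k" for i j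
          unfolding t_def by (rule someI_ex) (use D(3)[OF entryC[OF that x]] in \<open>unfold Bex_def\<close>)
        obtain r where r: "r \<in> carrier P" "\<And>i j. i < k \<Longrightarrow> j < k \<Longrightarrow> a i \<otimes>\<^bsub>P\<^esub> r \<otimes>\<^bsub>P\<^esub> b j = t i j"
          using m.entries_exist[of t, OF conjunct1[OF t]] by blast
        have "x = rsmult N u r"
          by (rule N_eqI) (use x r t Uu(2) right_entry in \<open>auto simp: rsmult_closed\<close>)
        then show "x \<in> (\<lambda>r. rsmult N u r) ` carrier P" using r(1) by blast
      qed
    qed
  qed
  define f where "f = inv_into (carrier P) (\<lambda>r. r \<odot>\<^bsub>N\<^esub> u)"
  have fb: "bij_betw f (carrier N) (carrier P)" unfolding f_def by (rule bij_betw_inv_into[OF Lb])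
  have fc: "f x \<in> carrier P" if "x \<in> carrier N" for x using fb that by (auto simp: bij_betw_def)
  have fu: "f x \<odot>\<^bsub>N\<^esub> u = x" if "x \<in> carrier N" for x
    unfolding f_def using Lb that by (intro f_inv_into_f[where f = "\<lambda>r. r \<odot>\<^bsub>N\<^esub> u"]) (auto simp: bij_betw_def)
  have feq: "f x = r" if "r \<in> carrier P" "r \<odot>\<^bsub>N\<^esub> u = x" for x r
    unfolding f_def by (rule inv_into_f_eq[OF bij_betw_imp_inj_on[OF Lb] that])
  define \<sigma> where "\<sigma> r = f (rsmult N u r)" for r
  have \<sigma>c: "\<sigma> r \<in> carrier P" and \<sigma>u: "\<sigma> r \<odot>\<^bsub>N\<^esub> u = rsmult N u r" if "r \<in> carrier P" for r
    unfolding \<sigma>_def using fc fu rsmult_closed[OF that Uu(2)] by auto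
  have "bij_betw (f \<circ> rsmult N u) (carrier P) (carrier P)" by (rule bij_betw_trans[OF Rb fb])
  moreover have "f \<circ> rsmult N u = \<sigma>" by (rule ext) (simp add: \<sigma>_def)
  ultimately have \<sigma>b: "bij_betw \<sigma> (carrier P) (carrier P)" by simp
  have \<sigma>: "\<sigma> \<in> ring_iso P P"
  proof (rule ring_iso_memI[OF \<sigma>c _ _ _ \<sigma>b])
    fix r s assume rs: "r \<in> carrier P" "s \<in> carrier P"
    \<comment> \<open>Elements of \<open>P\<close> are compared through their action on
      \<open>u\<close>, which \<open>feq\<close> permits because \<open>r \<mapsto> ru\<close> is
      injective.\<close>
    have "(\<sigma> r \<otimes>\<^bsub>P\<^esub> \<sigma> s) \<odot>\<^bsub>N\<^esub> u = \<sigma> r \<odot>\<^bsub>N\<^esub> (rsmult N u s)"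
      using rs \<sigma>c \<sigma>u Uu(2) by (simp add: lsmult_assoc)
    also have "\<dots> = rsmult N (\<sigma> r \<odot>\<^bsub>N\<^esub> u) s" using rs \<sigma>c Uu(2) by (simp add: smult_rsmult_assoc)
    also have "\<dots> = rsmult N u (r \<otimes>\<^bsub>P\<^esub> s)" using rs \<sigma>u Uu(2) by (simp add: rsmult_assoc)
    finally show "\<sigma> (r \<otimes>\<^bsub>P\<^esub> s) = \<sigma> r \<otimes>\<^bsub>P\<^esub> \<sigma> s" using rs \<sigma>c unfolding \<sigma>_def[of "r \<otimes>\<^bsub>P\<^esub> s"] by (intro feq) auto
    have "(\<sigma> r \<oplus>\<^bsub>P\<^esub> \<sigma> s) \<odot>\<^bsub>N\<^esub> u = rsmult N u (r \<oplus>\<^bsub>P\<^esub> s)"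
      using rs \<sigma>c \<sigma>u Uu(2) by (simp add: lsmult_l_distr rsmult_r_distr)
    then show "\<sigma> (r \<oplus>\<^bsub>P\<^esub> s) = \<sigma> r \<oplus>\<^bsub>P\<^esub> \<sigma> s" using rs \<sigma>c unfolding \<sigma>_def[of "r \<oplus>\<^bsub>P\<^esub> s"] by (intro feq) auto
  next
    show "\<sigma> \<one>\<^bsub>P\<^esub> = \<one>\<^bsub>P\<^esub>" unfolding \<sigma>_def using Uu(2) by (intro feq) (auto simp: lsmult_one rsmult_one)
  qed
  have "bimodule_iso P N (twisted_bimodule P \<sigma>)"
    unfolding bimodule_iso_def
  proof (intro exI[of _ f] conjI ballI)
    show "bij_betw f (carrier N) (carrier (twisted_bimodule P \<sigma>))" using fb by (simp add: twisted_bimodule_def)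
    show "f (x \<oplus>\<^bsub>N\<^esub> y) = f x \<oplus>\<^bsub>twisted_bimodule P \<sigma>\<^esub> f y" if "x \<in> carrier N" "y \<in> carrier N" for x y
      using that fc fu Uu(2) by (intro feq) (auto simp: twisted_bimodule_def lsmult_l_distr)
    show "f (r \<odot>\<^bsub>N\<^esub> x) = r \<odot>\<^bsub>twisted_bimodule P \<sigma>\<^esub> f x" if "r \<in> carrier P" "x \<in> carrier N" for r x
      using that fc fu Uu(2) by (intro feq) (auto simp: twisted_bimodule_def lsmult_assoc)
    show "f (rsmult N x r) = rsmult (twisted_bimodule P \<sigma>) (f x) r" if rx: "r \<in> carrier P" "x \<in> carrier N" for r x
    proof -
      have "(f x \<otimes>\<^bsub>P\<^esub> \<sigma> r) \<odot>\<^bsub>N\<^esub> u = rsmult N (f x \<odot>\<^bsub>N\<^esub> u) r"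
        using rx fc \<sigma>c \<sigma>u Uu(2) by (simp add: lsmult_assoc smult_rsmult_assoc)
      then show ?thesis using rx fc fu \<sigma>c by (intro feq) (auto simp: twisted_bimodule_def)
    qed
  qed
  then show ?thesis unfolding zero_or_twisted_def using simple art \<sigma> by auto
qed

section \<open>Decompositions from central idempotents\<close>

context ring
begin

lemma sum_delta:
  assumes "p < (n::nat)" "\<And>q. q < n \<Longrightarrow> f q \<in> carrier R" "\<And>q. \<lbrakk>q < n; q \<noteq> p\<rbrakk> \<Longrightarrow> f q = \<zero>"
  shows "(\<Oplus>q\<in>{..<n}. f q) = f p"
proof -
  have "(\<Oplus>q\<in>{..<n}. f q) = (\<Oplus>q\<in>{..<n}. if p = q then f q else \<zero>)"
    by (rule finsum_cong') (use assms in auto)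
  also have "\<dots> = f p" by (rule finsum_singleton) (use assms in auto)
  finally show ?thesis .
qed

text \<open>Peirce decomposition: inserting \<open>1\<close> as the sum of all \<open>g p\<close>,
  on the right of \<open>g q \<otimes> x\<close> and on the left of \<open>x \<otimes> g q\<close>,
  leaves \<open>g q \<otimes> x \<otimes> g q\<close> both times.\<close>

lemma central_if_orthogonal:
  assumes g: "\<And>q. q < (n::nat) \<Longrightarrow> g q \<in> carrier R" and sum: "(\<Oplus>q\<in>{..<n}. g q) = \<one>"
    and orth: "\<And>p q x. \<lbrakk>p < n; q < n; p \<noteq> q; x \<in> carrier R\<rbrakk> \<Longrightarrow> g p \<otimes> x \<otimes> g q = \<zero>"
    and q: "q < n" and x: "x \<in> carrier R"
  shows "g q \<otimes> x = x \<otimes> g q"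
proof -
  have "g q \<otimes> x = (g q \<otimes> x) \<otimes> (\<Oplus>p\<in>{..<n}. g p)" using g q x sum by simp
  also have "\<dots> = (\<Oplus>p\<in>{..<n}. (g q \<otimes> x) \<otimes> g p)" using g q x by (intro finsum_rdistr) auto
  also have "\<dots> = (g q \<otimes> x) \<otimes> g q"
    using g q x orth[OF q _ _ x] by (intro sum_delta[OF q]) auto
  finally have 1: "g q \<otimes> x = g q \<otimes> x \<otimes> g q" .
  have "x \<otimes> g q = (\<Oplus>p\<in>{..<n}. g p) \<otimes> (x \<otimes> g q)" using g q x sum by simp
  also have "\<dots> = (\<Oplus>p\<in>{..<n}. g p \<otimes> (x \<otimes> g q))" using g q x by (intro finsum_ldistr) auto
  also have "\<dots> = g q \<otimes> (x \<otimes> g q)"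
    using g q x orth[OF _ q _ x] by (intro sum_delta[OF q]) (auto simp: m_assoc)
  finally show ?thesis using 1 g q x by (simp add: m_assoc)
qed

text \<open>The components \<open>g q \<otimes> x\<close> recover \<open>x\<close> as their sum, and
  prescribed components are glued by adding them up. For the bimodule this is applied in
  \<open>R \<propto> M\<close> to elements \<open>(0, m)\<close>.\<close>

lemma central_family:
  assumes g: "\<And>q. q < (n::nat) \<Longrightarrow> g q \<in> carrier R" and sum: "(\<Oplus>q\<in>{..<n}. g q) = \<one>"
    and orth: "\<And>p q. \<lbrakk>p < n; q < n; p \<noteq> q\<rbrakk> \<Longrightarrow> g p \<otimes> g q = \<zero>"
  shows "\<lbrakk>x \<in> carrier R; y \<in> carrier R; \<And>q. q < n \<Longrightarrow> g q \<otimes> x = g q \<otimes> y\<rbrakk> \<Longrightarrow> x = y"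
    and "(\<And>q. q < n \<Longrightarrow> f q \<in> carrier R \<and> g q \<otimes> f q = f q) \<Longrightarrow> \<exists>x\<in>carrier R. \<forall>q<n. g q \<otimes> x = f q"
proof -
  have exp: "x = (\<Oplus>q\<in>{..<n}. g q \<otimes> x)" if "x \<in> carrier R" for x
  proof -
    have "x = (\<Oplus>q\<in>{..<n}. g q) \<otimes> x" using that sum by simp
    also have "\<dots> = (\<Oplus>q\<in>{..<n}. g q \<otimes> x)" using that g by (intro finsum_ldistr) auto
    finally show ?thesis .
  qed
  show "x = y" if xy: "x \<in> carrier R" "y \<in> carrier R" "\<And>q. q < n \<Longrightarrow> g q \<otimes> x = g q \<otimes> y"
  proof -
    have "(\<Oplus>q\<in>{..<n}. g q \<otimes> x) = (\<Oplus>q\<in>{..<n}. g q \<otimes> y)"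
      by (rule finsum_cong') (use g xy in auto)
    then show ?thesis using exp[OF xy(1)] exp[OF xy(2)] by simp
  qed
  assume f: "\<And>q. q < n \<Longrightarrow> f q \<in> carrier R \<and> g q \<otimes> f q = f q"
  define x where "x = (\<Oplus>q\<in>{..<n}. f q)"
  have xc: "x \<in> carrier R" unfolding x_def using f by (intro finsum_closed) auto
  have "g p \<otimes> x = f p" if p: "p < n" for p
  proof -
    have "g p \<otimes> x = (\<Oplus>q\<in>{..<n}. g p \<otimes> f q)" unfolding x_def using g p f by (intro finsum_rdistr) auto
    also have "\<dots> = g p \<otimes> f p"
    proof (rule sum_delta[OF p])
      fix q assume q: "q < n"
      show "g p \<otimes> f q \<in> carrier R" using g p f q by simp
      assume "q \<noteq> p"
      then have "(g p \<otimes> g q) \<otimes> f q = \<zero>" using orth[OF p q] f[OF q] by simp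
      then show "g p \<otimes> f q = \<zero>" using g p q f[OF q] by (simp add: m_assoc)
    qed
    finally show ?thesis using f p by simp
  qed
  then show "\<exists>x\<in>carrier R. \<forall>q<n. g q \<otimes> x = f q" using xc by blast
qed

end

section \<open>Corners of bimodules and the decomposition they give\<close>

definition corner_bimodule :: "('a, 'm) bimodule \<Rightarrow> 'a \<Rightarrow> ('a, 'm) bimodule" where
  "corner_bimodule M g = M\<lparr>carrier := {m \<in> carrier M. g \<odot>\<^bsub>M\<^esub> m = m \<and> rsmult M m g = m}\<rparr>"

lemma corner_bimodule_simps [simp]:
  "m \<in> carrier (corner_bimodule M g) \<longleftrightarrow> m \<in> carrier M \<and> g \<odot>\<^bsub>M\<^esub> m = m \<and> rsmult M m g = m"
  "m \<oplus>\<^bsub>corner_bimodule M g\<^esub> m' = m \<oplus>\<^bsub>M\<^esub> m'"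
  "\<zero>\<^bsub>corner_bimodule M g\<^esub> = \<zero>\<^bsub>M\<^esub>"
  "r \<odot>\<^bsub>corner_bimodule M g\<^esub> m = r \<odot>\<^bsub>M\<^esub> m"
  "rsmult (corner_bimodule M g) m r = rsmult M m r"
  by (auto simp: corner_bimodule_def)

lemma bimodule_corner_bimodule:
  fixes R :: "'a ring" and M :: "('a, 'm) bimodule"
  assumes "bimodule R M" and g: "g \<in> carrier R" "g \<otimes>\<^bsub>R\<^esub> g = g"
  shows "bimodule (corner R g) (corner_bimodule M g)"
proof -
  interpret bimodule R M by fact
  have 1: "g \<odot>\<^bsub>M\<^esub> (a \<odot>\<^bsub>M\<^esub> x) = a \<odot>\<^bsub>M\<^esub> x" "rsmult M (a \<odot>\<^bsub>M\<^esub> x) g = a \<odot>\<^bsub>M\<^esub> x"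
    "g \<odot>\<^bsub>M\<^esub> (rsmult M x a) = rsmult M x a" "rsmult M (rsmult M x a) g = rsmult M x a"
    if "a \<in> carrier (corner R g)" "x \<in> carrier (corner_bimodule M g)" for a x
    using that g lsmult_assoc[of g a x] smult_rsmult_assoc[of a g x] smult_rsmult_assoc[of g a x] rsmult_assoc[of a g x]
    by auto
  have ab: "abelian_group (corner_bimodule M g)"
  proof (rule abelian_groupI)
    fix x assume x: "x \<in> carrier (corner_bimodule M g)"
    then have xc: "x \<in> carrier M" by simp
    have "g \<odot>\<^bsub>M\<^esub> (\<ominus>\<^bsub>M\<^esub> x) \<oplus>\<^bsub>M\<^esub> x = \<zero>\<^bsub>M\<^esub>"
      using lsmult_r_distr[of g "\<ominus>\<^bsub>M\<^esub> x" x] x g by (simp add: M.l_neg)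
    then have "g \<odot>\<^bsub>M\<^esub> (\<ominus>\<^bsub>M\<^esub> x) = \<ominus>\<^bsub>M\<^esub> x" using xc g lsmult_closed M.minus_equality by (metis M.a_inv_closed)
    moreover have "rsmult M (\<ominus>\<^bsub>M\<^esub> x) g \<oplus>\<^bsub>M\<^esub> x = \<zero>\<^bsub>M\<^esub>"
      using rsmult_l_distr[of g "\<ominus>\<^bsub>M\<^esub> x" x] x g by (simp add: M.l_neg)
    then have "rsmult M (\<ominus>\<^bsub>M\<^esub> x) g = \<ominus>\<^bsub>M\<^esub> x" using xc g rsmult_closed M.minus_equality by (metis M.a_inv_closed)
    ultimately show "\<exists>y\<in>carrier (corner_bimodule M g). y \<oplus>\<^bsub>corner_bimodule M g\<^esub> x = \<zero>\<^bsub>corner_bimodule M g\<^esub>"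
      using xc by (intro bexI[of _ "\<ominus>\<^bsub>M\<^esub> x"]) (auto simp: M.l_neg)
  qed (use g in \<open>auto simp: M.a_ac lsmult_r_distr rsmult_l_distr\<close>)
  show ?thesis
    by (intro bimodule.intro bimodule_axioms.intro ring_corner[OF R.ring_axioms g] ab)
      (use 1 in \<open>auto simp: lsmult_closed rsmult_closed lsmult_l_distr lsmult_r_distr rsmult_l_distr rsmult_r_distr
        lsmult_assoc rsmult_assoc smult_rsmult_assoc\<close>)
qed

lemma corner_corner:
  assumes "ring R" "g \<in> carrier R" "e \<in> carrier R" "g \<otimes>\<^bsub>R\<^esub> e = e" "e \<otimes>\<^bsub>R\<^esub> g = e"
  shows "corner (corner R g) e = corner R e"
proof -
  interpret ring R by fact
  have "g \<otimes>\<^bsub>R\<^esub> x = x" "x \<otimes>\<^bsub>R\<^esub> g = x" if "x \<in> carrier R" "e \<otimes>\<^bsub>R\<^esub> x = x" "x \<otimes>\<^bsub>R\<^esub> e = x" for x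
    using m_assoc[of g e x] m_assoc[of x e g] assms that by auto
  then have "{x \<in> {x \<in> carrier R. g \<otimes>\<^bsub>R\<^esub> x = x \<and> x \<otimes>\<^bsub>R\<^esub> g = x}. e \<otimes>\<^bsub>R\<^esub> x = x \<and> x \<otimes>\<^bsub>R\<^esub> e = x}
      = {x \<in> carrier R. e \<otimes>\<^bsub>R\<^esub> x = x \<and> x \<otimes>\<^bsub>R\<^esub> e = x}" by auto
  then show ?thesis by (simp add: corner_def)
qed

text \<open>\<open>gRg \<propto> gMg\<close> is the corner of \<open>R \<propto> M\<close> at
  \<open>(g, 0)\<close>, as an equality of records. So a uniformizer found in
  \<open>R \<propto> M\<close> serves the block without any transport.\<close>

lemma trivial_extension_corner:
  fixes R :: "'a ring" and M :: "('a, 'm) bimodule"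
  assumes "bimodule R M" and g: "g \<in> carrier R" "g \<otimes>\<^bsub>R\<^esub> g = g"
    and e: "e \<in> carrier R" "g \<otimes>\<^bsub>R\<^esub> e = e" "e \<otimes>\<^bsub>R\<^esub> g = e"
  shows "corner (corner R g \<propto> corner_bimodule M g) (e, \<zero>\<^bsub>M\<^esub>) = corner (R \<propto> M) (e, \<zero>\<^bsub>M\<^esub>)"
proof -
  interpret bimodule R M by fact
  interpret S: ring "R \<propto> M" by (rule ring_trivial_extension)
  have "corner R g \<propto> corner_bimodule M g = corner (R \<propto> M) (g, \<zero>\<^bsub>M\<^esub>)"
  proof -
    have "{x \<in> carrier R. g \<otimes>\<^bsub>R\<^esub> x = x \<and> x \<otimes>\<^bsub>R\<^esub> g = x} \<times> {m \<in> carrier M. g \<odot>\<^bsub>M\<^esub> m = m \<and> rsmult M m g = m}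
      = {z \<in> carrier (R \<propto> M). (g, \<zero>\<^bsub>M\<^esub>) \<otimes>\<^bsub>R \<propto> M\<^esub> z = z \<and> z \<otimes>\<^bsub>R \<propto> M\<^esub> (g, \<zero>\<^bsub>M\<^esub>) = z}"
      using g by (auto simp: lsmult_closed rsmult_closed)
    then show ?thesis by (simp add: corner_def corner_bimodule_def trivial_extension_def)
  qed
  moreover have "corner (corner (R \<propto> M) (g, \<zero>\<^bsub>M\<^esub>)) (e, \<zero>\<^bsub>M\<^esub>) = corner (R \<propto> M) (e, \<zero>\<^bsub>M\<^esub>)"
    by (rule corner_corner[OF S.ring_axioms]) (use g e in auto)
  ultimately show ?thesis by simp
qed

text \<open>\<open>cR\<close> and \<open>cM\<close> together say that \<open>(g q, 0)\<close> is
  central in \<open>R \<propto> M\<close>. Centrality puts the components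
  \<open>g q \<otimes> r\<close> and \<open>g q \<odot> m\<close> into two-sided corners and makes
  them compatible with multiplication and with both actions.\<close>

lemma decomposition_of_central_idempotents:
  fixes R :: "'a ring" and M :: "('a, 'm) bimodule"
  assumes bim: "bimodule R M"
    and g: "\<And>q. q < n \<Longrightarrow> g q \<in> carrier R" "\<And>q. q < n \<Longrightarrow> g q \<otimes>\<^bsub>R\<^esub> g q = g q"
      "\<And>p q. \<lbrakk>p < n; q < n; p \<noteq> q\<rbrakk> \<Longrightarrow> g p \<otimes>\<^bsub>R\<^esub> g q = \<zero>\<^bsub>R\<^esub>"
    and sum: "(\<Oplus>\<^bsub>R\<^esub>q\<in>{..<n}. g q) = \<one>\<^bsub>R\<^esub>"
    and cR: "\<And>q r. \<lbrakk>q < n; r \<in> carrier R\<rbrakk> \<Longrightarrow> g q \<otimes>\<^bsub>R\<^esub> r = r \<otimes>\<^bsub>R\<^esub> g q"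
    and cM: "\<And>q m. \<lbrakk>q < n; m \<in> carrier M\<rbrakk> \<Longrightarrow> g q \<odot>\<^bsub>M\<^esub> m = rsmult M m (g q)"
  shows "decomposition R M n (\<lambda>q. corner R (g q)) (\<lambda>q. corner_bimodule M (g q))"
proof -
  interpret bimodule R M by fact
  interpret S: ring "R \<propto> M" by (rule ring_trivial_extension)
  let ?P = "RDirProd_list (map (\<lambda>q. corner R (g q)) [0..<n])"
  have rg: "ring (corner R (g q))" if "q < n" for q by (rule ring_corner[OF R.ring_axioms g(1,2)[OF that]])
  interpret P: ring ?P by (rule RDirProd_list_is_ring) (use rg in auto)
  define \<phi> where "\<phi> r = map (\<lambda>q. g q \<otimes>\<^bsub>R\<^esub> r) [0..<n]" for r
  have gg: "g q \<otimes>\<^bsub>R\<^esub> (g q \<otimes>\<^bsub>R\<^esub> r) = g q \<otimes>\<^bsub>R\<^esub> r" if "q < n" "r \<in> carrier R" for q r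
    using g that by (simp add: R.m_assoc[symmetric])
  have \<phi>c: "\<phi> r \<in> carrier ?P" if r: "r \<in> carrier R" for r
  proof (rule RDirProd_list_carrier_memI)
    fix q assume "q < length (map (\<lambda>q. corner R (g q)) [0..<n])"
    then have q: "q < n" by simp
    have "(g q \<otimes>\<^bsub>R\<^esub> r) \<otimes>\<^bsub>R\<^esub> g q = g q \<otimes>\<^bsub>R\<^esub> r" using cR[OF q, of "g q \<otimes>\<^bsub>R\<^esub> r"] gg[OF q r] g(1)[OF q] r by simp
    then show "\<phi> r ! q \<in> carrier (map (\<lambda>q. corner R (g q)) [0..<n] ! q)"
      using q r g gg by (simp add: \<phi>_def)
  qed (simp add: \<phi>_def)
  have Pl: "length x = n" if "x \<in> carrier ?P" for x using RDirProd_list_carrier_mem(1)[OF that] by simp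
  have Pn: "x ! q \<in> carrier (corner R (g q))" if "x \<in> carrier ?P" "q < n" for x q
    using RDirProd_list_carrier_mem(2)[OF that(1), of q] that(2) by simp
  have ops: "(x \<otimes>\<^bsub>?P\<^esub> y) ! q = x ! q \<otimes>\<^bsub>R\<^esub> y ! q" "(x \<oplus>\<^bsub>?P\<^esub> y) ! q = x ! q \<oplus>\<^bsub>R\<^esub> y ! q"
    if "x \<in> carrier ?P" "y \<in> carrier ?P" "q < n" for x y q
    using RDirProd_list_ops_nth[OF that(1,2), of q] that(3) by auto
  have \<phi>: "\<phi> \<in> ring_iso R ?P"
  proof (rule ring_iso_memI[OF \<phi>c])
    fix r s assume rs: "r \<in> carrier R" "s \<in> carrier R"
    show "\<phi> (r \<otimes>\<^bsub>R\<^esub> s) = \<phi> r \<otimes>\<^bsub>?P\<^esub> \<phi> s"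
    proof (rule nth_equalityI)
      have "\<phi> r \<otimes>\<^bsub>?P\<^esub> \<phi> s \<in> carrier ?P" using rs by (intro P.m_closed \<phi>c)
      then show "length (\<phi> (r \<otimes>\<^bsub>R\<^esub> s)) = length (\<phi> r \<otimes>\<^bsub>?P\<^esub> \<phi> s)" using Pl by (simp add: \<phi>_def)
      fix q assume "q < length (\<phi> (r \<otimes>\<^bsub>R\<^esub> s))"
      then have q: "q < n" by (simp add: \<phi>_def)
      have "(g q \<otimes>\<^bsub>R\<^esub> r) \<otimes>\<^bsub>R\<^esub> (g q \<otimes>\<^bsub>R\<^esub> s) = ((g q \<otimes>\<^bsub>R\<^esub> r) \<otimes>\<^bsub>R\<^esub> g q) \<otimes>\<^bsub>R\<^esub> s" using g q rs by (simp add: R.m_assoc)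
      also have "\<dots> = (g q \<otimes>\<^bsub>R\<^esub> (g q \<otimes>\<^bsub>R\<^esub> r)) \<otimes>\<^bsub>R\<^esub> s" using cR[OF q, of "g q \<otimes>\<^bsub>R\<^esub> r"] g q rs by simp
      also have "\<dots> = g q \<otimes>\<^bsub>R\<^esub> (r \<otimes>\<^bsub>R\<^esub> s)" unfolding gg[OF q rs(1)] using g q rs by (simp add: R.m_assoc)
      finally show "\<phi> (r \<otimes>\<^bsub>R\<^esub> s) ! q = (\<phi> r \<otimes>\<^bsub>?P\<^esub> \<phi> s) ! q"
        using ops(1)[OF \<phi>c[OF rs(1)] \<phi>c[OF rs(2)] q] q by (simp add: \<phi>_def)
    qed
    show "\<phi> (r \<oplus>\<^bsub>R\<^esub> s) = \<phi> r \<oplus>\<^bsub>?P\<^esub> \<phi> s"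
    proof (rule nth_equalityI)
      have "\<phi> r \<oplus>\<^bsub>?P\<^esub> \<phi> s \<in> carrier ?P" using rs by (intro P.a_closed \<phi>c)
      then show "length (\<phi> (r \<oplus>\<^bsub>R\<^esub> s)) = length (\<phi> r \<oplus>\<^bsub>?P\<^esub> \<phi> s)" using Pl by (simp add: \<phi>_def)
      fix q assume "q < length (\<phi> (r \<oplus>\<^bsub>R\<^esub> s))"
      then have q: "q < n" by (simp add: \<phi>_def)
      then show "\<phi> (r \<oplus>\<^bsub>R\<^esub> s) ! q = (\<phi> r \<oplus>\<^bsub>?P\<^esub> \<phi> s) ! q"
        using ops(2)[OF \<phi>c[OF rs(1)] \<phi>c[OF rs(2)] q] rs g by (simp add: \<phi>_def R.r_distr)
    qed
  next
    show "\<phi> \<one>\<^bsub>R\<^esub> = \<one>\<^bsub>?P\<^esub>"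
    proof (rule nth_equalityI)
      show "length (\<phi> \<one>\<^bsub>R\<^esub>) = length \<one>\<^bsub>?P\<^esub>" using Pl[OF P.one_closed] by (simp add: \<phi>_def)
      fix q assume "q < length (\<phi> \<one>\<^bsub>R\<^esub>)"
      then have q: "q < n" by (simp add: \<phi>_def)
      then show "\<phi> \<one>\<^bsub>R\<^esub> ! q = \<one>\<^bsub>?P\<^esub> ! q"
        using RDirProd_list_one_nth[of q "map (\<lambda>q. corner R (g q)) [0..<n]"] g by (simp add: \<phi>_def)
    qed
    show "bij_betw \<phi> (carrier R) (carrier ?P)"
    proof (rule bij_betw_imageI)
      show "inj_on \<phi> (carrier R)"
        by (rule inj_onI, rule R.central_family(1)[OF g(1) sum g(3)]) (auto simp: \<phi>_def)
      show "\<phi> ` carrier R = carrier ?P"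
      proof
        show "\<phi> ` carrier R \<subseteq> carrier ?P" using \<phi>c by auto
        show "carrier ?P \<subseteq> \<phi> ` carrier R"
        proof
          fix x assume x: "x \<in> carrier ?P"
          have "x ! q \<in> carrier R \<and> g q \<otimes>\<^bsub>R\<^esub> x ! q = x ! q" if "q < n" for q using Pn[OF x that] by simp
          then obtain r where r: "r \<in> carrier R" "\<And>q. q < n \<Longrightarrow> g q \<otimes>\<^bsub>R\<^esub> r = x ! q"
            using R.central_family(2)[OF g(1) sum g(3), of "\<lambda>q. x ! q"] by blast
          have "x = \<phi> r" by (rule nth_equalityI) (use Pl[OF x] r in \<open>auto simp: \<phi>_def\<close>)
          then show "x \<in> \<phi> ` carrier R" using r(1) by blast
        qed
      qed
    qed
  qed
  define \<psi> where "\<psi> m = map (\<lambda>q. g q \<odot>\<^bsub>M\<^esub> m) [0..<n]" for m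
  have gm: "g q \<odot>\<^bsub>M\<^esub> (g q \<odot>\<^bsub>M\<^esub> m) = g q \<odot>\<^bsub>M\<^esub> m" if "q < n" "m \<in> carrier M" for q m
    using g that by (simp add: lsmult_assoc[symmetric])
  have gmr: "rsmult M (g q \<odot>\<^bsub>M\<^esub> m) (g q) = g q \<odot>\<^bsub>M\<^esub> m" if "q < n" "m \<in> carrier M" for q m
    using cM[of q "g q \<odot>\<^bsub>M\<^esub> m"] gm[OF that] g that lsmult_closed by simp
  have gS: "(g q, \<zero>\<^bsub>M\<^esub>) \<in> carrier (R \<propto> M)" if "q < n" for q using g that by simp
  have sumS: "(\<Oplus>\<^bsub>R \<propto> M\<^esub>q\<in>{..<n}. (g q, \<zero>\<^bsub>M\<^esub>)) = \<one>\<^bsub>R \<propto> M\<^esub>"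
    using finsum_trivial_extension[of "{..<n}" g] g sum by auto
  have orthS: "(g p, \<zero>\<^bsub>M\<^esub>) \<otimes>\<^bsub>R \<propto> M\<^esub> (g q, \<zero>\<^bsub>M\<^esub>) = \<zero>\<^bsub>R \<propto> M\<^esub>" if "p < n" "q < n" "p \<noteq> q" for p q
    using g that by simp
  let ?D = "bimodule_direct_sum n (\<lambda>i. restrict_scalars (\<lambda>r. \<phi> r ! i) (corner_bimodule M (g i)))"
  have Dc: "carrier ?D = {xs. length xs = n \<and> (\<forall>i<n. xs ! i \<in> carrier (corner_bimodule M (g i)))}"
    by (simp add: bimodule_direct_sum_def restrict_scalars_def)
  have "bij_betw \<psi> (carrier M) (carrier ?D)"
  proof (rule bij_betw_imageI)
    show "inj_on \<psi> (carrier M)"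
    proof (rule inj_onI)
      fix x y assume xy: "x \<in> carrier M" "y \<in> carrier M" "\<psi> x = \<psi> y"
      have "(\<zero>\<^bsub>R\<^esub>, x) = (\<zero>\<^bsub>R\<^esub>, y)"
        by (rule S.central_family(1)[OF gS sumS orthS])
          (use xy g in \<open>auto simp: \<psi>_def lsmult_closed\<close>)
      then show "x = y" by simp
    qed
    show "\<psi> ` carrier M = carrier ?D"
    proof
      show "\<psi> ` carrier M \<subseteq> carrier ?D"
        unfolding Dc using g gm gmr by (auto simp: \<psi>_def lsmult_closed)
      show "carrier ?D \<subseteq> \<psi> ` carrier M"
      proof
        fix x assume "x \<in> carrier ?D"
        then have x: "length x = n" "\<And>q. q < n \<Longrightarrow> x ! q \<in> carrier M \<and> g q \<odot>\<^bsub>M\<^esub> x ! q = x ! q" unfolding Dc by auto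
        have "(\<zero>\<^bsub>R\<^esub>, x ! q) \<in> carrier (R \<propto> M) \<and> (g q, \<zero>\<^bsub>M\<^esub>) \<otimes>\<^bsub>R \<propto> M\<^esub> (\<zero>\<^bsub>R\<^esub>, x ! q) = (\<zero>\<^bsub>R\<^esub>, x ! q)" if "q < n" for q
          using x(2)[OF that] g that by simp
        then obtain z where z: "z \<in> carrier (R \<propto> M)" "\<And>q. q < n \<Longrightarrow> (g q, \<zero>\<^bsub>M\<^esub>) \<otimes>\<^bsub>R \<propto> M\<^esub> z = (\<zero>\<^bsub>R\<^esub>, x ! q)"
          using S.central_family(2)[OF gS sumS orthS, of "\<lambda>q. (\<zero>\<^bsub>R\<^esub>, x ! q)"] by blast
        obtain r m where rm: "z = (r, m)" "r \<in> carrier R" "m \<in> carrier M" using z(1) by auto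
        have "g q \<odot>\<^bsub>M\<^esub> m = x ! q" if "q < n" for q
          using z(2)[OF that] rm g that by (simp add: lsmult_closed)
        then have "x = \<psi> m" by (intro nth_equalityI) (use x(1) in \<open>auto simp: \<psi>_def\<close>)
        then show "x \<in> \<psi> ` carrier M" using rm(3) by blast
      qed
    qed
  qed
  moreover have "\<psi> (x \<oplus>\<^bsub>M\<^esub> y) = \<psi> x \<oplus>\<^bsub>?D\<^esub> \<psi> y" if "x \<in> carrier M" "y \<in> carrier M" for x y
    using that g by (simp add: \<psi>_def bimodule_direct_sum_def restrict_scalars_def lsmult_r_distr)
  moreover have "\<psi> (r \<odot>\<^bsub>M\<^esub> x) = r \<odot>\<^bsub>?D\<^esub> \<psi> x" if rx: "r \<in> carrier R" "x \<in> carrier M" for r x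
  proof -
    have "g q \<odot>\<^bsub>M\<^esub> (r \<odot>\<^bsub>M\<^esub> x) = (g q \<otimes>\<^bsub>R\<^esub> r) \<odot>\<^bsub>M\<^esub> (g q \<odot>\<^bsub>M\<^esub> x)" if q: "q < n" for q
    proof -
      have "(g q \<otimes>\<^bsub>R\<^esub> r) \<odot>\<^bsub>M\<^esub> (g q \<odot>\<^bsub>M\<^esub> x) = ((g q \<otimes>\<^bsub>R\<^esub> r) \<otimes>\<^bsub>R\<^esub> g q) \<odot>\<^bsub>M\<^esub> x" using rx g q by (simp add: lsmult_assoc lsmult_closed)
      also have "(g q \<otimes>\<^bsub>R\<^esub> r) \<otimes>\<^bsub>R\<^esub> g q = g q \<otimes>\<^bsub>R\<^esub> r" using cR[OF q, of "g q \<otimes>\<^bsub>R\<^esub> r"] gg[OF q rx(1)] g(1)[OF q] rx by simp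
      finally show ?thesis using rx g q by (simp add: lsmult_assoc)
    qed
    then show ?thesis by (simp add: \<psi>_def \<phi>_def bimodule_direct_sum_def restrict_scalars_def)
  qed
  moreover have "\<psi> (rsmult M x r) = rsmult ?D (\<psi> x) r" if rx: "r \<in> carrier R" "x \<in> carrier M" for r x
  proof -
    have "g q \<odot>\<^bsub>M\<^esub> (rsmult M x r) = rsmult M (g q \<odot>\<^bsub>M\<^esub> x) (g q \<otimes>\<^bsub>R\<^esub> r)" if q: "q < n" for q
      using rx g(1)[OF q] gmr[OF q rx(2)] by (simp add: rsmult_assoc lsmult_closed smult_rsmult_assoc[symmetric])
    then show ?thesis by (simp add: \<psi>_def \<phi>_def bimodule_direct_sum_def restrict_scalars_def)
  qed
  ultimately have "bimodule_iso R M ?D" unfolding bimodule_iso_def by blast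
  then show ?thesis
    unfolding decomposition_def using \<phi> bimodule_corner_bimodule[OF bim g(1,2)] by blast
qed

section \<open>The blocks of a morphic ring\<close>

context local_idempotents
begin

definition block :: "'a set \<Rightarrow> 'a" where
  "block X = (\<Oplus>e\<in>X. e)"

lemma sub_E: "X \<subseteq> E \<Longrightarrow> finite X" "X \<subseteq> E \<Longrightarrow> e \<in> X \<Longrightarrow> e \<in> carrier R"
  using finite_E finite_subset E_carrier by auto

lemma block_closed [simp]: "X \<subseteq> E \<Longrightarrow> block X \<in> carrier R"
  unfolding block_def by (rule finsum_closed) (use sub_E in auto)

lemma block_mult_both:
  assumes X: "X \<subseteq> E" and Y: "Y \<subseteq> E" and r: "r \<in> carrier R"
    and zero: "\<And>e f. e \<in> X \<Longrightarrow> f \<in> Y \<Longrightarrow> e \<otimes> r \<otimes> f = \<zero>"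
  shows "block X \<otimes> r \<otimes> block Y = \<zero>"
proof -
  have eY: "e \<otimes> r \<otimes> block Y = \<zero>" if e: "e \<in> X" for e
  proof -
    have ec: "e \<in> carrier R" using sub_E(2)[OF X e] .
    have "e \<otimes> r \<otimes> block Y = (\<Oplus>f\<in>Y. e \<otimes> r \<otimes> f)"
      unfolding block_def using sub_E[OF Y] ec r by (intro finsum_rdistr) auto
    also have "\<dots> = (\<Oplus>f\<in>Y. \<zero>)" by (rule finsum_cong') (use zero[OF e] in auto)
    finally show ?thesis by simp
  qed
  have "block X \<otimes> r \<otimes> block Y = block X \<otimes> (r \<otimes> block Y)" using X Y r by (simp add: m_assoc)
  also have "\<dots> = (\<Oplus>e\<in>X. e \<otimes> (r \<otimes> block Y))"
    unfolding block_def[of X] using sub_E[OF X] Y r by (intro finsum_ldistr) auto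
  also have "\<dots> = (\<Oplus>e\<in>X. \<zero>)"
    by (rule finsum_cong') (use eY sub_E[OF X] Y r in \<open>auto simp: m_assoc\<close>)
  finally show ?thesis by simp
qed

lemma mem_block:
  assumes X: "X \<subseteq> E" and e: "e \<in> X"
  shows "block X \<otimes> e = e" "e \<otimes> block X = e"
proof -
  have eE: "e \<in> E" and ec: "e \<in> carrier R" using assms E_carrier by auto
  have "block X \<otimes> e = (\<Oplus>f\<in>X. f \<otimes> e)"
    unfolding block_def using sub_E[OF X] ec by (intro finsum_ldistr) auto
  also have "\<dots> = (\<Oplus>f\<in>X. if e = f then f else \<zero>)"
    by (rule finsum_cong') (use E_orth E_idem eE X sub_E[OF X] in auto)
  also have "\<dots> = e" by (rule finsum_singleton[OF e]) (use sub_E[OF X] in auto)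
  finally show "block X \<otimes> e = e" .
  have "e \<otimes> block X = (\<Oplus>f\<in>X. e \<otimes> f)"
    unfolding block_def using sub_E[OF X] ec by (intro finsum_rdistr) auto
  also have "\<dots> = (\<Oplus>f\<in>X. if e = f then f else \<zero>)"
    by (rule finsum_cong') (use E_orth E_idem eE X sub_E[OF X] in auto)
  also have "\<dots> = e" by (rule finsum_singleton[OF e]) (use sub_E[OF X] in auto)
  finally show "e \<otimes> block X = e" .
qed

lemma block_idem: "X \<subseteq> E \<Longrightarrow> block X \<otimes> block X = block X"
proof -
  assume X: "X \<subseteq> E"
  have "block X \<otimes> block X = (\<Oplus>f\<in>X. block X \<otimes> f)"
    unfolding block_def[of X] using sub_E[OF X] X by (intro finsum_rdistr) (auto simp: block_def[symmetric])
  also have "\<dots> = block X" unfolding block_def[of X]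
    by (rule finsum_cong') (use mem_block[OF X] sub_E[OF X] in \<open>auto simp: block_def\<close>)
  finally show ?thesis .
qed

lemma sum_blocks:
  assumes "\<And>q. q < (n::nat) \<Longrightarrow> X q \<subseteq> E" "\<And>p q. p < n \<Longrightarrow> q < n \<Longrightarrow> p \<noteq> q \<Longrightarrow> X p \<inter> X q = {}"
  shows "(\<Oplus>q\<in>{..<n}. block (X q)) = block (\<Union>q<n. X q)"
  using assms
proof (induct n)
  case 0
  then show ?case by (simp add: block_def)
next
  case (Suc n)
  have IH: "(\<Oplus>q\<in>{..<n}. block (X q)) = block (\<Union>q<n. X q)" by (rule Suc.hyps) (use Suc.prems in auto)
  have U: "(\<Union>q<n. X q) \<subseteq> E" using Suc.prems(1) by (auto dest: less_SucI)
  have Xn: "X n \<subseteq> E" using Suc.prems(1) by simp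
  have "X n \<inter> X q = {}" if "q < n" for q using Suc.prems(2)[of n q] that by simp
  then have d: "X n \<inter> (\<Union>q<n. X q) = {}" by blast
  have "(\<Oplus>q\<in>{..<Suc n}. block (X q)) = block (X n) \<oplus> (\<Oplus>q\<in>{..<n}. block (X q))"
    unfolding lessThan_Suc using Suc.prems(1) by (subst finsum_insert) auto
  also have "\<dots> = block (X n) \<oplus> block (\<Union>q<n. X q)" unfolding IH ..
  also have "\<dots> = block (X n \<union> (\<Union>q<n. X q))"
    unfolding block_def
    using sub_E(2)[OF Xn] sub_E(2)[OF U] by (intro finsum_Un_disjoint[symmetric] sub_E(1) Xn U d) auto
  finally show ?case by (simp add: lessThan_Suc)
qed

text \<open>The elements that link \<open>e\<close> with the idempotent \<open>u i\<close> of the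
  block serve as \<open>a i\<close> and \<open>b i\<close>. Then
  \<open>b i \<otimes> a i = u i\<close> sums to the unit of the block, and orthogonality of the
  \<open>u i\<close> yields \<open>a i \<otimes> b j = 0\<close> for
  \<open>i \<noteq> j\<close>.\<close>

lemma matrix_units_block:
  assumes X: "X \<subseteq> E" and u: "bij_betw u {..<k} X" and e: "e \<in> X"
    and linked: "\<And>f. f \<in> X \<Longrightarrow> linked e f"
  shows "\<exists>a b. matrix_units (corner R (block X)) e k a b"
proof -
  have uX: "u i \<in> X" if "i < k" for i using u that by (auto simp: bij_betw_def)
  have inj: "u i \<noteq> u j" if "i < k" "j < k" "i \<noteq> j" for i j using u that by (auto simp: bij_betw_def inj_on_def)
  have "\<forall>i\<in>{..<k}. \<exists>x. fst x \<in> carrier R \<and> snd x \<in> carrier R \<and> e \<otimes> fst x = fst x \<and> fst x \<otimes> u i = fst x \<and>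
      u i \<otimes> snd x = snd x \<and> snd x \<otimes> e = snd x \<and> fst x \<otimes> snd x = e \<and> snd x \<otimes> fst x = u i"
  proof
    fix i assume "i \<in> {..<k}"
    then have "linked e (u i)" using linked uX by simp
    then obtain x y where "x \<in> carrier R" "y \<in> carrier R" "e \<otimes> x = x" "x \<otimes> u i = x" "u i \<otimes> y = y" "y \<otimes> e = y"
      "x \<otimes> y = e" "y \<otimes> x = u i" unfolding linked_def by blast
    then show "\<exists>x. fst x \<in> carrier R \<and> snd x \<in> carrier R \<and> e \<otimes> fst x = fst x \<and> fst x \<otimes> u i = fst x \<and>
      u i \<otimes> snd x = snd x \<and> snd x \<otimes> e = snd x \<and> fst x \<otimes> snd x = e \<and> snd x \<otimes> fst x = u i"
      by (intro exI[of _ "(x, y)"]) simp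
  qed
  from bchoice[OF this] obtain w where w: "\<forall>i\<in>{..<k}. fst (w i) \<in> carrier R \<and> snd (w i) \<in> carrier R \<and>
      e \<otimes> fst (w i) = fst (w i) \<and> fst (w i) \<otimes> u i = fst (w i) \<and>
      u i \<otimes> snd (w i) = snd (w i) \<and> snd (w i) \<otimes> e = snd (w i) \<and> fst (w i) \<otimes> snd (w i) = e \<and> snd (w i) \<otimes> fst (w i) = u i"
    by (elim exE)
  define a b where "a i = fst (w i)" and "b i = snd (w i)" for i
  have ab: "a i \<in> carrier R" "b i \<in> carrier R" "e \<otimes> a i = a i" "a i \<otimes> u i = a i" "u i \<otimes> b i = b i" "b i \<otimes> e = b i"
    "a i \<otimes> b i = e" "b i \<otimes> a i = u i" if "i < k" for i
    using w that by (simp_all add: a_def b_def)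
  let ?g = "block X"
  have g: "?g \<in> carrier R" "?g \<otimes> ?g = ?g" using X block_idem by auto
  interpret C: ring "corner R ?g" by (rule ring_corner[OF ring_axioms g])
  have ec: "e \<in> carrier R" "e \<otimes> e = e" using sub_E(2)[OF X e] E_idem X e by auto
  have uc: "u i \<in> carrier R" if "i < k" for i using sub_E(2)[OF X uX[OF that]] .
  have eC: "e \<in> carrier (corner R ?g)" using ec mem_block[OF X e] by simp
  have aC: "a i \<in> carrier (corner R ?g)" and bC: "b i \<in> carrier (corner R ?g)" if i: "i < k" for i
  proof -
    have "?g \<otimes> a i = a i" using m_assoc[OF g(1) ec(1) ab(1)[OF i]] mem_block[OF X e] ab(3)[OF i] by simp
    moreover have "a i \<otimes> ?g = a i" using m_assoc[OF ab(1)[OF i] uc[OF i] g(1)] mem_block[OF X uX[OF i]] ab(4)[OF i] by simp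
    ultimately show "a i \<in> carrier (corner R ?g)" using ab(1)[OF i] by simp
    have "?g \<otimes> b i = b i" using m_assoc[OF g(1) uc[OF i] ab(2)[OF i]] mem_block[OF X uX[OF i]] ab(5)[OF i] by simp
    moreover have "b i \<otimes> ?g = b i" using m_assoc[OF ab(2)[OF i] ec(1) g(1)] mem_block[OF X e] ab(6)[OF i] by simp
    ultimately show "b i \<in> carrier (corner R ?g)" using ab(2)[OF i] by simp
  qed
  have orth: "a i \<otimes> b j = \<zero>" if ij: "i < k" "j < k" "i \<noteq> j" for i j
  proof -
    have "a i \<otimes> b j = (a i \<otimes> u i) \<otimes> (u j \<otimes> b j)" using ab ij by simp
    also have "\<dots> = a i \<otimes> ((u i \<otimes> u j) \<otimes> b j)" using ab(1,2) uc ij by (simp add: m_assoc)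
    also have "u i \<otimes> u j = \<zero>" using E_orth inj[OF ij] uX ij X by blast
    finally show ?thesis using ab ij by simp
  qed
  have "(\<Oplus>\<^bsub>corner R ?g\<^esub>i\<in>{..<k}. b i \<otimes>\<^bsub>corner R ?g\<^esub> a i) = (\<Oplus>i\<in>{..<k}. b i \<otimes>\<^bsub>corner R ?g\<^esub> a i)"
    by (rule finsum_corner[OF ring_axioms g]) (use C.m_closed[OF bC aC] in \<open>auto simp del: corner_simps\<close>)
  also have "\<dots> = (\<Oplus>i\<in>{..<k}. u i)" by (rule finsum_cong') (use ab uc in auto)
  also have "\<dots> = (\<Oplus>f\<in>u ` {..<k}. f)"
    using u uc by (intro finsum_reindex[symmetric]) (auto simp: bij_betw_def)
  also have "\<dots> = ?g" using u by (simp add: bij_betw_def block_def)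
  finally have "(\<Oplus>\<^bsub>corner R ?g\<^esub>i\<in>{..<k}. b i \<otimes>\<^bsub>corner R ?g\<^esub> a i) = \<one>\<^bsub>corner R ?g\<^esub>" by simp
  then have "matrix_units (corner R ?g) e k a b"
    by (intro matrix_units.intro matrix_units_axioms.intro C.ring_axioms eC aC bC)
      (use ab ec orth in \<open>simp_all\<close>)
  then show ?thesis by blast
qed

end

text \<open>The blocks are classes of \<open>linked\<close> in \<open>R\<close>, while the mixed
  parts have to vanish in \<open>R \<propto> M\<close>, for the sake of the bimodule. Idempotents
  linked in \<open>R \<propto> M\<close> have linked first components, so different classes remain
  unlinked there.\<close>

theorem decomposition_exists:
  fixes R :: "'a ring" and M :: "('a, 'm) bimodule"
  assumes bim: "bimodule R M" and perf: "left_perfect R" and mor: "morphic (R \<propto> M)"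
  shows "\<exists>n (Rs :: nat \<Rightarrow> 'a ring) (Ms :: nat \<Rightarrow> ('a, 'm) bimodule) ks (Ls :: nat \<Rightarrow> 'a ring).
           decomposition_into_standard_components R M n Rs Ms ks Ls"
proof -
  interpret bimodule R M by fact
  obtain E where "local_idempotents R (jacobson_radical R) E"
    using left_perfect_imp_local_idempotents[OF perf] by blast
  then interpret L: local_idempotents R "jacobson_radical R" E .
  let ?\<iota> = "\<lambda>e. (e, \<zero>\<^bsub>M\<^esub>)"
  interpret S: local_idempotents "R \<propto> M" "jacobson_radical R \<times> carrier M" "?\<iota> ` E"
    by (rule local_idempotents_trivial_extension[OF L.local_idempotents_axioms])
  have lm: "left_morphic (R \<propto> M)" and rm: "left_morphic (opposite_ring (R \<propto> M))"
    using mor by (auto simp: morphic_def)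
  have unif: "\<exists>c. uniformizer (corner (R \<propto> M) (?\<iota> e)) c" if "e \<in> E" for e
    using S.corner_uniformizer[OF _ lm rm] that by blast
  have proj: "L.linked e f" if ef: "e \<in> E" "f \<in> E" "S.linked (?\<iota> e) (?\<iota> f)" for e f
  proof -
    note c = L.E_carrier[OF ef(1)] L.E_carrier[OF ef(2)]
    obtain x y where xy: "x \<in> carrier (R \<propto> M)" "y \<in> carrier (R \<propto> M)" "?\<iota> e \<otimes>\<^bsub>R \<propto> M\<^esub> x = x" "x \<otimes>\<^bsub>R \<propto> M\<^esub> ?\<iota> f = x"
      "?\<iota> f \<otimes>\<^bsub>R \<propto> M\<^esub> y = y" "y \<otimes>\<^bsub>R \<propto> M\<^esub> ?\<iota> e = y" "x \<otimes>\<^bsub>R \<propto> M\<^esub> y = ?\<iota> e"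
      using ef(3) unfolding S.linked_def by blast
    obtain x1 x2 y1 y2 where "x = (x1, x2)" "y = (y1, y2)" by (cases x, cases y) auto
    then show ?thesis using xy by (intro L.linkedI[OF ef(1,2), of x1 y1]) auto
  qed
  define cls where "cls e = {f \<in> E. L.linked e f}" for e
  have cls_eq: "cls e = cls f" if "e \<in> E" "f \<in> E" "L.linked e f" for e f
    using that L.linked_trans L.linked_sym unfolding cls_def by blast
  obtain h where h: "bij_betw h {..<card (cls ` E)} (cls ` E)"
    using ex_bij_betw_nat_finite[of "cls ` E"] L.finite_E by (auto simp: atLeast0LessThan)
  define n where "n = card (cls ` E)"
  have hX: "h q \<in> cls ` E" if "q < n" for q using h that unfolding n_def by (auto simp: bij_betw_def)
  have hE: "h q \<subseteq> E" if "q < n" for q using hX[OF that] by (auto simp: cls_def)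
  have hlinked: "L.linked e f" if qef: "q < n" "e \<in> h q" "f \<in> h q" for q e f
  proof -
    obtain d where d: "d \<in> E" "h q = cls d" using hX[OF qef(1)] by blast
    then have "e \<in> E" "f \<in> E" "L.linked d e" "L.linked d f" using qef by (auto simp: cls_def)
    then show ?thesis using L.linked_trans[of e d f] L.linked_sym d(1) by blast
  qed
  have hnot: "\<not> L.linked e f" if pq: "p < n" "q < n" "p \<noteq> q" "e \<in> h p" "f \<in> h q" for p q e f
  proof
    assume ef: "L.linked e f"
    obtain d where d: "d \<in> E" "h p = cls d" using hX[OF pq(1)] by blast
    obtain d' where d': "d' \<in> E" "h q = cls d'" using hX[OF pq(2)] by blast
    have "e \<in> E" "L.linked d e" using pq(4) d by (auto simp: cls_def)
    then have "cls d = cls e" using cls_eq d(1) by blast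
    moreover have "f \<in> E" "L.linked d' f" using pq(5) d' by (auto simp: cls_def)
    then have "cls d' = cls f" using cls_eq d'(1) by blast
    moreover have "cls e = cls f" using cls_eq \<open>e \<in> E\<close> \<open>f \<in> E\<close> ef by blast
    ultimately have "h p = h q" using d d' by simp
    then show False using h pq unfolding n_def by (auto simp: bij_betw_def inj_on_def)
  qed
  have disj: "h p \<inter> h q = {}" if pq: "p < n" "q < n" "p \<noteq> q" for p q
  proof (rule ccontr)
    assume "h p \<inter> h q \<noteq> {}"
    then obtain e where "e \<in> h p" "e \<in> h q" by blast
    then show False using hnot[OF pq] L.linked_refl hE[OF pq(1)] by blast
  qed
  have cover: "(\<Union>q<n. h q) = E"
  proof
    show "(\<Union>q<n. h q) \<subseteq> E" using hE by auto
    show "E \<subseteq> (\<Union>q<n. h q)"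
    proof
      fix e assume e: "e \<in> E"
      then have "cls e \<in> h ` {..<n}" using h unfolding n_def by (auto simp: bij_betw_def)
      moreover have "e \<in> cls e" using e L.linked_refl by (simp add: cls_def)
      ultimately show "e \<in> (\<Union>q<n. h q)" by auto
    qed
  qed
  define g where "g q = L.block (h q)" for q
  have gc: "g q \<in> carrier R" and gi: "g q \<otimes>\<^bsub>R\<^esub> g q = g q" if "q < n" for q
    unfolding g_def using hE[OF that] L.block_idem by auto
  have "L.block E = \<one>\<^bsub>R\<^esub>" using L.E_sum by (simp add: L.block_def)
  then have sum: "(\<Oplus>\<^bsub>R\<^esub>q\<in>{..<n}. g q) = \<one>\<^bsub>R\<^esub>"
    using L.sum_blocks[of n h, OF hE disj] cover by (simp add: g_def)
  have gS: "S.block (?\<iota> ` h q) = (g q, \<zero>\<^bsub>M\<^esub>)" if q: "q < n" for q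
  proof -
    have c: "e \<in> carrier R" if "e \<in> h q" for e using L.sub_E(2)[OF hE[OF q] that] .
    have "S.block (?\<iota> ` h q) = (\<Oplus>\<^bsub>R \<propto> M\<^esub>e\<in>h q. ?\<iota> e)"
      unfolding S.block_def using c by (intro S.finsum_reindex) (auto simp: inj_on_def)
    also have "\<dots> = (g q, \<zero>\<^bsub>M\<^esub>)"
      unfolding g_def L.block_def using finsum_trivial_extension[of "h q" "\<lambda>e. e"] c L.sub_E(1)[OF hE[OF q]] by auto
    finally show ?thesis .
  qed
  have gcS: "(g q, \<zero>\<^bsub>M\<^esub>) \<in> carrier (R \<propto> M)" if "q < n" for q using gc[OF that] by simp
  have sumS: "(\<Oplus>\<^bsub>R \<propto> M\<^esub>q\<in>{..<n}. (g q, \<zero>\<^bsub>M\<^esub>)) = \<one>\<^bsub>R \<propto> M\<^esub>"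
    using finsum_trivial_extension[of "{..<n}" g] gc sum by auto
  have orthS: "(g p, \<zero>\<^bsub>M\<^esub>) \<otimes>\<^bsub>R \<propto> M\<^esub> z \<otimes>\<^bsub>R \<propto> M\<^esub> (g q, \<zero>\<^bsub>M\<^esub>) = \<zero>\<^bsub>R \<propto> M\<^esub>"
    if pq: "p < n" "q < n" "p \<noteq> q" and z: "z \<in> carrier (R \<propto> M)" for p q z
    unfolding gS[OF pq(1), symmetric] gS[OF pq(2), symmetric]
  proof (rule S.block_mult_both[OF _ _ z])
    show "?\<iota> ` h p \<subseteq> ?\<iota> ` E" "?\<iota> ` h q \<subseteq> ?\<iota> ` E" using hE pq by auto
    fix e' f' assume "e' \<in> ?\<iota> ` h p" "f' \<in> ?\<iota> ` h q"
    then obtain e f where ef: "e \<in> h p" "f \<in> h q" "e' = ?\<iota> e" "f' = ?\<iota> f" by blast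
    then have E: "e \<in> E" "f \<in> E" using hE pq by auto
    then have "\<not> S.linked e' f'" using hnot[OF pq ef(1,2)] proj ef(3,4) by blast
    moreover have e'E: "e' \<in> ?\<iota> ` E" "f' \<in> ?\<iota> ` E" using E ef by auto
    note c = S.E_carrier[OF e'E(1)] S.E_carrier[OF e'E(2)]
    note i = S.E_idem[OF e'E(1)] S.E_idem[OF e'E(2)]
    have ezf: "e' \<otimes>\<^bsub>R \<propto> M\<^esub> z \<otimes>\<^bsub>R \<propto> M\<^esub> f' \<in> carrier (R \<propto> M)" by (intro S.m_closed c z)
    moreover have "e' \<otimes>\<^bsub>R \<propto> M\<^esub> (e' \<otimes>\<^bsub>R \<propto> M\<^esub> z \<otimes>\<^bsub>R \<propto> M\<^esub> f') = e' \<otimes>\<^bsub>R \<propto> M\<^esub> z \<otimes>\<^bsub>R \<propto> M\<^esub> f'"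
      using S.m_assoc[OF c(1,1) z] S.m_assoc[OF c(1) S.m_closed[OF c(1) z] c(2)] i(1) by simp
    moreover have "(e' \<otimes>\<^bsub>R \<propto> M\<^esub> z \<otimes>\<^bsub>R \<propto> M\<^esub> f') \<otimes>\<^bsub>R \<propto> M\<^esub> f' = e' \<otimes>\<^bsub>R \<propto> M\<^esub> z \<otimes>\<^bsub>R \<propto> M\<^esub> f'"
      using S.m_assoc[OF S.m_closed[OF c(1) z] c(2,2)] i(2) by simp
    ultimately show "e' \<otimes>\<^bsub>R \<propto> M\<^esub> z \<otimes>\<^bsub>R \<propto> M\<^esub> f' = \<zero>\<^bsub>R \<propto> M\<^esub>"
      using S.not_linked_imp_zero[OF rm e'E] by blast
  qed
  \<comment> \<open>Centrality in \<open>R \<propto> M\<close>, read at \<open>(r, 0)\<close> and at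
    \<open>(0, m)\<close>, gives \<open>cR\<close> and \<open>cM\<close>.\<close>
  have cenS: "(g q, \<zero>\<^bsub>M\<^esub>) \<otimes>\<^bsub>R \<propto> M\<^esub> z = z \<otimes>\<^bsub>R \<propto> M\<^esub> (g q, \<zero>\<^bsub>M\<^esub>)" if "q < n" "z \<in> carrier (R \<propto> M)" for q z
    by (rule S.central_if_orthogonal[OF gcS sumS orthS that])
  have cR: "g q \<otimes>\<^bsub>R\<^esub> r = r \<otimes>\<^bsub>R\<^esub> g q" if "q < n" "r \<in> carrier R" for q r
    using cenS[OF that(1), of "(r, \<zero>\<^bsub>M\<^esub>)"] that(2) by simp
  have cM: "g q \<odot>\<^bsub>M\<^esub> m = rsmult M m (g q)" if "q < n" "m \<in> carrier M" for q m
    using cenS[OF that(1), of "(\<zero>\<^bsub>R\<^esub>, m)"] that gc[OF that(1)] by (simp add: lsmult_closed rsmult_closed)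
  have go: "g p \<otimes>\<^bsub>R\<^esub> g q = \<zero>\<^bsub>R\<^esub>" if "p < n" "q < n" "p \<noteq> q" for p q
    using orthS[OF that S.one_closed] gc that by simp
  have dec: "decomposition R M n (\<lambda>q. corner R (g q)) (\<lambda>q. corner_bimodule M (g q))"
    by (rule decomposition_of_central_idempotents[OF bim gc gi go sum cR cM])
  have comp: "\<exists>k L. matrix_ring_over_artinian_principal_local (corner R (g q)) k (L :: 'a ring) \<and>
      zero_or_twisted (corner R (g q)) (corner_bimodule M (g q))" if q: "q < n" for q
  proof -
    obtain e where e: "e \<in> E" "h q = cls e" using hX[OF q] by blast
    then have eh: "e \<in> h q" using L.linked_refl by (simp add: cls_def)
    obtain u where u: "bij_betw u {..<card (h q)} (h q)"
      using ex_bij_betw_nat_finite[OF L.sub_E(1)[OF hE[OF q]]] by (auto simp: atLeast0LessThan)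
    define k where "k = card (h q)"
    have k: "k \<ge> 1" unfolding k_def using eh L.sub_E(1)[OF hE[OF q]] by (auto simp: Suc_le_eq card_gt_0_iff)
    obtain a b where mu: "matrix_units (corner R (g q)) e k a b"
      using L.matrix_units_block[OF hE[OF q] u[folded k_def] eh hlinked[OF q eh]] unfolding g_def by blast
    note ge = L.mem_block[OF hE[OF q] eh, folded g_def]
    have ec: "e \<in> carrier R" "e \<otimes>\<^bsub>R\<^esub> e = e" using L.E_carrier L.E_idem e by auto
    have cc: "corner (corner R (g q)) e = corner R e"
      by (rule corner_corner[OF R.ring_axioms gc[OF q] ec(1) ge])
    obtain c where c: "uniformizer (corner (R \<propto> M) (e, \<zero>\<^bsub>M\<^esub>)) c" using unif[OF e(1)] by blast
    have "uniformizer (corner R e) (fst c)" by (rule ring_hom_fst_corner[OF bim ec c])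
    note L = uniformizer_imp[OF this]
    have iso: "corner R (g q) \<simeq> matrix_ring k (corner R e)"
      using matrix_units.matrix_ring_iso[OF mu] unfolding cc is_ring_iso_def by blast
    have "uniformizer (corner (corner R (g q) \<propto> corner_bimodule M (g q)) (e, \<zero>\<^bsub>corner_bimodule M (g q)\<^esub>)) c"
      using c trivial_extension_corner[OF bim gc[OF q] gi[OF q] ec(1) ge] by simp
    then have "zero_or_twisted (corner R (g q)) (corner_bimodule M (g q))"
      by (rule zero_or_twisted_if_uniformizer[OF bimodule_corner_bimodule[OF bim gc[OF q] gi[OF q]] mu])
    moreover have "matrix_ring_over_artinian_principal_local (corner R (g q)) k (corner R e)"
      unfolding matrix_ring_over_artinian_principal_local_def using k L iso by blast
    ultimately show ?thesis by blast
  qed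
  then have "\<forall>q\<in>{..<n}. \<exists>x. matrix_ring_over_artinian_principal_local (corner R (g q)) (fst x) (snd x :: 'a ring) \<and>
      zero_or_twisted (corner R (g q)) (corner_bimodule M (g q))" by simp
  from bchoice[OF this] obtain x where x: "\<forall>q\<in>{..<n}.
      matrix_ring_over_artinian_principal_local (corner R (g q)) (fst (x q)) (snd (x q) :: 'a ring) \<and>
      zero_or_twisted (corner R (g q)) (corner_bimodule M (g q))" by (elim exE)
  have "decomposition_into_standard_components R M n (\<lambda>q. corner R (g q)) (\<lambda>q. corner_bimodule M (g q))
      (\<lambda>q. fst (x q)) (\<lambda>q. snd (x q))"
    unfolding decomposition_into_standard_components_def using dec x by simp
  then show ?thesis by blast
qed

theorem corollary3p7:
  fixes R :: "'a ring" and M :: "('a, 'm) bimodule"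
  assumes "ring R" and "bimodule R M"
  shows
    "(left_perfect R \<and> morphic (R \<propto> M) \<longrightarrow>
        (\<exists>n (Rs :: nat \<Rightarrow> 'a ring) (Ms :: nat \<Rightarrow> ('a, 'm) bimodule) ks (Ls :: nat \<Rightarrow> 'a ring).
           decomposition_into_standard_components R M n Rs Ms ks Ls))
     \<and> (\<forall>n (Rs :: nat \<Rightarrow> 'b ring) (Ms :: nat \<Rightarrow> ('b, 'n) bimodule) ks (Ls :: nat \<Rightarrow> 'c ring).
           decomposition_into_standard_components R M n Rs Ms ks Ls \<longrightarrow> morphic (R \<propto> M))"
  using decomposition_exists[OF assms(2)] morphic_trivial_extension[OF assms(2)] by blast

end
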